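(* Let $\mathrm{Ra}\ge1$, let $\Omega$ be $C^{1,1}$ with $h^-=h$, $h^+=h+1$, $u_0\in L^2(\Omega)$ and $0<\alpha\in L^\infty(\gamma^-\cup\gamma^+)$. Then there is a constant $C>0$ depending only on $\Gamma$ and the Lipschitz constant of the boundary such that $$\mathrm{Nu}\le C\big(\mathrm{Ra}^{\frac12}+\|\kappa\|_\infty\big)$$ if $|\kappa|\le2\alpha$ on $\gamma^-\cup\gamma^+$, and $$\mathrm{Nu}\le C\Big(\big(1+\|\alpha^{-1}\|_\infty^{\frac12}\big)\mathrm{Ra}^{\frac12}+\|\kappa\|_\infty\Big)$$ if $|\kappa|\le2\alpha+\frac{1}{4\sqrt{1+(h'(x_1))^2}}\min\{1,\sqrt{\alpha}\}$ on $\gamma^-\cup\gamma^+$.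
   Context: Domain: $\Gamma>0$, $h$ a $\Gamma$-periodic function, $\Omega=\{(x_1,x_2): 0\le x_1\le\Gamma,\ h(x_1)\le x_2\le 1+h(x_1)\}$; all functions are $\Gamma$-periodic in $x_1$. The boundaries are $\gamma^-=\{x_2=h(x_1)\}$ and $\gamma^+=\{x_2=1+h(x_1)\}$. $\Omega$ is of class $C^{k,1}$ if $h$ has Lipschitz derivatives up to order $k$. $n$ is the outward unit normal, $\tau=n^\perp$ with $(a_1,a_2)^\perp=(-a_2,a_1)$, $\mathbb{D}u=\frac12(\nabla u+\nabla u^T)$, and $\kappa=n\cdot(\tau\cdot\nabla)\tau$ is the boundary curvature on $\gamma^-\cup\gamma^+$. The slip coefficient $\alpha=\alpha(x)>0$ is a function on $\gamma^-\cup\gamma^+$. Norms of $\alpha^{-1},\kappa$ are $L^\infty(\gamma^-\cup\gamma^+)$ norms. Rayleigh–Bénard system: for $\mathrm{Pr},\mathrm{Ra}>0$, $(u,p,\theta)$ is a (sufficiently regular, global in time) solution of $\mathrm{Pr}^{-1}(u_t+u\cdot\nabla u)+\nabla p-\Delta u=\mathrm{Ra}\,\theta e_2$, $\nabla\cdot u=0$, $\theta_t+u\cdot\nabla\theta-\Delta\theta=0$ in $\Omega$; $n\cdot u=0$ and $\tau\cdot(\mathbb{D}u\,n+\alpha u)=0$ on $\gamma^-\cup\gamma^+$; $\theta=0$ on $\gamma^+$, $\theta=1$ on $\gamma^-$; $(u,\theta)(\cdot,0)=(u_0,\theta_0)$, with $e_2=(0,1)$ and $0\le\theta_0\le1$ a.e.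 (hence $0\le\theta\le1$ by the maximum principle). The Nusselt number is $\mathrm{Nu}=\langle n\cdot\nabla\theta\rangle_{\gamma^-}$, where $\langle f\rangle_X=\limsup_{T\to\infty}\frac1T\int_0^T\frac1\Gamma\int_X f(x,t)\,dx\,dt$. *)

theory Defs
  imports "HOL-Analysis.Analysis" "HOL-Probability.Essential_Supremum"
begin

section \<open>Geometry\<close>

text \<open>
  Points and vectors of the plane are pairs. Functions that are periodic in the first variable
  live on the infinite strip; \<open>Omega\<close> is one period of it.
\<close>

definition strip :: "(real \<Rightarrow> real) \<Rightarrow> (real \<times> real) set" where
  "strip h = {(x1, x2). h x1 \<le> x2 \<and> x2 \<le> 1 + h x1}"

definition open_strip :: "(real \<Rightarrow> real) \<Rightarrow> (real \<times> real) set" where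
  "open_strip h = {(x1, x2). h x1 < x2 \<and> x2 < 1 + h x1}"

definition Omega :: "real \<Rightarrow> (real \<Rightarrow> real) \<Rightarrow> (real \<times> real) set" where
  "Omega \<Gamma> h = {(x1, x2). 0 \<le> x1 \<and> x1 \<le> \<Gamma> \<and> h x1 \<le> x2 \<and> x2 \<le> 1 + h x1}"

definition x1_periodic_on :: "(real \<times> real) set \<Rightarrow> real \<Rightarrow> (real \<times> real \<Rightarrow> 'b) \<Rightarrow> bool" where
  "x1_periodic_on S \<Gamma> f \<longleftrightarrow> (\<forall>x\<in>S. f (x + (\<Gamma>, 0)) = f x)"

definition C11 :: "(real \<Rightarrow> real) \<Rightarrow> bool" where
  "C11 h \<longleftrightarrow> h differentiable_on UNIV \<and> (\<exists>K. K-lipschitz_on UNIV h) \<and> (\<exists>K. K-lipschitz_on UNIV (deriv h))"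

datatype side = Bottom | Top

text \<open>
  \<open>slice h s \<epsilon> x1\<close> is the point of the strip above \<open>x1\<close> at vertical distance \<open>\<epsilon>\<close> from the side
  \<open>s\<close>; so \<open>bdry h Bottom\<close> and \<open>bdry h Top\<close> parametrise the lower and the upper boundary.
\<close>

fun slice :: "(real \<Rightarrow> real) \<Rightarrow> side \<Rightarrow> real \<Rightarrow> real \<Rightarrow> real \<times> real" where
  "slice h Bottom \<epsilon> x1 = (x1, h x1 + \<epsilon>)"
| "slice h Top \<epsilon> x1 = (x1, 1 + h x1 - \<epsilon>)"

definition bdry :: "(real \<Rightarrow> real) \<Rightarrow> side \<Rightarrow> real \<Rightarrow> real \<times> real" where
  "bdry h s x1 = slice h s 0 x1"

definition arclen :: "(real \<Rightarrow> real) \<Rightarrow> real \<Rightarrow> real" where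
  "arclen h x1 = sqrt (1 + (deriv h x1)\<^sup>2)"

text \<open>Outward unit normal, tangent \<open>\<tau> = n\<^sup>\<bottom>\<close> and curvature, at the boundary point \<open>bdry h s x1\<close>.\<close>

fun normal :: "(real \<Rightarrow> real) \<Rightarrow> side \<Rightarrow> real \<Rightarrow> real \<times> real" where
  "normal h Bottom x1 = (1 / arclen h x1) *\<^sub>R (deriv h x1, -1)"
| "normal h Top x1 = (1 / arclen h x1) *\<^sub>R (- deriv h x1, 1)"

definition perp :: "real \<times> real \<Rightarrow> real \<times> real" where
  "perp a = (- snd a, fst a)"

definition tangent :: "(real \<Rightarrow> real) \<Rightarrow> side \<Rightarrow> real \<Rightarrow> real \<times> real" where
  "tangent h s x1 = perp (normal h s x1)"

text \<open>
  For a function \<open>f\<close> on the boundary, written as a function of \<open>x1\<close>, the tangential derivative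
  \<open>(\<tau> \<cdot> \<nabla>)f\<close> is \<open>\<tau>\<^sub>1 f'(x1)\<close>: the graph is run through with velocity \<open>(1, h')\<close> and
  \<open>\<tau> = \<tau>\<^sub>1 (1, h')\<close>. Since \<open>h'\<close> is only Lipschitz, the curvature is meaningful almost everywhere.
\<close>

definition curvature :: "(real \<Rightarrow> real) \<Rightarrow> side \<Rightarrow> real \<Rightarrow> real" where
  "curvature h s x1 =
     normal h s x1 \<bullet> (fst (tangent h s x1) *\<^sub>R vector_derivative (tangent h s) (at x1))"

text \<open>
  Almost-everywhere statements and \<open>L\<^sup>\<infinity>\<close> norms on the boundary are taken with respect to Lebesgue
  measure in \<open>x1\<close>, which has the same null sets as arc length. Norms may be infinite.
\<close>

definition AE_bdry :: "real \<Rightarrow> (side \<Rightarrow> real \<Rightarrow> bool) \<Rightarrow> bool" where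
  "AE_bdry \<Gamma> P \<longleftrightarrow> (\<forall>s. AE x1 in lebesgue_on {0..\<Gamma>}. P s x1)"

definition Linf_bdry :: "real \<Rightarrow> (side \<Rightarrow> real \<Rightarrow> real) \<Rightarrow> ereal" where
  "Linf_bdry \<Gamma> f =
     max (esssup (lebesgue_on {0..\<Gamma>}) (\<lambda>x1. ereal \<bar>f Bottom x1\<bar>))
         (esssup (lebesgue_on {0..\<Gamma>}) (\<lambda>x1. ereal \<bar>f Top x1\<bar>))"

text \<open>Only used for non-negative arguments.\<close>

definition ereal_sqrt :: "ereal \<Rightarrow> ereal" where
  "ereal_sqrt a = (if a = \<infinity> then \<infinity> else ereal (sqrt (real_of_ereal a)))"

section \<open>Differential operators\<close>

definition pd1 :: "(real \<times> real \<Rightarrow> 'b::real_normed_vector) \<Rightarrow> real \<times> real \<Rightarrow> 'b" where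
  "pd1 f x = vector_derivative (\<lambda>r. f (r, snd x)) (at (fst x))"

definition pd2 :: "(real \<times> real \<Rightarrow> 'b::real_normed_vector) \<Rightarrow> real \<times> real \<Rightarrow> 'b" where
  "pd2 f x = vector_derivative (\<lambda>r. f (fst x, r)) (at (snd x))"

definition pdt :: "(real \<Rightarrow> real \<times> real \<Rightarrow> 'b::real_normed_vector) \<Rightarrow> real \<Rightarrow> real \<times> real \<Rightarrow> 'b" where
  "pdt f t x = vector_derivative (\<lambda>r. f r x) (at t)"

definition grad :: "(real \<times> real \<Rightarrow> real) \<Rightarrow> real \<times> real \<Rightarrow> real \<times> real" where
  "grad f x = (pd1 f x, pd2 f x)"

definition divergence :: "(real \<times> real \<Rightarrow> real \<times> real) \<Rightarrow> real \<times> real \<Rightarrow> real" where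
  "divergence v x = fst (pd1 v x) + snd (pd2 v x)"

definition laplacian :: "(real \<times> real \<Rightarrow> 'b::real_normed_vector) \<Rightarrow> real \<times> real \<Rightarrow> 'b" where
  "laplacian f x = pd1 (pd1 f) x + pd2 (pd2 f) x"

definition advect :: "real \<times> real \<Rightarrow> (real \<times> real \<Rightarrow> 'b::real_normed_vector) \<Rightarrow> real \<times> real \<Rightarrow> 'b" where
  "advect v f x = fst v *\<^sub>R pd1 f x + snd v *\<^sub>R pd2 f x"

text \<open>
  \<open>strain g1 g2 v\<close> is \<open>\<D>u v\<close> where \<open>\<D>u = (\<nabla>u + \<nabla>u\<^sup>T)/2\<close> and \<open>g1\<close>, \<open>g2\<close> are the values of the
  partial derivatives \<open>\<partial>\<^sub>1u\<close>, \<open>\<partial>\<^sub>2u\<close>, that is, the columns of the Jacobian matrix.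
\<close>

definition strain :: "real \<times> real \<Rightarrow> real \<times> real \<Rightarrow> real \<times> real \<Rightarrow> real \<times> real" where
  "strain g1 g2 v = (1/2) *\<^sub>R ((fst v *\<^sub>R g1 + snd v *\<^sub>R g2) + (g1 \<bullet> v, g2 \<bullet> v))"

section \<open>Regularity and solutions\<close>

text \<open>
  Time dependent fields are functions of \<open>t\<close> and \<open>x\<close>; only their values for \<open>t > 0\<close> matter, the
  initial values being attained in \<open>L\<^sup>2(\<Omega>)\<close> as \<open>t \<rightarrow> 0\<close>.
\<close>

definition jointly_continuous ::
    "(real \<times> real) set \<Rightarrow> (real \<Rightarrow> real \<times> real \<Rightarrow> 'b::topological_space) \<Rightarrow> bool" where
  "jointly_continuous S w \<longleftrightarrow> continuous_on ({0<..} \<times> S) (\<lambda>(t, x). w t x)"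

text \<open>Once continuously differentiable in time and twice in space, inside the strip.\<close>

definition C12_inside ::
    "(real \<Rightarrow> real) \<Rightarrow> (real \<Rightarrow> real \<times> real \<Rightarrow> 'b::real_normed_vector) \<Rightarrow> bool" where
  "C12_inside h w \<longleftrightarrow>
     (\<forall>t>0. \<forall>x\<in>open_strip h.
        (\<lambda>r. w r x) differentiable (at t) \<and> w t differentiable (at x) \<and>
        pd1 (w t) differentiable (at x) \<and> pd2 (w t) differentiable (at x)) \<and>
     jointly_continuous (open_strip h) w \<and>
     jointly_continuous (open_strip h) (pdt w) \<and>
     jointly_continuous (open_strip h) (\<lambda>t. pd1 (w t)) \<and>
     jointly_continuous (open_strip h) (\<lambda>t. pd2 (w t)) \<and>
     jointly_continuous (open_strip h) (\<lambda>t. pd1 (pd1 (w t))) \<and>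
     jointly_continuous (open_strip h) (\<lambda>t. pd1 (pd2 (w t))) \<and>
     jointly_continuous (open_strip h) (\<lambda>t. pd2 (pd1 (w t))) \<and>
     jointly_continuous (open_strip h) (\<lambda>t. pd2 (pd2 (w t)))"

definition extends_continuously ::
    "(real \<Rightarrow> real) \<Rightarrow> (real \<Rightarrow> real \<times> real \<Rightarrow> 'b::topological_space) \<Rightarrow> bool" where
  "extends_continuously h w \<longleftrightarrow>
     (\<exists>w'. jointly_continuous (strip h) w' \<and> (\<forall>t>0. \<forall>x\<in>open_strip h. w' t x = w t x))"

text \<open>
  \<open>g t x1\<close> is the boundary value of \<open>w\<close> at \<open>bdry h s x1\<close> in the \<open>L\<^sup>2\<close> sense, locally in \<open>t > 0\<close>.
  This is used for \<open>\<nabla>u\<close> and \<open>p\<close>: for a merely bounded slip coefficient these need not be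
  continuous (nor bounded) up to the boundary.
\<close>

definition L2_trace ::
    "real \<Rightarrow> (real \<Rightarrow> real) \<Rightarrow> side \<Rightarrow> (real \<Rightarrow> real \<times> real \<Rightarrow> 'b::real_normed_vector)
      \<Rightarrow> (real \<Rightarrow> real \<Rightarrow> 'b) \<Rightarrow> bool" where
  "L2_trace \<Gamma> h s w g \<longleftrightarrow>
     (\<lambda>(t, x1). g t x1) \<in> borel_measurable borel \<and>
     (\<forall>a b. 0 < a \<and> a < b \<longrightarrow>
        ((\<lambda>\<epsilon>. \<integral>\<^sup>+ z \<in> {a..b} \<times> {0..\<Gamma>}.
            ennreal ((norm (w (fst z) (slice h s \<epsilon> (snd z)) - g (fst z) (snd z)))\<^sup>2) \<partial>lborel)
          \<longlongrightarrow> 0) (at_right 0))"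

definition square_integrable_on_Omega ::
    "real \<Rightarrow> (real \<Rightarrow> real) \<Rightarrow> (real \<times> real \<Rightarrow> 'b::real_normed_vector) \<Rightarrow> bool" where
  "square_integrable_on_Omega \<Gamma> h f \<longleftrightarrow>
     f \<in> borel_measurable (lebesgue_on (Omega \<Gamma> h)) \<and>
     (\<integral>\<^sup>+ x. ennreal ((norm (f x))\<^sup>2) \<partial>lebesgue_on (Omega \<Gamma> h)) < \<infinity>"

definition attains_L2 ::
    "real \<Rightarrow> (real \<Rightarrow> real) \<Rightarrow> (real \<Rightarrow> real \<times> real \<Rightarrow> 'b::real_normed_vector)
      \<Rightarrow> (real \<times> real \<Rightarrow> 'b) \<Rightarrow> bool" where
  "attains_L2 \<Gamma> h w w0 \<longleftrightarrow>
     ((\<lambda>t. \<integral>\<^sup>+ x. ennreal ((norm (w t x - w0 x))\<^sup>2) \<partial>lebesgue_on (Omega \<Gamma> h)) \<longlongrightarrow> 0) (at_right 0)"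

text \<open>
  Global solutions of the Rayleigh-Benard system with Navier-slip boundary conditions: the
  equations hold classically inside the strip for \<open>t > 0\<close>, \<open>u\<close>, \<open>\<theta>\<close> and \<open>\<nabla>\<theta>\<close> are continuous up
  to the boundary, while \<open>\<nabla>u\<close> and \<open>p\<close> have \<open>L\<^sup>2\<close> boundary values. The slip condition holds
  almost everywhere, as \<open>\<alpha>\<close> is only given up to null sets. The bound \<open>0 \<le> \<theta> \<le> 1\<close> is not part
  of the definition.
\<close>

definition RB_solution ::
    "real \<Rightarrow> (real \<Rightarrow> real) \<Rightarrow> (real \<times> real \<Rightarrow> real) \<Rightarrow> real \<Rightarrow> real
      \<Rightarrow> (real \<times> real \<Rightarrow> real \<times> real) \<Rightarrow> (real \<times> real \<Rightarrow> real)
      \<Rightarrow> (real \<Rightarrow> real \<times> real \<Rightarrow> real \<times> real) \<Rightarrow> (real \<Rightarrow> real \<times> real \<Rightarrow> real)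
      \<Rightarrow> (real \<Rightarrow> real \<times> real \<Rightarrow> real) \<Rightarrow> bool" where
  "RB_solution \<Gamma> h \<alpha> Pr Ra u0 \<theta>0 u p \<theta> \<longleftrightarrow>
     \<comment> \<open>periodicity\<close>
     (\<forall>t>0. x1_periodic_on (strip h) \<Gamma> (u t) \<and> x1_periodic_on (strip h) \<Gamma> (\<theta> t) \<and>
            x1_periodic_on (open_strip h) \<Gamma> (p t)) \<and>
     \<comment> \<open>regularity\<close>
     C12_inside h u \<and> C12_inside h \<theta> \<and>
     jointly_continuous (open_strip h) p \<and> (\<forall>t>0. \<forall>x\<in>open_strip h. p t differentiable (at x)) \<and>
     jointly_continuous (strip h) u \<and> jointly_continuous (strip h) \<theta> \<and>
     extends_continuously h (\<lambda>t. grad (\<theta> t)) \<and>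
     (\<forall>s. \<exists>q. L2_trace \<Gamma> h s p q) \<and>
     \<comment> \<open>equations\<close>
     (\<forall>t>0. \<forall>x\<in>open_strip h.
        (1 / Pr) *\<^sub>R (pdt u t x + advect (u t x) (u t) x) + grad (p t) x - laplacian (u t) x
          = (Ra * \<theta> t x) *\<^sub>R (0, 1) \<and>
        divergence (u t) x = 0 \<and>
        pdt \<theta> t x + advect (u t x) (\<theta> t) x - laplacian (\<theta> t) x = 0) \<and>
     \<comment> \<open>boundary conditions\<close>
     (\<forall>s. \<forall>t>0. \<forall>x1. normal h s x1 \<bullet> u t (bdry h s x1) = 0) \<and>
     (\<forall>s. \<exists>g1 g2.
        L2_trace \<Gamma> h s (\<lambda>t. pd1 (u t)) g1 \<and> L2_trace \<Gamma> h s (\<lambda>t. pd2 (u t)) g2 \<and>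
        (AE z in lebesgue. case z of (t, x1) \<Rightarrow> t > 0 \<and> x1 \<in> {0..\<Gamma>} \<longrightarrow>
           tangent h s x1 \<bullet> (strain (g1 t x1) (g2 t x1) (normal h s x1)
                              + \<alpha> (bdry h s x1) *\<^sub>R u t (bdry h s x1)) = 0)) \<and>
     (\<forall>t>0. \<forall>x1. \<theta> t (bdry h Top x1) = 0 \<and> \<theta> t (bdry h Bottom x1) = 1) \<and>
     \<comment> \<open>initial conditions\<close>
     attains_L2 \<Gamma> h u u0 \<and> attains_L2 \<Gamma> h \<theta> \<theta>0"

section \<open>Nusselt number\<close>

text \<open>The value at \<open>bdry h s x1\<close> of a function given inside the strip.\<close>

definition bdry_value ::
    "(real \<Rightarrow> real) \<Rightarrow> side \<Rightarrow> (real \<times> real \<Rightarrow> 'b::t2_space) \<Rightarrow> real \<Rightarrow> 'b" where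
  "bdry_value h s f x1 = Lim (at_right 0) (\<lambda>\<epsilon>. f (slice h s \<epsilon> x1))"

text \<open>
  \<open>long_time_avg \<Gamma> h f\<close> is the long-time average of \<open>f\<close> over the lower or the upper boundary,
  where \<open>f t x1\<close> is the value at time \<open>t\<close> at the boundary point above \<open>x1\<close>; both boundaries
  have the same arc length element.
\<close>

definition long_time_avg :: "real \<Rightarrow> (real \<Rightarrow> real) \<Rightarrow> (real \<Rightarrow> real \<Rightarrow> real) \<Rightarrow> ereal" where
  "long_time_avg \<Gamma> h f =
     Limsup at_top (\<lambda>T. ereal ((1 / T) *
       (LINT t:{0<..T}|lborel. (1 / \<Gamma>) * (LINT x1:{0..\<Gamma>}|lborel. f t x1 * arclen h x1))))"

definition Nusselt :: "real \<Rightarrow> (real \<Rightarrow> real) \<Rightarrow> (real \<Rightarrow> real \<times> real \<Rightarrow> real) \<Rightarrow> ereal" where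
  "Nusselt \<Gamma> h \<theta> =
     long_time_avg \<Gamma> h (\<lambda>t x1. normal h Bottom x1 \<bullet> bdry_value h Bottom (grad (\<theta> t)) x1)"

end

theory Submission
  imports Defs
begin

text \<open>
  Points of the strip are written \<open>(x, h x + s)\<close> with \<open>0 \<le> s \<le> 1\<close>, and \<open>\<nu> = (-h', 1)\<close> is the
  normal, not normalised, of the graphs \<open>s = const\<close>; it does not depend on \<open>s\<close>. Let \<open>X\<close> be the heat
  that enters through the lower boundary during the time \<open>[t0, T]\<close>. The aim is
  \<open>X \<le> K + B \<Gamma> (T - t0)\<close> with \<open>B = C (M Ra)\<^sup>1\<^sup>/\<^sup>2\<close>; dividing by \<open>\<Gamma> T\<close> gives the Nusselt number.

  By the heat equation \<open>X\<close> differs by at most \<open>\<Gamma>\<close> from the time integral of the flux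
  \<open>\<integral> (\<theta> u - \<nabla>\<theta>) \<bullet> \<nu>\<close> through each graph (\<open>flux_identity\<close>). This flux is averaged over the layer
  \<open>0 < s < \<delta>\<close>. Since \<open>0 \<le> \<theta> \<le> 1\<close> (\<open>maximum_principle\<close>), its convective part is at most \<open>\<integral> \<bar>u \<bullet> \<nu>\<bar>\<close>; as
  \<open>u \<bullet> \<nu>\<close> vanishes for \<open>s = 0\<close> and its derivative in \<open>s\<close> is \<open>\<partial>\<^sub>2u \<bullet> \<nu>\<close>, Young's inequality bounds it by
  \<open>\<mu> \<delta> \<Gamma> (T - t0) + (1/\<mu>) \<integral> \<bar>\<nabla>u\<bar>\<^sup>2\<close> up to constants (\<open>normal_velocity_bound\<close>). The conductive part is
  at most a constant times \<open>\<Gamma> (T - t0) / \<delta>\<close> plus a quarter of \<open>\<integral> \<bar>\<nabla>\<theta>\<bar>\<^sup>2 \<le> X + \<Gamma>\<close>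
  (\<open>dissipation_bound\<close>, \<open>flux_le_layer_average\<close>).

  It remains to control the velocity by \<open>\<integral> \<bar>\<nabla>u\<bar>\<^sup>2 \<le> M Ra (c X + K)\<close>: then \<open>\<mu>\<close> of order \<open>M Ra\<close> absorbs
  half of \<open>X\<close> and \<open>\<delta>\<close> of order \<open>(M Ra)\<^sup>-\<^sup>1\<^sup>/\<^sup>2\<close> balances the rest (\<open>boundary_flux_bound\<close>). The kinetic
  energy balance, with the slip condition in the boundary terms, reads
  \<open>\<integral> \<bar>\<nabla>u\<bar>\<^sup>2 + \<integral>\<^sub>\<partial> (2\<alpha> + \<kappa>) \<bar>u\<bar>\<^sup>2 = Ra \<integral> \<theta> u\<^sub>2\<close> minus the gain of kinetic energy. The work \<open>\<integral> \<theta> u\<^sub>2\<close> is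
  controlled by \<open>X\<close> on testing the heat equation with the height \<open>x\<^sub>2\<close>, because by the maximum principle
  the boundary heat flux has a sign (\<open>buoyancy_work_bound\<close>).

  If \<open>\<bar>\<kappa>\<bar> \<le> 2\<alpha>\<close> the boundary integral is nonnegative and \<open>M = 1\<close>. In general let
  \<open>- \<kappa> \<le> 2\<alpha> (1 + a)\<close>; the second hypothesis of the theorem gives this with
  \<open>a = \<parallel>\<alpha>\<^sup>-\<^sup>1\<parallel>\<^sup>1\<^sup>/\<^sup>2 / 8\<close>, since \<open>\<surd>\<alpha> \<le> \<parallel>\<alpha>\<^sup>-\<^sup>1\<parallel>\<^sup>1\<^sup>/\<^sup>2 \<alpha>\<close>. The determinant of \<open>\<nabla>u\<close> is a divergence and
  \<open>\<bar>\<nabla>u\<bar>\<^sup>2 \<ge> 2 det \<nabla>u\<close>, which yields \<open>\<integral> \<bar>\<nabla>u\<bar>\<^sup>2 + \<integral>\<^sub>\<partial> \<kappa> \<bar>u\<bar>\<^sup>2 \<ge> 0\<close>. So the friction \<open>\<integral>\<^sub>\<partial> 2\<alpha> \<bar>u\<bar>\<^sup>2\<close> alone is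
  bounded by the work, and the negative part of the boundary integral, at most \<open>a\<close> times the friction,
  costs a factor \<open>M = 1 + a\<close> (\<open>dissipation_upper_bound\<close>).

  The velocity gradient and the pressure have boundary values in \<open>L\<^sup>2\<close> only, and \<open>h'\<close> is only Lipschitz.
  All integrations by parts are therefore made on slices \<open>s = \<epsilon>\<close> and \<open>s = 1 - \<epsilon>\<close>, followed by
  \<open>\<epsilon> \<rightarrow> 0\<close>. On a slice the curvature appears on integrating by parts a factor \<open>h'\<close>
  (\<open>Lipschitz_integration_by_parts\<close>), which rests on the almost everywhere differentiability of
  Lipschitz functions (\<open>Lipschitz_differentiable_AE\<close>).
\<close>

section \<open>Lipschitz functions are differentiable almost everywhere\<close>

text \<open>
  The balls of the hypothesis form a Vitali cover. A disjoint subfamily covers almost all of \<open>S\<close>, and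
  both measures are additive on it.
\<close>

lemma Vitali_measure_comparison:
  fixes M N :: "real measure" and S U :: "real set"
  assumes sets: "sets M = sets borel" "sets N = sets borel"
    and U: "open U" "S \<subseteq> U"
    and cover: "\<And>x d. x \<in> S \<Longrightarrow> 0 < d \<Longrightarrow>
        \<exists>c r. 0 < r \<and> r < d \<and> x \<in> cball c r \<and> emeasure M (ball c r) \<le> emeasure N (ball c r)"
  obtains V where "open V" "V \<subseteq> U" "negligible (S - V)" "emeasure M V \<le> emeasure N V"
proof -
  define K where "K = {(c, r). 0 < r \<and> cball c r \<subseteq> U \<and> emeasure M (ball c r) \<le> emeasure N (ball c r)}"
  have fine: "\<exists>i. i \<in> K \<and> x \<in> cball (fst i) (snd i) \<and> snd i < d" if x: "x \<in> S" and d: "0 < d" for x d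
  proof -
    obtain e where e: "e > 0" "ball x e \<subseteq> U"
      using U x by (meson openE subsetD)
    obtain c r where cr: "0 < r" "r < min d (e/2)" "x \<in> cball c r"
        "emeasure M (ball c r) \<le> emeasure N (ball c r)"
      using cover[OF x, of "min d (e/2)"] e d by auto
    have "cball c r \<subseteq> ball x e"
    proof
      fix y assume y: "y \<in> cball c r"
      have "dist x y \<le> dist c x + dist c y"
        by (metis dist_commute dist_triangle)
      then show "y \<in> ball x e" using y cr by auto
    qed
    then show ?thesis
      using cr e d by (intro exI[of _ "(c, r)"]) (auto simp: K_def)
  qed
  obtain C where C: "countable C" "C \<subseteq> K"
     "pairwise (\<lambda>i j. disjnt (cball (fst i) (snd i)) (cball (fst j) (snd j))) C"
     "negligible (S - (\<Union>i \<in> C. cball (fst i) (snd i)))"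
  proof (rule Vitali_covering_theorem_cballs[of K snd S fst])
    show "\<And>i. i \<in> K \<Longrightarrow> 0 < snd i" by (auto simp: K_def)
  qed (use fine in blast)+
  define V where "V = (\<Union>i \<in> C. ball (fst i) (snd i))"
  have disj: "disjoint_family_on (\<lambda>i. ball (fst i) (snd i)) C"
    using C(3) ball_subset_cball unfolding disjoint_family_on_def pairwise_def disjnt_def by blast
  have "emeasure M V = (\<integral>\<^sup>+i. emeasure M (ball (fst i) (snd i)) \<partial>count_space C)"
    unfolding V_def by (rule emeasure_UN_countable) (use C disj sets in auto)
  also have "\<dots> \<le> (\<integral>\<^sup>+i. emeasure N (ball (fst i) (snd i)) \<partial>count_space C)"
    by (intro nn_integral_mono) (use C in \<open>auto simp: K_def\<close>)
  also have "\<dots> = emeasure N V"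
    unfolding V_def by (rule emeasure_UN_countable[symmetric]) (use C disj sets in auto)
  finally have MN: "emeasure M V \<le> emeasure N V" .
  have "countable (\<Union>i\<in>C. {fst i - snd i, fst i + snd i})"
    using C(1) by auto
  then have "negligible (S - (\<Union>i \<in> C. cball (fst i) (snd i)) \<union> (\<Union>i\<in>C. {fst i - snd i, fst i + snd i}))"
    using C(4) countable_imp_null_set_lborel
    by (intro negligible_Un) (auto simp: negligible_iff_null_sets intro: null_sets_completionI)
  moreover have "S - V \<subseteq> S - (\<Union>i \<in> C. cball (fst i) (snd i)) \<union> (\<Union>i\<in>C. {fst i - snd i, fst i + snd i})"
    by (force simp: V_def dist_real_def cball_eq_atLeastAtMost ball_eq_greaterThanLessThan)
  ultimately have "negligible (S - V)"
    by (meson negligible_subset)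
  moreover have "V \<subseteq> U"
    using C(2) ball_subset_cball by (fastforce simp: V_def K_def)
  moreover have "open V" by (auto simp: V_def)
  ultimately show ?thesis using that MN by blast
qed

lemma emeasure_interval_measure_Ioo_continuous:
  fixes g :: "real \<Rightarrow> real"
  assumes g: "mono g" "continuous_on UNIV g" and "a \<le> b"
  shows "emeasure (interval_measure g) {a<..<b} = ennreal (g b - g a)"
proof (cases "a = b")
  case False
  then have ab: "a < b" using assms by simp
  have mono: "\<And>x y. x \<le> y \<Longrightarrow> g x \<le> g y" using g by (auto dest: monoD)
  have rc: "continuous (at_right x) g" for x
    using g(2) by (simp add: continuous_on_eq_continuous_at continuous_at_imp_continuous_at_within)
  have 1: "emeasure (interval_measure g) {a<..b} = ennreal (g b - g a)"
    using emeasure_interval_measure_Ioc ab mono rc by (simp add: emeasure_interval_measure_Ioc)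
  have "emeasure (interval_measure g) {b..b} = ennreal (g b - g b)"
    by (rule emeasure_interval_measure_Icc) (use mono g in auto)
  then have 2: "emeasure (interval_measure g) {b} = 0" by simp
  have "emeasure (interval_measure g) ({a<..<b} \<union> {b}) = emeasure (interval_measure g) {a<..<b}"
    by (rule emeasure_Un_null_set) (use 2 in \<open>auto simp: null_sets_def\<close>)
  moreover have "{a<..<b} \<union> {b} = {a<..b}" using ab by auto
  ultimately show ?thesis using 1 by simp
qed auto

lemma negligible_if_geometric:
  fixes S U :: "real set"
  assumes c: "0 \<le> c" "c < 1" and U: "emeasure lborel U < \<infinity>"
    and V: "\<And>n::nat. \<exists>V. open V \<and> negligible (S - V) \<and> emeasure lborel V \<le> ennreal (c ^ n) * emeasure lborel U"
  shows "negligible S"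
  unfolding negligible_outer
proof (intro allI impI)
  fix e :: real assume e: "e > 0"
  define m where "m = enn2real (emeasure lborel U)"
  have m: "emeasure lborel U = ennreal m" "m \<ge> 0"
    using U by (auto simp: m_def)
  have "(\<lambda>n. c ^ n * m) \<longlonglongrightarrow> 0 * m"
    by (intro tendsto_mult LIMSEQ_power_zero tendsto_const) (use c in auto)
  then have "eventually (\<lambda>n. c ^ n * m < e) sequentially"
    using e by (auto dest!: order_tendstoD(2)[of _ _ _ e])
  then obtain n where n: "c ^ n * m < e"
    by (auto simp: eventually_sequentially)
  obtain V where V: "open V" "negligible (S - V)" "emeasure lborel V \<le> ennreal (c ^ n) * emeasure lborel U"
    using V by blast
  have Ve: "emeasure lborel V < ennreal e"
  proof -
    have "emeasure lborel V \<le> ennreal (c ^ n * m)"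
      using V(3) m c by (simp add: ennreal_mult)
    also have "\<dots> < ennreal e" using n m c e by (simp add: ennreal_less_iff)
    finally show ?thesis .
  qed
  have Vm: "V \<in> lmeasurable" "measure lebesgue V < e"
  proof -
    have b: "V \<in> sets borel" using V by auto
    have "emeasure lebesgue V < ennreal e" using Ve b by simp
    then show "V \<in> lmeasurable" using b by (intro fmeasurableI) (auto intro: less_trans simp: less_top)
    then show "measure lebesgue V < e"
      using \<open>emeasure lebesgue V < ennreal e\<close> e by (simp add: emeasure_eq_measure2 ennreal_less_iff)
  qed
  have "S - V \<in> lmeasurable" "measure lebesgue (S - V) = 0"
    using V(2) by (auto simp: negligible_imp_measurable negligible_imp_measure0)
  then have "V \<union> (S - V) \<in> lmeasurable" "measure lebesgue (V \<union> (S - V)) \<le> measure lebesgue V + 0"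
    using Vm measure_Un_le[of V lebesgue "S - V"] fmeasurable.Un by (auto simp: fmeasurableD simp del: Un_Diff_cancel)
  then show "\<exists>T. S \<subseteq> T \<and> T \<in> lmeasurable \<and> measure lebesgue T < e"
    using Vm by (intro exI[of _ "V \<union> (S - V)"]) auto
qed

lemma diff_quotient_interval:
  fixes g :: "real \<Rightarrow> real" and x d :: real
  assumes P: "frequently (\<lambda>k. P ((g (x + k) - g x) / k)) (at 0)" and d: "d > 0"
  shows "\<exists>c r. 0 < r \<and> r < d \<and> x \<in> cball c r \<and> P ((g (c + r) - g (c - r)) / (2 * r))"
proof -
  have "eventually (\<lambda>k::real. k \<noteq> 0 \<and> \<bar>k\<bar> < d) (at 0)"
    using d by (auto simp: eventually_at dist_real_def)
  then obtain k where k: "P ((g (x + k) - g x) / k)" "k \<noteq> 0" "\<bar>k\<bar> < d"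
    using frequently_rev_mp frequently_ex P
    by (smt (verit) eventually_mono frequently_def)
  define c r where "c = x + k / 2" and "r = \<bar>k\<bar> / 2"
  have "(g (c + r) - g (c - r)) / (2 * r) = (g (x + k) - g x) / k"
  proof (cases "k > 0")
    case True
    then have e: "c + r = x + k" "c - r = x" "2 * r = k" by (auto simp: c_def r_def field_simps)
    show ?thesis unfolding e ..
  next
    case False
    then have e: "c + r = x" "c - r = x + k" "2 * r = - k" using k by (auto simp: c_def r_def field_simps)
    show ?thesis unfolding e using k by (simp add: field_simps)
  qed
  then show ?thesis
    using k by (intro exI[of _ c] exI[of _ r]) (auto simp: c_def r_def dist_real_def)
qed

text \<open>
  Let \<open>\<mu>\<close> be the Stieltjes measure of \<open>g\<close>. A point of the set lies in arbitrarily short intervals on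
  which \<open>\<mu>\<close> is less than \<open>p\<close> times the length, and in others on which it is more than \<open>q\<close> times the
  length. Two applications of the Vitali comparison replace an open set around the points by one whose
  length is smaller by the factor \<open>p/q\<close>, and this can be iterated.
\<close>

lemma negligible_oscillating_quotients:
  fixes g :: "real \<Rightarrow> real"
  assumes g: "mono g" "continuous_on UNIV g" and pq: "0 < p" "p < q"
  shows "negligible {x. frequently (\<lambda>k. (g (x + k) - g x) / k < p) (at 0) \<and>
                        frequently (\<lambda>k. q < (g (x + k) - g x) / k) (at 0)}" (is "negligible ?E")
proof -
  let ?\<mu> = "interval_measure g"
  have ball_\<mu>: "emeasure ?\<mu> (ball c r) = ennreal (g (c + r) - g (c - r))" if "r > 0" for c r
    using emeasure_interval_measure_Ioo_continuous[OF g, of "c - r" "c + r"] that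
    by (simp add: ball_eq_greaterThanLessThan)
  have ball_l: "emeasure lborel (ball c r) = ennreal (2 * r)" if "r > 0" for c r :: real
    using that by (simp add: ball_eq_greaterThanLessThan)
  have gm: "g (c - r) \<le> g (c + r)" if "r > 0" for c r using g(1) that by (simp add: monoD)
  have shrink: "\<exists>W. open W \<and> W \<subseteq> U \<and> negligible (?E \<inter> U - W) \<and>
      emeasure lborel W \<le> ennreal (p / q) * emeasure lborel U" if U: "open U" for U
  proof -
    have "\<exists>c r. 0 < r \<and> r < d \<and> x \<in> cball c r \<and>
        emeasure ?\<mu> (ball c r) \<le> emeasure (scale_measure (ennreal p) lborel) (ball c r)"
      if "x \<in> ?E \<inter> U" "d > 0" for x d
    proof -
      obtain c r where "0 < r" "r < d" "x \<in> cball c r" "(g (c + r) - g (c - r)) / (2 * r) < p"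
        using diff_quotient_interval[of "\<lambda>y. y < p" g x d] \<open>x \<in> ?E \<inter> U\<close> \<open>d > 0\<close> by auto
      then show ?thesis
        using pq by (intro exI[of _ c] exI[of _ r])
          (auto simp: ball_\<mu> ball_l ennreal_mult[symmetric] field_simps intro!: ennreal_leI)
    qed
    then obtain V where V: "open V" "V \<subseteq> U" "negligible (?E \<inter> U - V)"
        "emeasure ?\<mu> V \<le> emeasure (scale_measure (ennreal p) lborel) V"
      using Vitali_measure_comparison[of ?\<mu> "scale_measure (ennreal p) lborel" U "?E \<inter> U"] U
      by (auto simp del: emeasure_scale_measure)
    have "\<exists>c r. 0 < r \<and> r < d \<and> x \<in> cball c r \<and>
        emeasure (scale_measure (ennreal q) lborel) (ball c r) \<le> emeasure ?\<mu> (ball c r)"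
      if "x \<in> ?E \<inter> V" "d > 0" for x d
    proof -
      obtain c r where "0 < r" "r < d" "x \<in> cball c r" "q < (g (c + r) - g (c - r)) / (2 * r)"
        using diff_quotient_interval[of "\<lambda>y. q < y" g x d] \<open>x \<in> ?E \<inter> V\<close> \<open>d > 0\<close> by auto
      then show ?thesis
        using pq by (intro exI[of _ c] exI[of _ r])
          (auto simp: ball_\<mu> ball_l ennreal_mult[symmetric] field_simps intro!: ennreal_leI)
    qed
    then obtain W where W: "open W" "W \<subseteq> V" "negligible (?E \<inter> V - W)"
        "emeasure (scale_measure (ennreal q) lborel) W \<le> emeasure ?\<mu> W"
      using Vitali_measure_comparison[of "scale_measure (ennreal q) lborel" ?\<mu> V "?E \<inter> V"] V
      by (auto simp del: emeasure_scale_measure)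
    have "ennreal q * emeasure lborel W \<le> emeasure ?\<mu> W" using W by simp
    also have "\<dots> \<le> emeasure ?\<mu> V" by (rule emeasure_mono) (use W V in auto)
    also have "\<dots> \<le> ennreal p * emeasure lborel V" using V by simp
    also have "\<dots> \<le> ennreal p * emeasure lborel U"
      by (intro mult_left_mono emeasure_mono) (use V U in auto)
    finally have "ennreal (1/q) * (ennreal q * emeasure lborel W) \<le> ennreal (1/q) * (ennreal p * emeasure lborel U)"
      by (rule mult_left_mono) simp
    then have "emeasure lborel W \<le> ennreal (p / q) * emeasure lborel U"
      using pq by (simp add: mult.assoc[symmetric] ennreal_mult[symmetric])
    moreover have "negligible (?E \<inter> U - W)"
      by (rule negligible_subset[OF negligible_Un[OF V(3) W(3)]]) auto
    ultimately show ?thesis using W V by blast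
  qed
  have "negligible (?E \<inter> ball 0 R)" for R
  proof (rule negligible_if_geometric[of "p / q" "ball 0 R"])
    fix n :: nat
    have "\<exists>V. open V \<and> V \<subseteq> ball 0 R \<and> negligible (?E \<inter> ball 0 R - V) \<and>
      emeasure lborel V \<le> ennreal ((p / q) ^ n) * emeasure lborel (ball (0::real) R)"
    proof (induction n)
      case 0
      show ?case by (intro exI[of _ "ball 0 R"]) auto
    next
      case (Suc n)
      then obtain V where V: "open V" "V \<subseteq> ball 0 R" "negligible (?E \<inter> ball 0 R - V)"
        "emeasure lborel V \<le> ennreal ((p / q) ^ n) * emeasure lborel (ball (0::real) R)" by blast
      obtain W where W: "open W" "W \<subseteq> V" "negligible (?E \<inter> V - W)"
        "emeasure lborel W \<le> ennreal (p / q) * emeasure lborel V" using shrink[OF V(1)] by blast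
      have "emeasure lborel W \<le> ennreal (p / q) * (ennreal ((p / q) ^ n) * emeasure lborel (ball (0::real) R))"
        using W(4) V(4) by (meson mult_left_mono order_trans zero_le)
      then have "emeasure lborel W \<le> ennreal ((p / q) ^ Suc n) * emeasure lborel (ball (0::real) R)"
        using pq by (simp add: mult.assoc[symmetric] ennreal_mult[symmetric])
      moreover have "negligible (?E \<inter> ball 0 R - W)"
        by (rule negligible_subset[OF negligible_Un[OF V(3) W(3)]]) auto
      ultimately show ?case using W V by blast
    qed
    then show "\<exists>V. open V \<and> negligible (?E \<inter> ball 0 R - V) \<and>
      emeasure lborel V \<le> ennreal ((p / q) ^ n) * emeasure lborel (ball (0::real) R)" by blast
  next
    show "emeasure lborel (ball 0 R) < \<infinity>"
      using emeasure_bounded_finite[OF bounded_ball] by blast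
  qed (use pq in auto)
  then have "negligible (\<Union>n::nat. ?E \<inter> ball 0 (real n))"
    by (intro negligible_countable_Union) auto
  moreover have "(\<Union>n::nat. ?E \<inter> ball 0 (real n)) = ?E"
    by (auto simp: reals_Archimedean2)
  ultimately show ?thesis by simp
qed

text \<open>
  The failure of differentiability at a point means that the lower and the upper limit of the difference
  quotients are separated by two rationals, so countably many null sets suffice.
\<close>

theorem Lipschitz_differentiable_AE:
  fixes f :: "real \<Rightarrow> real"
  assumes lip: "K-lipschitz_on UNIV f"
  shows "negligible {x. \<not> f differentiable (at x)}"
proof -
  \<comment> \<open>the difference quotients of \<open>g\<close> lie in \<open>[1, 2K + 1]\<close>: \<open>g\<close> is increasing, the rationals are positive\<close>
  define g where "g x = f x + (K + 1) * x" for x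
  have K: "K \<ge> 0" using lip lipschitz_on_nonneg by blast
  have fxy: "\<bar>f y - f x\<bar> \<le> K * \<bar>y - x\<bar>" for x y
    using lipschitz_onD[OF lip, of y x] by (simp add: dist_real_def)
  have quot: "(g (x + k) - g x) / k = (f (x + k) - f x) / k + (K + 1)" if "k \<noteq> 0" for x k
    using that by (simp add: g_def field_simps)
  have quot_bound: "1 \<le> (g (x + k) - g x) / k \<and> (g (x + k) - g x) / k \<le> 2 * K + 1" if "k \<noteq> 0" for x k
  proof -
    have "\<bar>(f (x + k) - f x) / k\<bar> \<le> K"
      using fxy[of "x + k" x] that by (simp add: field_simps abs_divide)
    then show ?thesis using quot[OF that, of x] by linarith
  qed
  have g_mono: "mono g"
  proof (rule monoI)
    fix x y :: real assume "x \<le> y"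
    then show "g x \<le> g y"
      using quot_bound[of "y - x" x] by (cases "x = y") (auto simp: field_simps)
  qed
  have g_cont: "continuous_on UNIV g"
    unfolding g_def by (intro continuous_intros lipschitz_on_continuous_on[OF lip])
  define E where "E p q = {x. frequently (\<lambda>k. (g (x + k) - g x) / k < p) (at 0) \<and>
                        frequently (\<lambda>k. q < (g (x + k) - g x) / k) (at 0)}" for p q
  have neg: "negligible (\<Union>(p, q) \<in> {(p, q). p \<in> \<rat> \<and> q \<in> \<rat> \<and> 0 < p \<and> p < q}. E p q)"
  proof (rule negligible_countable_Union)
    have "countable ((\<rat>::real set) \<times> (\<rat>::real set))" using countable_rat by blast
    then show "countable ((\<lambda>(p, q). E p q) ` {(p, q). p \<in> \<rat> \<and> q \<in> \<rat> \<and> 0 < p \<and> p < q})"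
      by (intro countable_image) (auto elim!: countable_subset[rotated])
  qed (use negligible_oscillating_quotients[OF g_mono g_cont] in \<open>auto simp: E_def\<close>)
  have "x \<in> (\<Union>(p, q) \<in> {(p, q). p \<in> \<rat> \<and> q \<in> \<rat> \<and> 0 < p \<and> p < q}. E p q)"
    if nd: "\<not> f differentiable (at x)" for x
  proof (rule ccontr)
    assume nE: "\<not> ?thesis"
    let ?Q = "\<lambda>k. ereal ((g (x + k) - g x) / k)"
    have nz: "eventually (\<lambda>k::real. k \<noteq> 0) (at 0)" by (simp add: eventually_at_filter)
    have lo: "1 \<le> Liminf (at 0) ?Q"
      by (rule Liminf_bounded) (use nz quot_bound in \<open>auto elim!: eventually_mono\<close>)
    have up: "Limsup (at 0) ?Q \<le> ereal (2 * K + 1)"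
      by (rule Limsup_bounded) (use nz quot_bound in \<open>auto elim!: eventually_mono\<close>)
    have le: "Liminf (at 0) ?Q \<le> Limsup (at 0) ?Q" by (rule Liminf_le_Limsup) simp
    have real: "\<exists>r. a = ereal r" if "1 \<le> a" "a \<le> ereal (2 * K + 1)" for a
      using that by (cases a) auto
    have "\<not> Liminf (at 0) ?Q < Limsup (at 0) ?Q"
    proof
      assume lt: "Liminf (at 0) ?Q < Limsup (at 0) ?Q"
      obtain a b where ab: "Liminf (at 0) ?Q = ereal a" "Limsup (at 0) ?Q = ereal b"
        using real[OF lo order_trans[OF le up]] real[OF order_trans[OF lo le] up] by blast
      have "a < b" "1 \<le> a" using lt lo ab by auto
      obtain p where p: "p \<in> \<rat>" "a < p" "p < b" using Rats_dense_in_real[OF \<open>a < b\<close>] by blast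
      obtain q where q: "q \<in> \<rat>" "p < q" "q < b" using Rats_dense_in_real[OF p(3)] by blast
      have "frequently (\<lambda>k. (g (x + k) - g x) / k < p) (at 0)"
      proof (rule ccontr)
        assume "\<not> ?thesis"
        then have "eventually (\<lambda>k. ereal p \<le> ?Q k) (at 0)"
          by (simp add: not_frequently not_less)
        then have "ereal p \<le> Liminf (at 0) ?Q" by (rule Liminf_bounded)
        then show False using ab p by simp
      qed
      moreover have "frequently (\<lambda>k. q < (g (x + k) - g x) / k) (at 0)"
      proof (rule ccontr)
        assume "\<not> ?thesis"
        then have "eventually (\<lambda>k. ?Q k \<le> ereal q) (at 0)"
          by (simp add: not_frequently not_less)
        then have "Limsup (at 0) ?Q \<le> ereal q" by (rule Limsup_bounded)
        then show False using ab q by simp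
      qed
      ultimately have "x \<in> E p q" by (simp add: E_def)
      then show False using nE p q \<open>1 \<le> a\<close> by force
    qed
    then have eq: "Liminf (at 0) ?Q = Limsup (at 0) ?Q" using le by simp
    obtain l where l: "Limsup (at 0) ?Q = ereal l"
      using real[OF order_trans[OF lo le] up] by blast
    have "(?Q \<longlongrightarrow> ereal l) (at 0)"
      by (rule Liminf_eq_Limsup) (use eq l in auto)
    then have "((\<lambda>k. (g (x + k) - g x) / k) \<longlongrightarrow> l) (at 0)" by simp
    then have "(g has_real_derivative l) (at x)" by (simp add: DERIV_def)
    then have "((\<lambda>x. g x - (K + 1) * x) has_real_derivative (l - (K + 1) * 1)) (at x)"
      by (intro DERIV_diff DERIV_cmult DERIV_ident)
    then have "(f has_real_derivative (l - (K + 1))) (at x)" by (simp add: g_def)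
    then show False using nd real_differentiable_def by blast
  qed
  then have "{x. \<not> f differentiable (at x)} \<subseteq> (\<Union>(p, q) \<in> {(p, q). p \<in> \<rat> \<and> q \<in> \<rat> \<and> 0 < p \<and> p < q}. E p q)"
    by blast
  then show ?thesis using neg negligible_subset by blast
qed

section \<open>Integration in straightened coordinates\<close>

lemmas HK_integral_add = Henstock_Kurzweil_Integration.integral_add
  and HK_integral_diff = Henstock_Kurzweil_Integration.integral_diff
  and HK_integral_cong = Henstock_Kurzweil_Integration.integral_cong
  and HK_integral_divide = Henstock_Kurzweil_Integration.integral_divide
  and HK_integral_norm_bound_integral = Henstock_Kurzweil_Integration.integral_norm_bound_integral
  and HK_integral_combine = Henstock_Kurzweil_Integration.integral_combine

lemma integral_periodic_shift:
  fixes f :: "real \<Rightarrow> real"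
  assumes per: "\<And>x. f (x + \<Gamma>) = f x" and cont: "continuous_on UNIV f" and a: "0 \<le> a" "a \<le> \<Gamma>"
  shows "integral {0..\<Gamma>} (\<lambda>x. f (x + a)) = integral {0..\<Gamma>} f"
proof -
  have int: "f integrable_on {c..d}" for c d
    by (intro integrable_continuous_real continuous_on_subset[OF cont]) auto
  have sh: "integral {c..d} (\<lambda>x. f (x + e)) = integral {c+e..d+e} f" for c d e
    using integral_shift_Icc_real[of c d f e] by (simp add: o_def add.commute)
  have "integral {0..\<Gamma>} (\<lambda>x. f (x + a)) = integral {a..\<Gamma> + a} f"
    by (simp add: sh)
  also have "\<dots> = integral {a..\<Gamma>} f + integral {\<Gamma>..\<Gamma> + a} f"
    using HK_integral_combine[of a \<Gamma> "\<Gamma> + a" f] a int by simp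
  also have "integral {\<Gamma>..\<Gamma> + a} f = integral {0..a} f"
    using sh[of 0 a \<Gamma>] per by (simp add: add.commute)
  also have "integral {a..\<Gamma>} f + integral {0..a} f = integral {0..\<Gamma>} f"
    using HK_integral_combine[of 0 a \<Gamma> f] a int by simp
  finally show ?thesis .
qed

definition has_partials :: "(real \<times> real \<Rightarrow> real) \<Rightarrow> real \<Rightarrow> real \<Rightarrow> real \<times> real \<Rightarrow> bool" where
  "has_partials f a b x \<longleftrightarrow> (f has_derivative (\<lambda>k. fst k * a + snd k * b)) (at x)"

lemma has_partials_add:
  "has_partials f a b x \<Longrightarrow> has_partials g c d x \<Longrightarrow> has_partials (\<lambda>x. f x + g x) (a + c) (b + d) x"
  unfolding has_partials_def
  by (rule has_derivative_eq_rhs, erule (1) has_derivative_add) (auto simp: algebra_simps)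

lemma has_partials_diff:
  "has_partials f a b x \<Longrightarrow> has_partials g c d x \<Longrightarrow> has_partials (\<lambda>x. f x - g x) (a - c) (b - d) x"
  unfolding has_partials_def
  by (rule has_derivative_eq_rhs, erule (1) has_derivative_diff) (auto simp: algebra_simps)

lemma has_partials_minus:
  "has_partials f a b x \<Longrightarrow> has_partials (\<lambda>x. - f x) (- a) (- b) x"
  unfolding has_partials_def
  by (rule has_derivative_eq_rhs, erule has_derivative_minus) (auto simp: algebra_simps)

lemma has_partials_mult:
  "has_partials f a b x \<Longrightarrow> has_partials g c d x \<Longrightarrow>
    has_partials (\<lambda>x. f x * g x) (f x * c + a * g x) (f x * d + b * g x) x"
  unfolding has_partials_def
  by (rule has_derivative_eq_rhs, erule (1) has_derivative_mult) (auto simp: algebra_simps)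

lemma has_partials_const: "has_partials (\<lambda>x. c) 0 0 x"
  unfolding has_partials_def by (auto intro!: derivative_eq_intros)

lemma has_partials_snd: "has_partials snd 0 1 x"
  unfolding has_partials_def by (auto intro!: derivative_eq_intros)

lemma has_partials_compose:
  assumes "has_partials f a b x" "(g has_real_derivative g') (at (f x))"
  shows "has_partials (\<lambda>x. g (f x)) (g' * a) (g' * b) x"
proof -
  have "(g \<circ> f has_derivative ((*) g') \<circ> (\<lambda>k. fst k * a + snd k * b)) (at x)"
    using assms unfolding has_partials_def has_field_derivative_def by (rule diff_chain_at)
  then show ?thesis
    unfolding has_partials_def o_def by (simp add: algebra_simps)
qed

lemma has_partials_eq_rhs:
  "has_partials f a b x \<Longrightarrow> a = a' \<Longrightarrow> b = b' \<Longrightarrow> has_partials f a' b' x"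
  by simp

lemma has_partials_slices:
  assumes "has_partials f a b (x1, x2)"
  shows "((\<lambda>r. f (r, x2)) has_real_derivative a) (at x1)"
    and "((\<lambda>r. f (x1, r)) has_real_derivative b) (at x2)"
proof -
  have 1: "((\<lambda>r. (r, x2)) has_derivative (\<lambda>k. (k, 0))) (at x1)"
    and 2: "((\<lambda>r. (x1, r)) has_derivative (\<lambda>k. (0, k))) (at x2)"
    by (auto intro!: derivative_eq_intros)
  show "((\<lambda>r. f (r, x2)) has_real_derivative a) (at x1)"
    using diff_chain_at[OF 1, of f "\<lambda>k. fst k * a + snd k * b"] assms
    unfolding has_partials_def has_field_derivative_def o_def by (simp add: mult_commute_abs)
  show "((\<lambda>r. f (x1, r)) has_real_derivative b) (at x2)"
    using diff_chain_at[OF 2, of f "\<lambda>k. fst k * a + snd k * b"] assms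
    unfolding has_partials_def has_field_derivative_def o_def by (simp add: mult_commute_abs)
qed

lemma pd_eqI:
  assumes "has_partials f a b x"
  shows "pd1 f x = a" "pd2 f x = b"
  using has_partials_slices[of f a b "fst x" "snd x"] assms
  unfolding pd1_def pd2_def
  by (auto simp: has_real_derivative_iff_has_vector_derivative intro!: vector_derivative_at)

lemma differentiable_has_partials:
  assumes "f differentiable (at x)"
  shows "has_partials f (pd1 f x) (pd2 f x) x"
proof -
  obtain D where D: "(f has_derivative D) (at x)" using assms by (auto simp: differentiable_def)
  interpret linear D using D has_derivative_linear by blast
  have "D k = fst k * D (1, 0) + snd k * D (0, 1)" for k
  proof -
    have "D (fst k *\<^sub>R (1, 0) + snd k *\<^sub>R (0, 1)) = fst k * D (1, 0) + snd k * D (0, 1)"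
      by (simp only: add scaleR real_scaleR_def)
    then show ?thesis by (simp add: prod_eq_iff)
  qed
  then have "D = (\<lambda>k. fst k * D (1, 0) + snd k * D (0, 1))" by (rule ext)
  from D[unfolded has_partials_def, THEN has_derivative_eq_rhs, OF this]
  have p: "has_partials f (D (1, 0)) (D (0, 1)) x" unfolding has_partials_def .
  show ?thesis unfolding pd_eqI[OF p] by (rule p)
qed

lemma has_partials_transform_open:
  assumes "has_partials f a b x" "open S" "x \<in> S" "\<And>y. y \<in> S \<Longrightarrow> f y = g y"
  shows "has_partials g a b x"
  using assms unfolding has_partials_def by (blast intro: has_derivative_transform_within_open)

text \<open>
  The coordinates \<open>(x, s)\<close> map the curved strip to \<open>\<real> \<times> [0, 1]\<close>. They have unit Jacobian.
\<close>

definition straight :: "(real \<Rightarrow> real) \<Rightarrow> (real \<Rightarrow> real \<times> real \<Rightarrow> 'b) \<Rightarrow> real \<times> real \<times> real \<Rightarrow> 'b" where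
  "straight h w = (\<lambda>(t, x, s). w t (x, h x + s))"

lemma straight_apply [simp]: "straight h w (t, x, s) = w t (x, h x + s)"
  by (simp add: straight_def)

lemma straight_continuous:
  assumes w: "jointly_continuous S w" and h: "continuous_on UNIV h"
    and B: "\<And>t x s. (t, x, s) \<in> B \<Longrightarrow> 0 < t \<and> (x, h x + s) \<in> S"
  shows "continuous_on B (straight h w)"
proof -
  have 1: "continuous_on B (\<lambda>z. (fst z, (fst (snd z), h (fst (snd z)) + snd (snd z))))"
    by (intro continuous_intros continuous_on_compose2[OF h]) auto
  have "continuous_on B (\<lambda>z. (\<lambda>(t, x). w t x) (fst z, (fst (snd z), h (fst (snd z)) + snd (snd z))))"
    by (rule continuous_on_compose2[OF w[unfolded jointly_continuous_def] 1]) (use B in auto)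
  then show ?thesis by (simp add: straight_def case_prod_beta)
qed

lemma jointly_continuousI:
  "continuous_on ({0<..} \<times> S) (\<lambda>z. w (fst z) (snd z)) \<Longrightarrow> jointly_continuous S w"
  by (simp add: jointly_continuous_def case_prod_beta)

lemma jointly_continuousD:
  "jointly_continuous S w \<Longrightarrow> continuous_on ({0<..} \<times> S) (\<lambda>z. w (fst z) (snd z))"
  by (simp add: jointly_continuous_def case_prod_beta)

lemma cbox_triple:
  "cbox (t0, x0, s0) (t1, x1, s1) = {t0..t1} \<times> {x0..x1} \<times> {s0..s1 :: real}"
  for t0 t1 x0 x1 :: real
  by (simp add: cbox_Pair_eq)

lemma cbox_double: "cbox (t0, x0) (t1, x1) = {t0..t1} \<times> {x0..x1 :: real}" for t0 t1 :: real
  by (simp add: cbox_Pair_eq)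

lemma integral_box_derivative_last:
  fixes g g' :: "real \<times> real \<times> real \<Rightarrow> real"
  assumes g: "continuous_on (cbox (t0, x0, a) (T, x1, b)) g"
    and g': "continuous_on (cbox (t0, x0, a) (T, x1, b)) g'" and ab: "a \<le> b"
    and d: "\<And>t x s. t \<in> {t0..T} \<Longrightarrow> x \<in> {x0..x1} \<Longrightarrow> s \<in> {a..b} \<Longrightarrow>
        ((\<lambda>s. g (t, x, s)) has_real_derivative g' (t, x, s)) (at s)"
  shows "integral (cbox (t0, x0, a) (T, x1, b)) g' =
      integral (cbox (t0, x0) (T, x1)) (\<lambda>(t, x). g (t, x, b) - g (t, x, a))"
proof -
  have "integral (cbox (t0, x0, a) (T, x1, b)) g' =
      integral {t0..T} (\<lambda>t. integral (cbox (x0, a) (x1, b)) (\<lambda>y. g' (t, y)))"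
    using integral_prod_continuous[OF g'] by simp
  also have "\<dots> = integral {t0..T} (\<lambda>t. integral {x0..x1} (\<lambda>x. g (t, x, b) - g (t, x, a)))"
  proof (rule HK_integral_cong)
    fix t assume t: "t \<in> {t0..T}"
    have c: "continuous_on (cbox (x0, a) (x1, b)) (\<lambda>y. g' (t, y))"
      by (rule continuous_on_compose2[OF g']) (use t in \<open>auto intro!: continuous_intros simp: cbox_Pair_eq\<close>)
    have "integral (cbox (x0, a) (x1, b)) (\<lambda>y. g' (t, y)) =
        integral {x0..x1} (\<lambda>x. integral {a..b} (\<lambda>s. g' (t, x, s)))"
      using integral_prod_continuous[OF c] by simp
    also have "\<dots> = integral {x0..x1} (\<lambda>x. g (t, x, b) - g (t, x, a))"
    proof (rule HK_integral_cong)
      fix x assume x: "x \<in> {x0..x1}"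
      show "integral {a..b} (\<lambda>s. g' (t, x, s)) = g (t, x, b) - g (t, x, a)"
        by (intro integral_unique fundamental_theorem_of_calculus ab)
          (use d[OF t x] in \<open>auto simp: has_real_derivative_iff_has_vector_derivative
              intro: has_vector_derivative_at_within\<close>)
    qed
    finally show "integral (cbox (x0, a) (x1, b)) (\<lambda>y. g' (t, y)) =
        integral {x0..x1} (\<lambda>x. g (t, x, b) - g (t, x, a))" .
  qed
  also have "\<dots> = integral (cbox (t0, x0) (T, x1)) (\<lambda>(t, x). g (t, x, b) - g (t, x, a))"
  proof -
    have "continuous_on (cbox (t0, x0) (T, x1)) (\<lambda>z. g (fst z, snd z, c))" if "c \<in> {a..b}" for c
      by (rule continuous_on_compose2[OF g]) (use that in \<open>auto intro!: continuous_intros simp: cbox_Pair_eq\<close>)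
    then have "continuous_on (cbox (t0, x0) (T, x1)) (\<lambda>(t, x). g (t, x, b) - g (t, x, a))"
      using ab by (auto simp: case_prod_beta intro!: continuous_intros)
    from integral_prod_continuous[OF this] show ?thesis by simp
  qed
  finally show ?thesis .
qed

lemma integral_box_derivative_first:
  fixes g g' :: "real \<times> real \<times> real \<Rightarrow> real"
  assumes g': "continuous_on (cbox (t0, x0, a) (T, x1, b)) g'" and T: "t0 \<le> T"
    and d: "\<And>t z. t \<in> {t0..T} \<Longrightarrow> z \<in> cbox (x0, a) (x1, b) \<Longrightarrow>
        ((\<lambda>t. g (t, z)) has_real_derivative g' (t, z)) (at t)"
  shows "integral (cbox (t0, x0, a) (T, x1, b)) g' =
      integral (cbox (x0, a) (x1, b)) (\<lambda>z. g (T, z) - g (t0, z))"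
proof -
  have "integral (cbox (t0, x0, a) (T, x1, b)) g' =
      integral (cbox t0 T) (\<lambda>t. integral (cbox (x0, a) (x1, b)) (\<lambda>z. g' (t, z)))"
    using integral_prod_continuous[OF g'] by simp
  also have "\<dots> = integral (cbox (x0, a) (x1, b)) (\<lambda>z. integral (cbox t0 T) (\<lambda>t. g' (t, z)))"
    using integral_swap_continuous[of t0 "(x0, a)" T "(x1, b)" "\<lambda>t z. g' (t, z)"] g' by simp
  also have "\<dots> = integral (cbox (x0, a) (x1, b)) (\<lambda>z. g (T, z) - g (t0, z))"
  proof (rule HK_integral_cong)
    fix z assume z: "z \<in> cbox (x0, a) (x1, b)"
    show "integral (cbox t0 T) (\<lambda>t. g' (t, z)) = g (T, z) - g (t0, z)"
      unfolding cbox_interval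
      by (intro integral_unique fundamental_theorem_of_calculus T)
        (use d[OF _ z] in \<open>auto simp: has_real_derivative_iff_has_vector_derivative
            intro: has_vector_derivative_at_within\<close>)
  qed
  finally show ?thesis .
qed

lemma integral_box_derivative_periodic:
  fixes g g' :: "real \<times> real \<times> real \<Rightarrow> real"
  assumes g': "continuous_on (cbox (t0, x0, a) (T, x1, b)) g'" and x: "x0 \<le> x1"
    and d: "\<And>t x s. t \<in> {t0..T} \<Longrightarrow> x \<in> {x0..x1} \<Longrightarrow> s \<in> {a..b} \<Longrightarrow>
        ((\<lambda>x. g (t, x, s)) has_real_derivative g' (t, x, s)) (at x)"
    and per: "\<And>t s. t \<in> {t0..T} \<Longrightarrow> s \<in> {a..b} \<Longrightarrow> g (t, x1, s) = g (t, x0, s)"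
  shows "integral (cbox (t0, x0, a) (T, x1, b)) g' = 0"
proof -
  have "integral (cbox (t0, x0, a) (T, x1, b)) g' =
      integral {t0..T} (\<lambda>t. integral (cbox (x0, a) (x1, b)) (\<lambda>y. g' (t, y)))"
    using integral_prod_continuous[OF g'] by simp
  also have "\<dots> = integral {t0..T} (\<lambda>t. 0)"
  proof (rule HK_integral_cong)
    fix t assume t: "t \<in> {t0..T}"
    have c: "continuous_on (cbox (x0, a) (x1, b)) (\<lambda>(x, s). g' (t, x, s))"
      unfolding case_prod_beta
      by (rule continuous_on_compose2[OF g']) (use t in \<open>auto intro!: continuous_intros simp: cbox_Pair_eq\<close>)
    have "integral (cbox (x0, a) (x1, b)) (\<lambda>y. g' (t, y)) =
        integral (cbox a b) (\<lambda>s. integral (cbox x0 x1) (\<lambda>x. g' (t, x, s)))"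
    proof -
      have "(\<lambda>y. g' (t, y)) = (\<lambda>(x, s). g' (t, x, s))" by auto
      then show ?thesis using integral_prod_continuous[OF c] integral_swap_continuous[OF c] by simp
    qed
    also have "\<dots> = integral (cbox a b) (\<lambda>s. 0)"
    proof (rule HK_integral_cong)
      fix s assume s: "s \<in> cbox a b"
      have "((\<lambda>x. g' (t, x, s)) has_integral (g (t, x1, s) - g (t, x0, s))) {x0..x1}"
        by (intro fundamental_theorem_of_calculus x)
          (use d[OF t] s in \<open>auto simp: has_real_derivative_iff_has_vector_derivative
              intro: has_vector_derivative_at_within\<close>)
      then show "integral (cbox x0 x1) (\<lambda>x. g' (t, x, s)) = 0"
        using per[OF t, of s] s by (auto dest: integral_unique)
    qed
    finally show "integral (cbox (x0, a) (x1, b)) (\<lambda>y. g' (t, y)) = 0" by simp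
  qed
  finally show ?thesis by simp
qed

lemma open_strip_open:
  assumes "continuous_on UNIV h" shows "open (open_strip h)"
proof -
  have "open_strip h = {x. h (fst x) < snd x} \<inter> {x. snd x < 1 + h (fst x)}"
    by (auto simp: open_strip_def)
  moreover have "open {x :: real \<times> real. h (fst x) < snd x}" "open {x :: real \<times> real. snd x < 1 + h (fst x)}"
    by (intro open_Collect_less continuous_intros continuous_on_compose2[OF assms]; simp)+
  ultimately show ?thesis by auto
qed

text \<open>
  Along a slice \<open>s = const\<close> the derivative of \<open>V1\<close> in \<open>x\<close> is \<open>P1 + h' Q1\<close>, and the derivative of
  \<open>V2 - h' V1\<close> in \<open>s\<close> is \<open>Q2 - h' Q1\<close>. Their sum is the divergence \<open>P1 + Q2\<close>; the first integrates to
  zero over a period and the second to a difference of fluxes.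
\<close>

theorem strip_divergence:
  fixes q V1 V2 dq P1 Q1 P2 Q2 :: "real \<Rightarrow> real \<times> real \<Rightarrow> real"
  assumes h: "\<And>x. (h has_real_derivative h' x) (at x)" "continuous_on UNIV h'" "\<And>x. h (x + \<Gamma>) = h x"
    and \<Gamma>: "\<Gamma> > 0"
    and per: "\<And>t. 0 < t \<Longrightarrow> x1_periodic_on (open_strip h) \<Gamma> (V1 t)"
    and dq: "\<And>t x. 0 < t \<Longrightarrow> x \<in> open_strip h \<Longrightarrow> ((\<lambda>r. q r x) has_real_derivative dq t x) (at t)"
    and dV1: "\<And>t x. 0 < t \<Longrightarrow> x \<in> open_strip h \<Longrightarrow> has_partials (V1 t) (P1 t x) (Q1 t x) x"
    and dV2: "\<And>t x. 0 < t \<Longrightarrow> x \<in> open_strip h \<Longrightarrow> has_partials (V2 t) (P2 t x) (Q2 t x) x"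
    and cont: "jointly_continuous (open_strip h) V1" "jointly_continuous (open_strip h) V2"
      "jointly_continuous (open_strip h) dq" "jointly_continuous (open_strip h) P1"
      "jointly_continuous (open_strip h) Q1" "jointly_continuous (open_strip h) Q2"
    and box: "0 < t0" "t0 \<le> T" "0 < a" "a \<le> b" "b < 1"
  shows "integral (cbox (t0, 0, a) (T, \<Gamma>, b)) (straight h (\<lambda>t x. dq t x + P1 t x + Q2 t x)) =
      integral (cbox (0, a) (\<Gamma>, b)) (\<lambda>z. straight h q (T, z) - straight h q (t0, z)) +
      (integral (cbox (t0, 0) (T, \<Gamma>)) (\<lambda>(t, x). V2 t (x, h x + b) - h' x * V1 t (x, h x + b)) -
       integral (cbox (t0, 0) (T, \<Gamma>)) (\<lambda>(t, x). V2 t (x, h x + a) - h' x * V1 t (x, h x + a)))"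
proof -
  let ?B = "cbox (t0, 0, a) (T, \<Gamma>, b)"
  have hc: "continuous_on UNIV h"
    using h(1) DERIV_isCont continuous_at_imp_continuous_on by blast
  have inB: "0 < t \<and> (x, h x + s) \<in> open_strip h" if "(t, x, s) \<in> ?B" for t x s
    using that box by (auto simp: open_strip_def cbox_triple)
  have sc: "continuous_on ?B (straight h w)" if "jointly_continuous (open_strip h) w" for w :: "real \<Rightarrow> real \<times> real \<Rightarrow> real"
    using straight_continuous[OF that hc] inB by blast
  have h'B: "continuous_on ?B (\<lambda>z. h' (fst (snd z)))"
    by (intro continuous_on_compose2[OF h(2)] continuous_intros) auto
  define gx where "gx z = straight h P1 z + h' (fst (snd z)) * straight h Q1 z" for z
  define gs where "gs z = straight h Q2 z - h' (fst (snd z)) * straight h Q1 z" for z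
  define G where "G z = straight h V2 z - h' (fst (snd z)) * straight h V1 z" for z
  have c: "continuous_on ?B gx" "continuous_on ?B gs" "continuous_on ?B G" "continuous_on ?B (straight h dq)"
    unfolding gx_def gs_def G_def by (intro continuous_intros sc cont h'B)+
  have vert: "((\<lambda>s. W t (x, h x + s)) has_real_derivative Q) (at s)"
    if "has_partials (W t) P Q (x, h x + s)" for W :: "real \<Rightarrow> real \<times> real \<Rightarrow> real" and t P Q x s
  proof -
    have "((\<lambda>s. h x + s) has_real_derivative 1) (at s)" by (auto intro!: derivative_eq_intros)
    from DERIV_chain2[where f = "\<lambda>r. W t (x, r)", OF has_partials_slices(2)[OF that] this]
    show ?thesis by simp
  qed
  have t_part: "integral ?B (straight h dq) =
      integral (cbox (0, a) (\<Gamma>, b)) (\<lambda>z. straight h q (T, z) - straight h q (t0, z))"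
  proof (rule integral_box_derivative_first[OF c(4) box(2)])
    fix t z assume "t \<in> {t0..T}" and "z \<in> cbox (0, a) (\<Gamma>, b)"
    then have "(t, z) \<in> ?B" by (auto simp: cbox_Pair_eq)
    then show "((\<lambda>t. straight h q (t, z)) has_real_derivative straight h dq (t, z)) (at t)"
      using dq inB by (cases z) auto
  qed
  have x_part: "integral ?B gx = 0"
  proof (rule integral_box_derivative_periodic[OF c(1)])
    fix t x s assume "t \<in> {t0..T}" "x \<in> {0..\<Gamma>}" "s \<in> {a..b}"
    then have "(t, x, s) \<in> ?B" by (auto simp: cbox_Pair_eq)
    then have d: "has_partials (V1 t) (P1 t (x, h x + s)) (Q1 t (x, h x + s)) (x, h x + s)"
      using dV1 inB by blast
    have e: "((\<lambda>x. (x, h x + s)) has_derivative (\<lambda>k. (k, h' x * k))) (at x)"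
      using h(1)[of x] by (auto intro!: derivative_eq_intros simp: has_field_derivative_def)
    show "((\<lambda>x. straight h V1 (t, x, s)) has_real_derivative gx (t, x, s)) (at x)"
      using diff_chain_at[OF e d[unfolded has_partials_def]]
      unfolding has_field_derivative_def o_def gx_def straight_apply fst_conv snd_conv
      by (rule has_derivative_eq_rhs) (auto simp: fun_eq_iff algebra_simps)
  next
    fix t s assume "t \<in> {t0..T}" "s \<in> {a..b}"
    then have "0 < t" "(0, h 0 + s) \<in> open_strip h" using box by (auto simp: open_strip_def)
    then show "straight h V1 (t, \<Gamma>, s) = straight h V1 (t, 0, s)"
      using per[of t] h(3)[of 0] by (auto simp: x1_periodic_on_def)
  qed (use \<Gamma> in simp)
  have s_part: "integral ?B gs = integral (cbox (t0, 0) (T, \<Gamma>)) (\<lambda>(t, x). G (t, x, b) - G (t, x, a))"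
  proof (rule integral_box_derivative_last[OF c(3) c(2) box(4)])
    fix t x s assume "t \<in> {t0..T}" "x \<in> {0..\<Gamma>}" "s \<in> {a..b}"
    then have "(t, x, s) \<in> ?B" by (auto simp: cbox_Pair_eq)
    then have "((\<lambda>s. V1 t (x, h x + s)) has_real_derivative Q1 t (x, h x + s)) (at s)"
      "((\<lambda>s. V2 t (x, h x + s)) has_real_derivative Q2 t (x, h x + s)) (at s)"
      using vert[of V1] vert[of V2] dV1 dV2 inB by blast+
    then show "((\<lambda>s. G (t, x, s)) has_real_derivative gs (t, x, s)) (at s)"
      unfolding G_def gs_def by (auto intro!: derivative_eq_intros)
  qed
  have "straight h (\<lambda>t x. dq t x + P1 t x + Q2 t x) = (\<lambda>z. straight h dq z + gx z + gs z)"
    by (auto simp: gx_def gs_def)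
  then have "integral ?B (straight h (\<lambda>t x. dq t x + P1 t x + Q2 t x)) =
      integral ?B (straight h dq) + integral ?B gx + integral ?B gs"
    by (simp add: HK_integral_add integrable_continuous c continuous_on_add)
  moreover have "integral (cbox (t0, 0) (T, \<Gamma>)) (\<lambda>(t, x). G (t, x, b) - G (t, x, a)) =
      integral (cbox (t0, 0) (T, \<Gamma>)) (\<lambda>(t, x). G (t, x, b)) -
      integral (cbox (t0, 0) (T, \<Gamma>)) (\<lambda>(t, x). G (t, x, a))"
  proof -
    have "continuous_on (cbox (t0, 0) (T, \<Gamma>)) (\<lambda>z. G (fst z, snd z, e))" if "e \<in> {a..b}" for e
      by (rule continuous_on_compose2[OF c(3)]) (use that in \<open>auto intro!: continuous_intros simp: cbox_Pair_eq\<close>)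
    then have "(\<lambda>(t, x). G (t, x, e)) integrable_on cbox (t0, 0) (T, \<Gamma>)" if "e \<in> {a..b}" for e
      using that by (intro integrable_continuous) (simp add: case_prod_unfold)
    then show ?thesis
      using box HK_integral_diff[of "\<lambda>(t, x). G (t, x, b)" _ "\<lambda>(t, x). G (t, x, a)"]
      by (simp add: case_prod_unfold)
  qed
  ultimately show ?thesis unfolding t_part x_part s_part by (simp add: G_def)
qed

section \<open>Square integrable boundary values\<close>

lemma absolutely_integrable_continuous_mult:
  fixes f c :: "'a::euclidean_space \<Rightarrow> real"
  assumes f: "f absolutely_integrable_on cbox a b" and c: "continuous_on (cbox a b) c"
  shows "(\<lambda>x. f x * c x) absolutely_integrable_on cbox a b"
proof -
  have "(\<lambda>x. c x * f x) absolutely_integrable_on cbox a b"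
    by (rule absolutely_integrable_bounded_measurable_product[OF bilinear_times])
      (use c f in \<open>auto intro!: continuous_imp_measurable_on_sets_lebesgue
        compact_imp_bounded compact_continuous_image\<close>)
  then show ?thesis by (simp add: mult.commute)
qed

text \<open>
  On a set of finite measure \<open>\<bar>d\<bar> \<le> \<eta> + d\<^sup>2 / \<eta>\<close> turns convergence in \<open>L\<^sup>2\<close> into convergence in \<open>L\<^sup>1\<close>.
\<close>

lemma L2_trace_L1:
  fixes w :: "real \<Rightarrow> real \<times> real \<Rightarrow> real"
  assumes tr: "L2_trace \<Gamma> h s w g" and t: "0 < t0" "t0 < T"
    and cont: "\<And>\<epsilon>. 0 < \<epsilon> \<Longrightarrow> \<epsilon> < 1 \<Longrightarrow>
        continuous_on (cbox (t0, 0) (T, \<Gamma>)) (\<lambda>z. w (fst z) (slice h s \<epsilon> (snd z)))"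
  shows "(\<lambda>z. g (fst z) (snd z)) absolutely_integrable_on cbox (t0, 0) (T, \<Gamma>)"
    and "eventually (\<lambda>\<epsilon>. (\<lambda>z. w (fst z) (slice h s \<epsilon> (snd z)) - g (fst z) (snd z))
          absolutely_integrable_on cbox (t0, 0) (T, \<Gamma>)) (at_right 0)"
    and "((\<lambda>\<epsilon>. integral (cbox (t0, 0) (T, \<Gamma>))
          (\<lambda>z. \<bar>w (fst z) (slice h s \<epsilon> (snd z)) - g (fst z) (snd z)\<bar>)) \<longlongrightarrow> 0) (at_right 0)"
proof -
  let ?R = "cbox (t0, 0) (T, \<Gamma>)"
  define d where "d \<epsilon> z = w (fst z) (slice h s \<epsilon> (snd z)) - g (fst z) (snd z)" for \<epsilon> z
  define I where "I \<epsilon> = (\<integral>\<^sup>+ z \<in> ?R. ennreal ((norm (d \<epsilon> z))\<^sup>2) \<partial>lborel)" for \<epsilon>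
  have I0: "(I \<longlongrightarrow> 0) (at_right 0)"
    using tr t unfolding L2_trace_def I_def d_def cbox_double by blast
  have gm: "(\<lambda>z. g (fst z) (snd z)) \<in> borel_measurable borel"
    using tr unfolding L2_trace_def by (simp add: case_prod_unfold)
  have dm: "(\<lambda>z. indicator ?R z *\<^sub>R d \<epsilon> z) \<in> borel_measurable lborel" if "0 < \<epsilon>" "\<epsilon> < 1" for \<epsilon>
  proof -
    have 1: "(\<lambda>z. indicator ?R z *\<^sub>R w (fst z) (slice h s \<epsilon> (snd z))) \<in> borel_measurable borel"
      by (rule borel_measurable_continuous_on_indicator) (use cont[OF that] in auto)
    have 2: "(\<lambda>z. indicator ?R z *\<^sub>R g (fst z) (snd z)) \<in> borel_measurable borel"
      using gm by (intro borel_measurable_scaleR) auto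
    from borel_measurable_diff[OF 1 2] show ?thesis
      by (simp add: d_def right_diff_distrib)
  qed
  define m where "m = measure lborel ?R"
  have m: "emeasure lborel ?R = ennreal m" "m \<ge> 0"
    unfolding m_def by (rule emeasure_eq_ennreal_measure) (use emeasure_lborel_cbox_finite in \<open>auto simp: less_top\<close>)
  have bound: "(\<integral>\<^sup>+ z. ennreal (norm (indicator ?R z *\<^sub>R d \<epsilon> z)) \<partial>lborel)
      \<le> ennreal (\<eta> * m) + ennreal (1 / \<eta>) * I \<epsilon>" if "0 < \<epsilon>" "\<epsilon> < 1" "\<eta> > 0" for \<epsilon> \<eta>
  proof -
    have [measurable]: "(\<lambda>z. (norm (d \<epsilon> z))\<^sup>2 * indicator ?R z) \<in> borel_measurable lborel"
    proof -
      have "(\<lambda>z. (norm (indicator ?R z *\<^sub>R d \<epsilon> z))\<^sup>2) \<in> borel_measurable lborel"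
        using dm[OF that(1,2)] by measurable
      moreover have "(\<lambda>z. (norm (indicator ?R z *\<^sub>R d \<epsilon> z))\<^sup>2) = (\<lambda>z. (norm (d \<epsilon> z))\<^sup>2 * indicator ?R z)"
        by (auto simp: indicator_def)
      ultimately show ?thesis by simp
    qed
    have pt: "\<bar>x\<bar> \<le> \<eta> + 1 / \<eta> * x\<^sup>2" for x :: real
    proof -
      have "0 \<le> (\<bar>x\<bar> - \<eta>)\<^sup>2" "0 \<le> \<bar>x\<bar> * \<eta>" using that by auto
      then have "\<bar>x\<bar> * \<eta> \<le> \<eta>\<^sup>2 + x\<^sup>2" by (simp add: power2_diff)
      then show ?thesis using that by (simp add: field_simps power2_eq_square)
    qed
    have "(\<integral>\<^sup>+ z. ennreal (norm (indicator ?R z *\<^sub>R d \<epsilon> z)) \<partial>lborel)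
      \<le> (\<integral>\<^sup>+ z. ennreal \<eta> * indicator ?R z + ennreal (1 / \<eta>) * ennreal ((norm (d \<epsilon> z))\<^sup>2 * indicator ?R z) \<partial>lborel)"
      by (intro nn_integral_mono)
        (use that pt in \<open>auto simp: indicator_def ennreal_mult[symmetric] ennreal_plus[symmetric]
          simp del: ennreal_plus intro!: ennreal_leI\<close>)
    also have "\<dots> = ennreal \<eta> * emeasure lborel ?R + ennreal (1 / \<eta>) *
        (\<integral>\<^sup>+ z. ennreal ((norm (d \<epsilon> z))\<^sup>2 * indicator ?R z) \<partial>lborel)"
    proof -
      have M: "(\<lambda>z. ennreal ((norm (d \<epsilon> z))\<^sup>2 * indicator ?R z)) \<in> borel_measurable lborel"
        by measurable
      have "(\<integral>\<^sup>+ z. ennreal \<eta> * indicator ?R z \<partial>lborel) = ennreal \<eta> * emeasure lborel ?R"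
        by (rule nn_integral_cmult_indicator) simp
      moreover have "(\<lambda>z. ennreal \<eta> * indicator ?R z) \<in> borel_measurable lborel" by measurable
      moreover have "(\<lambda>z. ennreal (1 / \<eta>) * ennreal ((norm (d \<epsilon> z))\<^sup>2 * indicator ?R z)) \<in> borel_measurable lborel"
        using M by (intro borel_measurable_times_ennreal) auto
      ultimately show ?thesis
        using nn_integral_add[of "\<lambda>z. ennreal \<eta> * indicator ?R z" lborel
            "\<lambda>z. ennreal (1 / \<eta>) * ennreal ((norm (d \<epsilon> z))\<^sup>2 * indicator ?R z)"]
          nn_integral_cmult[OF M, of "ennreal (1 / \<eta>)"]
        by simp
    qed
    also have "(\<integral>\<^sup>+ z. ennreal ((norm (d \<epsilon> z))\<^sup>2 * indicator ?R z) \<partial>lborel) = I \<epsilon>"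
      unfolding I_def by (intro nn_integral_cong) (auto simp: indicator_def)
    finally show ?thesis using m that by (simp add: ennreal_mult)
  qed
  have fin: "eventually (\<lambda>\<epsilon>. I \<epsilon> < e) (at_right 0)" if "e > 0" for e
    using I0 that by (rule order_tendstoD)
  have small: "eventually (\<lambda>\<epsilon>::real. 0 < \<epsilon> \<and> \<epsilon> < 1) (at_right 0)"
    by (auto simp: eventually_at_right_field intro!: exI[of _ 1])
  have int: "set_integrable lborel ?R (d \<epsilon>)" if e: "0 < \<epsilon>" "\<epsilon> < 1" "I \<epsilon> < 1" for \<epsilon>
    unfolding set_integrable_def
  proof (rule integrableI_bounded[OF dm[OF e(1,2)]])
    show "(\<integral>\<^sup>+ z. ennreal (norm (indicator ?R z *\<^sub>R d \<epsilon> z)) \<partial>lborel) < \<infinity>"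
    proof -
      have "I \<epsilon> < top" using e(3) by (rule less_trans) simp
      then show ?thesis using bound[OF e(1,2), of 1] by (auto elim!: le_less_trans)
    qed
  qed
  have leb: "set_integrable lborel ?R f \<Longrightarrow> f absolutely_integrable_on ?R" for f :: "real \<times> real \<Rightarrow> real"
    unfolding set_integrable_def by (subst integrable_completion) auto
  have ev: "eventually (\<lambda>\<epsilon>. 0 < \<epsilon> \<and> \<epsilon> < 1 \<and> I \<epsilon> < 1) (at_right 0)"
    using eventually_conj[OF small fin[of 1]] by simp
  show evd: "eventually (\<lambda>\<epsilon>. (\<lambda>z. w (fst z) (slice h s \<epsilon> (snd z)) - g (fst z) (snd z))
          absolutely_integrable_on ?R) (at_right 0)"
    by (rule eventually_mono[OF ev]) (use int leb in \<open>auto simp: d_def[abs_def]\<close>)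
  obtain \<epsilon> where \<epsilon>: "0 < \<epsilon> \<and> \<epsilon> < 1 \<and> I \<epsilon> < 1"
    using eventually_happens'[OF _ ev] by auto
  have "(\<lambda>z. w (fst z) (slice h s \<epsilon> (snd z)) - d \<epsilon> z) absolutely_integrable_on ?R"
    by (intro set_integral_diff(1) absolutely_integrable_continuous cont leb int) (use \<epsilon> in auto)
  then show "(\<lambda>z. g (fst z) (snd z)) absolutely_integrable_on ?R" by (simp add: d_def)
  show "((\<lambda>\<epsilon>. integral ?R (\<lambda>z. \<bar>w (fst z) (slice h s \<epsilon> (snd z)) - g (fst z) (snd z)\<bar>)) \<longlongrightarrow> 0) (at_right 0)"
  proof (rule tendstoI)
    fix e :: real assume e: "e > 0"
    define \<eta> where "\<eta> = e / (2 * (m + 1))"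
    have \<eta>: "\<eta> > 0" "\<eta> * m \<le> e / 2" using e m by (auto simp: \<eta>_def field_simps)
    have f2: "eventually (\<lambda>\<epsilon>. I \<epsilon> < ennreal (\<eta> * e / 2)) (at_right 0)"
      using \<eta> e by (intro fin) simp
    show "eventually (\<lambda>\<epsilon>. dist (integral ?R (\<lambda>z. \<bar>w (fst z) (slice h s \<epsilon> (snd z)) - g (fst z) (snd z)\<bar>)) 0 < e) (at_right 0)"
      using ev f2
    proof eventually_elim
      case (elim \<epsilon>)
      have si: "set_integrable lborel ?R (\<lambda>z. \<bar>d \<epsilon> z\<bar>)"
        using int elim set_integrable_abs by blast
      then have "integral ?R (\<lambda>z. \<bar>d \<epsilon> z\<bar>) = (LINT z:?R|lborel. \<bar>d \<epsilon> z\<bar>)"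
        by (simp add: set_borel_integral_eq_integral)
      moreover have "ennreal (LINT z:?R|lborel. \<bar>d \<epsilon> z\<bar>) = (\<integral>\<^sup>+ z. ennreal (norm (indicator ?R z *\<^sub>R d \<epsilon> z)) \<partial>lborel)"
        unfolding set_lebesgue_integral_def
        using nn_integral_eq_integral[of lborel "\<lambda>z. indicator ?R z *\<^sub>R \<bar>d \<epsilon> z\<bar>"] si
        by (simp add: set_integrable_def abs_mult)
      ultimately have "ennreal (integral ?R (\<lambda>z. \<bar>d \<epsilon> z\<bar>)) \<le> ennreal (\<eta> * m) + ennreal (1 / \<eta>) * I \<epsilon>"
        using bound elim \<eta> by auto
      also have "\<dots> < ennreal (e / 2) + ennreal (e / 2)"
      proof -
        have "ennreal (1 / \<eta>) * I \<epsilon> < ennreal (1 / \<eta>) * ennreal (\<eta> * e / 2)"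
          using elim \<eta> by (intro ennreal_mult_strict_left_mono) auto
        also have "\<dots> = ennreal (e / 2)" using \<eta> e by (simp add: ennreal_mult[symmetric])
        finally have "ennreal (e / 2) + ennreal (1 / \<eta>) * I \<epsilon> < ennreal (e / 2) + ennreal (e / 2)"
          by (simp add: ennreal_add_left_cancel_less)
        moreover have "ennreal (\<eta> * m) + ennreal (1 / \<eta>) * I \<epsilon> \<le> ennreal (e / 2) + ennreal (1 / \<eta>) * I \<epsilon>"
          using \<eta> by (intro add_right_mono ennreal_leI)
        ultimately show ?thesis by (rule le_less_trans[rotated])
      qed
      also have "\<dots> = ennreal e" using e by (simp add: ennreal_plus[symmetric] del: ennreal_plus)
      finally have "ennreal (integral ?R (\<lambda>z. \<bar>d \<epsilon> z\<bar>)) < ennreal e" .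
      moreover have "0 \<le> integral ?R (\<lambda>z. \<bar>d \<epsilon> z\<bar>)"
        by (intro Henstock_Kurzweil_Integration.integral_nonneg set_borel_integral_eq_integral(1)[OF si]) auto
      ultimately show ?case
        using e by (simp add: ennreal_less_iff d_def)
    qed
  qed
qed

text \<open>
  Every boundary term below pairs a field with an \<open>L\<^sup>2\<close> trace with coefficients \<open>c\<close> that are continuous
  up to the boundary; \<open>L\<^sup>1\<close> convergence of the one and uniform convergence of the other pass to the limit.
\<close>

theorem L2_trace_pairing_tendsto:
  fixes w :: "real \<Rightarrow> real \<times> real \<Rightarrow> real" and c :: "real \<times> real \<times> real \<Rightarrow> real"
  assumes tr: "L2_trace \<Gamma> h s w g" and t: "0 < t0" "t0 < T"
    and cont: "\<And>\<epsilon>. 0 < \<epsilon> \<Longrightarrow> \<epsilon> < 1 \<Longrightarrow>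
        continuous_on (cbox (t0, 0) (T, \<Gamma>)) (\<lambda>z. w (fst z) (slice h s \<epsilon> (snd z)))"
    and c: "continuous_on ({0..1/2} \<times> cbox (t0, 0) (T, \<Gamma>)) c"
  shows "(\<lambda>z. g (fst z) (snd z) * c (0, z)) absolutely_integrable_on cbox (t0, 0) (T, \<Gamma>)" (is ?A)
    and "((\<lambda>\<epsilon>. integral (cbox (t0, 0) (T, \<Gamma>)) (\<lambda>z. w (fst z) (slice h s \<epsilon> (snd z)) * c (\<epsilon>, z)))
        \<longlongrightarrow> integral (cbox (t0, 0) (T, \<Gamma>)) (\<lambda>z. g (fst z) (snd z) * c (0, z))) (at_right 0)" (is ?B)
proof -
  let ?R = "cbox (t0, 0) (T, \<Gamma>)"
  define W where "W \<epsilon> z = w (fst z) (slice h s \<epsilon> (snd z))" for \<epsilon> z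
  define g' where "g' z = g (fst z) (snd z)" for z
  have gi: "g' absolutely_integrable_on ?R"
    and di: "eventually (\<lambda>\<epsilon>. (\<lambda>z. W \<epsilon> z - g' z) absolutely_integrable_on ?R) (at_right 0)"
    and d0: "((\<lambda>\<epsilon>. integral ?R (\<lambda>z. \<bar>W \<epsilon> z - g' z\<bar>)) \<longlongrightarrow> 0) (at_right 0)"
    using L2_trace_L1[OF tr t cont] by (simp_all add: W_def g'_def[abs_def])
  have cc: "continuous_on ?R (\<lambda>z. c (\<epsilon>, z))" if "\<epsilon> \<in> {0..1/2}" for \<epsilon>
    by (rule continuous_on_compose2[OF c]) (use that in \<open>auto intro!: continuous_intros\<close>)
  show ?A using absolutely_integrable_continuous_mult[OF gi cc[of 0]] by (simp add: g'_def)
  have comp: "compact ({0..1/2::real} \<times> ?R)" by (intro compact_Times) auto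
  obtain B where B: "B > 0" "\<And>x. x \<in> {0..1/2} \<times> ?R \<Longrightarrow> \<bar>c x\<bar> \<le> B"
    using compact_imp_bounded[OF compact_continuous_image[OF c comp]]
    by (auto simp: bounded_pos)
  define G where "G = integral ?R (\<lambda>z. \<bar>g' z\<bar>)"
  have gai: "(\<lambda>z. \<bar>g' z\<bar>) integrable_on ?R"
    using gi by (auto simp: absolutely_integrable_on_def)
  have G: "G \<ge> 0" unfolding G_def by (intro integral_nonneg gai) auto
  have uc: "uniformly_continuous_on ({0..1/2} \<times> ?R) c"
    by (rule compact_uniformly_continuous[OF c comp])
  show ?B
  proof (rule tendstoI)
    fix e :: real assume e: "e > 0"
    define e' where "e' = e / (2 * (G + 1))"
    have e': "e' > 0" using e G by (simp add: e'_def)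
    obtain \<delta> where \<delta>: "\<delta> > 0" "\<And>x y. x \<in> {0..1/2} \<times> ?R \<Longrightarrow> y \<in> {0..1/2} \<times> ?R \<Longrightarrow> dist y x < \<delta> \<Longrightarrow>
        dist (c y) (c x) < e'"
      using uc e' unfolding uniformly_continuous_on_def by metis
    have ev1: "eventually (\<lambda>\<epsilon>. integral ?R (\<lambda>z. \<bar>W \<epsilon> z - g' z\<bar>) < e / (2 * B)) (at_right 0)"
      using order_tendstoD(2)[OF d0, of "e / (2 * B)"] e B by simp
    have ev2: "eventually (\<lambda>\<epsilon>. 0 < \<epsilon> \<and> \<epsilon> < min \<delta> (1/2)) (at_right 0)"
      using \<delta> by (auto simp: eventually_at_right_field intro!: exI[of _ "min \<delta> (1/2)"])
    show "eventually (\<lambda>\<epsilon>. dist (integral ?R (\<lambda>z. w (fst z) (slice h s \<epsilon> (snd z)) * c (\<epsilon>, z)))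
        (integral ?R (\<lambda>z. g (fst z) (snd z) * c (0, z))) < e) (at_right 0)"
      using di ev1 ev2
    proof eventually_elim
      case (elim \<epsilon>)
      then have \<epsilon>: "\<epsilon> \<in> {0..1/2}" "0 < \<epsilon>" "\<epsilon> < 1" "\<epsilon> < \<delta>" by auto
      have Wi: "(\<lambda>z. W \<epsilon> z * c (\<epsilon>, z)) absolutely_integrable_on ?R"
        unfolding W_def
        by (intro absolutely_integrable_continuous continuous_intros cc cont) (use \<epsilon> in auto)
      have g0: "(\<lambda>z. g' z * c (0, z)) absolutely_integrable_on ?R"
        using absolutely_integrable_continuous_mult[OF gi cc[of 0]] by simp
      have dabs: "(\<lambda>z. \<bar>W \<epsilon> z - g' z\<bar>) integrable_on ?R"
        using elim(1) by (auto simp: absolutely_integrable_on_def)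
      have pt: "\<bar>W \<epsilon> z * c (\<epsilon>, z) - g' z * c (0, z)\<bar>
          \<le> B * \<bar>W \<epsilon> z - g' z\<bar> + e' * \<bar>g' z\<bar>" if z: "z \<in> ?R" for z
      proof -
        have "W \<epsilon> z * c (\<epsilon>, z) - g' z * c (0, z) = c (\<epsilon>, z) * (W \<epsilon> z - g' z) + (c (\<epsilon>, z) - c (0, z)) * g' z"
          by (simp add: algebra_simps)
        then have "\<bar>W \<epsilon> z * c (\<epsilon>, z) - g' z * c (0, z)\<bar>
            \<le> \<bar>c (\<epsilon>, z)\<bar> * \<bar>W \<epsilon> z - g' z\<bar> + \<bar>c (\<epsilon>, z) - c (0, z)\<bar> * \<bar>g' z\<bar>"
          by (metis abs_mult abs_triangle_ineq)
        also have "\<dots> \<le> B * \<bar>W \<epsilon> z - g' z\<bar> + e' * \<bar>g' z\<bar>"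
        proof (intro add_mono mult_right_mono)
          show "\<bar>c (\<epsilon>, z)\<bar> \<le> B" using B(2)[of "(\<epsilon>, z)"] \<epsilon> z by auto
          have "dist (\<epsilon>, z) (0, z) < \<delta>" using \<epsilon> by (simp add: dist_Pair_Pair)
          then show "\<bar>c (\<epsilon>, z) - c (0, z)\<bar> \<le> e'"
            using \<delta>(2)[of "(0, z)" "(\<epsilon>, z)"] \<epsilon> z by (auto simp: dist_real_def)
        qed auto
        finally show ?thesis .
      qed
      have "\<bar>integral ?R (\<lambda>z. W \<epsilon> z * c (\<epsilon>, z) - g' z * c (0, z))\<bar>
          \<le> integral ?R (\<lambda>z. B * \<bar>W \<epsilon> z - g' z\<bar> + e' * \<bar>g' z\<bar>)"
        unfolding real_norm_def[symmetric]
        by (rule HK_integral_norm_bound_integral)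
          (use pt in \<open>auto intro!: integrable_add integrable_on_mult_right[OF dabs]
            integrable_on_mult_right[OF gai] integrable_diff 
            set_lebesgue_integral_eq_integral(1)[OF Wi] set_lebesgue_integral_eq_integral(1)[OF g0]
            simp del: times_divide_eq_left\<close>)
      also have "\<dots> = B * integral ?R (\<lambda>z. \<bar>W \<epsilon> z - g' z\<bar>) + e' * G"
        unfolding G_def
        using HK_integral_add[OF integrable_on_mult_right[OF dabs, of B]
            integrable_on_mult_right[OF gai, of e']] by simp
      also have "\<dots> < e / 2 + e / 2"
      proof (rule add_less_le_mono)
        show "B * integral ?R (\<lambda>z. \<bar>W \<epsilon> z - g' z\<bar>) < e / 2"
          using elim(2) B by (simp add: field_simps)
        show "e' * G \<le> e / 2"
          using e G by (simp add: e'_def field_simps)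
      qed
      finally have "\<bar>integral ?R (\<lambda>z. W \<epsilon> z * c (\<epsilon>, z) - g' z * c (0, z))\<bar> < e" by simp
      then show ?case
        unfolding dist_real_def
        by (subst (asm) HK_integral_diff)
          (use Wi g0 in \<open>auto simp: W_def g'_def dest: set_lebesgue_integral_eq_integral(1)\<close>)
    qed
  qed
qed

lemma L2_trace_component:
  fixes w :: "real \<Rightarrow> real \<times> real \<Rightarrow> real \<times> real"
  assumes tr: "L2_trace \<Gamma> h s w g" and p: "\<And>v. \<bar>p v\<bar> \<le> norm v" "linear p"
  shows "L2_trace \<Gamma> h s (\<lambda>t x. p (w t x)) (\<lambda>t x1. p (g t x1))"
proof -
  have "(\<lambda>z. p ((\<lambda>(t, x1). g t x1) z)) \<in> borel_measurable borel"
    by (rule measurable_compose[of _ _ borel])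
      (use tr p in \<open>auto simp: L2_trace_def intro!: borel_measurable_continuous_onI linear_continuous_on linear_linear[THEN iffD1]
        simp: linear_conv_bounded_linear\<close>)
  moreover have "((\<lambda>\<epsilon>. \<integral>\<^sup>+ z \<in> {a..b} \<times> {0..\<Gamma>}.
            ennreal ((norm (p (w (fst z) (slice h s \<epsilon> (snd z))) - p (g (fst z) (snd z))))\<^sup>2) \<partial>lborel)
          \<longlongrightarrow> 0) (at_right 0)" if "0 < a" "a < b" for a b
  proof (rule tendsto_sandwich[OF _ _ tendsto_const])
    show "((\<lambda>\<epsilon>. \<integral>\<^sup>+ z \<in> {a..b} \<times> {0..\<Gamma>}.
            ennreal ((norm (w (fst z) (slice h s \<epsilon> (snd z)) - g (fst z) (snd z)))\<^sup>2) \<partial>lborel)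
          \<longlongrightarrow> 0) (at_right 0)"
      using tr that by (auto simp: L2_trace_def)
    show "\<forall>\<^sub>F \<epsilon> in at_right 0. (\<integral>\<^sup>+ z \<in> {a..b} \<times> {0..\<Gamma>}.
            ennreal ((norm (p (w (fst z) (slice h s \<epsilon> (snd z))) - p (g (fst z) (snd z))))\<^sup>2) \<partial>lborel) \<le>
        (\<integral>\<^sup>+ z \<in> {a..b} \<times> {0..\<Gamma>}.
            ennreal ((norm (w (fst z) (slice h s \<epsilon> (snd z)) - g (fst z) (snd z)))\<^sup>2) \<partial>lborel)"
    proof (intro always_eventually allI nn_integral_mono mult_right_mono ennreal_leI power_mono)
      fix \<epsilon> z
      show "norm (p (w (fst z) (slice h s \<epsilon> (snd z))) - p (g (fst z) (snd z)))
          \<le> norm (w (fst z) (slice h s \<epsilon> (snd z)) - g (fst z) (snd z))"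
        using p(1)[of "w (fst z) (slice h s \<epsilon> (snd z)) - g (fst z) (snd z)"] linear_diff[OF p(2)] by simp
    qed auto
  qed auto
  ultimately show ?thesis
    unfolding L2_trace_def by (auto simp: case_prod_beta)
qed

lemma L2_trace_fst: "L2_trace \<Gamma> h s w g \<Longrightarrow> L2_trace \<Gamma> h s (\<lambda>t x. fst (w t x)) (\<lambda>t x1. fst (g t x1))"
  for w :: "real \<Rightarrow> real \<times> real \<Rightarrow> real \<times> real"
  by (rule L2_trace_component) (auto simp: linear_fst norm_prod_def real_le_rsqrt)

lemma L2_trace_snd: "L2_trace \<Gamma> h s w g \<Longrightarrow> L2_trace \<Gamma> h s (\<lambda>t x. snd (w t x)) (\<lambda>t x1. snd (g t x1))"
  for w :: "real \<Rightarrow> real \<times> real \<Rightarrow> real \<times> real"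
  by (rule L2_trace_component) (auto simp: linear_snd norm_prod_def real_le_rsqrt)

section \<open>Slices, exhaustion of the strip and second derivatives\<close>

lemma integral_box_slices:
  fixes f :: "real \<times> real \<times> real \<Rightarrow> real"
  assumes f: "continuous_on (cbox (t0, x0, a) (T, x1, b)) f"
  shows "integral (cbox (t0, x0, a) (T, x1, b)) f =
      integral {a..b} (\<lambda>s. integral (cbox (t0, x0) (T, x1)) (\<lambda>(t, x). f (t, x, s)))"
proof -
  define F where "F = (\<lambda>(z, s). f (fst z, snd z, s))"
  have F: "continuous_on (cbox ((t0, x0), a) ((T, x1), b)) F"
    unfolding F_def case_prod_beta
    by (rule continuous_on_compose2[OF f]) (auto intro!: continuous_intros simp: cbox_Pair_eq)
  have F': "continuous_on (cbox ((t0, x0), a) ((T, x1), b)) (\<lambda>(z, s). F (z, s))"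
    using F by simp
  have ct: "continuous_on (cbox (x0, a) (x1, b)) (\<lambda>y. f (t, y))" if "t \<in> {t0..T}" for t
    by (rule continuous_on_compose2[OF f]) (use that in \<open>auto intro!: continuous_intros simp: cbox_Pair_eq\<close>)
  have "integral (cbox (t0, x0, a) (T, x1, b)) f =
      integral {t0..T} (\<lambda>t. integral (cbox (x0, a) (x1, b)) (\<lambda>y. f (t, y)))"
    using integral_prod_continuous[OF f] by simp
  also have "\<dots> = integral {t0..T} (\<lambda>t. integral {x0..x1} (\<lambda>x. integral {a..b} (\<lambda>s. f (t, x, s))))"
    by (intro HK_integral_cong) (use integral_prod_continuous[OF ct] in simp)
  also have "\<dots> = integral (cbox (t0, x0) (T, x1)) (\<lambda>z. integral (cbox a b) (\<lambda>s. F (z, s)))"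
  proof -
    have "continuous_on (cbox (t0, x0) (T, x1)) (\<lambda>z. integral (cbox a b) (\<lambda>s. F (z, s)))"
      by (rule integral_continuous_on_param) (use F in \<open>simp add: cbox_Pair_eq\<close>)
    from integral_prod_continuous[OF this] show ?thesis by (simp add: F_def)
  qed
  also have "\<dots> = integral (cbox a b) (\<lambda>s. integral (cbox (t0, x0) (T, x1)) (\<lambda>z. F (z, s)))"
    using integral_swap_continuous[OF F'] by simp
  finally show ?thesis by (simp add: F_def case_prod_unfold)
qed

lemma integral_slice_continuous:
  fixes f :: "real \<times> real \<times> real \<Rightarrow> real"
  assumes f: "continuous_on (cbox (t0, x0, a) (T, x1, b)) f"
  shows "continuous_on {a..b} (\<lambda>s. integral (cbox (t0, x0) (T, x1)) (\<lambda>(t, x). f (t, x, s)))"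
proof (rule integral_continuous_on_param)
  have "continuous_on ({a..b} \<times> cbox (t0, x0) (T, x1)) (\<lambda>y. f (fst (snd y), snd (snd y), fst y))"
    by (rule continuous_on_compose2[OF f]) (auto intro!: continuous_intros simp: cbox_Pair_eq)
  then show "continuous_on ({a..b} \<times> cbox (t0, x0) (T, x1)) (\<lambda>(s, t). case t of (t, x) \<Rightarrow> f (t, x, s))"
    by (simp add: case_prod_beta)
qed

lemma tendsto_at_right_0_compose:
  fixes \<phi> lev :: "real \<Rightarrow> real"
  assumes \<phi>: "continuous_on {0..1} \<phi>" and l: "l \<in> {0..1}" "(lev \<longlongrightarrow> l) (at_right 0)"
    and lev: "\<And>\<epsilon>. 0 < \<epsilon> \<Longrightarrow> \<epsilon> < 1/2 \<Longrightarrow> lev \<epsilon> \<in> {0..1}"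
  shows "((\<lambda>\<epsilon>. \<phi> (lev \<epsilon>)) \<longlongrightarrow> \<phi> l) (at_right 0)"
proof (rule continuous_on_tendsto_compose[OF \<phi> l(2) l(1)])
  show "eventually (\<lambda>\<epsilon>. lev \<epsilon> \<in> {0..1}) (at_right 0)"
    using lev by (auto simp: eventually_at_right_field intro!: exI[of _ "1/2"])
qed

lemma integral_exhaustion_tendsto:
  fixes f :: "real \<times> real \<times> real \<Rightarrow> real"
  assumes f: "continuous_on (cbox (t0, x0, 0) (T, x1, 1)) f"
  shows "((\<lambda>\<epsilon>. integral (cbox (t0, x0, \<epsilon>) (T, x1, 1 - \<epsilon>)) f)
      \<longlongrightarrow> integral (cbox (t0, x0, 0) (T, x1, 1)) f) (at_right 0)"
proof -
  define \<phi> where "\<phi> s = integral (cbox (t0, x0) (T, x1)) (\<lambda>(t, x). f (t, x, s))" for s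
  define I where "I s = integral {0..s} \<phi>" for s
  have \<phi>: "continuous_on {0..1} \<phi>"
    unfolding \<phi>_def by (rule integral_slice_continuous[OF f])
  have int: "\<phi> integrable_on {c..d}" if "0 \<le> c" "d \<le> 1" for c d
    by (intro integrable_continuous_real continuous_on_subset[OF \<phi>]) (use that in auto)
  have I: "continuous_on {0..1} I"
    unfolding I_def[abs_def] by (rule indefinite_integral_continuous_1) (use int in simp)
  have eq: "integral (cbox (t0, x0, c) (T, x1, d)) f = I d - I c" if "0 \<le> c" "c \<le> d" "d \<le> 1" for c d
  proof -
    have "integral (cbox (t0, x0, c) (T, x1, d)) f = integral {c..d} \<phi>"
      unfolding \<phi>_def
      by (rule integral_box_slices[OF continuous_on_subset[OF f]]) (use that in \<open>auto simp: cbox_Pair_eq\<close>)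
    also have "\<dots> = I d - I c"
      using HK_integral_combine[of 0 c d \<phi>] that int by (simp add: I_def)
    finally show ?thesis .
  qed
  have 1: "((\<lambda>\<epsilon>. I (1 - \<epsilon>)) \<longlongrightarrow> I 1) (at_right 0)"
    by (rule tendsto_at_right_0_compose[OF I]) (auto intro!: tendsto_eq_intros)
  have 0: "((\<lambda>\<epsilon>. I \<epsilon>) \<longlongrightarrow> I 0) (at_right 0)"
    by (rule tendsto_at_right_0_compose[OF I]) (auto intro!: tendsto_eq_intros)
  have "((\<lambda>\<epsilon>. I (1 - \<epsilon>) - I \<epsilon>) \<longlongrightarrow> I 1 - I 0) (at_right 0)"
    by (intro tendsto_diff 1 0)
  moreover have "eventually (\<lambda>\<epsilon>. I (1 - \<epsilon>) - I \<epsilon> = integral (cbox (t0, x0, \<epsilon>) (T, x1, 1 - \<epsilon>)) f) (at_right 0)"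
    using eq by (auto simp: eventually_at_right_field intro!: exI[of _ "1/2"])
  ultimately show ?thesis
    by (subst eq) (auto elim: Lim_transform_eventually)
qed

lemma integral_exhaustion_tendsto_2:
  fixes f :: "real \<times> real \<Rightarrow> real"
  assumes f: "continuous_on (cbox (x0, 0) (x1, 1)) f"
  shows "((\<lambda>\<epsilon>. integral (cbox (x0, \<epsilon>) (x1, 1 - \<epsilon>)) f)
      \<longlongrightarrow> integral (cbox (x0, 0) (x1, 1)) f) (at_right 0)"
proof -
  have eq: "integral (cbox (0::real, x0, c) (1, x1, d)) (\<lambda>z. f (snd z)) = integral (cbox (x0, c) (x1, d)) f"
    if "0 \<le> c" "d \<le> 1" for c d
  proof -
    have "continuous_on (cbox (0::real, x0, c) (1, x1, d)) (\<lambda>z. f (snd z))"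
      by (rule continuous_on_compose2[OF f]) (use that in \<open>auto intro!: continuous_intros simp: cbox_Pair_eq\<close>)
    from integral_prod_continuous[OF this] show ?thesis by simp
  qed
  have "continuous_on (cbox (0::real, x0, 0) (1, x1, 1)) (\<lambda>z. f (snd z))"
    by (rule continuous_on_compose2[OF f]) (auto intro!: continuous_intros simp: cbox_Pair_eq)
  from integral_exhaustion_tendsto[OF this]
  have "((\<lambda>\<epsilon>. integral (cbox (0::real, x0, \<epsilon>) (1, x1, 1 - \<epsilon>)) (\<lambda>z. f (snd z)))
      \<longlongrightarrow> integral (cbox (x0, 0) (x1, 1)) f) (at_right 0)" by (simp add: eq)
  then show ?thesis
    by (rule Lim_transform_eventually)
      (use eq in \<open>auto simp: eventually_at_right_field intro!: exI[of _ 1]\<close>)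
qed

text \<open>
  By the mean value theorem a second difference over a small square equals, up to the factor \<open>r\<^sup>2\<close>, a
  value of either mixed derivative in this square.
\<close>

lemma mixed_partials_commute:
  fixes f f1 f2 f12 f21 :: "real \<times> real \<Rightarrow> real"
  assumes S: "open S" "x \<in> S"
    and f: "\<And>y. y \<in> S \<Longrightarrow> has_partials f (f1 y) (f2 y) y"
    and f1: "\<And>y. y \<in> S \<Longrightarrow> has_partials f1 (f11 y) (f12 y) y"
    and f2: "\<And>y. y \<in> S \<Longrightarrow> has_partials f2 (f21 y) (f22 y) y"
    and cont: "continuous_on S f12" "continuous_on S f21"
  shows "f12 x = f21 x"
proof -
  obtain a b where x: "x = (a, b)" by (cases x)
  have near: "\<exists>y z. y \<in> S \<and> z \<in> S \<and> dist y x < e \<and> dist z x < e \<and> f12 y = f21 z" if e: "e > 0" for e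
  proof -
    obtain d where d: "d > 0" "ball x d \<subseteq> S" using S openE by blast
    define r where "r = min d e / 3"
    have r: "r > 0" "r < d / 2" "r < e / 2" using d e by (auto simp: r_def)
    have box: "dist (a', b') x < d \<and> dist (a', b') x < e"
      if "a \<le> a'" "a' \<le> a + r" "b \<le> b'" "b' \<le> b + r" for a' b'
    proof -
      have "dist (a', b') (a, b) \<le> \<bar>a' - a\<bar> + \<bar>b' - b\<bar>"
        using sqrt_sum_squares_le_sum_abs[of "a' - a" "b' - b"] by (simp add: dist_Pair_Pair dist_real_def)
      then show ?thesis using that r unfolding x by auto
    qed
    have inS: "(a', b') \<in> S" if "a \<le> a'" "a' \<le> a + r" "b \<le> b'" "b' \<le> b + r" for a' b'
      using box[OF that] d(2) by (auto simp: dist_commute)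
    have s1: "((\<lambda>r. f (r, b')) has_real_derivative f1 (a', b')) (at a')"
        "((\<lambda>r. f (a', r)) has_real_derivative f2 (a', b')) (at b')"
        "((\<lambda>r. f1 (a', r)) has_real_derivative f12 (a', b')) (at b')"
        "((\<lambda>r. f2 (r, b')) has_real_derivative f21 (a', b')) (at a')"
      if "a \<le> a'" "a' \<le> a + r" "b \<le> b'" "b' \<le> b + r" for a' b'
      using has_partials_slices[OF f[OF inS[OF that]]] has_partials_slices[OF f1[OF inS[OF that]]]
        has_partials_slices[OF f2[OF inS[OF that]]] by auto
    define \<Delta> where "\<Delta> = f (a + r, b + r) - f (a + r, b) - f (a, b + r) + f (a, b)"
    have "\<exists>\<xi>>a. \<xi> < a + r \<and> (f (a + r, b + r) - f (a + r, b)) - (f (a, b + r) - f (a, b)) =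
        (a + r - a) * (f1 (\<xi>, b + r) - f1 (\<xi>, b))"
      by (rule MVT2[of a "a + r" "\<lambda>s. f (s, b + r) - f (s, b)"])
        (use r in \<open>auto intro!: DERIV_diff s1\<close>)
    then obtain \<xi> where \<xi>: "a < \<xi>" "\<xi> < a + r" "\<Delta> = r * (f1 (\<xi>, b + r) - f1 (\<xi>, b))"
      by (auto simp: \<Delta>_def)
    have "\<exists>\<eta>>b. \<eta> < b + r \<and> f1 (\<xi>, b + r) - f1 (\<xi>, b) = (b + r - b) * f12 (\<xi>, \<eta>)"
      by (rule MVT2[of b "b + r" "\<lambda>s. f1 (\<xi>, s)"])
        (use r \<xi> in \<open>auto intro!: s1\<close>)
    then obtain \<eta> where \<eta>: "b < \<eta>" "\<eta> < b + r" "\<Delta> = r * (r * f12 (\<xi>, \<eta>))"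
      using \<xi> by auto
    have "\<exists>\<eta>'>b. \<eta>' < b + r \<and> (f (a + r, b + r) - f (a, b + r)) - (f (a + r, b) - f (a, b)) =
        (b + r - b) * (f2 (a + r, \<eta>') - f2 (a, \<eta>'))"
      by (rule MVT2[of b "b + r" "\<lambda>s. f (a + r, s) - f (a, s)"])
        (use r in \<open>auto intro!: DERIV_diff s1\<close>)
    then obtain \<eta>' where \<eta>': "b < \<eta>'" "\<eta>' < b + r" "\<Delta> = r * (f2 (a + r, \<eta>') - f2 (a, \<eta>'))"
      by (auto simp: \<Delta>_def)
    have "\<exists>\<xi>'>a. \<xi>' < a + r \<and> f2 (a + r, \<eta>') - f2 (a, \<eta>') = (a + r - a) * f21 (\<xi>', \<eta>')"
      by (rule MVT2[of a "a + r" "\<lambda>s. f2 (s, \<eta>')"])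
        (use r \<eta>' in \<open>auto intro!: s1\<close>)
    then obtain \<xi>' where \<xi>': "a < \<xi>'" "\<xi>' < a + r" "\<Delta> = r * (r * f21 (\<xi>', \<eta>'))"
      using \<eta>' by auto
    have "f12 (\<xi>, \<eta>) = f21 (\<xi>', \<eta>')" using \<eta>(3) \<xi>'(3) r by simp
    then show ?thesis using inS box \<xi> \<eta> \<xi>' \<eta>' by (meson less_imp_le)
  qed
  show ?thesis
  proof (rule ccontr)
    assume ne: "f12 x \<noteq> f21 x"
    define e where "e = \<bar>f12 x - f21 x\<bar> / 2"
    have e: "e > 0" using ne by (simp add: e_def)
    obtain d1 where d1: "d1 > 0" "\<And>y. y \<in> S \<Longrightarrow> dist y x < d1 \<Longrightarrow> dist (f12 y) (f12 x) < e"
      using cont(1) S(2) e unfolding continuous_on_iff by blast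
    obtain d2 where d2: "d2 > 0" "\<And>y. y \<in> S \<Longrightarrow> dist y x < d2 \<Longrightarrow> dist (f21 y) (f21 x) < e"
      using cont(2) S(2) e unfolding continuous_on_iff by blast
    obtain y z where "y \<in> S" "z \<in> S" "dist y x < min d1 d2" "dist z x < min d1 d2" "f12 y = f21 z"
      using near[of "min d1 d2"] d1 d2 by auto
    then have "\<bar>f12 y - f12 x\<bar> < e" "\<bar>f12 y - f21 x\<bar> < e"
      using d1(2)[of y] d2(2)[of z] by (auto simp: dist_real_def)
    moreover have "\<bar>f12 x - f21 x\<bar> \<le> \<bar>f12 y - f12 x\<bar> + \<bar>f12 y - f21 x\<bar>" by linarith
    ultimately show False unfolding e_def by (simp add: field_simps)
  qed
qed

lemma pd_cong_open:
  assumes "open S" "x \<in> S" "\<And>y. y \<in> S \<Longrightarrow> f y = g y"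
  shows "pd1 f x = pd1 g x" "pd2 f x = pd2 g x"
proof -
  obtain e where e: "e > 0" "ball x e \<subseteq> S" using assms openE by blast
  have "eventually (\<lambda>r. f (r, snd x) = g (r, snd x)) (nhds (fst x))"
    unfolding eventually_nhds_metric
    by (rule exI[of _ e]) (use e assms in \<open>auto simp: dist_Pair_Pair dist_commute
      intro!: assms(3) subsetD[OF e(2)] simp: mem_ball dist_prod_def\<close>)
  then show "pd1 f x = pd1 g x"
    unfolding pd1_def by (intro vector_derivative_cong_eq) (auto elim: eventually_mono)
  have "eventually (\<lambda>r. f (fst x, r) = g (fst x, r)) (nhds (snd x))"
    unfolding eventually_nhds_metric
    by (rule exI[of _ e]) (use e assms in \<open>auto simp: dist_Pair_Pair dist_commute
      intro!: assms(3) subsetD[OF e(2)] simp: mem_ball dist_prod_def\<close>)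
  then show "pd2 f x = pd2 g x"
    unfolding pd2_def by (intro vector_derivative_cong_eq) (auto elim: eventually_mono)
qed

lemma pd_bounded_linear:
  assumes f: "f differentiable (at x)" and p: "bounded_linear p"
  shows "pd1 (\<lambda>y. p (f y)) x = p (pd1 f x)" "pd2 (\<lambda>y. p (f y)) x = p (pd2 f x)"
proof -
  have "(\<lambda>r. f (r, snd x)) differentiable (at (fst x))"
    by (rule differentiable_compose[of f "\<lambda>r. (r, snd x)", unfolded o_def])
      (use f in \<open>auto intro!: derivative_intros\<close>)
  then have "((\<lambda>r. f (r, snd x)) has_vector_derivative pd1 f x) (at (fst x))"
    unfolding pd1_def by (simp add: vector_derivative_works)
  from bounded_linear.has_vector_derivative[OF p this]
  show "pd1 (\<lambda>y. p (f y)) x = p (pd1 f x)" unfolding pd1_def by (rule vector_derivative_at)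
  have "(\<lambda>r. f (fst x, r)) differentiable (at (snd x))"
    by (rule differentiable_compose[of f "\<lambda>r. (fst x, r)", unfolded o_def])
      (use f in \<open>auto intro!: derivative_intros\<close>)
  then have "((\<lambda>r. f (fst x, r)) has_vector_derivative pd2 f x) (at (snd x))"
    unfolding pd2_def by (simp add: vector_derivative_works)
  from bounded_linear.has_vector_derivative[OF p this]
  show "pd2 (\<lambda>y. p (f y)) x = p (pd2 f x)" unfolding pd2_def by (rule vector_derivative_at)
qed

text \<open>
  This reduces the velocity field, where \<open>p\<close> is a coordinate projection, to real functions.
\<close>

lemma C12_inside_component:
  fixes w :: "real \<Rightarrow> real \<times> real \<Rightarrow> 'b::real_normed_vector" and p :: "'b \<Rightarrow> 'c::real_normed_vector"
  assumes w: "C12_inside h w" and p: "bounded_linear p" and h: "continuous_on UNIV h"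
  shows "C12_inside h (\<lambda>t x. p (w t x))"
    and "\<And>t x. 0 < t \<Longrightarrow> x \<in> open_strip h \<Longrightarrow> pdt (\<lambda>t x. p (w t x)) t x = p (pdt w t x)"
    and "\<And>t x. 0 < t \<Longrightarrow> x \<in> open_strip h \<Longrightarrow> pd1 (\<lambda>x. p (w t x)) x = p (pd1 (w t) x)"
    and "\<And>t x. 0 < t \<Longrightarrow> x \<in> open_strip h \<Longrightarrow> pd2 (\<lambda>x. p (w t x)) x = p (pd2 (w t) x)"
    and "\<And>t x. 0 < t \<Longrightarrow> x \<in> open_strip h \<Longrightarrow> pd1 (pd1 (\<lambda>x. p (w t x))) x = p (pd1 (pd1 (w t)) x)"
    and "\<And>t x. 0 < t \<Longrightarrow> x \<in> open_strip h \<Longrightarrow> pd2 (pd2 (\<lambda>x. p (w t x))) x = p (pd2 (pd2 (w t)) x)"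
proof -
  let ?S = "open_strip h"
  have S: "open ?S" by (rule open_strip_open[OF h])
  have d: "(\<lambda>r. w r x) differentiable (at t)" "w t differentiable (at x)"
      "pd1 (w t) differentiable (at x)" "pd2 (w t) differentiable (at x)" if "0 < t" "x \<in> ?S" for t x
    using w that unfolding C12_inside_def by auto
  note c = w[unfolded C12_inside_def, THEN conjunct2]
  have pt: "pdt (\<lambda>t x. p (w t x)) t x = p (pdt w t x)" if "0 < t" "x \<in> ?S" for t x
    unfolding pdt_def
    by (rule vector_derivative_at, rule bounded_linear.has_vector_derivative[OF p])
      (use d(1)[OF that] in \<open>simp add: vector_derivative_works\<close>)
  have p1: "pd1 (\<lambda>x. p (w t x)) x = p (pd1 (w t) x)" and p2: "pd2 (\<lambda>x. p (w t x)) x = p (pd2 (w t) x)"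
    if "0 < t" "x \<in> ?S" for t x
    using pd_bounded_linear[OF d(2)[OF that] p] by auto
  have p11: "pd1 (pd1 (\<lambda>x. p (w t x))) x = p (pd1 (pd1 (w t)) x)"
    and p21: "pd2 (pd1 (\<lambda>x. p (w t x))) x = p (pd2 (pd1 (w t)) x)" if "0 < t" "x \<in> ?S" for t x
    using pd_cong_open[OF S that(2) p1[OF that(1)]] pd_bounded_linear[OF d(3)[OF that] p] by simp_all
  have p12: "pd1 (pd2 (\<lambda>x. p (w t x))) x = p (pd1 (pd2 (w t)) x)"
    and p22: "pd2 (pd2 (\<lambda>x. p (w t x))) x = p (pd2 (pd2 (w t)) x)" if "0 < t" "x \<in> ?S" for t x
    using pd_cong_open[OF S that(2) p2[OF that(1)]] pd_bounded_linear[OF d(4)[OF that] p] by simp_all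
  have pdiff: "(\<lambda>y. p (f y)) differentiable (at y)" if "f differentiable (at y)" for f :: "'d::real_normed_vector \<Rightarrow> 'b" and y
    using that bounded_linear.has_derivative[OF p] unfolding differentiable_def by blast
  have tr: "g differentiable (at x)" if "f differentiable (at x)" "x \<in> ?S" "\<And>y. y \<in> ?S \<Longrightarrow> g y = f y"
    for f g :: "real \<times> real \<Rightarrow> 'c" and x
    using that S unfolding differentiable_def by (metis has_derivative_transform_within_open)
  have jc: "jointly_continuous ?S v'" if "jointly_continuous ?S v" "\<And>t x. 0 < t \<Longrightarrow> x \<in> ?S \<Longrightarrow> v' t x = p (v t x)"
    for v :: "real \<Rightarrow> real \<times> real \<Rightarrow> 'b" and v'
  proof (rule jointly_continuousI)
    have "continuous_on ({0<..} \<times> ?S) (\<lambda>z. p (v (fst z) (snd z)))"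
      using bounded_linear.continuous_on[OF p jointly_continuousD[OF that(1)]] .
    then show "continuous_on ({0<..} \<times> ?S) (\<lambda>z. v' (fst z) (snd z))"
      by (rule continuous_on_eq) (use that(2) in auto)
  qed
  show "C12_inside h (\<lambda>t x. p (w t x))"
    unfolding C12_inside_def
  proof (intro conjI allI impI ballI)
    fix t x assume tx: "(0::real) < t" "x \<in> ?S"
    show "(\<lambda>r. p (w r x)) differentiable (at t)" "(\<lambda>x. p (w t x)) differentiable (at x)"
      using pdiff[OF d(1)[OF tx]] pdiff[OF d(2)[OF tx]] by auto
    show "pd1 (\<lambda>x. p (w t x)) differentiable (at x)"
      by (rule tr[OF pdiff[OF d(3)[OF tx]] tx(2)]) (use p1 tx in auto)
    show "pd2 (\<lambda>x. p (w t x)) differentiable (at x)"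
      by (rule tr[OF pdiff[OF d(4)[OF tx]] tx(2)]) (use p2 tx in auto)
  qed (use c pt p1 p2 p11 p12 p21 p22 in \<open>auto intro: jc\<close>)
  show "\<And>t x. 0 < t \<Longrightarrow> x \<in> open_strip h \<Longrightarrow> pdt (\<lambda>t x. p (w t x)) t x = p (pdt w t x)"
    "\<And>t x. 0 < t \<Longrightarrow> x \<in> open_strip h \<Longrightarrow> pd1 (\<lambda>x. p (w t x)) x = p (pd1 (w t) x)"
    "\<And>t x. 0 < t \<Longrightarrow> x \<in> open_strip h \<Longrightarrow> pd2 (\<lambda>x. p (w t x)) x = p (pd2 (w t) x)"
    "\<And>t x. 0 < t \<Longrightarrow> x \<in> open_strip h \<Longrightarrow> pd1 (pd1 (\<lambda>x. p (w t x))) x = p (pd1 (pd1 (w t)) x)"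
    "\<And>t x. 0 < t \<Longrightarrow> x \<in> open_strip h \<Longrightarrow> pd2 (pd2 (\<lambda>x. p (w t x))) x = p (pd2 (pd2 (w t)) x)"
    by (fact pt p1 p2 p11 p22)+
qed

lemma C12_inside_scalarD:
  fixes w :: "real \<Rightarrow> real \<times> real \<Rightarrow> real"
  assumes w: "C12_inside h w"
  shows "\<And>t x. 0 < t \<Longrightarrow> x \<in> open_strip h \<Longrightarrow> ((\<lambda>r. w r x) has_real_derivative pdt w t x) (at t)"
    and "\<And>t x. 0 < t \<Longrightarrow> x \<in> open_strip h \<Longrightarrow> has_partials (w t) (pd1 (w t) x) (pd2 (w t) x) x"
    and "\<And>t x. 0 < t \<Longrightarrow> x \<in> open_strip h \<Longrightarrow>
        has_partials (pd1 (w t)) (pd1 (pd1 (w t)) x) (pd2 (pd1 (w t)) x) x"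
    and "\<And>t x. 0 < t \<Longrightarrow> x \<in> open_strip h \<Longrightarrow>
        has_partials (pd2 (w t)) (pd1 (pd2 (w t)) x) (pd2 (pd2 (w t)) x) x"
    and "jointly_continuous (open_strip h) w" "jointly_continuous (open_strip h) (pdt w)"
      "jointly_continuous (open_strip h) (\<lambda>t. pd1 (w t))" "jointly_continuous (open_strip h) (\<lambda>t. pd2 (w t))"
      "jointly_continuous (open_strip h) (\<lambda>t. pd1 (pd1 (w t)))" "jointly_continuous (open_strip h) (\<lambda>t. pd2 (pd1 (w t)))"
      "jointly_continuous (open_strip h) (\<lambda>t. pd1 (pd2 (w t)))" "jointly_continuous (open_strip h) (\<lambda>t. pd2 (pd2 (w t)))"
  using w unfolding C12_inside_def pdt_def
  by (auto intro: differentiable_has_partials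
      simp: has_real_derivative_iff_has_vector_derivative vector_derivative_works[symmetric])

lemma pd_periodic:
  fixes f :: "real \<times> real \<Rightarrow> real"
  assumes f: "x1_periodic_on (open_strip h) \<Gamma> f" "\<And>x. x \<in> open_strip h \<Longrightarrow> has_partials f (f1 x) (f2 x) x"
    and h: "continuous_on UNIV h" "\<And>x. h (x + \<Gamma>) = h x"
  shows "x1_periodic_on (open_strip h) \<Gamma> f1" "x1_periodic_on (open_strip h) \<Gamma> f2"
proof -
  let ?S = "open_strip h"
  have "f1 (x + (\<Gamma>, 0)) = f1 x \<and> f2 (x + (\<Gamma>, 0)) = f2 x" if x: "x \<in> ?S" for x
  proof -
    have x': "x + (\<Gamma>, 0) \<in> ?S" using x h(2) by (auto simp: open_strip_def)
    have "((\<lambda>y. y + (\<Gamma>, 0)) has_derivative (\<lambda>k. k)) (at x)" by (auto intro!: derivative_eq_intros)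
    from diff_chain_at[OF this f(2)[OF x', unfolded has_partials_def]]
    have "has_partials (\<lambda>y. f (y + (\<Gamma>, 0))) (f1 (x + (\<Gamma>, 0))) (f2 (x + (\<Gamma>, 0))) x"
      by (simp add: has_partials_def o_def)
    then have "has_partials f (f1 (x + (\<Gamma>, 0))) (f2 (x + (\<Gamma>, 0))) x"
      by (rule has_partials_transform_open[OF _ open_strip_open[OF h(1)] x])
        (use f(1) in \<open>auto simp: x1_periodic_on_def\<close>)
    then show ?thesis using pd_eqI f(2)[OF x] by metis
  qed
  then show "x1_periodic_on ?S \<Gamma> f1" "x1_periodic_on ?S \<Gamma> f2"
    by (auto simp: x1_periodic_on_def)
qed

section \<open>The divergence identity up to the boundary\<close>

context
  fixes f g :: "real \<Rightarrow> real \<times> real \<Rightarrow> real" and S :: "(real \<times> real) set"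
  assumes f: "jointly_continuous S f"
begin

lemma jointly_continuous_minus: "jointly_continuous S (\<lambda>t x. - f t x)"
  using f unfolding jointly_continuous_def case_prod_unfold by (rule continuous_on_minus)

lemma jointly_continuous_power: "jointly_continuous S (\<lambda>t x. (f t x) ^ n)"
  using f unfolding jointly_continuous_def case_prod_unfold by (rule continuous_on_power)

context
  assumes g: "jointly_continuous S g"
begin

lemma jointly_continuous_add: "jointly_continuous S (\<lambda>t x. f t x + g t x)"
  using f g unfolding jointly_continuous_def case_prod_unfold by (rule continuous_on_add)

lemma jointly_continuous_diff: "jointly_continuous S (\<lambda>t x. f t x - g t x)"
  using f g unfolding jointly_continuous_def case_prod_unfold by (rule continuous_on_diff)

lemma jointly_continuous_mult: "jointly_continuous S (\<lambda>t x. f t x * g t x)"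
  using f g unfolding jointly_continuous_def case_prod_unfold by (rule continuous_on_mult)

end
end

lemma jointly_continuous_const: "jointly_continuous S (\<lambda>t x. c :: real)"
  unfolding jointly_continuous_def case_prod_unfold by (rule continuous_on_const)

lemma jointly_continuous_snd: "jointly_continuous S (\<lambda>t x. snd x :: real)"
  by (rule jointly_continuousI) (intro continuous_on_snd continuous_on_id)

lemmas jointly_continuous_intros = jointly_continuous_add jointly_continuous_diff jointly_continuous_mult
  jointly_continuous_minus jointly_continuous_power jointly_continuous_const jointly_continuous_snd

lemma jointly_continuous_compose:
  fixes f :: "real \<Rightarrow> real \<times> real \<Rightarrow> real" and g :: "real \<Rightarrow> real"
  assumes "continuous_on UNIV g" "jointly_continuous S f"
  shows "jointly_continuous S (\<lambda>t x. g (f t x))"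
  using continuous_on_compose2[OF assms(1) jointly_continuousD[OF assms(2)]]
  by (intro jointly_continuousI) auto

lemma jointly_continuous_cong:
  assumes "jointly_continuous S f" "\<And>t x. 0 < t \<Longrightarrow> x \<in> S \<Longrightarrow> f t x = g t x"
  shows "jointly_continuous S g"
  using assms unfolding jointly_continuous_def case_prod_unfold by (auto elim!: continuous_on_eq)

lemma integral_box_slices_2:
  fixes f :: "real \<times> real \<Rightarrow> real"
  assumes f: "continuous_on (cbox (x0, a) (x1, b)) f"
  shows "integral (cbox (x0, a) (x1, b)) f = integral {a..b} (\<lambda>s. integral {x0..x1} (\<lambda>x. f (x, s)))"
    and "continuous_on {a..b} (\<lambda>s. integral {x0..x1} (\<lambda>x. f (x, s)))"
proof -
  have f': "continuous_on (cbox (x0, a) (x1, b)) (\<lambda>(x, s). f (x, s))" using f by simp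
  show "integral (cbox (x0, a) (x1, b)) f = integral {a..b} (\<lambda>s. integral {x0..x1} (\<lambda>x. f (x, s)))"
    using integral_prod_continuous[OF f] integral_swap_continuous[OF f'] by simp
  have "continuous_on ({a..b} \<times> cbox x0 x1) (\<lambda>(s, x). f (x, s))"
    unfolding case_prod_unfold
    by (rule continuous_on_compose2[OF f]) (auto intro!: continuous_intros simp: cbox_Pair_eq)
  from integral_continuous_on_param[OF this]
  show "continuous_on {a..b} (\<lambda>s. integral {x0..x1} (\<lambda>x. f (x, s)))" by simp
qed

lemma interval_identity_closure:
  fixes m \<phi> :: "real \<Rightarrow> real"
  assumes m: "continuous_on {0..1} m" and \<phi>: "continuous_on {0..1} \<phi>"
    and eq: "\<And>a b. 0 < a \<Longrightarrow> a \<le> b \<Longrightarrow> b < 1 \<Longrightarrow> integral {a..b} m = \<phi> b - \<phi> a"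
    and ab: "0 \<le> a" "a \<le> b" "b \<le> 1"
  shows "integral {a..b} m = \<phi> b - \<phi> a"
proof -
  have int: "m integrable_on {c..d}" if "0 \<le> c" "d \<le> 1" for c d
    by (intro integrable_continuous_real continuous_on_subset[OF m]) (use that in auto)
  define E where "E s = integral {0..s} m - \<phi> s" for s
  have comb: "integral {c..d} m = integral {0..d} m - integral {0..c} m" if "0 \<le> c" "c \<le> d" "d \<le> 1" for c d
    using HK_integral_combine[of 0 c d m] that int by simp
  have E: "continuous_on {0..1} E"
    unfolding E_def[abs_def]
    by (intro continuous_intros indefinite_integral_continuous_1 \<phi>) (use int in simp)
  have const: "E s = E (1/2)" if "s \<in> {0<..<1}" for s
  proof (cases "s \<le> 1/2")
    case True
    then show ?thesis using eq[of s "1/2"] comb[of s "1/2"] that by (simp add: E_def)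
  next
    case False
    then show ?thesis using eq[of "1/2" s] comb[of "1/2" s] that by (simp add: E_def)
  qed
  have E1: "E s = E (1/2)" if "s \<in> {0..1}" for s
  proof (rule continuous_constant_on_closure[of "{0<..<1}", OF _ const])
    show "continuous_on (closure {0<..<1}) E" "s \<in> closure {0<..<1}" using E that by simp_all
  qed
  have "E a = E b" using E1[of a] E1[of b] ab by simp
  then show ?thesis using comb[of a b] ab by (simp add: E_def)
qed

text \<open>
  If the density \<open>D\<close> and the flux \<open>B\<close> extend continuously to the closed strip, both sides of the
  identity are continuous in the levels \<open>a\<close> and \<open>b\<close>, and the levels \<open>0\<close> and \<open>1\<close> become admissible.
\<close>

theorem strip_divergence_closed:
  fixes q V1 V2 dq P1 Q1 P2 Q2 :: "real \<Rightarrow> real \<times> real \<Rightarrow> real" and D B :: "real \<times> real \<times> real \<Rightarrow> real"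
  assumes h: "\<And>x. (h has_real_derivative h' x) (at x)" "continuous_on UNIV h'" "\<And>x. h (x + \<Gamma>) = h x"
    and \<Gamma>: "\<Gamma> > 0"
    and per: "\<And>t. 0 < t \<Longrightarrow> x1_periodic_on (open_strip h) \<Gamma> (V1 t)"
    and dq: "\<And>t x. 0 < t \<Longrightarrow> x \<in> open_strip h \<Longrightarrow> ((\<lambda>r. q r x) has_real_derivative dq t x) (at t)"
    and dV1: "\<And>t x. 0 < t \<Longrightarrow> x \<in> open_strip h \<Longrightarrow> has_partials (V1 t) (P1 t x) (Q1 t x) x"
    and dV2: "\<And>t x. 0 < t \<Longrightarrow> x \<in> open_strip h \<Longrightarrow> has_partials (V2 t) (P2 t x) (Q2 t x) x"
    and cont: "jointly_continuous (open_strip h) V1" "jointly_continuous (open_strip h) V2"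
      "jointly_continuous (open_strip h) dq" "jointly_continuous (open_strip h) P1"
      "jointly_continuous (open_strip h) Q1" "jointly_continuous (open_strip h) Q2"
    and q: "jointly_continuous (strip h) q"
    and D: "continuous_on (cbox (t0, 0, 0) (T, \<Gamma>, 1)) D"
      "\<And>t x. 0 < t \<Longrightarrow> x \<in> open_strip h \<Longrightarrow> dq t x + P1 t x + Q2 t x = D (t, fst x, snd x - h (fst x))"
    and B: "continuous_on (cbox (t0, 0, 0) (T, \<Gamma>, 1)) B"
      "\<And>t x. 0 < t \<Longrightarrow> x \<in> open_strip h \<Longrightarrow>
        V2 t x - h' (fst x) * V1 t x = B (t, fst x, snd x - h (fst x))"
    and box: "0 < t0" "t0 \<le> T" "0 \<le> a" "a \<le> b" "b \<le> 1"
  shows "integral (cbox (t0, 0, a) (T, \<Gamma>, b)) D =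
      integral (cbox (0, a) (\<Gamma>, b)) (\<lambda>z. straight h q (T, z) - straight h q (t0, z)) +
      (integral (cbox (t0, 0) (T, \<Gamma>)) (\<lambda>(t, x). B (t, x, b)) -
       integral (cbox (t0, 0) (T, \<Gamma>)) (\<lambda>(t, x). B (t, x, a)))"
proof -
  have hc: "continuous_on UNIV h"
    using h(1) DERIV_isCont continuous_at_imp_continuous_on by blast
  define Q where "Q z = straight h q (T, z) - straight h q (t0, z)" for z
  have Qc: "continuous_on (cbox (0, 0) (\<Gamma>, 1)) Q"
  proof -
    have s: "continuous_on ({0<..} \<times> cbox (0, 0) (\<Gamma>, 1)) (straight h q)"
      by (rule straight_continuous[OF q hc]) (auto simp: strip_def cbox_Pair_eq)
    show ?thesis unfolding Q_def
      by (intro continuous_intros continuous_on_compose2[OF s]) (use box in auto)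
  qed
  define \<phi> where "\<phi> s = integral (cbox (t0, 0) (T, \<Gamma>)) (\<lambda>(t, x). B (t, x, s))" for s
  define d where "d s = integral (cbox (t0, 0) (T, \<Gamma>)) (\<lambda>(t, x). D (t, x, s))" for s
  define r where "r s = integral {0..\<Gamma>} (\<lambda>x. Q (x, s))" for s
  have c: "continuous_on {0..1} \<phi>" "continuous_on {0..1} d" "continuous_on {0..1} r"
    unfolding \<phi>_def d_def r_def using integral_slice_continuous[OF B(1)] integral_slice_continuous[OF D(1)]
      integral_box_slices_2(2)[OF Qc] by auto
  have dr: "integral (cbox (t0, 0, a) (T, \<Gamma>, b)) D - integral (cbox (0, a) (\<Gamma>, b)) Q =
      integral {a..b} (\<lambda>s. d s - r s)" if "0 \<le> a" "b \<le> 1" for a b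
  proof -
    have "integral (cbox (t0, 0, a) (T, \<Gamma>, b)) D = integral {a..b} d"
      unfolding d_def by (rule integral_box_slices[OF continuous_on_subset[OF D(1)]])
        (use that in \<open>auto simp: cbox_Pair_eq\<close>)
    moreover have "integral (cbox (0, a) (\<Gamma>, b)) Q = integral {a..b} r"
      unfolding r_def by (rule integral_box_slices_2(1)[OF continuous_on_subset[OF Qc]])
        (use that in \<open>auto simp: cbox_Pair_eq\<close>)
    moreover have "d integrable_on {a..b}" "r integrable_on {a..b}"
      by (intro integrable_continuous_real continuous_on_subset[OF c(2)] continuous_on_subset[OF c(3)];
          use that in auto)+
    ultimately show ?thesis by (simp add: HK_integral_diff)
  qed
  have "integral {a..b} (\<lambda>s. d s - r s) = \<phi> b - \<phi> a"
  proof (rule interval_identity_closure[OF _ c(1) _ box(3,4,5)])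
    fix a b :: real assume ab: "0 < a" "a \<le> b" "b < 1"
    have inB: "0 < t \<and> (x, h x + s) \<in> open_strip h" if "(t, x, s) \<in> cbox (t0, 0, a) (T, \<Gamma>, b)" for t x s
      using that box ab by (auto simp: open_strip_def cbox_triple)
    have 1: "integral (cbox (t0, 0, a) (T, \<Gamma>, b)) (straight h (\<lambda>t x. dq t x + P1 t x + Q2 t x)) =
        integral (cbox (t0, 0, a) (T, \<Gamma>, b)) D"
    proof (rule HK_integral_cong)
      fix z assume z: "z \<in> cbox (t0, 0, a) (T, \<Gamma>, b)"
      obtain t x s where "z = (t, x, s)" by (cases z)
      with inB z D(2)[of t "(x, h x + s)"] show "straight h (\<lambda>t x. dq t x + P1 t x + Q2 t x) z = D z" by auto
    qed
    have 2: "integral (cbox (t0, 0) (T, \<Gamma>)) (\<lambda>(t, x). V2 t (x, h x + s) - h' x * V1 t (x, h x + s)) = \<phi> s"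
      if "a \<le> s" "s \<le> b" for s
      unfolding \<phi>_def
    proof (rule HK_integral_cong)
      fix z assume z: "z \<in> cbox (t0, 0) (T, \<Gamma>)"
      obtain t x where tx: "z = (t, x)" by (cases z)
      have "0 < t \<and> (x, h x + s) \<in> open_strip h" using z tx that inB by (auto simp: cbox_Pair_eq)
      with B(2)[of t "(x, h x + s)"] tx
      show "(case z of (t, x) \<Rightarrow> V2 t (x, h x + s) - h' x * V1 t (x, h x + s)) = (case z of (t, x) \<Rightarrow> B (t, x, s))"
        by auto
    qed
    show "integral {a..b} (\<lambda>s. d s - r s) = \<phi> b - \<phi> a"
      using strip_divergence[OF h \<Gamma> per dq dV1 dV2 cont box(1,2) ab] dr[of a b] ab
      unfolding 1 2[OF order_refl ab(2)] 2[OF ab(2) order_refl] by (simp add: Q_def[abs_def])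
  qed (intro continuous_intros c)
  then show ?thesis using dr[of a b] box by (simp add: Q_def[abs_def] \<phi>_def)
qed

section \<open>The Rayleigh-Benard flow\<close>

locale Rayleigh_Benard =
  fixes \<Gamma> L :: real and h :: "real \<Rightarrow> real" and \<alpha> :: "real \<times> real \<Rightarrow> real" and Pr Ra :: real
    and u0 :: "real \<times> real \<Rightarrow> real \<times> real" and \<theta>0 :: "real \<times> real \<Rightarrow> real"
    and u :: "real \<Rightarrow> real \<times> real \<Rightarrow> real \<times> real" and p \<theta> :: "real \<Rightarrow> real \<times> real \<Rightarrow> real"
  assumes \<Gamma>: "\<Gamma> > 0" and per: "\<And>x. h (x + \<Gamma>) = h x" and C11: "C11 h" and lip: "L-lipschitz_on UNIV h"
    and Pr: "Pr > 0" and Ra: "Ra \<ge> 1"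
    and \<theta>0: "AE x in lebesgue_on (Omega \<Gamma> h). 0 \<le> \<theta>0 x \<and> \<theta>0 x \<le> 1"
    and sol: "RB_solution \<Gamma> h \<alpha> Pr Ra u0 \<theta>0 u p \<theta>"
begin

abbreviation "S \<equiv> open_strip h"
abbreviation "h' \<equiv> deriv h"

lemma h_deriv: "(h has_real_derivative h' x) (at x)"
  using C11 unfolding C11_def differentiable_on_def
  by (simp add: DERIV_deriv_iff_real_differentiable)

lemma h_cont: "continuous_on UNIV h"
  using lip by (rule lipschitz_on_continuous_on)

lemma h'_cont: "continuous_on UNIV h'"
  using C11 unfolding C11_def by (auto intro: lipschitz_on_continuous_on)

lemma h'_per: "h' (x + \<Gamma>) = h' x"
proof -
  have "((\<lambda>y. h (y + \<Gamma>)) has_real_derivative h' (x + \<Gamma>)) (at x)"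
    using DERIV_shift[of h "h' (x + \<Gamma>)" x \<Gamma>] h_deriv[of "x + \<Gamma>"] by simp
  then show ?thesis using DERIV_unique[OF _ h_deriv[of x]] by (simp add: per)
qed

lemma L_nonneg: "L \<ge> 0" using lip lipschitz_on_nonneg by blast

lemma h'_bound: "\<bar>h' x\<bar> \<le> L"
proof -
  have "((\<lambda>k. \<bar>(h (x + k) - h x) / k\<bar>) \<longlongrightarrow> \<bar>h' x\<bar>) (at 0)"
    using h_deriv[of x] by (intro tendsto_rabs) (simp add: DERIV_def)
  moreover have "eventually (\<lambda>k. \<bar>(h (x + k) - h x) / k\<bar> \<le> L) (at (0::real))"
  proof -
    have "\<bar>(h (x + k) - h x) / k\<bar> \<le> L" if "k \<noteq> 0" for k
      using lipschitz_onD[OF lip, of "x + k" x] that by (simp add: dist_real_def abs_divide field_simps)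
    then show ?thesis by (auto simp: eventually_at_filter)
  qed
  ultimately show ?thesis by (rule tendsto_upperbound) simp
qed

definition "u1 t x = fst (u t x)"
definition "u2 t x = snd (u t x)"

lemma S_open: "open S" by (rule open_strip_open[OF h_cont])
lemma S_sub: "S \<subseteq> strip h" by (auto simp: open_strip_def strip_def)

lemma C12: "C12_inside h u1" "C12_inside h u2" "C12_inside h \<theta>"
proof -
  have "C12_inside h u" "C12_inside h \<theta>" using sol by (auto simp: RB_solution_def)
  then show "C12_inside h u1" "C12_inside h u2" "C12_inside h \<theta>"
    using C12_inside_component(1)[of h u fst, OF _ bounded_linear_fst h_cont]
      C12_inside_component(1)[of h u snd, OF _ bounded_linear_snd h_cont]
    by (simp_all add: u1_def[abs_def] u2_def[abs_def])
qed

lemmas u1_C12 = C12_inside_scalarD[OF C12(1)]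
lemmas u2_C12 = C12_inside_scalarD[OF C12(2)]
lemmas \<theta>_C12 = C12_inside_scalarD[OF C12(3)]

lemma equations:
  assumes t: "0 < t" "x \<in> S"
  shows "pd1 (p t) x = pd1 (pd1 (u1 t)) x + pd2 (pd2 (u1 t)) x
           - (1 / Pr) * (pdt u1 t x + u1 t x * pd1 (u1 t) x + u2 t x * pd2 (u1 t) x)"
    and "pd2 (p t) x = Ra * \<theta> t x + pd1 (pd1 (u2 t)) x + pd2 (pd2 (u2 t)) x
           - (1 / Pr) * (pdt u2 t x + u1 t x * pd1 (u2 t) x + u2 t x * pd2 (u2 t) x)"
    and "pd1 (u1 t) x + pd2 (u2 t) x = 0"
    and "pdt \<theta> t x = pd1 (pd1 (\<theta> t)) x + pd2 (pd2 (\<theta> t)) x - u1 t x * pd1 (\<theta> t) x - u2 t x * pd2 (\<theta> t) x"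
proof -
  have u: "C12_inside h u" using sol by (auto simp: RB_solution_def)
  note f = C12_inside_component(2-6)[OF u bounded_linear_fst h_cont t]
  note s = C12_inside_component(2-6)[OF u bounded_linear_snd h_cont t]
  have e: "(1 / Pr) *\<^sub>R (pdt u t x + advect (u t x) (u t) x) + grad (p t) x - laplacian (u t) x
          = (Ra * \<theta> t x) *\<^sub>R (0, 1)" "divergence (u t) x = 0"
    "pdt \<theta> t x + advect (u t x) (\<theta> t) x - laplacian (\<theta> t) x = 0"
    using sol t by (auto simp: RB_solution_def)
  have d: "u1 = (\<lambda>t x. fst (u t x))" "u2 = (\<lambda>t x. snd (u t x))" by (simp_all add: fun_eq_iff u1_def u2_def)
  show "pd1 (u1 t) x + pd2 (u2 t) x = 0"
    using e(2) by (simp add: divergence_def d f s)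
  show "pdt \<theta> t x = pd1 (pd1 (\<theta> t)) x + pd2 (pd2 (\<theta> t)) x - u1 t x * pd1 (\<theta> t) x - u2 t x * pd2 (\<theta> t) x"
    using e(3) by (simp add: advect_def laplacian_def d)
  from arg_cong[OF e(1), of fst]
  show "pd1 (p t) x = pd1 (pd1 (u1 t)) x + pd2 (pd2 (u1 t)) x
           - (1 / Pr) * (pdt u1 t x + u1 t x * pd1 (u1 t) x + u2 t x * pd2 (u1 t) x)"
    unfolding d f by (simp add: advect_def laplacian_def grad_def algebra_simps)
  from arg_cong[OF e(1), of snd]
  show "pd2 (p t) x = Ra * \<theta> t x + pd1 (pd1 (u2 t)) x + pd2 (pd2 (u2 t)) x
           - (1 / Pr) * (pdt u2 t x + u1 t x * pd1 (u2 t) x + u2 t x * pd2 (u2 t) x)"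
    unfolding d s by (simp add: advect_def laplacian_def grad_def algebra_simps)
qed

lemma cont_strip: "jointly_continuous (strip h) u1" "jointly_continuous (strip h) u2" "jointly_continuous (strip h) \<theta>"
proof -
  have "jointly_continuous (strip h) u" "jointly_continuous (strip h) \<theta>" using sol by (auto simp: RB_solution_def)
  then show "jointly_continuous (strip h) u1" "jointly_continuous (strip h) u2" "jointly_continuous (strip h) \<theta>"
    unfolding jointly_continuous_def case_prod_unfold u1_def u2_def by (auto intro: continuous_intros)
qed

lemma periodic_strip:
  assumes "0 < t"
  shows "x1_periodic_on (strip h) \<Gamma> (u1 t)" "x1_periodic_on (strip h) \<Gamma> (u2 t)" "x1_periodic_on (strip h) \<Gamma> (\<theta> t)"
    "x1_periodic_on S \<Gamma> (p t)"
  using sol assms by (auto simp: RB_solution_def x1_periodic_on_def u1_def u2_def)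

lemma periodic_S:
  assumes "0 < t"
  shows "x1_periodic_on S \<Gamma> (u1 t)" "x1_periodic_on S \<Gamma> (u2 t)" "x1_periodic_on S \<Gamma> (\<theta> t)"
    "x1_periodic_on S \<Gamma> (pd1 (u1 t))" "x1_periodic_on S \<Gamma> (pd2 (u1 t))"
    "x1_periodic_on S \<Gamma> (pd1 (u2 t))" "x1_periodic_on S \<Gamma> (pd2 (u2 t))"
    "x1_periodic_on S \<Gamma> (pd1 (\<theta> t))" "x1_periodic_on S \<Gamma> (pd2 (\<theta> t))"
proof -
  show 1: "x1_periodic_on S \<Gamma> (u1 t)" "x1_periodic_on S \<Gamma> (u2 t)" "x1_periodic_on S \<Gamma> (\<theta> t)"
    using periodic_strip[OF assms] S_sub by (auto simp: x1_periodic_on_def)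
  show "x1_periodic_on S \<Gamma> (pd1 (u1 t))" "x1_periodic_on S \<Gamma> (pd2 (u1 t))"
    "x1_periodic_on S \<Gamma> (pd1 (u2 t))" "x1_periodic_on S \<Gamma> (pd2 (u2 t))"
    "x1_periodic_on S \<Gamma> (pd1 (\<theta> t))" "x1_periodic_on S \<Gamma> (pd2 (\<theta> t))"
    using pd_periodic[OF 1(1) u1_C12(2)[OF assms] h_cont per] pd_periodic[OF 1(2) u2_C12(2)[OF assms] h_cont per]
      pd_periodic[OF 1(3) \<theta>_C12(2)[OF assms] h_cont per] by auto
qed

lemma no_penetration:
  assumes "0 < t"
  shows "u2 t (x, h x) = h' x * u1 t (x, h x)" "u2 t (x, h x + 1) = h' x * u1 t (x, h x + 1)"
proof -
  have n: "normal h s x \<bullet> u t (bdry h s x) = 0" for s using sol assms by (auto simp: RB_solution_def)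
  have a: "arclen h x > 0" unfolding arclen_def by (simp add: add_pos_nonneg)
  show "u2 t (x, h x) = h' x * u1 t (x, h x)" "u2 t (x, h x + 1) = h' x * u1 t (x, h x + 1)"
    using n[of Bottom] n[of Top] a
    by (auto simp: bdry_def inner_prod_def u1_def u2_def field_simps add.commute)
qed

lemma \<theta>_boundary: "0 < t \<Longrightarrow> \<theta> t (x, h x) = 1" "0 < t \<Longrightarrow> \<theta> t (x, h x + 1) = 0"
  using sol by (auto simp: RB_solution_def bdry_def add.commute)

text \<open>
  The continuous extension of \<open>\<nabla>\<theta>\<close> to the closed strip; it is determined by its values inside.
\<close>

definition "G\<theta> = (SOME w. jointly_continuous (strip h) w \<and> (\<forall>t>0. \<forall>x\<in>S. w t x = grad (\<theta> t) x))"
definition "G1 t x = fst (G\<theta> t x)"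
definition "G2 t x = snd (G\<theta> t x)"

lemma G\<theta>: "jointly_continuous (strip h) G\<theta>" "\<And>t x. 0 < t \<Longrightarrow> x \<in> S \<Longrightarrow> G\<theta> t x = grad (\<theta> t) x"
proof -
  have "\<exists>w. jointly_continuous (strip h) w \<and> (\<forall>t>0. \<forall>x\<in>S. w t x = grad (\<theta> t) x)"
    using sol by (auto simp: RB_solution_def extends_continuously_def)
  from someI_ex[OF this]
  show "jointly_continuous (strip h) G\<theta>" "\<And>t x. 0 < t \<Longrightarrow> x \<in> S \<Longrightarrow> G\<theta> t x = grad (\<theta> t) x"
    unfolding G\<theta>_def by auto
qed

lemma G_inside: "0 < t \<Longrightarrow> x \<in> S \<Longrightarrow> G1 t x = pd1 (\<theta> t) x" "0 < t \<Longrightarrow> x \<in> S \<Longrightarrow> G2 t x = pd2 (\<theta> t) x"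
  using G\<theta>(2) by (auto simp: G1_def G2_def grad_def)

lemma G_cont: "jointly_continuous (strip h) G1" "jointly_continuous (strip h) G2"
  using G\<theta>(1) unfolding jointly_continuous_def case_prod_unfold G1_def G2_def by (auto intro: continuous_intros)

lemma straight_cont_closed:
  assumes "jointly_continuous (strip h) w" "0 < t0" "0 \<le> a" "b \<le> 1"
  shows "continuous_on (cbox (t0, x0, a) (T, x1, b)) (straight h w)"
  by (rule straight_continuous[OF assms(1) h_cont]) (use assms in \<open>auto simp: strip_def cbox_Pair_eq\<close>)

lemma straight_cont_inside:
  assumes "jointly_continuous S w" "0 < t0" "0 < a" "b < 1"
  shows "continuous_on (cbox (t0, x0, a) (T, x1, b)) (straight h w)"
  by (rule straight_continuous[OF assms(1) h_cont]) (use assms in \<open>auto simp: open_strip_def cbox_Pair_eq\<close>)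

lemma h'_cont_box: "continuous_on A (\<lambda>z. h' (fst (snd z)))"
  by (intro continuous_on_compose2[OF h'_cont] continuous_intros) auto

end

section \<open>The maximum principle\<close>

lemma DERIV_glue_zero:
  fixes g g' :: "real \<Rightarrow> real"
  assumes g: "\<And>r. 0 \<le> r \<Longrightarrow> (g has_real_derivative g' r) (at r)" and 0: "g 0 = 0" "g' 0 = 0"
  shows "((\<lambda>r. if r \<le> 0 then 0 else g r) has_real_derivative (if x \<le> 0 then 0 else g' x)) (at x)"
proof -
  consider "x < 0" | "x = 0" | "x > 0" by linarith
  then show ?thesis
  proof cases
    case 1
    have "((\<lambda>r. 0::real) has_real_derivative 0) (at x)" by simp
    from has_field_derivative_transform_within_open[OF this, of "{..<0}" "\<lambda>r. if r \<le> 0 then 0 else g r"]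
    show ?thesis using 1 by simp
  next
    case 2
    have "((\<lambda>k. g k / k) \<longlongrightarrow> 0) (at 0)" using g[of 0] 0 by (simp add: DERIV_def)
    then have "((\<lambda>k. (if k \<le> 0 then 0 else g k) / k) \<longlongrightarrow> 0) (at 0)"
    proof (rule tendsto_0_le[where K = 1], intro always_eventually allI)
      show "norm ((if k \<le> 0 then 0 else g k) / k) \<le> norm (g k / k) * 1" for k
        by (cases "k \<le> 0") (simp_all del: abs_divide real_norm_def)
    qed
    then show ?thesis using 2 by (simp add: DERIV_def cong: if_cong)
  next
    case 3
    have "(g has_real_derivative g' x) (at x)" using g 3 by simp
    from has_field_derivative_transform_within_open[OF this, of "{0<..}" "\<lambda>r. if r \<le> 0 then 0 else g r"]
    show ?thesis using 3 by simp
  qed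
qed

text \<open>
  A substitute for \<open>(max 0 r)\<^sup>2\<close> that is twice continuously differentiable: cubic at \<open>0\<close>, convex, and at
  most quadratic at infinity, so that it is integrable under the \<open>L\<^sup>2\<close> initial condition. The functions
  \<open>soft_pos'\<close> and \<open>soft_pos''\<close> are its derivatives.
\<close>

definition soft_pos :: "real \<Rightarrow> real" where
  "soft_pos r = (if r \<le> 0 then 0 else r ^ 3 / (1 + r))"
definition soft_pos' :: "real \<Rightarrow> real" where
  "soft_pos' r = (if r \<le> 0 then 0 else 2 * r - 1 + 1 / (1 + r)\<^sup>2)"
definition soft_pos'' :: "real \<Rightarrow> real" where
  "soft_pos'' r = 2 - 2 / (1 + max 0 r) ^ 3"

lemma soft_pos_deriv: "(soft_pos has_real_derivative soft_pos' x) (at x)"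
proof -
  have "((\<lambda>r. r ^ 3 / (1 + r)) has_real_derivative 2 * r - 1 + 1 / (1 + r)\<^sup>2) (at r)" if "0 \<le> r" for r :: real
  proof -
    have 1: "1 + r \<noteq> 0" using that by auto
    have "((\<lambda>r. r ^ 3 / (1 + r)) has_real_derivative ((3 * r ^ 2) * (1 + r) - r ^ 3 * 1) / ((1 + r) * (1 + r))) (at r)"
      using 1 by (auto intro!: derivative_eq_intros)
    moreover have "((3 * r ^ 2) * (1 + r) - r ^ 3 * 1) / ((1 + r) * (1 + r)) = 2 * r - 1 + 1 / (1 + r)\<^sup>2"
    proof -
      have "(3 * r ^ 2) * (1 + r) - r ^ 3 * 1 = (2 * r - 1) * ((1 + r) * (1 + r)) + 1"
        by (simp add: power2_eq_square power3_eq_cube algebra_simps)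
      then show ?thesis using 1 by (simp only: add_divide_distrib) (simp add: power2_eq_square)
    qed
    ultimately show ?thesis by simp
  qed
  from DERIV_glue_zero[of "\<lambda>r. r ^ 3 / (1 + r)" "\<lambda>r. 2 * r - 1 + 1 / (1 + r)\<^sup>2", OF this]
  show ?thesis by (simp add: soft_pos_def[abs_def] soft_pos'_def)
qed

lemma soft_pos'_deriv: "(soft_pos' has_real_derivative soft_pos'' x) (at x)"
proof -
  have "((\<lambda>r. 2 * r - 1 + 1 / (1 + r)\<^sup>2) has_real_derivative 2 - 2 / (1 + r) ^ 3) (at r)" if "0 \<le> r" for r :: real
  proof -
    have 1: "1 + r \<noteq> 0" using that by auto
    have "((\<lambda>r. 2 * r - 1 + 1 / (1 + r)\<^sup>2) has_real_derivative 2 + (0 * (1 + r)\<^sup>2 - 1 * (2 * (1 + r))) / ((1 + r)\<^sup>2 * (1 + r)\<^sup>2)) (at r)"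
      using 1 by (auto intro!: derivative_eq_intros)
    moreover have "(0 * d\<^sup>2 - 1 * (2 * d)) / (d\<^sup>2 * d\<^sup>2) = - 2 / d ^ 3" if "d \<noteq> 0" for d :: real
      using that by (simp add: divide_simps power2_eq_square power3_eq_cube)
    note this[OF 1]
    ultimately show ?thesis by (simp only: add_uminus_conv_diff minus_divide_left[symmetric])
  qed
  from DERIV_glue_zero[of "\<lambda>r. 2 * r - 1 + 1 / (1 + r)\<^sup>2" "\<lambda>r. 2 - 2 / (1 + r) ^ 3", OF this]
  have "((\<lambda>r. if r \<le> 0 then 0 else 2 * r - 1 + 1 / (1 + r)\<^sup>2) has_real_derivative
      (if x \<le> 0 then 0 else 2 - 2 / (1 + x) ^ 3)) (at x)" by simp
  moreover have "(if x \<le> 0 then 0 else 2 - 2 / (1 + x) ^ 3) = soft_pos'' x"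
    by (auto simp: soft_pos''_def max_def)
  ultimately show ?thesis by (simp add: soft_pos'_def[abs_def])
qed

text \<open>
  It vanishes exactly on \<open>[0, 1]\<close> and treats both bounds on the temperature at once.
\<close>

definition overshoot :: "real \<Rightarrow> real" where "overshoot r = soft_pos (r - 1) + soft_pos (- r)"
definition overshoot' :: "real \<Rightarrow> real" where "overshoot' r = soft_pos' (r - 1) - soft_pos' (- r)"
definition overshoot'' :: "real \<Rightarrow> real" where "overshoot'' r = soft_pos'' (r - 1) + soft_pos'' (- r)"

lemma overshoot_deriv: "(overshoot has_real_derivative overshoot' r) (at r)"
proof -
  have "((\<lambda>r. soft_pos (r - 1)) has_real_derivative soft_pos' (r - 1) * 1) (at r)"
    by (rule DERIV_chain2[OF soft_pos_deriv]) (auto intro!: derivative_eq_intros)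
  moreover have "((\<lambda>r. soft_pos (- r)) has_real_derivative soft_pos' (- r) * (- 1)) (at r)"
    by (rule DERIV_chain2[OF soft_pos_deriv]) (auto intro!: derivative_eq_intros)
  ultimately show ?thesis
    unfolding overshoot_def[abs_def] overshoot'_def using DERIV_add by fastforce
qed

lemma overshoot'_deriv: "(overshoot' has_real_derivative overshoot'' r) (at r)"
proof -
  have "((\<lambda>r. soft_pos' (r - 1)) has_real_derivative soft_pos'' (r - 1) * 1) (at r)"
    by (rule DERIV_chain2[OF soft_pos'_deriv]) (auto intro!: derivative_eq_intros)
  moreover have "((\<lambda>r. soft_pos' (- r)) has_real_derivative soft_pos'' (- r) * (- 1)) (at r)"
    by (rule DERIV_chain2[OF soft_pos'_deriv]) (auto intro!: derivative_eq_intros)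
  ultimately show ?thesis
    unfolding overshoot'_def[abs_def] overshoot''_def using DERIV_diff by fastforce
qed

lemma overshoot_cont: "continuous_on UNIV overshoot" "continuous_on UNIV overshoot'" "continuous_on UNIV overshoot''"
proof -
  show "continuous_on UNIV overshoot" "continuous_on UNIV overshoot'"
    using DERIV_isCont[OF overshoot_deriv] DERIV_isCont[OF overshoot'_deriv]
    by (simp_all add: continuous_at_imp_continuous_on)
  show "continuous_on UNIV overshoot''"
  proof -
    have "(1 + max 0 r) ^ 3 \<noteq> 0" for r :: real
      using max.cobounded1[of 0 r] by (auto simp: add_nonneg_eq_0_iff)
    then show ?thesis
      unfolding overshoot''_def[abs_def] soft_pos''_def by (intro continuous_intros) auto
  qed
qed

lemma soft_pos_nonneg: "0 \<le> soft_pos r" by (simp add: soft_pos_def)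

lemma soft_pos''_nonneg: "0 \<le> soft_pos'' r"
proof -
  have "1 ^ 3 \<le> (1 + max 0 r) ^ 3" by (rule power_mono) auto
  then have "2 / (1 + max 0 r) ^ 3 \<le> 2 / 1" by (intro divide_left_mono) auto
  then show ?thesis by (simp add: soft_pos''_def)
qed

lemma overshoot_simps [simp]:
  "overshoot 0 = 0" "overshoot 1 = 0" "overshoot' 0 = 0" "overshoot' 1 = 0"
  by (auto simp: overshoot_def overshoot'_def soft_pos_def soft_pos'_def)

lemma overshoot_nonneg: "0 \<le> overshoot r" "0 \<le> overshoot'' r"
  by (auto simp: overshoot_def overshoot''_def soft_pos_nonneg soft_pos''_nonneg)

lemma overshoot_eq_0D: "overshoot r = 0 \<Longrightarrow> 0 \<le> r \<and> r \<le> 1"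
  using soft_pos_nonneg[of "r - 1"] soft_pos_nonneg[of "- r"]
  by (auto simp: overshoot_def add_nonneg_eq_0_iff) (auto simp: soft_pos_def split: if_splits)

lemma soft_pos_le: "soft_pos r \<le> (max 0 r)\<^sup>2"
proof (cases "r \<le> 0")
  case False
  then have "r ^ 3 \<le> r\<^sup>2 * (1 + r)" by (simp add: power2_eq_square power3_eq_cube algebra_simps)
  then show ?thesis using False by (simp add: soft_pos_def field_simps)
qed (simp add: soft_pos_def)

text \<open>
  This carries the bounds on the initial temperature, attained in \<open>L\<^sup>2\<close>, over to the overshoot energy.
\<close>

lemma overshoot_le_dist:
  assumes "0 \<le> r0" "r0 \<le> 1" shows "overshoot r \<le> (r - r0)\<^sup>2"
proof -
  have sq: "x\<^sup>2 \<le> y\<^sup>2" if "\<bar>x\<bar> \<le> \<bar>y\<bar>" for x y :: real using that by (simp add: abs_le_square_iff)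
  consider "r < 0" | "0 \<le> r" "r \<le> 1" | "1 < r" by linarith
  then show ?thesis
  proof cases
    case 1
    then have "overshoot r = soft_pos (- r)" by (simp add: overshoot_def soft_pos_def)
    also have "\<dots> \<le> (max 0 (- r))\<^sup>2" by (rule soft_pos_le)
    also have "\<dots> \<le> (r - r0)\<^sup>2" by (rule sq) (use 1 assms in auto)
    finally show ?thesis .
  next
    case 2
    then show ?thesis by (simp add: overshoot_def soft_pos_def)
  next
    case 3
    then have "overshoot r = soft_pos (r - 1)" by (simp add: overshoot_def soft_pos_def)
    also have "\<dots> \<le> (max 0 (r - 1))\<^sup>2" by (rule soft_pos_le)
    also have "\<dots> \<le> (r - r0)\<^sup>2" by (rule sq) (use 3 assms in auto)
    finally show ?thesis .
  qed
qed

text \<open>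
  Straightening is a shear in each vertical line, hence preserves the integral.
\<close>

lemma nn_integral_Omega_straight:
  fixes f :: "real \<times> real \<Rightarrow> real"
  assumes h: "continuous_on UNIV h" and f: "continuous_on (strip h) f" "\<And>x. 0 \<le> f x"
  shows "(\<integral>\<^sup>+ x. ennreal (f x) \<partial>lebesgue_on (Omega \<Gamma> h)) =
      ennreal (integral (cbox (0, 0) (\<Gamma>, 1)) (\<lambda>(x, s). f (x, h x + s)))"
proof -
  let ?\<Omega> = "Omega \<Gamma> h" and ?R = "cbox (0, 0) (\<Gamma>, 1 :: real)"
  have "closed ({z. 0 \<le> fst z} \<inter> {z. fst z \<le> \<Gamma>} \<inter> {z. h (fst z) \<le> snd z} \<inter> {z. snd z \<le> 1 + h (fst z)})"
    by (intro closed_Int closed_Collect_le continuous_intros continuous_on_compose2[OF h]) auto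
  moreover have "{z. 0 \<le> fst z} \<inter> {z. fst z \<le> \<Gamma>} \<inter> {z. h (fst z) \<le> snd z} \<inter> {z. snd z \<le> 1 + h (fst z)} = ?\<Omega>"
    by (auto simp: Omega_def)
  ultimately have cl: "closed ?\<Omega>" by simp
  define F where "F z = indicator ?\<Omega> z *\<^sub>R f z" for z
  define G where "G z = indicator ?R z *\<^sub>R f (fst z, h (fst z) + snd z)" for z
  have Fm: "F \<in> borel_measurable borel"
    unfolding F_def by (rule borel_measurable_continuous_on_indicator)
      (use cl in \<open>auto intro: continuous_on_subset[OF f(1)] simp: Omega_def strip_def\<close>)
  have Gc: "continuous_on ?R (\<lambda>z. f (fst z, h (fst z) + snd z))"
    by (intro continuous_on_compose2[OF f(1)] continuous_intros continuous_on_compose2[OF h])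
      (auto simp: strip_def cbox_Pair_eq)
  have Gm: "G \<in> borel_measurable borel"
    unfolding G_def by (rule borel_measurable_continuous_on_indicator[OF _ Gc]) auto
  have FG: "F (x, h x + s) = G (x, s)" for x s
    by (auto simp: F_def G_def Omega_def indicator_def cbox_Pair_eq)
  have "(\<integral>\<^sup>+ x. ennreal (f x) \<partial>lebesgue_on ?\<Omega>) = (\<integral>\<^sup>+ x. ennreal (f x) * indicator ?\<Omega> x \<partial>lebesgue)"
    by (rule nn_integral_restrict_space) (use cl in auto)
  also have "\<dots> = (\<integral>\<^sup>+ x. ennreal (F x) \<partial>lborel)"
    unfolding nn_integral_completion by (intro nn_integral_cong) (auto simp: F_def indicator_def)
  also have "\<dots> = (\<integral>\<^sup>+ x. ennreal (F x) \<partial>(lborel \<Otimes>\<^sub>M lborel))"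
    by (simp add: lborel_prod)
  also have "\<dots> = (\<integral>\<^sup>+ x. \<integral>\<^sup>+ y. ennreal (F (x, y)) \<partial>lborel \<partial>lborel)"
    by (rule lborel.nn_integral_fst[symmetric]) (use Fm in \<open>simp add: lborel_prod\<close>)
  also have "\<dots> = (\<integral>\<^sup>+ x. \<integral>\<^sup>+ s. ennreal (G (x, s)) \<partial>lborel \<partial>lborel)"
  proof (rule nn_integral_cong)
    fix x :: real
    have "(\<lambda>y. F (x, y)) \<in> borel_measurable borel"
      using Fm by (rule measurable_compose[rotated]) (auto intro!: borel_measurable_continuous_onI continuous_intros)
    then have "(\<integral>\<^sup>+ y. ennreal (F (x, y)) \<partial>lborel) = ennreal \<bar>1\<bar> * (\<integral>\<^sup>+ s. ennreal (F (x, h x + 1 * s)) \<partial>lborel)"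
      by (intro nn_integral_real_affine) auto
    then show "(\<integral>\<^sup>+ y. ennreal (F (x, y)) \<partial>lborel) = (\<integral>\<^sup>+ s. ennreal (G (x, s)) \<partial>lborel)"
      by (simp add: FG)
  qed
  also have "\<dots> = (\<integral>\<^sup>+ x. ennreal (G x) \<partial>(lborel \<Otimes>\<^sub>M lborel))"
    by (rule lborel.nn_integral_fst) (use Gm in \<open>simp add: lborel_prod\<close>)
  also have "\<dots> = (\<integral>\<^sup>+ x. ennreal (G x) \<partial>lborel)"
    by (simp add: lborel_prod)
  also have "\<dots> = ennreal (integral ?R (\<lambda>z. f (fst z, h (fst z) + snd z)))"
  proof (rule nn_integral_has_integral_lborel[OF Gm])
    show "0 \<le> G z" for z using f(2) by (simp add: G_def)
    have "((\<lambda>z. f (fst z, h (fst z) + snd z)) has_integral integral ?R (\<lambda>z. f (fst z, h (fst z) + snd z))) ?R"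
      using integrable_continuous[OF Gc] by (rule integrable_integral)
    then have "((\<lambda>z. if z \<in> ?R then f (fst z, h (fst z) + snd z) else 0) has_integral
        integral ?R (\<lambda>z. f (fst z, h (fst z) + snd z))) UNIV"
      by (simp only: has_integral_restrict_UNIV)
    moreover have "G = (\<lambda>z. if z \<in> ?R then f (fst z, h (fst z) + snd z) else 0)"
      by (auto simp: G_def indicator_def)
    ultimately show "(G has_integral integral ?R (\<lambda>z. f (fst z, h (fst z) + snd z))) UNIV" by simp
  qed
  finally show ?thesis by (simp add: case_prod_unfold)
qed

context Rayleigh_Benard
begin

text \<open>
  For \<open>\<Phi> = overshoot\<close> the field \<open>V = \<Phi>(\<theta>) u - \<Phi>'(\<theta>) \<nabla>\<theta>\<close> satisfies
  \<open>\<partial>\<^sub>t \<Phi>(\<theta>) + div V = - \<Phi>''(\<theta>) \<bar>\<nabla>\<theta>\<bar>\<^sup>2 \<le> 0\<close>. Its flux through the boundary is zero because \<open>u\<close> is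
  tangential there and \<open>\<Phi>'\<close> vanishes at the boundary temperatures \<open>0\<close> and \<open>1\<close>.
\<close>

lemma overshoot_energy_decreasing:
  assumes t: "0 < t0" "t0 \<le> T"
  defines "E \<equiv> \<lambda>t. integral (cbox (0, 0) (\<Gamma>, 1)) (\<lambda>z. overshoot (straight h \<theta> (t, z)))"
  shows "E T \<le> E t0"
proof -
  let ?F = overshoot and ?F' = overshoot' and ?F'' = overshoot''
  define B where "B z = ?F (straight h \<theta> z) * (straight h u2 z - h' (fst (snd z)) * straight h u1 z)
     - ?F' (straight h \<theta> z) * (straight h G2 z - h' (fst (snd z)) * straight h G1 z)" for z
  have cF: "continuous_on A (\<lambda>z. ?F (straight h \<theta> z))" "continuous_on A (\<lambda>z. ?F' (straight h \<theta> z))"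
    if "continuous_on A (straight h \<theta>)" for A
    using overshoot_cont that by (auto intro: continuous_on_compose2[of UNIV])
  have Bc: "continuous_on (cbox (t0, 0, 0) (T, \<Gamma>, 1)) B"
    unfolding B_def by (intro continuous_intros cF straight_cont_closed cont_strip G_cont h'_cont_box) (use t in auto)
  define \<phi> where "\<phi> s = integral (cbox (t0, 0) (T, \<Gamma>)) (\<lambda>(t, x). B (t, x, s))" for s
  have \<phi>c: "continuous_on {0..1} \<phi>"
    unfolding \<phi>_def by (rule integral_slice_continuous[OF Bc])
  have B0: "B (t, x, 0) = 0" "B (t, x, 1) = 0" if "0 < t" for t x
    using no_penetration[OF that] \<theta>_boundary[OF that] by (auto simp: B_def)
  have \<phi>0: "\<phi> 0 = 0" "\<phi> 1 = 0"
    unfolding \<phi>_def by (rule integral_unique, rule has_integral_is_0, use B0 t in \<open>auto simp: cbox_Pair_eq\<close>)+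
  define Q where "Q z = ?F (straight h \<theta> (T, z)) - ?F (straight h \<theta> (t0, z))" for z
  have st: "continuous_on (cbox (0, 0) (\<Gamma>, 1)) (\<lambda>z. ?F (straight h \<theta> (t, z)))" if "0 < t" for t
    by (rule continuous_on_compose2[OF cF(1)[OF straight_cont_closed[OF cont_strip(3), of t 0 1 0 t \<Gamma>]]])
      (use that in \<open>auto intro!: continuous_intros simp: cbox_Pair_eq\<close>)
  have Qc: "continuous_on (cbox (0, 0) (\<Gamma>, 1)) Q"
    unfolding Q_def by (intro continuous_intros st) (use t in auto)
  define V where "V g w t x = ?F (\<theta> t x) * w t x - ?F' (\<theta> t x) * g (\<theta> t) x"
    for g :: "(real \<times> real \<Rightarrow> real) \<Rightarrow> real \<times> real \<Rightarrow> real" and w :: "real \<Rightarrow> real \<times> real \<Rightarrow> real" and t x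
  have main: "integral (cbox (0, \<epsilon>) (\<Gamma>, 1 - \<epsilon>)) Q + (\<phi> (1 - \<epsilon>) - \<phi> \<epsilon>) \<le> 0" if \<epsilon>: "0 < \<epsilon>" "\<epsilon> < 1/2" for \<epsilon>
  proof -
    have pF: "has_partials (\<lambda>y. ?F (\<theta> t y)) (?F' (\<theta> t x) * pd1 (\<theta> t) x) (?F' (\<theta> t x) * pd2 (\<theta> t) x) x"
      "has_partials (\<lambda>y. ?F' (\<theta> t y)) (?F'' (\<theta> t x) * pd1 (\<theta> t) x) (?F'' (\<theta> t x) * pd2 (\<theta> t) x) x"
      if "0 < t" "x \<in> S" for t x
      by (rule has_partials_compose[OF \<theta>_C12(2)[OF that] overshoot_deriv]
          has_partials_compose[OF \<theta>_C12(2)[OF that] overshoot'_deriv])+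
    have jF: "jointly_continuous S (\<lambda>t x. ?F (\<theta> t x))" "jointly_continuous S (\<lambda>t x. ?F' (\<theta> t x))"
      "jointly_continuous S (\<lambda>t x. ?F'' (\<theta> t x))"
      by (rule jointly_continuous_compose[OF overshoot_cont(1) \<theta>_C12(5)]
          jointly_continuous_compose[OF overshoot_cont(2) \<theta>_C12(5)]
          jointly_continuous_compose[OF overshoot_cont(3) \<theta>_C12(5)])+
    note jc = jointly_continuous_intros(1-6) jF u1_C12(5-) u2_C12(5-) \<theta>_C12(5-)
    let ?dq = "\<lambda>t x. ?F' (\<theta> t x) * pdt \<theta> t x"
    let ?P1 = "\<lambda>t x. ?F (\<theta> t x) * pd1 (u1 t) x + (?F' (\<theta> t x) * pd1 (\<theta> t) x) * u1 t x -
            (?F' (\<theta> t x) * pd1 (pd1 (\<theta> t)) x + (?F'' (\<theta> t x) * pd1 (\<theta> t) x) * pd1 (\<theta> t) x)"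
    let ?Q1 = "\<lambda>t x. ?F (\<theta> t x) * pd2 (u1 t) x + (?F' (\<theta> t x) * pd2 (\<theta> t) x) * u1 t x -
            (?F' (\<theta> t x) * pd2 (pd1 (\<theta> t)) x + (?F'' (\<theta> t x) * pd2 (\<theta> t) x) * pd1 (\<theta> t) x)"
    let ?P2 = "\<lambda>t x. ?F (\<theta> t x) * pd1 (u2 t) x + (?F' (\<theta> t x) * pd1 (\<theta> t) x) * u2 t x -
            (?F' (\<theta> t x) * pd1 (pd2 (\<theta> t)) x + (?F'' (\<theta> t x) * pd1 (\<theta> t) x) * pd2 (\<theta> t) x)"
    let ?Q2 = "\<lambda>t x. ?F (\<theta> t x) * pd2 (u2 t) x + (?F' (\<theta> t x) * pd2 (\<theta> t) x) * u2 t x -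
            (?F' (\<theta> t x) * pd2 (pd2 (\<theta> t)) x + (?F'' (\<theta> t x) * pd2 (\<theta> t) x) * pd2 (\<theta> t) x)"
    let ?D = "\<lambda>t x. ?dq t x + ?P1 t x + ?Q2 t x"
    have id: "integral (cbox (t0, 0, \<epsilon>) (T, \<Gamma>, 1 - \<epsilon>)) (straight h ?D) =
      integral (cbox (0, \<epsilon>) (\<Gamma>, 1 - \<epsilon>)) (\<lambda>z. straight h (\<lambda>t x. ?F (\<theta> t x)) (T, z) - straight h (\<lambda>t x. ?F (\<theta> t x)) (t0, z)) +
      (integral (cbox (t0, 0) (T, \<Gamma>)) (\<lambda>(t, x). V pd2 u2 t (x, h x + (1 - \<epsilon>)) - h' x * V pd1 u1 t (x, h x + (1 - \<epsilon>))) -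
       integral (cbox (t0, 0) (T, \<Gamma>)) (\<lambda>(t, x). V pd2 u2 t (x, h x + \<epsilon>) - h' x * V pd1 u1 t (x, h x + \<epsilon>)))"
    proof (rule strip_divergence[where ?V1.0 = "V pd1 u1" and ?V2.0 = "V pd2 u2" and dq = ?dq and ?P1.0 = ?P1
          and ?Q1.0 = ?Q1 and ?P2.0 = ?P2 and ?Q2.0 = ?Q2, OF h_deriv h'_cont per \<Gamma>])
      show "x1_periodic_on S \<Gamma> (V pd1 u1 t)" if "0 < t" for t
        using periodic_S[OF that] by (auto simp: x1_periodic_on_def V_def)
      show "((\<lambda>r. ?F (\<theta> r x)) has_real_derivative ?dq t x) (at t)" if "0 < t" "x \<in> S" for t x
        by (rule DERIV_chain2[OF overshoot_deriv \<theta>_C12(1)[OF that]])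
      show "has_partials (V pd1 u1 t) (?P1 t x) (?Q1 t x) x" if "0 < t" "x \<in> S" for t x
        unfolding V_def
        by (intro has_partials_diff has_partials_mult pF[OF that] u1_C12(2)[OF that] \<theta>_C12(3)[OF that])
      show "has_partials (V pd2 u2 t) (?P2 t x) (?Q2 t x) x" if "0 < t" "x \<in> S" for t x
        unfolding V_def
        by (intro has_partials_diff has_partials_mult pF[OF that] u2_C12(2)[OF that] \<theta>_C12(4)[OF that])
      show "jointly_continuous S (V pd1 u1)" "jointly_continuous S (V pd2 u2)"
        unfolding V_def by (intro jc)+
      show "0 < t0" "t0 \<le> T" "0 < \<epsilon>" "\<epsilon> \<le> 1 - \<epsilon>" "1 - \<epsilon> < 1" using t \<epsilon> by auto
    qed (intro jc)+
    have neg: "integral (cbox (t0, 0, \<epsilon>) (T, \<Gamma>, 1 - \<epsilon>)) (straight h ?D) \<le> 0"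
    proof -
      have le: "?D t x \<le> 0" if "0 < t" "x \<in> S" for t x
      proof -
        have "?D t x = ?F (\<theta> t x) * (pd1 (u1 t) x + pd2 (u2 t) x)
          + ?F' (\<theta> t x) * (pdt \<theta> t x - (pd1 (pd1 (\<theta> t)) x + pd2 (pd2 (\<theta> t)) x - u1 t x * pd1 (\<theta> t) x - u2 t x * pd2 (\<theta> t) x))
          - ?F'' (\<theta> t x) * ((pd1 (\<theta> t) x)\<^sup>2 + (pd2 (\<theta> t) x)\<^sup>2)"
          by (simp add: algebra_simps power2_eq_square)
        also have "\<dots> = - ?F'' (\<theta> t x) * ((pd1 (\<theta> t) x)\<^sup>2 + (pd2 (\<theta> t) x)\<^sup>2)"
          using equations(3,4)[OF that] by simp
        also have "\<dots> \<le> 0" using overshoot_nonneg(2) by (simp add: mult_nonneg_nonneg)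
        finally show ?thesis .
      qed
      have "straight h ?D integrable_on cbox (t0, 0, \<epsilon>) (T, \<Gamma>, 1 - \<epsilon>)"
        by (intro integrable_continuous straight_cont_inside jc) (use t \<epsilon> in auto)
      then have "integral (cbox (t0, 0, \<epsilon>) (T, \<Gamma>, 1 - \<epsilon>)) (straight h ?D) \<le> integral (cbox (t0, 0, \<epsilon>) (T, \<Gamma>, 1 - \<epsilon>)) (\<lambda>z. 0)"
      proof (rule integral_le)
        fix z assume z: "z \<in> cbox (t0, 0, \<epsilon>) (T, \<Gamma>, 1 - \<epsilon>)"
        obtain t' x s where "z = (t', x, s)" by (cases z)
        with z t \<epsilon> have "0 < t'" "(x, h x + s) \<in> S" "z = (t', x, s)" by (auto simp: open_strip_def cbox_Pair_eq)
        then show "straight h ?D z \<le> 0" using le[of t' "(x, h x + s)"] by (simp only: straight_apply)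
      qed auto
      then show ?thesis by simp
    qed
    have bd: "integral (cbox (t0, 0) (T, \<Gamma>)) (\<lambda>(t, x). V pd2 u2 t (x, h x + s) - h' x * V pd1 u1 t (x, h x + s)) = \<phi> s"
      if s: "0 < s" "s < 1" for s
      unfolding \<phi>_def
    proof (rule HK_integral_cong)
      fix z assume z: "z \<in> cbox (t0, 0) (T, \<Gamma>)"
      obtain t' x where z': "z = (t', x)" by (cases z)
      have "0 < t'" "(x, h x + s) \<in> S" using z z' t s by (auto simp: open_strip_def cbox_Pair_eq)
      then show "(case z of (t, x) \<Rightarrow> V pd2 u2 t (x, h x + s) - h' x * V pd1 u1 t (x, h x + s)) = (case z of (t, x) \<Rightarrow> B (t, x, s))"
        using z' by (simp add: V_def B_def G_inside algebra_simps)
    qed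
    have Qe: "(\<lambda>z. straight h (\<lambda>t x. ?F (\<theta> t x)) (T, z) - straight h (\<lambda>t x. ?F (\<theta> t x)) (t0, z)) = Q"
      by (simp add: fun_eq_iff Q_def straight_def)
    have b1: "0 < 1 - \<epsilon>" "1 - \<epsilon> < 1" and b2: "\<epsilon> < 1" using \<epsilon> by auto
    show ?thesis using neg unfolding id Qe bd[OF b1] bd[OF \<epsilon>(1) b2] .
  qed
  have "((\<lambda>\<epsilon>. integral (cbox (0, \<epsilon>) (\<Gamma>, 1 - \<epsilon>)) Q + (\<phi> (1 - \<epsilon>) - \<phi> \<epsilon>)) \<longlongrightarrow>
      integral (cbox (0, 0) (\<Gamma>, 1)) Q + (\<phi> 1 - \<phi> 0)) (at_right 0)"
    by (intro tendsto_add tendsto_diff integral_exhaustion_tendsto_2 Qc tendsto_at_right_0_compose[OF \<phi>c])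
      (auto intro!: tendsto_eq_intros)
  then have "integral (cbox (0, 0) (\<Gamma>, 1)) Q + (\<phi> 1 - \<phi> 0) \<le> 0"
    by (rule tendsto_upperbound)
      (use main in \<open>auto simp: eventually_at_right_field intro!: exI[of _ "1/2"]\<close>)
  moreover have "integral (cbox (0, 0) (\<Gamma>, 1)) Q = E T - E t0"
    unfolding Q_def E_def
    by (rule HK_integral_diff) (use st t in \<open>auto intro!: integrable_continuous\<close>)
  ultimately show ?thesis using \<phi>0 by simp
qed

text \<open>
  The overshoot energy is nonnegative, nonincreasing, and tends to zero as the time tends to zero.
\<close>

theorem maximum_principle:
  assumes T: "0 < T" and x: "x \<in> {0..\<Gamma>}" "s \<in> {0..1}"
  shows "0 \<le> \<theta> T (x, h x + s)" "\<theta> T (x, h x + s) \<le> 1"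
proof -
  define E where "E t = integral (cbox (0, 0) (\<Gamma>, 1)) (\<lambda>z. overshoot (straight h \<theta> (t, z)))" for t
  have st: "continuous_on (cbox (0, 0) (\<Gamma>, 1)) (\<lambda>z. overshoot (straight h \<theta> (t, z)))" if "0 < t" for t
  proof -
    have "continuous_on (cbox (0, 0) (\<Gamma>, 1)) (\<lambda>z. straight h \<theta> (t, z))"
      by (rule continuous_on_compose2[OF straight_cont_closed[OF cont_strip(3), of t 0 1 0 t \<Gamma>]])
        (use that in \<open>auto intro!: continuous_intros simp: cbox_Pair_eq\<close>)
    then show ?thesis by (rule continuous_on_compose2[OF overshoot_cont(1)]) auto
  qed
  have le: "ennreal (E t) \<le> (\<integral>\<^sup>+ x. ennreal ((norm (\<theta> t x - \<theta>0 x))\<^sup>2) \<partial>lebesgue_on (Omega \<Gamma> h))" if "0 < t" for t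
  proof -
    have c: "continuous_on (strip h) (\<lambda>x. overshoot (\<theta> t x))"
    proof -
      have "continuous_on (strip h) (\<lambda>x. \<theta> t x)"
      proof -
        have "continuous_on (strip h) (\<lambda>x. (\<lambda>z. \<theta> (fst z) (snd z)) (t, x))"
          by (rule continuous_on_compose2[OF jointly_continuousD[OF cont_strip(3)]
                continuous_on_Pair[OF continuous_on_const continuous_on_id]]) (use that in auto)
        then show ?thesis by simp
      qed
      then show ?thesis by (rule continuous_on_compose2[OF overshoot_cont(1)]) auto
    qed
    have "ennreal (E t) = (\<integral>\<^sup>+ x. ennreal (overshoot (\<theta> t x)) \<partial>lebesgue_on (Omega \<Gamma> h))"
      using nn_integral_Omega_straight[OF h_cont c] overshoot_nonneg(1)
      by (simp add: E_def straight_def case_prod_unfold)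
    also have "\<dots> \<le> (\<integral>\<^sup>+ x. ennreal ((norm (\<theta> t x - \<theta>0 x))\<^sup>2) \<partial>lebesgue_on (Omega \<Gamma> h))"
      by (rule nn_integral_mono_AE, rule AE_mp[OF \<theta>0])
        (auto intro!: AE_I2 ennreal_leI overshoot_le_dist)
    finally show ?thesis .
  qed
  have E0: "((\<lambda>t. ennreal (E t)) \<longlongrightarrow> 0) (at_right 0)"
  proof (rule tendsto_sandwich[OF _ _ tendsto_const])
    show "((\<lambda>t. \<integral>\<^sup>+ x. ennreal ((norm (\<theta> t x - \<theta>0 x))\<^sup>2) \<partial>lebesgue_on (Omega \<Gamma> h)) \<longlongrightarrow> 0) (at_right 0)"
      using sol by (auto simp: RB_solution_def attains_L2_def)
  qed (use le in \<open>auto simp: eventually_at_right_field intro!: exI[of _ 1]\<close>)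
  have Enn: "0 \<le> E t" if "0 < t" for t
    unfolding E_def by (intro integral_nonneg integrable_continuous st that) (simp add: overshoot_nonneg)
  have "ennreal (E T) \<le> 0"
  proof (rule tendsto_lowerbound[OF E0])
    show "\<forall>\<^sub>F t in at_right 0. ennreal (E T) \<le> ennreal (E t)"
      using overshoot_energy_decreasing T unfolding E_def
      by (auto simp: eventually_at_right_field intro!: exI[of _ T] ennreal_leI)
  qed simp
  then have "E T = 0" using Enn[OF T] by (simp add: ennreal_eq_0_iff)
  then have "\<forall>z\<in>cbox (0, 0) (\<Gamma>, 1). overshoot (straight h \<theta> (T, z)) = 0"
    unfolding E_def using integral_cbox_eq_0_iff[OF st[OF T]] \<Gamma> overshoot_nonneg(1)
    by (auto simp: box_ne_empty Basis_prod_def)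
  then have "overshoot (straight h \<theta> (T, x, s)) = 0" using x by (auto simp: cbox_Pair_eq)
  then show "0 \<le> \<theta> T (x, h x + s)" "\<theta> T (x, h x + s) \<le> 1" using overshoot_eq_0D by auto
qed


section \<open>Heat balance\<close>

text \<open>
  The density \<open>- \<nabla>\<theta> \<bullet> (-h', 1)\<close> of the upward conductive flux with respect to \<open>x\<close>. At the lower
  boundary it is \<open>n \<bullet> \<nabla>\<theta>\<close> times the arc length element.
\<close>

definition heat_flux :: "real \<times> real \<times> real \<Rightarrow> real" where
  "heat_flux z = h' (fst (snd z)) * straight h G1 z - straight h G2 z"

lemma heat_flux_cont:
  "0 < t0 \<Longrightarrow> 0 \<le> a \<Longrightarrow> b \<le> 1 \<Longrightarrow> continuous_on (cbox (t0, x0, a) (T, x1, b)) heat_flux"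
  unfolding heat_flux_def by (intro continuous_intros straight_cont_closed G_cont h'_cont_box)

lemma \<theta>_vertical_deriv:
  assumes "0 < t" "0 < s" "s < 1"
  shows "((\<lambda>s. \<theta> t (x, h x + s)) has_real_derivative G2 t (x, h x + s)) (at s)"
proof -
  have S: "(x, h x + s) \<in> S" using assms by (simp add: open_strip_def)
  have "((\<lambda>s. h x + s) has_real_derivative 1) (at s)" by (auto intro!: derivative_eq_intros)
  from DERIV_chain2[where f = "\<lambda>r. \<theta> t (x, r)", OF has_partials_slices(2)[OF \<theta>_C12(2)[OF assms(1) S]] this]
  show ?thesis using G_inside(2)[OF assms(1) S] by simp
qed

lemma \<theta>_horizontal_deriv:
  assumes "0 < t" "0 < s" "s < 1"
  shows "((\<lambda>x. \<theta> t (x, h x + s)) has_real_derivative G1 t (x, h x + s) + h' x * G2 t (x, h x + s)) (at x)"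
proof -
  have S: "(x, h x + s) \<in> S" using assms by (simp add: open_strip_def)
  have e: "((\<lambda>x. (x, h x + s)) has_derivative (\<lambda>k. (k, h' x * k))) (at x)"
    using h_deriv[of x] by (auto intro!: derivative_eq_intros simp: has_field_derivative_def)
  show ?thesis
    using diff_chain_at[OF e \<theta>_C12(2)[OF assms(1) S, unfolded has_partials_def]]
    unfolding has_field_derivative_def o_def G_inside(1)[OF assms(1) S] G_inside(2)[OF assms(1) S]
    by (rule has_derivative_eq_rhs) (auto simp: fun_eq_iff algebra_simps)
qed

lemma line_cont:
  assumes "jointly_continuous (strip h) w" "0 < t"
  shows "continuous_on {0..1} (\<lambda>s. w t (x, h x + s))"
proof -
  have "continuous_on {0..1} (\<lambda>s. straight h w (t, x, s))"
    by (rule continuous_on_compose2[OF straight_cont_closed[OF assms, of 0 1 x t x]])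
      (auto intro!: continuous_intros simp: cbox_Pair_eq)
  then show ?thesis by simp
qed

text \<open>
  The temperature attains its maximum on the lower and its minimum on the upper boundary, hence it does
  not increase vertically at either. The mean value theorem supplies interior points, arbitrarily close
  to the boundary, with the right sign.
\<close>

lemma G2_boundary_sign:
  assumes t: "0 < t" and x: "x \<in> {0..\<Gamma>}"
  shows "G2 t (x, h x) \<le> 0" "G2 t (x, h x + 1) \<le> 0"
proof -
  have \<theta>c: "continuous_on {0..1} (\<lambda>s. \<theta> t (x, h x + s))" and Gc: "continuous_on {0..1} (\<lambda>s. G2 t (x, h x + s))"
    using line_cont cont_strip(3) G_cont(2) t by auto
  have mvt: "\<exists>\<xi>. a < \<xi> \<and> \<xi> < b \<and> \<theta> t (x, h x + b) - \<theta> t (x, h x + a) = (b - a) * G2 t (x, h x + \<xi>)"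
    if "0 \<le> a" "a < b" "b \<le> 1" for a b
  proof -
    have "\<exists>\<xi>>a. \<xi> < b \<and> (\<lambda>s. \<theta> t (x, h x + s)) b - (\<lambda>s. \<theta> t (x, h x + s)) a = (\<lambda>k. k * G2 t (x, h x + \<xi>)) (b - a)"
    proof (rule mvt)
      show "continuous_on {a..b} (\<lambda>s. \<theta> t (x, h x + s))" by (rule continuous_on_subset[OF \<theta>c]) (use that in auto)
      show "((\<lambda>s. \<theta> t (x, h x + s)) has_derivative (\<lambda>k. k * G2 t (x, h x + \<xi>))) (at \<xi>)" if "a < \<xi>" "\<xi> < b" for \<xi>
        using \<theta>_vertical_deriv[OF t, of \<xi>] that \<open>0 \<le> a\<close> \<open>b \<le> 1\<close>
        by (simp add: has_field_derivative_def mult_commute_abs)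
    qed (use that in auto)
    then show ?thesis by auto
  qed
  have sgn: False if pos: "0 < G2 t (x, h x + s0)" and s0: "s0 \<in> {0..1}"
    and near: "\<And>d. 0 < d \<Longrightarrow> \<exists>\<xi>\<in>{0..1}. \<bar>\<xi> - s0\<bar> < d \<and> G2 t (x, h x + \<xi>) \<le> 0" for s0
  proof -
    obtain d where d: "0 < d" "\<And>\<xi>. \<xi> \<in> {0..1} \<Longrightarrow> dist \<xi> s0 < d \<Longrightarrow>
        dist (G2 t (x, h x + \<xi>)) (G2 t (x, h x + s0)) < G2 t (x, h x + s0)"
      using Gc s0 pos unfolding continuous_on_iff by blast
    obtain \<xi> where \<xi>: "\<xi> \<in> {0..1}" "\<bar>\<xi> - s0\<bar> < d" "G2 t (x, h x + \<xi>) \<le> 0" using near[OF d(1)] by blast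
    then show False using d(2)[of \<xi>] by (simp add: dist_real_def)
  qed
  show "G2 t (x, h x) \<le> 0"
  proof (rule ccontr)
    assume "\<not> ?thesis"
    then have pos: "0 < G2 t (x, h x + 0)" by simp
    show False
    proof (rule sgn[OF pos])
      fix d :: real assume d: "0 < d"
      define b where "b = min d 1"
      have b: "0 < b" "b \<le> 1" "b \<le> d" using d by (auto simp: b_def)
      obtain \<xi> where \<xi>: "0 < \<xi>" "\<xi> < b" "\<theta> t (x, h x + b) - \<theta> t (x, h x + 0) = (b - 0) * G2 t (x, h x + \<xi>)"
        using mvt[of 0 b] b by auto
      have "\<theta> t (x, h x + b) \<le> 1" using maximum_principle(2)[OF t x, of b] b by simp
      then have "b * G2 t (x, h x + \<xi>) \<le> 0" using \<xi>(3) \<theta>_boundary(1)[OF t, of x] by simp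
      then have "G2 t (x, h x + \<xi>) \<le> 0" using b by (simp add: mult_le_0_iff)
      then show "\<exists>\<xi>\<in>{0..1}. \<bar>\<xi> - 0\<bar> < d \<and> G2 t (x, h x + \<xi>) \<le> 0" using \<xi> b by (intro bexI[of _ \<xi>]) auto
    qed simp
  qed
  show "G2 t (x, h x + 1) \<le> 0"
  proof (rule ccontr)
    assume "\<not> ?thesis"
    then have pos: "0 < G2 t (x, h x + 1)" by simp
    show False
    proof (rule sgn[OF pos])
      fix d :: real assume d: "0 < d"
      define a where "a = 1 - min d 1"
      have a: "0 \<le> a" "a < 1" "1 - a \<le> d" using d by (auto simp: a_def)
      obtain \<xi> where \<xi>: "a < \<xi>" "\<xi> < 1" "\<theta> t (x, h x + 1) - \<theta> t (x, h x + a) = (1 - a) * G2 t (x, h x + \<xi>)"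
        using mvt[of a 1] a by auto
      have "0 \<le> \<theta> t (x, h x + a)" using maximum_principle(1)[OF t x, of a] a by simp
      then have "(1 - a) * G2 t (x, h x + \<xi>) \<le> 0" using \<xi>(3) \<theta>_boundary(2)[OF t, of x] by simp
      then have "G2 t (x, h x + \<xi>) \<le> 0" using a by (simp add: mult_le_0_iff)
      then show "\<exists>\<xi>\<in>{0..1}. \<bar>\<xi> - 1\<bar> < d \<and> G2 t (x, h x + \<xi>) \<le> 0" using \<xi> a by (intro bexI[of _ \<xi>]) auto
    qed simp
  qed
qed

text \<open>
  The temperature is constant along each boundary. The identity is first integrated over a piece of the
  slice \<open>s\<close>, where \<open>\<theta>\<close> is differentiable, and then taken to \<open>s = 0\<close> or \<open>s = 1\<close> by continuity.
\<close>

lemma G_tangential: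
  assumes t: "0 < t" and s: "s = 0 \<or> s = 1"
  shows "G1 t (x, h x + s) + h' x * G2 t (x, h x + s) = 0"
proof -
  define \<psi> where "\<psi> s y = G1 t (y, h y + s) + h' y * G2 t (y, h y + s)" for s y
  have \<psi>c: "continuous_on ({0..1} \<times> UNIV) (\<lambda>(s, y). \<psi> s y)"
  proof -
    have st: "continuous_on ({0..1} \<times> UNIV) (\<lambda>z. straight h w (t, snd z, fst z))"
      if "jointly_continuous (strip h) w" for w :: "real \<Rightarrow> real \<times> real \<Rightarrow> real"
      by (rule continuous_on_compose2[OF straight_continuous[OF that h_cont, of "{(t, x, s). 0 < t \<and> 0 \<le> s \<and> s \<le> 1}"]])
        (use t in \<open>auto intro!: continuous_intros simp: strip_def\<close>)
    show ?thesis
      unfolding \<psi>_def case_prod_unfold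
      using st[OF G_cont(1)] st[OF G_cont(2)]
      by (intro continuous_intros continuous_on_compose2[OF h'_cont]) auto
  qed
  have int0: "integral {a..b} (\<psi> s) = 0" if ab: "a \<le> b" for a b
  proof -
    define I where "I s = integral {a..b} (\<psi> s)" for s
    define D where "D s = \<theta> t (b, h b + s) - \<theta> t (a, h a + s)" for s
    have Ic: "continuous_on {0..1} I"
      unfolding I_def[abs_def] using integral_continuous_on_param[of "{0..1}" a b \<psi>]
        continuous_on_subset[OF \<psi>c, of "{0..1} \<times> cbox a b"] by auto
    have Dc: "continuous_on {0..1} D"
      unfolding D_def[abs_def] by (intro continuous_intros line_cont cont_strip t)
    have ID: "I s = D s" if "0 < s" "s < 1" for s
      unfolding I_def D_def
      by (intro integral_unique fundamental_theorem_of_calculus ab)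
        (use \<theta>_horizontal_deriv[OF t that] in \<open>auto simp: \<psi>_def has_real_derivative_iff_has_vector_derivative[symmetric]
          intro: has_field_derivative_at_within\<close>)
    have "I s - D s = 0" if "s \<in> {0..1}" for s
      by (rule continuous_constant_on_closure[of "{0<..<1}" "\<lambda>s. I s - D s"])
        (use that Ic Dc ID in \<open>auto intro!: continuous_intros\<close>)
    then have "I s = D s" using s by auto
    moreover have "D s = 0" using s \<theta>_boundary[OF t] by (auto simp: D_def)
    ultimately show ?thesis by (simp add: I_def)
  qed
  have \<psi>s: "continuous_on {x - 1..x + 1} (\<psi> s)"
    by (rule continuous_on_compose2[OF \<psi>c, of _ "\<lambda>y. (s, y)", simplified]) (use s in \<open>auto intro!: continuous_intros\<close>)
  have "((\<lambda>y. integral {x - 1..y} (\<psi> s)) has_real_derivative \<psi> s x) (at x within {x - 1..x + 1})"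
    by (rule integral_has_real_derivative[OF \<psi>s]) auto
  then have "((\<lambda>y. integral {x - 1..y} (\<psi> s)) has_real_derivative \<psi> s x) (at x)"
    by (simp add: at_within_Icc_at)
  moreover have "((\<lambda>y. integral {x - 1..y} (\<psi> s)) has_real_derivative 0) (at x)"
  proof (rule has_field_derivative_transform_within_open[of "\<lambda>y. 0" 0 x "{x - 1<..}"])
    show "0 = integral {x - 1..y} (\<psi> s)" if "y \<in> {x - 1<..}" for y using int0[of "x - 1" y] that by simp
  qed auto
  ultimately show ?thesis using DERIV_unique by (fastforce simp: \<psi>_def)
qed

text \<open>
  On the boundary the tangential condition leaves \<open>- (1 + h'\<^sup>2) \<partial>\<^sub>2\<theta>\<close>.
\<close>

lemma heat_flux_nonneg:
  assumes "0 < t" "x \<in> {0..\<Gamma>}" "s = 0 \<or> s = 1"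
  shows "0 \<le> heat_flux (t, x, s)"
proof -
  have G1: "G1 t (x, h x + s) = - (h' x * G2 t (x, h x + s))"
    using G_tangential[OF assms(1,3), of x] by simp
  have "heat_flux (t, x, s) = - ((1 + (h' x)\<^sup>2) * G2 t (x, h x + s))"
  proof -
    have "heat_flux (t, x, s) = h' x * G1 t (x, h x + s) - G2 t (x, h x + s)" by (simp add: heat_flux_def)
    then show ?thesis unfolding G1 by (simp add: power2_eq_square distrib_right)
  qed
  moreover have "G2 t (x, h x + s) \<le> 0" using G2_boundary_sign[OF assms(1,2)] assms(3) by auto
  then have "(1 + (h' x)\<^sup>2) * G2 t (x, h x + s) \<le> 0" by (intro mult_nonneg_nonpos) auto
  ultimately show ?thesis by simp
qed

definition boundary_flux :: "real \<Rightarrow> real \<Rightarrow> real \<Rightarrow> real" where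
  "boundary_flux t0 T s = integral (cbox (t0, 0) (T, \<Gamma>)) (\<lambda>(t, x). heat_flux (t, x, s))"

lemma slice_integrable:
  fixes f :: "real \<times> real \<times> real \<Rightarrow> real"
  assumes "continuous_on (cbox (t0, 0, 0) (T, \<Gamma>, 1)) f" "s \<in> {0..1}"
  shows "continuous_on (cbox (t0, 0) (T, \<Gamma>)) (\<lambda>(t, x). f (t, x, s))"
    "(\<lambda>(t, x). f (t, x, s)) integrable_on cbox (t0, 0) (T, \<Gamma>)"
proof -
  show "continuous_on (cbox (t0, 0) (T, \<Gamma>)) (\<lambda>(t, x). f (t, x, s))"
    unfolding case_prod_unfold
    by (rule continuous_on_compose2[OF assms(1)]) (use assms(2) in \<open>auto intro!: continuous_intros simp: cbox_Pair_eq\<close>)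
  then show "(\<lambda>(t, x). f (t, x, s)) integrable_on cbox (t0, 0) (T, \<Gamma>)" by (rule integrable_continuous)
qed

lemma boundary_flux_nonneg:
  assumes "0 < t0" "s = 0 \<or> s = 1"
  shows "0 \<le> boundary_flux t0 T s"
  unfolding boundary_flux_def
  by (rule integral_nonneg[OF slice_integrable(2)[OF heat_flux_cont]])
    (use assms heat_flux_nonneg in \<open>auto simp: cbox_Pair_eq\<close>)

lemma integral_period_rectangle_bound:
  fixes f :: "real \<times> real \<Rightarrow> real" and s c :: real
  assumes s: "0 \<le> s" "s \<le> 1" and c: "0 \<le> c"
    and f: "continuous_on (cbox (0, 0) (\<Gamma>, s)) f"
    and f_le: "\<And>z. z \<in> cbox (0, 0) (\<Gamma>, s) \<Longrightarrow> \<bar>f z\<bar> \<le> c"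
  shows "\<bar>integral (cbox (0, 0) (\<Gamma>, s)) f\<bar> \<le> c * \<Gamma>"
proof -
  have "norm (integral (cbox (0, 0) (\<Gamma>, s)) f) \<le> integral (cbox (0, 0) (\<Gamma>, s)) (\<lambda>z. c)"
    by (rule HK_integral_norm_bound_integral[OF integrable_continuous[OF f]])
      (use f_le in auto)
  also have "\<dots> = c * (\<Gamma> * s)" using \<Gamma> s by (simp add: content_Pair)
  also have "\<dots> \<le> c * \<Gamma>" using \<Gamma> s c by (intro mult_left_mono) (auto simp: mult_left_le)
  finally show ?thesis by simp
qed

lemma straight_\<theta>_cont_at:
  assumes "0 < t" "0 \<le> a" "b \<le> 1"
  shows "continuous_on (cbox (x0, a) (x1, b)) (\<lambda>z. straight h \<theta> (t, z))"
  by (rule continuous_on_compose2[OF straight_cont_closed[OF cont_strip(3), of t a b x0 t x1]])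
    (use assms in \<open>auto intro!: continuous_intros simp: cbox_Pair_eq\<close>)

lemmas jc = jointly_continuous_intros u1_C12(5-) u2_C12(5-) \<theta>_C12(5-)
lemmas hp = has_partials_diff has_partials_mult has_partials_const has_partials_snd

text \<open>
  The heat equation \<open>\<partial>\<^sub>t \<theta> + div (\<theta> u - \<nabla>\<theta>) = 0\<close> between the levels \<open>0\<close> and \<open>s\<close>: the heat stored there
  changes by at most \<open>\<Gamma>\<close>.
\<close>

lemma flux_identity:
  assumes t: "0 < t0" "t0 \<le> T" and s: "0 \<le> s" "s \<le> 1"
  defines "J \<equiv> integral (cbox (t0, 0) (T, \<Gamma>)) (\<lambda>(t, x).
      \<theta> t (x, h x + s) * (u2 t (x, h x + s) - h' x * u1 t (x, h x + s)) + heat_flux (t, x, s))"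
  shows "\<bar>boundary_flux t0 T 0 - J\<bar> \<le> \<Gamma>"
proof -
  define B where "B z = straight h \<theta> z * (straight h u2 z - h' (fst (snd z)) * straight h u1 z) + heat_flux z" for z
  let ?P1 = "\<lambda>t x. \<theta> t x * pd1 (u1 t) x + pd1 (\<theta> t) x * u1 t x - pd1 (pd1 (\<theta> t)) x"
  let ?Q1 = "\<lambda>t x. \<theta> t x * pd2 (u1 t) x + pd2 (\<theta> t) x * u1 t x - pd2 (pd1 (\<theta> t)) x"
  let ?P2 = "\<lambda>t x. \<theta> t x * pd1 (u2 t) x + pd1 (\<theta> t) x * u2 t x - pd1 (pd2 (\<theta> t)) x"
  let ?Q2 = "\<lambda>t x. \<theta> t x * pd2 (u2 t) x + pd2 (\<theta> t) x * u2 t x - pd2 (pd2 (\<theta> t)) x"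
  let ?V1 = "\<lambda>t x. \<theta> t x * u1 t x - pd1 (\<theta> t) x"
  let ?V2 = "\<lambda>t x. \<theta> t x * u2 t x - pd2 (\<theta> t) x"
  have "integral (cbox (t0, 0, 0) (T, \<Gamma>, s)) (\<lambda>z. 0) =
      integral (cbox (0, 0) (\<Gamma>, s)) (\<lambda>z. straight h \<theta> (T, z) - straight h \<theta> (t0, z)) +
      (integral (cbox (t0, 0) (T, \<Gamma>)) (\<lambda>(t, x). B (t, x, s)) -
       integral (cbox (t0, 0) (T, \<Gamma>)) (\<lambda>(t, x). B (t, x, 0)))"
  proof (rule strip_divergence_closed[where ?V1.0 = ?V1 and ?V2.0 = ?V2 and dq = "pdt \<theta>"
        and ?P1.0 = ?P1 and ?Q1.0 = ?Q1 and ?P2.0 = ?P2 and ?Q2.0 = ?Q2, OF h_deriv h'_cont per \<Gamma>])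
    show "x1_periodic_on S \<Gamma> (?V1 t)" if "0 < t" for t
      using periodic_S[OF that] by (auto simp: x1_periodic_on_def)
    show "((\<lambda>r. \<theta> r x) has_real_derivative pdt \<theta> t x) (at t)" if "0 < t" "x \<in> S" for t x
      by (rule \<theta>_C12(1)[OF that])
    show "has_partials (?V1 t) (?P1 t x) (?Q1 t x) x" if "0 < t" "x \<in> S" for t x
      by (intro hp \<theta>_C12(2,3)[OF that] u1_C12(2)[OF that])
    show "has_partials (?V2 t) (?P2 t x) (?Q2 t x) x" if "0 < t" "x \<in> S" for t x
      by (intro hp \<theta>_C12(2,4)[OF that] u2_C12(2)[OF that])
    show "continuous_on (cbox (t0, 0, 0) (T, \<Gamma>, 1)) B"
      unfolding B_def
      by (intro continuous_intros straight_cont_closed cont_strip heat_flux_cont h'_cont_box) (use t in auto)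
    show "continuous_on (cbox (t0, 0, 0) (T, \<Gamma>, 1)) (\<lambda>z. 0::real)" by simp
    show "pdt \<theta> t x + ?P1 t x + (?Q2 t x) = 0" if "0 < t" "x \<in> S" for t x
    proof -
      have "\<theta> t x * pd1 (u1 t) x + \<theta> t x * pd2 (u2 t) x = 0"
        using equations(3)[OF that] by (metis distrib_left mult_zero_right)
      then show ?thesis using equations(4)[OF that] by (simp add: algebra_simps)
    qed
    show "?V2 t x - h' (fst x) * (?V1 t x) =
        B (t, fst x, snd x - h (fst x))" if "0 < t" "x \<in> S" for t x
      using G_inside[OF that] by (simp add: B_def heat_flux_def algebra_simps)
    show "0 < t0" "t0 \<le> T" "(0::real) \<le> 0" "0 \<le> s" "s \<le> 1" using t s by auto
  qed (intro jc cont_strip)+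
  moreover have "integral (cbox (t0, 0) (T, \<Gamma>)) (\<lambda>(t, x). B (t, x, 0)) = boundary_flux t0 T 0"
    unfolding boundary_flux_def
  proof (rule HK_integral_cong)
    fix z assume "z \<in> cbox (t0, 0) (T, \<Gamma>)"
    then have "0 < fst z" using t by (cases z) (auto simp: cbox_Pair_eq)
    then show "(case z of (t, x) \<Rightarrow> B (t, x, 0)) = (case z of (t, x) \<Rightarrow> heat_flux (t, x, 0))"
      using no_penetration(1) by (cases z) (simp add: B_def)
  qed
  moreover have "integral (cbox (t0, 0) (T, \<Gamma>)) (\<lambda>(t, x). B (t, x, s)) = J"
    by (simp add: J_def B_def)
  moreover have "\<bar>integral (cbox (0, 0) (\<Gamma>, s)) (\<lambda>z. straight h \<theta> (T, z) - straight h \<theta> (t0, z))\<bar> \<le> 1 * \<Gamma>"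
  proof (rule integral_period_rectangle_bound[OF s])
    show "continuous_on (cbox (0, 0) (\<Gamma>, s)) (\<lambda>z. straight h \<theta> (T, z) - straight h \<theta> (t0, z))"
      by (intro continuous_intros straight_\<theta>_cont_at) (use t s in auto)
    fix z assume z: "z \<in> cbox (0, 0) (\<Gamma>, s)"
    obtain x r where xr: "z = (x, r)" by (cases z)
    then have "x \<in> {0..\<Gamma>}" "r \<in> {0..1}" using z s by (auto simp: cbox_Pair_eq)
    then show "\<bar>straight h \<theta> (T, z) - straight h \<theta> (t0, z)\<bar> \<le> 1"
      using maximum_principle[of T x r] maximum_principle[of t0 x r] t xr by auto
  qed simp
  ultimately show ?thesis by simp
qed

text \<open>
  The equation \<open>\<partial>\<^sub>t \<theta>\<^sup>2 + div (\<theta>\<^sup>2 u - 2 \<theta> \<nabla>\<theta>) = - 2 \<bar>\<nabla>\<theta>\<bar>\<^sup>2\<close>; as \<open>\<theta>\<close> is \<open>1\<close> below and \<open>0\<close> above, only the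
  flux through the lower boundary remains.
\<close>

lemma dissipation_bound:
  assumes t: "0 < t0" "t0 \<le> T"
  shows "integral (cbox (t0, 0, 0) (T, \<Gamma>, 1)) (\<lambda>z. (straight h G1 z)\<^sup>2 + (straight h G2 z)\<^sup>2)
    \<le> boundary_flux t0 T 0 + \<Gamma>"
proof -
  define B where "B z = straight h \<theta> z * straight h \<theta> z * (straight h u2 z - h' (fst (snd z)) * straight h u1 z)
      + 2 * straight h \<theta> z * heat_flux z" for z
  define D where "D z = (straight h G1 z)\<^sup>2 + (straight h G2 z)\<^sup>2" for z
  have Dc: "continuous_on (cbox (t0, 0, 0) (T, \<Gamma>, 1)) D"
    unfolding D_def by (intro continuous_intros straight_cont_closed G_cont) (use t in auto)
  let ?P1 = "\<lambda>t x. \<theta> t x * \<theta> t x * pd1 (u1 t) x + (\<theta> t x * pd1 (\<theta> t) x + pd1 (\<theta> t) x * \<theta> t x) * u1 t x - (2 * \<theta> t x * pd1 (pd1 (\<theta> t)) x + (2 * pd1 (\<theta> t) x + 0 * \<theta> t x) * pd1 (\<theta> t) x)"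
  let ?Q1 = "\<lambda>t x. \<theta> t x * \<theta> t x * pd2 (u1 t) x + (\<theta> t x * pd2 (\<theta> t) x + pd2 (\<theta> t) x * \<theta> t x) * u1 t x - (2 * \<theta> t x * pd2 (pd1 (\<theta> t)) x + (2 * pd2 (\<theta> t) x + 0 * \<theta> t x) * pd1 (\<theta> t) x)"
  let ?P2 = "\<lambda>t x. \<theta> t x * \<theta> t x * pd1 (u2 t) x + (\<theta> t x * pd1 (\<theta> t) x + pd1 (\<theta> t) x * \<theta> t x) * u2 t x - (2 * \<theta> t x * pd1 (pd2 (\<theta> t)) x + (2 * pd1 (\<theta> t) x + 0 * \<theta> t x) * pd2 (\<theta> t) x)"
  let ?Q2 = "\<lambda>t x. \<theta> t x * \<theta> t x * pd2 (u2 t) x + (\<theta> t x * pd2 (\<theta> t) x + pd2 (\<theta> t) x * \<theta> t x) * u2 t x - (2 * \<theta> t x * pd2 (pd2 (\<theta> t)) x + (2 * pd2 (\<theta> t) x + 0 * \<theta> t x) * pd2 (\<theta> t) x)"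
  let ?dq = "\<lambda>t x. pdt \<theta> t x * \<theta> t x + pdt \<theta> t x * \<theta> t x"
  let ?V1 = "\<lambda>t x. \<theta> t x * \<theta> t x * u1 t x - 2 * \<theta> t x * pd1 (\<theta> t) x"
  let ?V2 = "\<lambda>t x. \<theta> t x * \<theta> t x * u2 t x - 2 * \<theta> t x * pd2 (\<theta> t) x"
  have "integral (cbox (t0, 0, 0) (T, \<Gamma>, 1)) (\<lambda>z. - 2 * D z) =
      integral (cbox (0, 0) (\<Gamma>, 1)) (\<lambda>z. straight h (\<lambda>t x. \<theta> t x * \<theta> t x) (T, z) - straight h (\<lambda>t x. \<theta> t x * \<theta> t x) (t0, z)) +
      (integral (cbox (t0, 0) (T, \<Gamma>)) (\<lambda>(t, x). B (t, x, 1)) -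
       integral (cbox (t0, 0) (T, \<Gamma>)) (\<lambda>(t, x). B (t, x, 0)))"
  proof (rule strip_divergence_closed[where ?V1.0 = ?V1 and ?V2.0 = ?V2 and dq = ?dq
        and ?P1.0 = ?P1
        and ?Q1.0 = ?Q1
        and ?P2.0 = ?P2
        and ?Q2.0 = ?Q2,
        OF h_deriv h'_cont per \<Gamma>])
    show "x1_periodic_on S \<Gamma> (?V1 t)" if "0 < t" for t
      using periodic_S[OF that] by (auto simp: x1_periodic_on_def)
    show "((\<lambda>r. \<theta> r x * \<theta> r x) has_real_derivative ?dq t x) (at t)" if "0 < t" "x \<in> S" for t x
      by (rule DERIV_mult[OF \<theta>_C12(1)[OF that] \<theta>_C12(1)[OF that]])
    show "has_partials (?V1 t) (?P1 t x) (?Q1 t x) x" if "0 < t" "x \<in> S" for t x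
      by (intro hp \<theta>_C12(2,3)[OF that] u1_C12(2)[OF that])
    show "has_partials (?V2 t) (?P2 t x) (?Q2 t x) x" if "0 < t" "x \<in> S" for t x
      by (intro hp \<theta>_C12(2,4)[OF that] u2_C12(2)[OF that])
    show "continuous_on (cbox (t0, 0, 0) (T, \<Gamma>, 1)) B"
      unfolding B_def
      by (intro continuous_intros straight_cont_closed cont_strip heat_flux_cont h'_cont_box) (use t in auto)
    show "continuous_on (cbox (t0, 0, 0) (T, \<Gamma>, 1)) (\<lambda>z. - 2 * D z)" by (intro continuous_intros Dc)
    show "?dq t x +
        ?P1 t x + (?Q2 t x)
        = - 2 * D (t, fst x, snd x - h (fst x))" if "0 < t" "x \<in> S" for t x
    proof -
      have a: "pd2 (u2 t) x = - pd1 (u1 t) x" using equations(3)[OF that] by simp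
      show ?thesis unfolding equations(4)[OF that] a D_def
        using G_inside[OF that] by (simp add: algebra_simps power2_eq_square)
    qed
    show "?V2 t x
        - h' (fst x) * (?V1 t x) =
        B (t, fst x, snd x - h (fst x))" if "0 < t" "x \<in> S" for t x
      using G_inside[OF that] by (simp add: B_def heat_flux_def algebra_simps)
    show "0 < t0" "t0 \<le> T" "(0::real) \<le> 0" "(0::real) \<le> 1" "(1::real) \<le> 1" using t by auto
  qed (intro jc cont_strip)+
  moreover have "integral (cbox (t0, 0) (T, \<Gamma>)) (\<lambda>(t, x). B (t, x, 0)) = 2 * boundary_flux t0 T 0"
    unfolding boundary_flux_def integral_mult_right[symmetric]
  proof (rule HK_integral_cong)
    fix z assume "z \<in> cbox (t0, 0) (T, \<Gamma>)"
    then have "0 < fst z" using t by (cases z) (auto simp: cbox_Pair_eq)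
    then show "(case z of (t, x) \<Rightarrow> B (t, x, 0)) = 2 * (case z of (t, x) \<Rightarrow> heat_flux (t, x, 0))"
      using no_penetration(1) \<theta>_boundary(1) by (cases z) (simp add: B_def)
  qed
  moreover have "integral (cbox (t0, 0) (T, \<Gamma>)) (\<lambda>(t, x). B (t, x, 1)) = 0"
  proof (rule integral_unique, rule has_integral_is_0)
    fix z assume "z \<in> cbox (t0, 0) (T, \<Gamma>)"
    then have "0 < fst z" using t by (cases z) (auto simp: cbox_Pair_eq)
    then show "(case z of (t, x) \<Rightarrow> B (t, x, 1)) = 0"
      using \<theta>_boundary(2) by (cases z) (simp add: B_def)
  qed
  moreover have "\<bar>integral (cbox (0, 0) (\<Gamma>, 1)) (\<lambda>z. straight h (\<lambda>t x. \<theta> t x * \<theta> t x) (T, z) - straight h (\<lambda>t x. \<theta> t x * \<theta> t x) (t0, z))\<bar> \<le> 1 * \<Gamma>"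
  proof (rule integral_period_rectangle_bound)
    have e: "straight h (\<lambda>t x. \<theta> t x * \<theta> t x) (t, z) = straight h \<theta> (t, z) * straight h \<theta> (t, z)" for t z
      by (cases z) simp
    show "continuous_on (cbox (0, 0) (\<Gamma>, 1)) (\<lambda>z. straight h (\<lambda>t x. \<theta> t x * \<theta> t x) (T, z) - straight h (\<lambda>t x. \<theta> t x * \<theta> t x) (t0, z))"
      unfolding e by (intro continuous_intros straight_\<theta>_cont_at) (use t in auto)
    fix z :: "real \<times> real" assume z: "z \<in> cbox (0, 0) (\<Gamma>, 1)"
    obtain x r where xr: "z = (x, r)" by (cases z)
    then have m: "0 \<le> \<theta> T (x, h x + r)" "\<theta> T (x, h x + r) \<le> 1" "0 \<le> \<theta> t0 (x, h x + r)" "\<theta> t0 (x, h x + r) \<le> 1"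
      using z maximum_principle[of T x r] maximum_principle[of t0 x r] t by (auto simp: cbox_Pair_eq)
    then have "0 \<le> \<theta> T (x, h x + r) * \<theta> T (x, h x + r)" "\<theta> T (x, h x + r) * \<theta> T (x, h x + r) \<le> 1"
      "0 \<le> \<theta> t0 (x, h x + r) * \<theta> t0 (x, h x + r)" "\<theta> t0 (x, h x + r) * \<theta> t0 (x, h x + r) \<le> 1"
      by (auto intro: mult_le_one)
    then show "\<bar>straight h (\<lambda>t x. \<theta> t x * \<theta> t x) (T, z) - straight h (\<lambda>t x. \<theta> t x * \<theta> t x) (t0, z)\<bar> \<le> 1"
      unfolding xr straight_apply by linarith
  qed auto
  moreover have "integral (cbox (t0, 0, 0) (T, \<Gamma>, 1)) (\<lambda>z. - 2 * D z) = - 2 * integral (cbox (t0, 0, 0) (T, \<Gamma>, 1)) D"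
    by (rule integral_mult_right)
  ultimately show ?thesis using \<Gamma> unfolding D_def by linarith
qed

end

section \<open>Integration by parts with a Lipschitz factor\<close>

lemma negligible_UNIV_Times:
  fixes N :: "real set"
  assumes "negligible N" shows "negligible ((UNIV :: real set) \<times> N)"
proof -
  obtain N' where N': "N' \<in> null_sets lborel" "N \<subseteq> N'"
    using assms unfolding negligible_iff_null_sets null_sets_completion_iff2 by blast
  have "(UNIV :: real set) \<times> N' \<in> null_sets (lborel \<Otimes>\<^sub>M lborel)"
    using lborel.times_in_null_sets2[of "UNIV :: real set" lborel N'] N' by auto
  then have "(UNIV :: real set) \<times> N' \<in> null_sets (lborel :: (real \<times> real) measure)" by (simp add: lborel_prod)
  then have "negligible ((UNIV :: real set) \<times> N')"
    by (simp add: negligible_iff_null_sets null_sets_completionI)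
  then show ?thesis by (rule negligible_subset) (use N' in auto)
qed

text \<open>
  The product \<open>k v\<close> is periodic in \<open>x\<close>, so its difference quotients have integral zero. They are bounded
  and converge almost everywhere.
\<close>

lemma Lipschitz_integration_by_parts:
  fixes k H :: "real \<Rightarrow> real" and v vx :: "real \<times> real \<Rightarrow> real"
  assumes k: "K-lipschitz_on UNIV k" "\<And>x. k (x + \<Gamma>) = k x" and \<Gamma>: "\<Gamma> > 0"
    and N: "negligible N" and H: "\<And>x. x \<notin> N \<Longrightarrow> (k has_real_derivative H x) (at x)"
    and v: "continuous_on ({t0..T} \<times> UNIV) v" and vx: "continuous_on ({t0..T} \<times> UNIV) vx"
    and dv: "\<And>t x. t \<in> {t0..T} \<Longrightarrow> ((\<lambda>x. v (t, x)) has_real_derivative vx (t, x)) (at x)"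
    and per: "\<And>t x. t \<in> {t0..T} \<Longrightarrow> v (t, x + \<Gamma>) = v (t, x)"
  shows "((\<lambda>(t, x). H x * v (t, x) + k x * vx (t, x)) has_integral 0) (cbox (t0, 0) (T, \<Gamma>))"
proof -
  let ?R = "cbox (t0, 0) (T, \<Gamma>)" and ?R2 = "{t0..T} \<times> {0..2 * \<Gamma>}"
  have kc: "continuous_on UNIV k" using k(1) by (rule lipschitz_on_continuous_on)
  have K: "0 \<le> K" using k(1) lipschitz_on_nonneg by blast
  have comp: "compact ?R2" by (intro compact_Times) auto
  have "bounded (v ` ?R2)"
    by (intro compact_imp_bounded compact_continuous_image comp continuous_on_subset[OF v]) auto
  then obtain Bv where Bv: "Bv > 0" "\<And>z. z \<in> ?R2 \<Longrightarrow> \<bar>v z\<bar> \<le> Bv" by (auto simp: bounded_pos)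
  have "bounded (vx ` ?R2)"
    by (intro compact_imp_bounded compact_continuous_image comp continuous_on_subset[OF vx]) auto
  then obtain Bx where Bx: "Bx > 0" "\<And>z. z \<in> ?R2 \<Longrightarrow> \<bar>vx z\<bar> \<le> Bx" by (auto simp: bounded_pos)
  have "bounded (k ` {0..\<Gamma>})"
    by (intro compact_imp_bounded compact_continuous_image continuous_on_subset[OF kc]) auto
  then obtain Bk where Bk: "Bk > 0" "\<And>x. x \<in> {0..\<Gamma>} \<Longrightarrow> \<bar>k x\<bar> \<le> Bk" by (auto simp: bounded_pos)
  define \<eta> where "\<eta> n = \<Gamma> / real (Suc n)" for n
  have \<eta>: "0 < \<eta> n" "\<eta> n \<le> \<Gamma>" for n
    using \<Gamma> by (auto simp: \<eta>_def field_simps)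
  have "(\<lambda>n. \<Gamma> * (1 / real (Suc n))) \<longlonglongrightarrow> \<Gamma> * 0"
    by (intro tendsto_intros LIMSEQ_Suc lim_1_over_n)
  then have \<eta>0: "\<eta> \<longlonglongrightarrow> 0" by (simp add: \<eta>_def[abs_def])
  define \<phi> where "\<phi> z = k (snd z) * v z" for z
  have \<phi>c: "continuous_on ({t0..T} \<times> UNIV) \<phi>"
    unfolding \<phi>_def by (intro continuous_intros v continuous_on_compose2[OF kc]) auto
  define F where "F n z = (\<phi> (fst z, snd z + \<eta> n) - \<phi> z) / \<eta> n" for n z
  have Fint: "(F n has_integral 0) ?R" for n
  proof -
    have Fc: "continuous_on ?R (F n)"
      unfolding F_def
      by (intro continuous_intros continuous_on_compose2[OF \<phi>c]) (use \<eta>[of n] in \<open>auto simp: cbox_Pair_eq\<close>)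
    have "integral ?R (F n) = integral {t0..T} (\<lambda>t. integral {0..\<Gamma>} (\<lambda>x. F n (t, x)))"
      using integral_prod_continuous[OF Fc] by simp
    also have "\<dots> = integral {t0..T} (\<lambda>t. 0)"
    proof (rule HK_integral_cong)
      fix t assume t: "t \<in> {t0..T}"
      have c: "continuous_on UNIV (\<lambda>x. \<phi> (t, x))"
        by (rule continuous_on_compose2[OF \<phi>c]) (use t in \<open>auto intro!: continuous_intros\<close>)
      have i1: "(\<lambda>x. \<phi> (t, x)) integrable_on {0..\<Gamma>}"
        by (intro integrable_continuous_real continuous_on_subset[OF c]) auto
      have i2: "(\<lambda>x. \<phi> (t, x + \<eta> n)) integrable_on {0..\<Gamma>}"
        by (intro integrable_continuous_real continuous_on_compose2[OF c] continuous_intros) auto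
      have "integral {0..\<Gamma>} (\<lambda>x. \<phi> (t, x + \<eta> n)) = integral {0..\<Gamma>} (\<lambda>x. \<phi> (t, x))"
        by (rule integral_periodic_shift[OF _ c]) (use per[OF t] k(2) \<eta>[of n] in \<open>auto simp: \<phi>_def\<close>)
      then show "integral {0..\<Gamma>} (\<lambda>x. F n (t, x)) = 0"
        using i1 i2 by (simp add: F_def HK_integral_diff)
    qed
    finally show ?thesis using integrable_continuous[OF Fc] by (simp add: has_integral_iff)
  qed
  define Z where "Z = (UNIV :: real set) \<times> N"
  have Z: "negligible Z" unfolding Z_def by (rule negligible_UNIV_Times[OF N])
  define f where "f n z = (if z \<in> Z then 0 else F n z)" for n z
  define D where "D z = H (snd z) * v z + k (snd z) * vx z" for z
  have fint: "(f n has_integral 0) ?R" for n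
    by (rule has_integral_spike[OF Z _ Fint[of n]]) (auto simp: f_def)
  have "((\<lambda>z. if z \<in> Z then 0 else D z) has_integral 0) ?R"
  proof (rule has_integral_dominated_convergence[OF fint])
    show "(\<lambda>z::real \<times> real. K * Bv + Bk * Bx) integrable_on ?R" by auto
    show "\<forall>z\<in>?R. norm (f n z) \<le> K * Bv + Bk * Bx" for n
    proof
      fix z assume "z \<in> ?R"
      then obtain t x where z: "z = (t, x)" "t \<in> {t0..T}" "x \<in> {0..\<Gamma>}" by (cases z) (auto simp: cbox_Pair_eq)
      have e: "F n z = ((k (x + \<eta> n) - k x) / \<eta> n) * v (t, x + \<eta> n) + k x * ((v (t, x + \<eta> n) - v (t, x)) / \<eta> n)"
        using \<eta>[of n] by (simp add: F_def \<phi>_def z field_simps)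
      have "\<bar>k (x + \<eta> n) - k x\<bar> \<le> K * \<eta> n"
        using lipschitz_onD[OF k(1), of "x + \<eta> n" x] \<eta>[of n] by (simp add: dist_real_def)
      then have 1: "\<bar>(k (x + \<eta> n) - k x) / \<eta> n\<bar> \<le> K" using \<eta>[of n] by (simp add: abs_divide field_simps)
      have 2: "\<bar>v (t, x + \<eta> n)\<bar> \<le> Bv" using z \<eta>[of n] by (intro Bv) auto
      have 3: "\<bar>(v (t, x + \<eta> n) - v (t, x)) / \<eta> n\<bar> \<le> Bx"
      proof -
        have "\<exists>\<xi>>x. \<xi> < x + \<eta> n \<and> v (t, x + \<eta> n) - v (t, x) = (x + \<eta> n - x) * vx (t, \<xi>)"
          by (rule MVT2) (use \<eta>[of n] dv[OF z(2)] in auto)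
        then obtain \<xi> where \<xi>: "x < \<xi>" "\<xi> < x + \<eta> n" "v (t, x + \<eta> n) - v (t, x) = \<eta> n * vx (t, \<xi>)" by auto
        have "\<bar>vx (t, \<xi>)\<bar> \<le> Bx" using z \<xi> \<eta>[of n] by (intro Bx) auto
        then show ?thesis using \<xi>(3) \<eta>[of n] by simp
      qed
      have "\<bar>F n z\<bar> \<le> \<bar>(k (x + \<eta> n) - k x) / \<eta> n\<bar> * \<bar>v (t, x + \<eta> n)\<bar> + \<bar>k x\<bar> * \<bar>(v (t, x + \<eta> n) - v (t, x)) / \<eta> n\<bar>"
        unfolding e by (metis abs_mult abs_triangle_ineq)
      also have "\<dots> \<le> K * Bv + Bk * Bx"
        by (intro add_mono mult_mono 1 2 3 Bk) (use K Bk z in auto)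
      finally show "norm (f n z) \<le> K * Bv + Bk * Bx"
        using K Bv Bk Bx by (auto simp: f_def)
    qed
    show "\<forall>z\<in>?R. (\<lambda>n. f n z) \<longlonglongrightarrow> (if z \<in> Z then 0 else D z)"
    proof
      fix z assume "z \<in> ?R"
      then obtain t x where z: "z = (t, x)" "t \<in> {t0..T}" by (cases z) (auto simp: cbox_Pair_eq)
      show "(\<lambda>n. f n z) \<longlonglongrightarrow> (if z \<in> Z then 0 else D z)"
      proof (cases "z \<in> Z")
        case False
        then have x: "x \<notin> N" by (simp add: Z_def z)
        have "((\<lambda>x. k x * v (t, x)) has_real_derivative H x * v (t, x) + vx (t, x) * k x) (at x)"
          by (rule DERIV_mult[OF H[OF x] dv[OF z(2)]])
        then have "((\<lambda>e. (\<phi> (t, x + e) - \<phi> (t, x)) / e) \<longlongrightarrow> D z) (at 0)"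
          by (simp add: DERIV_def \<phi>_def D_def z mult.commute)
        moreover have "filterlim \<eta> (at 0) sequentially"
          using \<eta>0 \<eta>(1) by (auto simp: filterlim_at intro!: always_eventually simp: less_imp_neq[symmetric])
        ultimately have "(\<lambda>n. (\<phi> (t, x + \<eta> n) - \<phi> (t, x)) / \<eta> n) \<longlonglongrightarrow> D z"
          by (rule filterlim_compose)
        then show ?thesis using False by (simp add: f_def F_def z)
      qed (simp add: f_def)
    qed
  qed simp
  then have "(D has_integral 0) ?R"
    by (rule has_integral_spike[OF Z, rotated]) auto
  then show ?thesis by (simp add: D_def[abs_def] case_prod_unfold)
qed

lemma integral_nonneg_off_negligible:
  fixes f :: "real \<times> real \<Rightarrow> real"
  assumes "f integrable_on R" "negligible Z" "\<And>z. z \<in> R \<Longrightarrow> z \<notin> Z \<Longrightarrow> 0 \<le> f z"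
  shows "0 \<le> integral R f"
proof -
  have "integral R f = integral R (\<lambda>z. if z \<in> Z then 0 else f z)"
    by (rule integral_spike[OF assms(2)]) auto
  moreover have "(\<lambda>z. if z \<in> Z then 0 else f z) integrable_on R"
    by (rule integrable_spike[OF assms(1,2)]) auto
  ultimately show ?thesis using assms(3) by (auto intro!: integral_nonneg)
qed

section \<open>The work of buoyancy\<close>

context Rayleigh_Benard
begin

lemma h_near_h0: "x \<in> {0..\<Gamma>} \<Longrightarrow> \<bar>h x - h 0\<bar> \<le> L * \<Gamma>"
proof -
  assume x: "x \<in> {0..\<Gamma>}"
  have "\<bar>h x - h 0\<bar> \<le> L * \<bar>x\<bar>" using lipschitz_onD[OF lip, of x 0] by (simp add: dist_real_def)
  also have "\<dots> \<le> L * \<Gamma>" using x L_nonneg by (intro mult_left_mono) auto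
  finally show "\<bar>h x - h 0\<bar> \<le> L * \<Gamma>" .
qed

definition buoyancy_work :: "real \<Rightarrow> real \<Rightarrow> real" where
  "buoyancy_work t0 T = integral (cbox (t0, 0, 0) (T, \<Gamma>, 1)) (\<lambda>z. straight h \<theta> z * straight h u2 z)"

lemma integral_G2_nonpos:
  assumes t: "0 < t0" "t0 \<le> T"
  shows "integral (cbox (t0, 0, 0) (T, \<Gamma>, 1)) (straight h G2) \<le> 0"
proof -
  have "integral (cbox (t0, 0, 0) (T, \<Gamma>, 1)) (straight h G2) =
      integral (cbox (0, 0) (\<Gamma>, 1)) (\<lambda>z. straight h (\<lambda>t x. 0) (T, z) - straight h (\<lambda>t x. 0) (t0, z)) +
      (integral (cbox (t0, 0) (T, \<Gamma>)) (\<lambda>(t, x). straight h \<theta> (t, x, 1)) -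
       integral (cbox (t0, 0) (T, \<Gamma>)) (\<lambda>(t, x). straight h \<theta> (t, x, 0)))"
  proof (rule strip_divergence_closed[where ?V1.0 = "\<lambda>t x. 0" and ?V2.0 = \<theta> and dq = "\<lambda>t x. 0"
        and ?P1.0 = "\<lambda>t x. 0" and ?Q1.0 = "\<lambda>t x. 0" and ?P2.0 = "\<lambda>t. pd1 (\<theta> t)" and ?Q2.0 = "\<lambda>t. pd2 (\<theta> t)",
        OF h_deriv h'_cont per \<Gamma>])
    show "has_partials (\<theta> t) (pd1 (\<theta> t) x) (pd2 (\<theta> t) x) x" if "0 < t" "x \<in> S" for t x
      by (rule \<theta>_C12(2)[OF that])
    show "has_partials (\<lambda>x. 0) 0 0 x" for x by (rule has_partials_const)
    show "continuous_on (cbox (t0, 0, 0) (T, \<Gamma>, 1)) (straight h \<theta>)"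
      "continuous_on (cbox (t0, 0, 0) (T, \<Gamma>, 1)) (straight h G2)"
      by (intro straight_cont_closed cont_strip G_cont; use t in auto)+
    show "0 + 0 + pd2 (\<theta> t) x = straight h G2 (t, fst x, snd x - h (fst x))" if "0 < t" "x \<in> S" for t x
      using G_inside[OF that] by simp
    show "\<theta> t x - h' (fst x) * 0 = straight h \<theta> (t, fst x, snd x - h (fst x))" for t x by simp
  qed (use t in \<open>(intro jc | simp add: x1_periodic_on_def)+\<close>)
  also have "\<dots> = - integral (cbox (t0, 0) (T, \<Gamma>)) (\<lambda>z. 1)"
  proof -
    have "integral (cbox (t0, 0) (T, \<Gamma>)) (\<lambda>(t, x). straight h \<theta> (t, x, 1)) = integral (cbox (t0, 0) (T, \<Gamma>)) (\<lambda>z. 0)"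
      by (rule HK_integral_cong)
        (use t \<theta>_boundary(2) in \<open>auto simp: cbox_Pair_eq\<close>)
    moreover have "integral (cbox (t0, 0) (T, \<Gamma>)) (\<lambda>(t, x). straight h \<theta> (t, x, 0)) = integral (cbox (t0, 0) (T, \<Gamma>)) (\<lambda>z. 1)"
      by (rule HK_integral_cong)
        (use t \<theta>_boundary(1) in \<open>auto simp: cbox_Pair_eq\<close>)
    ultimately show ?thesis by (simp add: straight_def case_prod_unfold)
  qed
  also have "\<dots> \<le> 0" by simp
  finally show ?thesis .
qed

lemma boundary_flux_top_le:
  assumes t: "0 < t0" "t0 \<le> T"
  shows "boundary_flux t0 T 1 \<le> boundary_flux t0 T 0 + \<Gamma>"
proof -
  have "boundary_flux t0 T 1 = integral (cbox (t0, 0) (T, \<Gamma>)) (\<lambda>(t, x).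
      \<theta> t (x, h x + 1) * (u2 t (x, h x + 1) - h' x * u1 t (x, h x + 1)) + heat_flux (t, x, 1))"
    unfolding boundary_flux_def
    by (rule HK_integral_cong) (use t \<theta>_boundary(2) in \<open>auto simp: cbox_Pair_eq\<close>)
  then show ?thesis using flux_identity[OF t, of 1] by simp
qed

text \<open>
  The equation \<open>\<partial>\<^sub>t (y \<theta>) + div (y (\<theta> u - \<nabla>\<theta>)) = \<theta> u\<^sub>2 - \<partial>\<^sub>2\<theta>\<close> with the height \<open>y = x\<^sub>2 - h(0)\<close>. On the boundary
  \<open>y\<close> is at most \<open>1 + L \<Gamma>\<close> in modulus, and the boundary flux, being nonnegative, may be estimated with
  this weight; the total flux through the upper boundary is \<open>X\<close> up to \<open>\<Gamma>\<close>.
\<close>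

theorem buoyancy_work_bound:
  assumes t: "0 < t0" "t0 \<le> T"
  shows "buoyancy_work t0 T \<le> (1 + 2 * (L * \<Gamma>)) * boundary_flux t0 T 0 + 2 * (1 + L * \<Gamma>) * \<Gamma>"
proof -
  let ?y = "\<lambda>x :: real \<times> real. snd x - h 0"
  define B where "B z = (h (fst (snd z)) + snd (snd z) - h 0) *
      (straight h \<theta> z * (straight h u2 z - h' (fst (snd z)) * straight h u1 z) + heat_flux z)" for z
  define D where "D z = straight h \<theta> z * straight h u2 z - straight h G2 z" for z
  define q where "q t x = ?y x * \<theta> t x" for t x
  have hc: "continuous_on A (\<lambda>z. h (fst (snd z)))" for A :: "(real \<times> real \<times> real) set"
    by (intro continuous_on_compose2[OF h_cont] continuous_intros) auto
  have py: "has_partials (\<lambda>x. ?y x) (0 - 0) (1 - 0) x" for x by (intro hp)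
  let ?P1 = "\<lambda>t x. ?y x * (\<theta> t x * pd1 (u1 t) x + pd1 (\<theta> t) x * u1 t x - pd1 (pd1 (\<theta> t)) x) + (0 - 0) * (\<theta> t x * u1 t x - pd1 (\<theta> t) x)"
  let ?Q1 = "\<lambda>t x. ?y x * (\<theta> t x * pd2 (u1 t) x + pd2 (\<theta> t) x * u1 t x - pd2 (pd1 (\<theta> t)) x) + (1 - 0) * (\<theta> t x * u1 t x - pd1 (\<theta> t) x)"
  let ?P2 = "\<lambda>t x. ?y x * (\<theta> t x * pd1 (u2 t) x + pd1 (\<theta> t) x * u2 t x - pd1 (pd2 (\<theta> t)) x) + (0 - 0) * (\<theta> t x * u2 t x - pd2 (\<theta> t) x)"
  let ?Q2 = "\<lambda>t x. ?y x * (\<theta> t x * pd2 (u2 t) x + pd2 (\<theta> t) x * u2 t x - pd2 (pd2 (\<theta> t)) x) + (1 - 0) * (\<theta> t x * u2 t x - pd2 (\<theta> t) x)"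
  let ?dq = "\<lambda>t x. ?y x * pdt \<theta> t x"
  let ?V1 = "\<lambda>t x. ?y x * (\<theta> t x * u1 t x - pd1 (\<theta> t) x)"
  let ?V2 = "\<lambda>t x. ?y x * (\<theta> t x * u2 t x - pd2 (\<theta> t) x)"
  have main: "integral (cbox (t0, 0, 0) (T, \<Gamma>, 1)) D =
      integral (cbox (0, 0) (\<Gamma>, 1)) (\<lambda>z. straight h q (T, z) - straight h q (t0, z)) +
      (integral (cbox (t0, 0) (T, \<Gamma>)) (\<lambda>(t, x). B (t, x, 1)) -
       integral (cbox (t0, 0) (T, \<Gamma>)) (\<lambda>(t, x). B (t, x, 0)))"
    unfolding q_def
  proof (rule strip_divergence_closed[where ?V1.0 = ?V1 and ?V2.0 = ?V2 and dq = ?dq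
        and ?P1.0 = ?P1 and ?Q1.0 = ?Q1 and ?P2.0 = ?P2 and ?Q2.0 = ?Q2, OF h_deriv h'_cont per \<Gamma>])
    show "x1_periodic_on S \<Gamma> (?V1 t)" if "0 < t" for t
      using periodic_S[OF that] by (auto simp: x1_periodic_on_def)
    show "((\<lambda>r. ?y x * \<theta> r x) has_real_derivative ?y x * pdt \<theta> t x) (at t)" if "0 < t" "x \<in> S" for t x
      by (rule DERIV_cmult[OF \<theta>_C12(1)[OF that]])
    show "has_partials (?V1 t) (?P1 t x) (?Q1 t x) x" if "0 < t" "x \<in> S" for t x
      by (intro py has_partials_mult[OF py] hp(1,2) \<theta>_C12(2,3)[OF that] u1_C12(2)[OF that])
    show "has_partials (?V2 t) (?P2 t x) (?Q2 t x) x" if "0 < t" "x \<in> S" for t x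
      by (intro py has_partials_mult[OF py] hp(1,2) \<theta>_C12(2,4)[OF that] u2_C12(2)[OF that])
    show "continuous_on (cbox (t0, 0, 0) (T, \<Gamma>, 1)) B"
      unfolding B_def
      by (intro continuous_intros straight_cont_closed cont_strip heat_flux_cont h'_cont_box hc) (use t in auto)
    show "continuous_on (cbox (t0, 0, 0) (T, \<Gamma>, 1)) D"
      unfolding D_def by (intro continuous_intros straight_cont_closed cont_strip G_cont) (use t in auto)
    show "?y x * pdt \<theta> t x + (?P1 t x)
         + (?Q2 t x) = D (t, fst x, snd x - h (fst x))" if "0 < t" "x \<in> S" for t x
    proof -
      have a: "pd2 (u2 t) x = - pd1 (u1 t) x" using equations(3)[OF that] by simp
      show ?thesis unfolding equations(4)[OF that] a D_def
        using G_inside[OF that] by (simp add: algebra_simps)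
    qed
    show "?V2 t x - h' (fst x) * (?V1 t x) =
        B (t, fst x, snd x - h (fst x))" if "0 < t" "x \<in> S" for t x
      using G_inside[OF that] by (simp add: B_def heat_flux_def algebra_simps)
    show "0 < t0" "t0 \<le> T" "(0::real) \<le> 0" "(0::real) \<le> 1" "(1::real) \<le> 1" using t by auto
  qed (intro jc cont_strip)+
  have hf: "(\<lambda>(t, x). heat_flux (t, x, s)) integrable_on cbox (t0, 0) (T, \<Gamma>)" if "s \<in> {0..1}" for s
    by (rule slice_integrable(2)[OF heat_flux_cont that]) (use t in auto)
  have Bi: "(\<lambda>(t, x). B (t, x, s)) integrable_on cbox (t0, 0) (T, \<Gamma>)" if "s \<in> {0..1}" for s
    by (rule slice_integrable(2)[OF _ that], unfold B_def)
      (intro continuous_intros straight_cont_closed cont_strip heat_flux_cont h'_cont_box hc; use t in auto)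
  have top: "integral (cbox (t0, 0) (T, \<Gamma>)) (\<lambda>(t, x). B (t, x, 1)) \<le> (1 + L * \<Gamma>) * boundary_flux t0 T 1"
  proof -
    have "integral (cbox (t0, 0) (T, \<Gamma>)) (\<lambda>(t, x). B (t, x, 1)) \<le>
        integral (cbox (t0, 0) (T, \<Gamma>)) (\<lambda>z. (1 + L * \<Gamma>) * (case z of (t, x) \<Rightarrow> heat_flux (t, x, 1)))"
    proof (rule integral_le[OF Bi integrable_on_mult_right[OF hf]])
      fix z assume "z \<in> cbox (t0, 0) (T, \<Gamma>)"
      then obtain t' x where z: "z = (t', x)" "0 < t'" "x \<in> {0..\<Gamma>}" using t by (cases z) (auto simp: cbox_Pair_eq)
      have "B (t', x, 1) = (h x + 1 - h 0) * heat_flux (t', x, 1)"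
        using \<theta>_boundary(2)[OF z(2)] by (simp add: B_def)
      also have "\<dots> \<le> (1 + L * \<Gamma>) * heat_flux (t', x, 1)"
        using h_near_h0[OF z(3)] heat_flux_nonneg[OF z(2,3), of 1] by (intro mult_right_mono) auto
      finally show "(case z of (t, x) \<Rightarrow> B (t, x, 1)) \<le> (1 + L * \<Gamma>) * (case z of (t, x) \<Rightarrow> heat_flux (t, x, 1))"
        by (simp add: z)
    qed auto
    then show ?thesis by (simp add: boundary_flux_def)
  qed
  have bot: "- (L * \<Gamma>) * boundary_flux t0 T 0 \<le> integral (cbox (t0, 0) (T, \<Gamma>)) (\<lambda>(t, x). B (t, x, 0))"
  proof -
    have "integral (cbox (t0, 0) (T, \<Gamma>)) (\<lambda>z. - (L * \<Gamma>) * (case z of (t, x) \<Rightarrow> heat_flux (t, x, 0))) \<le>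
        integral (cbox (t0, 0) (T, \<Gamma>)) (\<lambda>(t, x). B (t, x, 0))"
    proof (rule integral_le[OF integrable_on_mult_right[OF hf] Bi])
      fix z assume "z \<in> cbox (t0, 0) (T, \<Gamma>)"
      then obtain t' x where z: "z = (t', x)" "0 < t'" "x \<in> {0..\<Gamma>}" using t by (cases z) (auto simp: cbox_Pair_eq)
      have "- (L * \<Gamma>) * heat_flux (t', x, 0) \<le> (h x + 0 - h 0) * heat_flux (t', x, 0)"
        using h_near_h0[OF z(3)] heat_flux_nonneg[OF z(2,3), of 0] by (intro mult_right_mono) auto
      also have "\<dots> = B (t', x, 0)"
        using no_penetration(1)[OF z(2)] by (simp add: B_def)
      finally show "- (L * \<Gamma>) * (case z of (t, x) \<Rightarrow> heat_flux (t, x, 0)) \<le> (case z of (t, x) \<Rightarrow> B (t, x, 0))"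
        by (simp add: z)
    qed auto
    then show ?thesis by (simp add: boundary_flux_def)
  qed
  have qd: "\<bar>integral (cbox (0, 0) (\<Gamma>, 1)) (\<lambda>z. straight h q (T, z) - straight h q (t0, z))\<bar> \<le> (1 + L * \<Gamma>) * \<Gamma>"
  proof (rule integral_period_rectangle_bound)
    have e: "straight h q (t, z) = (h (fst z) + snd z - h 0) * straight h \<theta> (t, z)" for t z
      by (cases z) (simp add: q_def)
    show "continuous_on (cbox (0, 0) (\<Gamma>, 1)) (\<lambda>z. straight h q (T, z) - straight h q (t0, z))"
      unfolding e by (intro continuous_intros straight_\<theta>_cont_at continuous_on_compose2[OF h_cont]) (use t in auto)
    fix z :: "real \<times> real" assume z: "z \<in> cbox (0, 0) (\<Gamma>, 1)"
    obtain x r where xr: "z = (x, r)" by (cases z)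
    then have xr': "x \<in> {0..\<Gamma>}" "r \<in> {0..1}" using z by (auto simp: cbox_Pair_eq)
    have "\<bar>\<theta> T (x, h x + r) - \<theta> t0 (x, h x + r)\<bar> \<le> 1"
      using maximum_principle[of T x r] maximum_principle[of t0 x r] t xr' by auto
    moreover have "\<bar>h x + r - h 0\<bar> \<le> 1 + L * \<Gamma>" using h_near_h0[OF xr'(1)] xr'(2) by auto
    ultimately have "\<bar>h x + r - h 0\<bar> * \<bar>\<theta> T (x, h x + r) - \<theta> t0 (x, h x + r)\<bar> \<le> (1 + L * \<Gamma>) * 1"
      by (intro mult_mono) auto
    then show "\<bar>straight h q (T, z) - straight h q (t0, z)\<bar> \<le> 1 + L * \<Gamma>"
      by (simp add: xr q_def abs_mult[symmetric] right_diff_distrib)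
  qed (use L_nonneg \<Gamma> in auto)
  have "integral (cbox (t0, 0, 0) (T, \<Gamma>, 1)) D = buoyancy_work t0 T - integral (cbox (t0, 0, 0) (T, \<Gamma>, 1)) (straight h G2)"
    unfolding D_def buoyancy_work_def
    by (rule HK_integral_diff)
      (intro integrable_continuous continuous_intros straight_cont_closed cont_strip G_cont; use t in auto)+
  then have "buoyancy_work t0 T \<le> (1 + L * \<Gamma>) * \<Gamma> + (1 + L * \<Gamma>) * boundary_flux t0 T 1 + L * \<Gamma> * boundary_flux t0 T 0"
    using integral_G2_nonpos[OF t] main top bot qd by auto
  also have "\<dots> \<le> (1 + L * \<Gamma>) * \<Gamma> + (1 + L * \<Gamma>) * (boundary_flux t0 T 0 + \<Gamma>) + L * \<Gamma> * boundary_flux t0 T 0"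
    using boundary_flux_top_le[OF t] L_nonneg \<Gamma> by (intro add_mono mult_left_mono) auto
  finally show ?thesis by (simp add: algebra_simps)
qed

end

section \<open>Work of the fluid at the boundary\<close>

lemma L2_trace_cong:
  assumes tr: "L2_trace \<Gamma> h s w g" and eq: "\<And>t x. 0 < t \<Longrightarrow> x \<in> open_strip h \<Longrightarrow> w t x = w' t x"
  shows "L2_trace \<Gamma> h s w' g"
  unfolding L2_trace_def
proof (intro conjI allI impI)
  show "(\<lambda>(t, x1). g t x1) \<in> borel_measurable borel" using tr by (simp add: L2_trace_def)
  fix a b :: real assume ab: "0 < a \<and> a < b"
  have "((\<lambda>\<epsilon>. \<integral>\<^sup>+ z \<in> {a..b} \<times> {0..\<Gamma>}.
            ennreal ((norm (w (fst z) (slice h s \<epsilon> (snd z)) - g (fst z) (snd z)))\<^sup>2) \<partial>lborel)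
          \<longlongrightarrow> 0) (at_right 0)"
    using tr ab by (simp add: L2_trace_def)
  then show "((\<lambda>\<epsilon>. \<integral>\<^sup>+ z \<in> {a..b} \<times> {0..\<Gamma>}.
            ennreal ((norm (w' (fst z) (slice h s \<epsilon> (snd z)) - g (fst z) (snd z)))\<^sup>2) \<partial>lborel)
          \<longlongrightarrow> 0) (at_right 0)"
  proof (rule Lim_transform_eventually)
    have "(\<integral>\<^sup>+ z \<in> {a..b} \<times> {0..\<Gamma>}.
            ennreal ((norm (w (fst z) (slice h s \<epsilon> (snd z)) - g (fst z) (snd z)))\<^sup>2) \<partial>lborel) =
        (\<integral>\<^sup>+ z \<in> {a..b} \<times> {0..\<Gamma>}.
            ennreal ((norm (w' (fst z) (slice h s \<epsilon> (snd z)) - g (fst z) (snd z)))\<^sup>2) \<partial>lborel)"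
      if e: "0 < \<epsilon>" "\<epsilon> < 1" for \<epsilon>
    proof (rule nn_integral_cong)
      fix z :: "real \<times> real"
      have "slice h s \<epsilon> (snd z) \<in> open_strip h" using e by (cases s) (auto simp: open_strip_def)
      then show "ennreal ((norm (w (fst z) (slice h s \<epsilon> (snd z)) - g (fst z) (snd z)))\<^sup>2) * indicator ({a..b} \<times> {0..\<Gamma>}) z =
          ennreal ((norm (w' (fst z) (slice h s \<epsilon> (snd z)) - g (fst z) (snd z)))\<^sup>2) * indicator ({a..b} \<times> {0..\<Gamma>}) z"
        using eq[of "fst z" "slice h s \<epsilon> (snd z)"] ab by (cases "z \<in> {a..b} \<times> {0..\<Gamma>}") auto
    qed
    then show "\<forall>\<^sub>F \<epsilon> in at_right 0. (\<integral>\<^sup>+ z \<in> {a..b} \<times> {0..\<Gamma>}.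
            ennreal ((norm (w (fst z) (slice h s \<epsilon> (snd z)) - g (fst z) (snd z)))\<^sup>2) \<partial>lborel) =
        (\<integral>\<^sup>+ z \<in> {a..b} \<times> {0..\<Gamma>}.
            ennreal ((norm (w' (fst z) (slice h s \<epsilon> (snd z)) - g (fst z) (snd z)))\<^sup>2) \<partial>lborel)"
      by (auto simp: eventually_at_right_field intro!: exI[of _ 1])
  qed
qed

text \<open>
  The level \<open>s\<close> of the slice at distance \<open>\<epsilon>\<close> from a side, and the sign by which the outward normal
  differs from the downward one. With them both sides are treated together.
\<close>

fun height :: "side \<Rightarrow> real \<Rightarrow> real" where
  "height Bottom \<epsilon> = \<epsilon>"
| "height Top \<epsilon> = 1 - \<epsilon>"

fun orientation :: "side \<Rightarrow> real" where
  "orientation Bottom = 1"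
| "orientation Top = - 1"

lemma slice_height: "slice h s \<epsilon> x = (x, h x + height s \<epsilon>)"
  by (cases s) auto

lemma height_cont: "continuous_on A (\<lambda>y. height s (f y))" if "continuous_on A f"
  using that by (cases s) (auto intro: continuous_intros)

context Rayleigh_Benard
begin

text \<open>
  The default value on the null set \<open>nondiff\<close> keeps \<open>h''\<close> bounded.
\<close>

definition h'' :: "real \<Rightarrow> real" where
  "h'' x = (if h' differentiable (at x) then deriv h' x else 0)"

definition nondiff :: "real set" where "nondiff = {x. \<not> h' differentiable (at x)}"

lemma h'_Lipschitz: obtains K where "K-lipschitz_on UNIV h'"
  using C11 by (auto simp: C11_def)

lemma nondiff_negligible: "negligible nondiff"
  unfolding nondiff_def using h'_Lipschitz Lipschitz_differentiable_AE by metis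

lemma h'_deriv: "x \<notin> nondiff \<Longrightarrow> (h' has_real_derivative h'' x) (at x)"
  by (simp add: nondiff_def h''_def DERIV_deriv_iff_real_differentiable)

lemma h''_bounded: obtains K where "\<And>x. \<bar>h'' x\<bar> \<le> K"
proof -
  obtain K where K: "K-lipschitz_on UNIV h'" by (rule h'_Lipschitz)
  have "\<bar>h'' x\<bar> \<le> K" for x
  proof (cases "x \<in> nondiff")
    case False
    have "((\<lambda>k. \<bar>(h' (x + k) - h' x) / k\<bar>) \<longlongrightarrow> \<bar>h'' x\<bar>) (at 0)"
      using h'_deriv[OF False] by (intro tendsto_rabs) (simp add: DERIV_def)
    moreover have "\<bar>(h' (x + k) - h' x) / k\<bar> \<le> K" if "k \<noteq> 0" for k
      using lipschitz_onD[OF K, of "x + k" x] that by (simp add: dist_real_def abs_divide field_simps)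
    then have "eventually (\<lambda>k. \<bar>(h' (x + k) - h' x) / k\<bar> \<le> K) (at (0::real))"
      by (auto simp: eventually_at_filter)
    ultimately show ?thesis by (rule tendsto_upperbound) simp
  qed (use lipschitz_on_nonneg[OF K] in \<open>simp add: h''_def nondiff_def\<close>)
  then show ?thesis by (rule that)
qed

lemma integration_by_parts_h':
  fixes v vx :: "real \<times> real \<Rightarrow> real"
  assumes "continuous_on ({t0..T} \<times> UNIV) v" "continuous_on ({t0..T} \<times> UNIV) vx"
    and "\<And>t x. t \<in> {t0..T} \<Longrightarrow> ((\<lambda>x. v (t, x)) has_real_derivative vx (t, x)) (at x)"
    and "\<And>t x. t \<in> {t0..T} \<Longrightarrow> v (t, x + \<Gamma>) = v (t, x)"
  shows "((\<lambda>(t, x). h'' x * v (t, x) + h' x * vx (t, x)) has_integral 0) (cbox (t0, 0) (T, \<Gamma>))"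
proof -
  obtain K where K: "K-lipschitz_on UNIV h'" by (rule h'_Lipschitz)
  show ?thesis
    by (rule Lipschitz_integration_by_parts[where k = h' and H = h'' and v = v and vx = vx,
          OF K h'_per \<Gamma> nondiff_negligible h'_deriv assms])
qed

lemma h''_absolutely_integrable:
  fixes t0 T :: real
  shows "(\<lambda>z. h'' (snd z)) absolutely_integrable_on cbox (t0, 0) (T, \<Gamma>)"
proof -
  obtain K where K: "\<And>x. \<bar>h'' x\<bar> \<le> K" using h''_bounded by blast
  have "((\<lambda>(t, x). h'' x * 1 + h' x * 0) has_integral 0) (cbox (t0, 0) (T, \<Gamma>))"
    using integration_by_parts_h'[of t0 T "\<lambda>z. 1" "\<lambda>z. 0"] by simp
  then have "(\<lambda>z. h'' (snd z)) integrable_on cbox (t0, 0) (T, \<Gamma>)"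
    by (auto simp: case_prod_unfold)
  then show ?thesis
    by (rule absolutely_integrable_integrable_bound[rotated]) (use K in auto)
qed

lemma curvature_eq:
  assumes x: "x \<notin> nondiff"
  shows "curvature h s x = - orientation s * h'' x / (arclen h x) ^ 3"
proof -
  define l where "l = arclen h x"
  have l: "l > 0" "l\<^sup>2 = 1 + (h' x)\<^sup>2" by (auto simp: l_def arclen_def add_pos_nonneg)
  have dl: "(arclen h has_real_derivative h' x * h'' x / l) (at x)"
  proof -
    have "((\<lambda>x. 1 + (h' x)\<^sup>2) has_real_derivative 2 * (h' x * h'' x)) (at x)"
      using h'_deriv[OF x] by (auto intro!: derivative_eq_intros)
    from DERIV_chain2[where f = sqrt, OF DERIV_real_sqrt this]
    have "((\<lambda>x. sqrt (1 + (h' x)\<^sup>2)) has_real_derivative inverse (sqrt (1 + (h' x)\<^sup>2)) / 2 * (2 * (h' x * h'' x))) (at x)"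
      by (simp add: add_pos_nonneg)
    moreover have "inverse (sqrt (1 + (h' x)\<^sup>2)) / 2 * (2 * (h' x * h'' x)) = h' x * h'' x / l"
    proof -
      have ls: "sqrt (1 + (h' x)\<^sup>2) = l" by (simp only: l_def arclen_def)
      show ?thesis unfolding ls using l(1) by (simp add: field_simps)
    qed
    moreover have "(\<lambda>x. sqrt (1 + (h' x)\<^sup>2)) = arclen h" by (simp add: fun_eq_iff arclen_def)
    ultimately show ?thesis by simp
  qed
  have d1: "((\<lambda>x. 1 / arclen h x) has_real_derivative - (h' x * h'' x) / l ^ 3) (at x)"
  proof -
    have "((\<lambda>x. 1 / arclen h x) has_real_derivative (0 * arclen h x - 1 * (h' x * h'' x / l)) / (arclen h x * arclen h x)) (at x)"
      by (rule DERIV_divide[OF DERIV_const dl]) (use l in \<open>simp add: l_def\<close>)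
    moreover have "(0 * arclen h x - 1 * (h' x * h'' x / l)) / (arclen h x * arclen h x) = - (h' x * h'' x) / l ^ 3"
      using l by (simp add: l_def[symmetric] power3_eq_cube)
    ultimately show ?thesis by (simp only:)
  qed
  have d2: "((\<lambda>x. h' x / arclen h x) has_real_derivative h'' x / l ^ 3) (at x)"
  proof -
    have "((\<lambda>x. h' x / arclen h x) has_real_derivative (h'' x * arclen h x - h' x * (h' x * h'' x / l)) / (arclen h x * arclen h x)) (at x)"
      by (rule DERIV_divide[OF h'_deriv[OF x] dl]) (use l in \<open>simp add: l_def\<close>)
    moreover have "(h'' x * arclen h x - h' x * (h' x * h'' x / l)) / (arclen h x * arclen h x) = h'' x / l ^ 3"
    proof -
      have "(h'' x * l - h' x * (h' x * h'' x / l)) / (l * l) = h'' x * (l\<^sup>2 - (h' x)\<^sup>2) / l ^ 3"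
        using l(1) by (simp add: field_simps power2_eq_square power3_eq_cube)
      then show ?thesis using l by (simp add: l_def[symmetric])
    qed
    ultimately show ?thesis by (simp only:)
  qed
  have vec: "((\<lambda>x. c *\<^sub>R (1 / arclen h x, h' x / arclen h x)) has_vector_derivative
      c *\<^sub>R (- (h' x * h'' x) / l ^ 3, h'' x / l ^ 3)) (at x)" for c :: real
    using has_vector_derivative_scaleR[OF DERIV_const[of c], OF has_vector_derivative_Pair[OF
        d1[unfolded has_real_derivative_iff_has_vector_derivative] d2[unfolded has_real_derivative_iff_has_vector_derivative]]]
    by simp
  have alg: "- (h' x) * (h' x * h'' x) - h'' x = - (h'' x * l\<^sup>2)"
    unfolding l(2) by (simp add: algebra_simps power2_eq_square)
  have canc: "h'' x * l\<^sup>2 / (l\<^sup>2 * l ^ 3) = h'' x / l ^ 3"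
    by (subst mult.commute[of "h'' x"], rule mult_divide_mult_cancel_left) (use l(1) in simp)
  have "curvature h s x = - orientation s * h'' x / l ^ 3"
  proof (cases s)
    case Bottom
    have "tangent h Bottom = (\<lambda>x. 1 *\<^sub>R (1 / arclen h x, h' x / arclen h x))"
      by (simp add: tangent_def perp_def fun_eq_iff)
    then have "vector_derivative (tangent h Bottom) (at x) = 1 *\<^sub>R (- (h' x * h'' x) / l ^ 3, h'' x / l ^ 3)"
      using vector_derivative_at[OF vec[of 1]] by simp
    then have "curvature h Bottom x = (1 / l) * ((h' x / l) * (- (h' x * h'' x) / l ^ 3) + (- 1 / l) * (h'' x / l ^ 3))"
      unfolding curvature_def by (simp add: tangent_def perp_def inner_prod_def l_def[symmetric] algebra_simps)
    also have "\<dots> = (- (h' x) * (h' x * h'' x) - h'' x) / (l\<^sup>2 * l ^ 3)"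
      using l(1) by (simp add: field_simps power2_eq_square)
    also have "\<dots> = - h'' x / l ^ 3" unfolding alg minus_divide_left[symmetric] canc ..
    finally show ?thesis using Bottom by simp
  next
    case Top
    have "tangent h Top = (\<lambda>x. (- 1) *\<^sub>R (1 / arclen h x, h' x / arclen h x))"
      by (simp add: tangent_def perp_def fun_eq_iff)
    then have "vector_derivative (tangent h Top) (at x) = (- 1) *\<^sub>R (- (h' x * h'' x) / l ^ 3, h'' x / l ^ 3)"
      using vector_derivative_at[OF vec[of "- 1"]] by simp
    then have "curvature h Top x = - (1 / l) * ((h' x / l) * (- (h' x * h'' x) / l ^ 3) + (- 1 / l) * (h'' x / l ^ 3))"
      unfolding curvature_def by (simp add: tangent_def perp_def inner_prod_def l_def[symmetric] algebra_simps)
    also have "\<dots> = - (- (h' x) * (h' x * h'' x) - h'' x) / (l\<^sup>2 * l ^ 3)"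
      using l(1) by (simp add: field_simps power2_eq_square)
    also have "\<dots> = h'' x / l ^ 3" unfolding alg minus_minus canc ..
    finally show ?thesis using Top by simp
  qed
  then show ?thesis by (simp add: l_def)
qed

lemma slice_continuous:
  fixes w :: "real \<Rightarrow> real \<times> real \<Rightarrow> real"
  assumes "jointly_continuous S w" "0 < t0" "0 < \<epsilon>" "\<epsilon> < 1"
  shows "continuous_on ({t0..T} \<times> A) (\<lambda>z. w (fst z) (slice h s \<epsilon> (snd z)))"
proof -
  have hs: "0 < height s \<epsilon>" "height s \<epsilon> < 1" using assms by (cases s; simp)+
  have "continuous_on ({t0..T} \<times> A) (\<lambda>z. straight h w (fst z, snd z, height s \<epsilon>))"
    by (rule continuous_on_compose2[OF straight_continuous[OF assms(1) h_cont, of "{(t, x, r). 0 < t \<and> 0 < r \<and> r < 1}"]])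
      (use assms hs in \<open>auto intro!: continuous_intros simp: open_strip_def\<close>)
  then show ?thesis by (simp add: slice_height)
qed

lemma slice_coefficient_continuous:
  fixes w :: "real \<Rightarrow> real \<times> real \<Rightarrow> real"
  assumes "jointly_continuous (strip h) w" "0 < t0"
  shows "continuous_on ({0..1/2} \<times> cbox (t0, 0) (T, \<Gamma>)) (\<lambda>y. w (fst (snd y)) (slice h s (fst y) (snd (snd y))))"
proof -
  have hs: "0 \<le> height s e \<and> height s e \<le> 1" if "0 \<le> e" "e \<le> 1 / 2" for e using that by (cases s) auto
  have "continuous_on ({0..1/2} \<times> cbox (t0, 0) (T, \<Gamma>))
      (\<lambda>y. straight h w (fst (snd y), snd (snd y), height s (fst y)))"
    by (rule continuous_on_compose2[OF straight_continuous[OF assms(1) h_cont, of "{(t, x, r). 0 < t \<and> 0 \<le> r \<and> r \<le> 1}"]])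
      (use assms(2) hs in \<open>auto intro!: continuous_intros height_cont simp: strip_def cbox_Pair_eq\<close>)
  then show ?thesis by (simp add: slice_height)
qed

lemma h'_coefficient_continuous: "continuous_on A (\<lambda>y. h' (snd (snd y)))"
  by (intro continuous_on_compose2[OF h'_cont] continuous_intros) auto

lemma slice_in_S: "0 < \<epsilon> \<Longrightarrow> \<epsilon> < 1 \<Longrightarrow> slice h s \<epsilon> x \<in> S"
  by (cases s) (auto simp: open_strip_def)

lemma slice_deriv:
  assumes "has_partials (w t) a b (slice h s \<epsilon> x)"
  shows "((\<lambda>x. w t (slice h s \<epsilon> x)) has_real_derivative a + h' x * b) (at x)"
proof -
  have e: "((\<lambda>x. (x, h x + height s \<epsilon>)) has_derivative (\<lambda>k. (k, h' x * k))) (at x)"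
    using h_deriv[of x] by (auto intro!: derivative_eq_intros simp: has_field_derivative_def)
  show ?thesis
    using diff_chain_at[OF e assms[unfolded has_partials_def slice_height]]
    unfolding has_field_derivative_def o_def slice_height
    by (rule has_derivative_eq_rhs) (auto simp: fun_eq_iff algebra_simps)
qed

lemma slice_periodic:
  assumes "x1_periodic_on S \<Gamma> (w t)" "0 < \<epsilon>" "\<epsilon> < 1"
  shows "w t (slice h s \<epsilon> (x + \<Gamma>)) = w t (slice h s \<epsilon> x)"
proof -
  have "slice h s \<epsilon> (x + \<Gamma>) = slice h s \<epsilon> x + (\<Gamma>, 0)" by (simp add: slice_height per)
  then show ?thesis using assms slice_in_S by (simp add: x1_periodic_on_def)
qed

end

lemma negligible_AE_lebesgue_on:
  assumes "AE x in lebesgue_on {a..b::real}. P x"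
  obtains N where "negligible N" "\<And>x. x \<in> {a..b} \<Longrightarrow> x \<notin> N \<Longrightarrow> P x"
proof -
  have "AE x in lebesgue. x \<in> {a..b} \<longrightarrow> P x"
    using assms by (subst (asm) AE_restrict_space_iff) auto
  then obtain N where N: "{x \<in> space lebesgue. \<not> (x \<in> {a..b} \<longrightarrow> P x)} \<subseteq> N" "N \<in> null_sets lebesgue"
    unfolding eventually_ae_filter by auto
  show ?thesis
    by (rule that[of N]) (use N in \<open>auto simp: negligible_iff_null_sets\<close>)
qed

context Rayleigh_Benard
begin

text \<open>
  With \<open>\<nu> = (-h', 1)\<close> this is \<open>u \<bullet> (\<nu> \<bullet> \<nabla>)u - (\<bar>u\<bar>\<^sup>2 / (2 Pr) + p) (u \<bullet> \<nu>)\<close>, minus the flux of kinetic energy.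
\<close>

definition traction :: "real \<Rightarrow> real \<times> real \<Rightarrow> real" where
  "traction t x = u1 t x * pd2 (u1 t) x + u2 t x * pd2 (u2 t) x
     - h' (fst x) * (u1 t x * pd1 (u1 t) x + u2 t x * pd1 (u2 t) x)
     - ((u1 t x * u1 t x + u2 t x * u2 t x) * (1 / (2 * Pr)) + p t x) * (u2 t x - h' (fst x) * u1 t x)"

text \<open>
  The flux of the field \<open>(- u\<^sub>1 \<partial>\<^sub>2u\<^sub>2, u\<^sub>1 \<partial>\<^sub>1u\<^sub>2)\<close>, whose divergence is \<open>- det \<nabla>u\<close>. It equals \<open>u\<^sub>1\<close> times the
  derivative of \<open>u\<^sub>2\<close> along the slice.
\<close>

definition shear :: "real \<Rightarrow> real \<times> real \<Rightarrow> real" where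
  "shear t x = u1 t x * (pd1 (u2 t) x + h' (fst x) * pd2 (u2 t) x)"

lemma p_cont: "jointly_continuous S p" using sol by (simp add: RB_solution_def)

lemma velocity_gradient_traces:
  obtains g11 g12 g21 g22 q where
    "L2_trace \<Gamma> h s (\<lambda>t. pd1 (u1 t)) g11" "L2_trace \<Gamma> h s (\<lambda>t. pd2 (u1 t)) g12"
    "L2_trace \<Gamma> h s (\<lambda>t. pd1 (u2 t)) g21" "L2_trace \<Gamma> h s (\<lambda>t. pd2 (u2 t)) g22"
    "L2_trace \<Gamma> h s p q"
    "AE z in lebesgue. case z of (t, x) \<Rightarrow> t > 0 \<and> x \<in> {0..\<Gamma>} \<longrightarrow>
       tangent h s x \<bullet> (strain (g11 t x, g21 t x) (g12 t x, g22 t x) (normal h s x) + \<alpha> (bdry h s x) *\<^sub>R u t (bdry h s x)) = 0"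
proof -
  have u: "C12_inside h u" using sol by (auto simp: RB_solution_def)
  have d: "u1 = (\<lambda>t x. fst (u t x))" "u2 = (\<lambda>t x. snd (u t x))" by (simp_all add: fun_eq_iff u1_def u2_def)
  note f = C12_inside_component(3,4)[OF u bounded_linear_fst h_cont]
  note sn = C12_inside_component(3,4)[OF u bounded_linear_snd h_cont]
  obtain g1 g2 where g: "L2_trace \<Gamma> h s (\<lambda>t. pd1 (u t)) g1" "L2_trace \<Gamma> h s (\<lambda>t. pd2 (u t)) g2"
    "AE z in lebesgue. case z of (t, x1) \<Rightarrow> t > 0 \<and> x1 \<in> {0..\<Gamma>} \<longrightarrow>
           tangent h s x1 \<bullet> (strain (g1 t x1) (g2 t x1) (normal h s x1)
                              + \<alpha> (bdry h s x1) *\<^sub>R u t (bdry h s x1)) = 0"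
    using sol unfolding RB_solution_def by blast
  obtain q where q: "L2_trace \<Gamma> h s p q" using sol unfolding RB_solution_def by blast
  show ?thesis
  proof (rule that[of "\<lambda>t x. fst (g1 t x)" "\<lambda>t x. fst (g2 t x)" "\<lambda>t x. snd (g1 t x)" "\<lambda>t x. snd (g2 t x)" q])
    show "L2_trace \<Gamma> h s (\<lambda>t. pd1 (u1 t)) (\<lambda>t x. fst (g1 t x))"
      by (rule L2_trace_cong[OF L2_trace_fst[OF g(1)]]) (simp add: d f)
    show "L2_trace \<Gamma> h s (\<lambda>t. pd2 (u1 t)) (\<lambda>t x. fst (g2 t x))"
      by (rule L2_trace_cong[OF L2_trace_fst[OF g(2)]]) (simp add: d f)
    show "L2_trace \<Gamma> h s (\<lambda>t. pd1 (u2 t)) (\<lambda>t x. snd (g1 t x))"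
      by (rule L2_trace_cong[OF L2_trace_snd[OF g(1)]]) (simp add: d sn)
    show "L2_trace \<Gamma> h s (\<lambda>t. pd2 (u2 t)) (\<lambda>t x. snd (g2 t x))"
      by (rule L2_trace_cong[OF L2_trace_snd[OF g(2)]]) (simp add: d sn)
  qed (use q g(3) in auto)
qed

text \<open>
  The slip condition times \<open>2 u\<^sub>1\<close> and powers of the arc length element, with \<open>u = u\<^sub>1 (1, h')\<close> inserted. The
  first bracket is \<open>u \<bullet> (\<nu> \<bullet> \<nabla>)u\<close>, the second \<open>u\<^sub>1\<close> times the normal part of the derivative of \<open>u\<close> along
  the boundary. The right hand side is \<open>2\<alpha> \<bar>u\<bar>\<^sup>2\<close> times the arc length element.
\<close>

lemma slip_condition_scalar:
  assumes t: "0 < t"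
    and slip: "tangent h s x \<bullet> (strain (a11, a21) (a12, a22) (normal h s x) + al *\<^sub>R u t (bdry h s x)) = 0"
  defines "v1 \<equiv> u1 t (bdry h s x)" and "v2 \<equiv> u2 t (bdry h s x)"
  shows "orientation s * ((v1 * a12 + v2 * a22 - h' x * (v1 * a11 + v2 * a21))
     + (v1 * (a21 + h' x * a22) - h' x * v1 * (a11 + h' x * a12))) = 2 * al * v1\<^sup>2 * arclen h x ^ 3"
proof -
  define l where "l = arclen h x"
  have l: "l > 0" "l\<^sup>2 = 1 + (h' x)\<^sup>2" by (auto simp: l_def arclen_def add_pos_nonneg)
  have v2: "v2 = h' x * v1"
    using no_penetration[OF t, of x] by (cases s) (auto simp: v1_def v2_def bdry_def add.commute)
  have uv: "u t (bdry h s x) = (v1, v2)" by (simp add: v1_def v2_def u1_def u2_def)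
  define E where "E = h' x * a11 - a12 + h' x * (h' x * a21 - a22) + (h' x * a11 - a21) + h' x * (h' x * a12 - a22)"
  have key: "E + orientation s * (2 * al * l * (v1 + h' x * v2)) = 0"
  proof (cases s)
    case Bottom
    have "tangent h s x \<bullet> (strain (a11, a21) (a12, a22) (normal h s x) + al *\<^sub>R u t (bdry h s x))
        = (E + 2 * al * l * (v1 + h' x * v2)) / (2 * l\<^sup>2)"
      unfolding Bottom uv[unfolded Bottom] using l(1)
      by (simp add: tangent_def perp_def strain_def inner_prod_def l_def[symmetric] E_def field_simps power2_eq_square)
    then show ?thesis using slip l(1) Bottom by simp
  next
    case Top
    have "tangent h s x \<bullet> (strain (a11, a21) (a12, a22) (normal h s x) + al *\<^sub>R u t (bdry h s x))
        = (E - 2 * al * l * (v1 + h' x * v2)) / (2 * l\<^sup>2)"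
      unfolding Top uv[unfolded Top] using l(1)
      by (simp add: tangent_def perp_def strain_def inner_prod_def l_def[symmetric] E_def field_simps power2_eq_square)
    then show ?thesis using slip l(1) Top by simp
  qed
  have "v1 + h' x * v2 = l\<^sup>2 * v1" unfolding v2 l(2) by (simp add: algebra_simps power2_eq_square)
  then have "E = - orientation s * (2 * al * l ^ 3 * v1)"
    using key by (simp add: power2_eq_square power3_eq_cube algebra_simps)
  moreover have "(v1 * a12 + v2 * a22 - h' x * (v1 * a11 + v2 * a21))
     + (v1 * (a21 + h' x * a22) - h' x * v1 * (a11 + h' x * a12)) = - E * v1"
    unfolding v2 E_def by (simp add: algebra_simps)
  moreover have "orientation s * orientation s = 1" by (cases s) auto
  ultimately show ?thesis
    by (simp add: l_def[symmetric] power2_eq_square mult.assoc[symmetric])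
qed

text \<open>
  Here \<open>A\<close> is the limit of \<open>\<integral> h'' u\<^sub>1\<^sup>2\<close>, so that \<open>- orientation s * A\<close> is the curvature integral
  \<open>\<integral> \<kappa> \<bar>u\<bar>\<^sup>2\<close>, and \<open>N0\<close> is the limit of the traction. On a slice, with \<open>X\<^sub>i\<close> the derivative of \<open>u\<^sub>i\<close> along
  it, integration by parts gives \<open>\<integral> u\<^sub>1 (X\<^sub>2 - h' X\<^sub>1) = \<integral> h'' u\<^sub>1\<^sup>2 - \<integral> (u\<^sub>2 - h' u\<^sub>1) X\<^sub>1\<close> and
  \<open>\<integral> u\<^sub>1 X\<^sub>2 = \<integral> h'' u\<^sub>1\<^sup>2 / 2 - \<integral> (u\<^sub>2 - h' u\<^sub>1) X\<^sub>1\<close>. The last integral tends to zero, since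
  \<open>u\<^sub>2 - h' u\<^sub>1 \<rightarrow> 0\<close> uniformly. No derivative of the boundary values of \<open>u\<close> is taken. The slip condition then
  identifies \<open>orientation s * (N0 + A)\<close> as the friction \<open>\<integral> 2\<alpha> \<bar>u\<bar>\<^sup>2\<close>.
\<close>

lemma boundary_work_limits:
  assumes t: "0 < t0" "t0 < T" and a: "0 \<le> a"
    and slip: "AE x in lebesgue_on {0..\<Gamma>}. 0 < \<alpha> (bdry h s x) \<and> - curvature h s x \<le> 2 * \<alpha> (bdry h s x) * (1 + a)"
  obtains N0 A where
    "((\<lambda>\<epsilon>. integral (cbox (t0, 0) (T, \<Gamma>)) (\<lambda>z. traction (fst z) (slice h s \<epsilon> (snd z)))) \<longlongrightarrow> N0) (at_right 0)"
    "((\<lambda>\<epsilon>. integral (cbox (t0, 0) (T, \<Gamma>)) (\<lambda>z. shear (fst z) (slice h s \<epsilon> (snd z)))) \<longlongrightarrow> A / 2) (at_right 0)"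
    "0 \<le> orientation s * (N0 + A)"
    "orientation s * A \<le> (1 + a) * (orientation s * (N0 + A))"
proof -
  let ?R = "cbox (t0, 0) (T, \<Gamma>)"
  obtain g11 g12 g21 g22 q where
    tr: "L2_trace \<Gamma> h s (\<lambda>t. pd1 (u1 t)) g11" "L2_trace \<Gamma> h s (\<lambda>t. pd2 (u1 t)) g12"
    "L2_trace \<Gamma> h s (\<lambda>t. pd1 (u2 t)) g21" "L2_trace \<Gamma> h s (\<lambda>t. pd2 (u2 t)) g22"
    "L2_trace \<Gamma> h s p q"
    and sl: "AE z in lebesgue. case z of (t, x) \<Rightarrow> t > 0 \<and> x \<in> {0..\<Gamma>} \<longrightarrow>
       tangent h s x \<bullet> (strain (g11 t x, g21 t x) (g12 t x, g22 t x) (normal h s x) + \<alpha> (bdry h s x) *\<^sub>R u t (bdry h s x)) = 0"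
    using velocity_gradient_traces by blast
  define sl' where "sl' w \<epsilon> z = w (fst z) (slice h s \<epsilon> (snd z))" for w :: "real \<Rightarrow> real \<times> real \<Rightarrow> real" and \<epsilon> and z :: "real \<times> real"
  have slc: "continuous_on ?R (sl' w \<epsilon>)" if "jointly_continuous S w" "0 < \<epsilon>" "\<epsilon> < 1" for w \<epsilon>
    using slice_continuous[OF that(1) t(1) that(2,3), of T "{0..\<Gamma>}"] by (simp add: sl'_def[abs_def] cbox_double)
  define c1 where "c1 y = u1 (fst (snd y)) (slice h s (fst y) (snd (snd y)))" for y :: "real \<times> real \<times> real"
  define c2 where "c2 y = u2 (fst (snd y)) (slice h s (fst y) (snd (snd y)))" for y :: "real \<times> real \<times> real"
  define k where "k y = h' (snd (snd y))" for y :: "real \<times> real \<times> real"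
  let ?D = "{0..1/2} \<times> ?R"
  have cc: "continuous_on ?D c1" "continuous_on ?D c2" "continuous_on ?D k"
    unfolding c1_def c2_def k_def
    by (intro slice_coefficient_continuous cont_strip t h'_coefficient_continuous)+
  define dn where "dn y = c2 y - k y * c1 y" for y
  have dnc: "continuous_on ?D dn" unfolding dn_def by (intro continuous_intros cc)
  have dn0: "dn (0, z) = 0" if "z \<in> ?R" for z
  proof -
    have "0 < fst z" using that t by (cases z) (auto simp: cbox_Pair_eq)
    then show ?thesis using no_penetration[of "fst z" "snd z"]
      by (cases s) (auto simp: dn_def c1_def c2_def k_def add.commute)
  qed
  \<comment> \<open>\<open>F\<close> pairs the four velocity derivatives on the slice with coefficients, \<open>G\<close> their traces\<close>
  define G where "G d1 d2 d3 d4 z = g11 (fst z) (snd z) * d1 (0::real, z) + g12 (fst z) (snd z) * d2 (0, z)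
      + g21 (fst z) (snd z) * d3 (0, z) + g22 (fst z) (snd z) * d4 (0, z)" for d1 d2 d3 d4 :: "real \<times> real \<times> real \<Rightarrow> real" and z
  define F where "F d1 d2 d3 d4 \<epsilon> z = sl' (\<lambda>t. pd1 (u1 t)) \<epsilon> z * d1 (\<epsilon>, z) + sl' (\<lambda>t. pd2 (u1 t)) \<epsilon> z * d2 (\<epsilon>, z)
      + sl' (\<lambda>t. pd1 (u2 t)) \<epsilon> z * d3 (\<epsilon>, z) + sl' (\<lambda>t. pd2 (u2 t)) \<epsilon> z * d4 (\<epsilon>, z)" for d1 d2 d3 d4 :: "real \<times> real \<times> real \<Rightarrow> real" and \<epsilon> z
  have dsl: "continuous_on ?R (\<lambda>z. d (\<epsilon>, z))" if "continuous_on ?D d" "0 \<le> \<epsilon>" "\<epsilon> \<le> 1/2" for d :: "real \<times> real \<times> real \<Rightarrow> real" and \<epsilon>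
    by (rule continuous_on_compose2[OF that(1)]) (use that in \<open>auto intro!: continuous_intros\<close>)
  have jcs: "jointly_continuous S (\<lambda>t. pd1 (u1 t))" "jointly_continuous S (\<lambda>t. pd2 (u1 t))"
    "jointly_continuous S (\<lambda>t. pd1 (u2 t))" "jointly_continuous S (\<lambda>t. pd2 (u2 t))" by (intro jc)+
  have Fc: "continuous_on ?R (F d1 d2 d3 d4 \<epsilon>)"
    if "continuous_on ?D d1" "continuous_on ?D d2" "continuous_on ?D d3" "continuous_on ?D d4" "0 < \<epsilon>" "\<epsilon> < 1/2"
    for d1 d2 d3 d4 \<epsilon>
    unfolding F_def by (intro continuous_intros slc jcs dsl) (use that in auto)
  have pair: "(\<lambda>z. g (fst z) (snd z) * d (0, z)) integrable_on ?R"
      "((\<lambda>\<epsilon>. integral ?R (\<lambda>z. sl' w \<epsilon> z * d (\<epsilon>, z))) \<longlongrightarrow> integral ?R (\<lambda>z. g (fst z) (snd z) * d (0, z))) (at_right 0)"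
    if "L2_trace \<Gamma> h s w g" "jointly_continuous S w" "continuous_on ?D d" for w g d
  proof -
    note P = L2_trace_pairing_tendsto[OF that(1) t _ that(3)]
    show "(\<lambda>z. g (fst z) (snd z) * d (0, z)) integrable_on ?R"
      using P(1) slc[OF that(2)] by (auto simp: sl'_def[abs_def] dest: set_lebesgue_integral_eq_integral(1))
    show "((\<lambda>\<epsilon>. integral ?R (\<lambda>z. sl' w \<epsilon> z * d (\<epsilon>, z))) \<longlongrightarrow> integral ?R (\<lambda>z. g (fst z) (snd z) * d (0, z))) (at_right 0)"
      using P(2) slc[OF that(2)] by (auto simp: sl'_def[abs_def])
  qed
  have small: "eventually (\<lambda>\<epsilon>::real. 0 < \<epsilon> \<and> \<epsilon> < 1/2) (at_right 0)"
    by (auto simp: eventually_at_right_field intro!: exI[of _ "1/2"])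
  have lim4: "G d1 d2 d3 d4 integrable_on ?R"
      "((\<lambda>\<epsilon>. integral ?R (F d1 d2 d3 d4 \<epsilon>)) \<longlongrightarrow> integral ?R (G d1 d2 d3 d4)) (at_right 0)"
    if d: "continuous_on ?D d1" "continuous_on ?D d2" "continuous_on ?D d3" "continuous_on ?D d4" for d1 d2 d3 d4
  proof -
    note p1 = pair[OF tr(1) jcs(1) d(1)] and p2 = pair[OF tr(2) jcs(2) d(2)]
      and p3 = pair[OF tr(3) jcs(3) d(3)] and p4 = pair[OF tr(4) jcs(4) d(4)]
    show "G d1 d2 d3 d4 integrable_on ?R"
      unfolding G_def by (intro integrable_add p1 p2 p3 p4)
    have Gi: "integral ?R (G d1 d2 d3 d4) = integral ?R (\<lambda>z. g11 (fst z) (snd z) * d1 (0, z)) + integral ?R (\<lambda>z. g12 (fst z) (snd z) * d2 (0, z))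
      + integral ?R (\<lambda>z. g21 (fst z) (snd z) * d3 (0, z)) + integral ?R (\<lambda>z. g22 (fst z) (snd z) * d4 (0, z))"
      unfolding G_def by (simp add: HK_integral_add integrable_add p1(1) p2(1) p3(1) p4(1))
    have Fi: "integral ?R (\<lambda>z. sl' (\<lambda>t. pd1 (u1 t)) \<epsilon> z * d1 (\<epsilon>, z)) + integral ?R (\<lambda>z. sl' (\<lambda>t. pd2 (u1 t)) \<epsilon> z * d2 (\<epsilon>, z))
      + integral ?R (\<lambda>z. sl' (\<lambda>t. pd1 (u2 t)) \<epsilon> z * d3 (\<epsilon>, z)) + integral ?R (\<lambda>z. sl' (\<lambda>t. pd2 (u2 t)) \<epsilon> z * d4 (\<epsilon>, z))
      = integral ?R (F d1 d2 d3 d4 \<epsilon>)" if e: "0 < \<epsilon> \<and> \<epsilon> < 1/2" for \<epsilon>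
    proof -
      have i: "(\<lambda>z. sl' w \<epsilon> z * d (\<epsilon>, z)) integrable_on ?R" if "jointly_continuous S w" "continuous_on ?D d" for w d
        by (intro integrable_continuous continuous_intros slc dsl) (use that e in auto)
      show ?thesis
        unfolding F_def by (simp add: HK_integral_add integrable_add i jcs d)
    qed
    show "((\<lambda>\<epsilon>. integral ?R (F d1 d2 d3 d4 \<epsilon>)) \<longlongrightarrow> integral ?R (G d1 d2 d3 d4)) (at_right 0)"
      unfolding Gi
      by (rule Lim_transform_eventually[OF tendsto_add[OF tendsto_add[OF tendsto_add[OF p1(2) p2(2)] p3(2)] p4(2)]])
        (use small Fi in \<open>auto elim: eventually_mono\<close>)
  qed
  define N0 where "N0 = integral ?R (G (\<lambda>y. - (k y * c1 y)) c1 (\<lambda>y. - (k y * c2 y)) c2)"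
  have dN: "continuous_on ?D (\<lambda>y. - (k y * c1 y))" "continuous_on ?D (\<lambda>y. - (k y * c2 y))"
    by (intro continuous_intros cc)+
  define kin where "kin y = (c1 y * c1 y + c2 y * c2 y) * (1 / (2 * Pr)) * dn y" for y
  have kinc: "continuous_on ?D kin" unfolding kin_def by (intro continuous_intros cc dnc)
  have N_lim: "((\<lambda>\<epsilon>. integral ?R (\<lambda>z. traction (fst z) (slice h s \<epsilon> (snd z)))) \<longlongrightarrow> N0) (at_right 0)"
  proof -
    have kin_lim: "((\<lambda>\<epsilon>. integral ?R (\<lambda>z. kin (\<epsilon>, z))) \<longlongrightarrow> integral ?R (\<lambda>z. kin (0, z))) (at_right 0)"
    proof -
      have "continuous_on {0..1/2} (\<lambda>\<epsilon>. integral ?R (\<lambda>z. kin (\<epsilon>, z)))"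
        by (rule integral_continuous_on_param) (use kinc in \<open>simp add: case_prod_unfold\<close>)
      then have "((\<lambda>\<epsilon>. integral ?R (\<lambda>z. kin (\<epsilon>, z))) \<longlongrightarrow> integral ?R (\<lambda>z. kin (0, z))) (at 0 within {0..1/2})"
        by (auto simp: continuous_on_def)
      then show ?thesis by (simp add: at_within_Icc_at_right)
    qed
    have kin0: "integral ?R (\<lambda>z. kin (0, z)) = 0"
      by (rule integral_unique, rule has_integral_is_0) (simp add: kin_def dn0)
    have p0: "integral ?R (\<lambda>z. q (fst z) (snd z) * dn (0, z)) = 0"
      by (rule integral_unique, rule has_integral_is_0) (simp add: dn0)
    have "((\<lambda>\<epsilon>. integral ?R (F (\<lambda>y. - (k y * c1 y)) c1 (\<lambda>y. - (k y * c2 y)) c2 \<epsilon>)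
        - integral ?R (\<lambda>z. kin (\<epsilon>, z)) - integral ?R (\<lambda>z. sl' p \<epsilon> z * dn (\<epsilon>, z))) \<longlongrightarrow> N0 - 0 - 0) (at_right 0)"
      unfolding N0_def
      by (intro tendsto_diff lim4(2) dN cc kin_lim[unfolded kin0] pair(2)[OF tr(5) p_cont dnc, unfolded p0])
    then have L: "((\<lambda>\<epsilon>. integral ?R (F (\<lambda>y. - (k y * c1 y)) c1 (\<lambda>y. - (k y * c2 y)) c2 \<epsilon>)
        - integral ?R (\<lambda>z. kin (\<epsilon>, z)) - integral ?R (\<lambda>z. sl' p \<epsilon> z * dn (\<epsilon>, z))) \<longlongrightarrow> N0) (at_right 0)" by simp
    show ?thesis
    proof (rule Lim_transform_eventually[OF L], rule eventually_mono[OF small])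
      fix \<epsilon> :: real assume e: "0 < \<epsilon> \<and> \<epsilon> < 1/2"
      have i1: "F (\<lambda>y. - (k y * c1 y)) c1 (\<lambda>y. - (k y * c2 y)) c2 \<epsilon> integrable_on ?R"
        by (intro integrable_continuous Fc dN cc) (use e in auto)
      have i2: "(\<lambda>z. kin (\<epsilon>, z)) integrable_on ?R"
        by (intro integrable_continuous dsl kinc) (use e in auto)
      have i3: "(\<lambda>z. sl' p \<epsilon> z * dn (\<epsilon>, z)) integrable_on ?R"
        by (intro integrable_continuous continuous_intros dsl dnc slc p_cont) (use e in auto)
      have "integral ?R (F (\<lambda>y. - (k y * c1 y)) c1 (\<lambda>y. - (k y * c2 y)) c2 \<epsilon>)
        - integral ?R (\<lambda>z. kin (\<epsilon>, z)) - integral ?R (\<lambda>z. sl' p \<epsilon> z * dn (\<epsilon>, z)) =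
        integral ?R (\<lambda>z. F (\<lambda>y. - (k y * c1 y)) c1 (\<lambda>y. - (k y * c2 y)) c2 \<epsilon> z - kin (\<epsilon>, z) - sl' p \<epsilon> z * dn (\<epsilon>, z))"
        using i1 i2 i3 by (simp add: HK_integral_diff integrable_diff)
      also have "(\<lambda>z. F (\<lambda>y. - (k y * c1 y)) c1 (\<lambda>y. - (k y * c2 y)) c2 \<epsilon> z - kin (\<epsilon>, z) - sl' p \<epsilon> z * dn (\<epsilon>, z)) =
          (\<lambda>z. traction (fst z) (slice h s \<epsilon> (snd z)))"
        by (simp add: fun_eq_iff F_def kin_def dn_def sl'_def traction_def c1_def c2_def k_def slice_height algebra_simps)
      finally show "integral ?R (F (\<lambda>y. - (k y * c1 y)) c1 (\<lambda>y. - (k y * c2 y)) c2 \<epsilon>)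
        - integral ?R (\<lambda>z. kin (\<epsilon>, z)) - integral ?R (\<lambda>z. sl' p \<epsilon> z * dn (\<epsilon>, z)) =
        integral ?R (\<lambda>z. traction (fst z) (slice h s \<epsilon> (snd z)))" .
    qed
  qed
  define A where "A = integral ?R (\<lambda>z. h'' (snd z) * (c1 (0, z))\<^sup>2)"
  have h2i: "(\<lambda>z. h'' (snd z) * d (\<epsilon>, z)) integrable_on ?R"
    if "continuous_on ?D d" "0 \<le> \<epsilon>" "\<epsilon> \<le> 1/2" for d :: "real \<times> real \<times> real \<Rightarrow> real" and \<epsilon>
    using absolutely_integrable_continuous_mult[OF h''_absolutely_integrable dsl[OF that]]
    by (rule set_lebesgue_integral_eq_integral(1))
  have c1sq: "continuous_on ?D (\<lambda>y. (c1 y)\<^sup>2)" by (intro continuous_intros cc)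
  have A_lim: "((\<lambda>\<epsilon>. integral ?R (\<lambda>z. h'' (snd z) * (c1 (\<epsilon>, z))\<^sup>2)) \<longlongrightarrow> A) (at_right 0)"
  proof -
    obtain K where K: "\<And>x. \<bar>h'' x\<bar> \<le> K" using h''_bounded by blast
    have K0: "0 \<le> K" using K[of 0] by auto
    define m where "m = integral ?R (\<lambda>z::real \<times> real. 1::real)"
    have uc: "uniformly_continuous_on ?D (\<lambda>y. (c1 y)\<^sup>2)"
      by (rule compact_uniformly_continuous[OF c1sq]) (intro compact_Times; simp)
    have m0: "0 \<le> m" unfolding m_def by (intro integral_nonneg) auto
    show ?thesis
    proof (rule tendstoI)
      fix e :: real assume e: "0 < e"
      define e' where "e' = e / (K * m + 1)"
      have pos: "0 < K * m + 1" using K0 m0 by (simp add: add_nonneg_pos)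
      have e': "0 < e'" "K * e' * m < e"
      proof -
        show 1: "0 < e'" using e pos by (simp add: e'_def)
        have "e' * (K * m + 1) = e" using pos by (simp add: e'_def)
        then show "K * e' * m < e" using 1 by (simp add: algebra_simps)
      qed
      obtain \<delta> where \<delta>: "0 < \<delta>" "\<And>x y. x \<in> ?D \<Longrightarrow> y \<in> ?D \<Longrightarrow> dist y x < \<delta> \<Longrightarrow> dist ((c1 y)\<^sup>2) ((c1 x)\<^sup>2) < e'"
        using uc e'(1) unfolding uniformly_continuous_on_def by metis
      have "dist (integral ?R (\<lambda>z. h'' (snd z) * (c1 (\<epsilon>, z))\<^sup>2)) A < e" if \<epsilon>: "0 < \<epsilon>" "\<epsilon> < min \<delta> (1/2)" for \<epsilon>
      proof -
        have i: "(\<lambda>z. h'' (snd z) * (c1 (\<epsilon>, z))\<^sup>2) integrable_on ?R" "(\<lambda>z. h'' (snd z) * (c1 (0, z))\<^sup>2) integrable_on ?R"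
          using h2i[OF c1sq, of \<epsilon>] h2i[OF c1sq, of 0] \<epsilon> by auto
        have "norm (integral ?R (\<lambda>z. h'' (snd z) * (c1 (\<epsilon>, z))\<^sup>2 - h'' (snd z) * (c1 (0, z))\<^sup>2))
            \<le> integral ?R (\<lambda>z. K * e')"
        proof (rule HK_integral_norm_bound_integral)
          fix z assume z: "z \<in> ?R"
          have "dist (\<epsilon>, z) (0, z) < \<delta>" using \<epsilon> by (simp add: dist_Pair_Pair)
          then have "\<bar>(c1 (\<epsilon>, z))\<^sup>2 - (c1 (0, z))\<^sup>2\<bar> < e'"
            using \<delta>(2)[of "(0, z)" "(\<epsilon>, z)"] \<epsilon> z by (auto simp: dist_real_def)
          then have "\<bar>h'' (snd z)\<bar> * \<bar>(c1 (\<epsilon>, z))\<^sup>2 - (c1 (0, z))\<^sup>2\<bar> \<le> K * e'"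
            using K K0 by (intro mult_mono) auto
          then show "norm (h'' (snd z) * (c1 (\<epsilon>, z))\<^sup>2 - h'' (snd z) * (c1 (0, z))\<^sup>2) \<le> K * e'"
            by (simp add: right_diff_distrib[symmetric] abs_mult)
        qed (use i in \<open>auto intro: integrable_diff\<close>)
        also have "\<dots> = K * e' * m" unfolding m_def by simp
        also have "\<dots> < e" by (rule e'(2))
        finally show ?thesis
          using HK_integral_diff[OF i] by (simp add: A_def dist_real_def)
      qed
      then show "\<forall>\<^sub>F \<epsilon> in at_right 0. dist (integral ?R (\<lambda>z. h'' (snd z) * (c1 (\<epsilon>, z))\<^sup>2)) A < e"
        using \<delta>(1) by (auto simp: eventually_at_right_field intro!: exI[of _ "min \<delta> (1/2)"])
    qed
  qed
  define C where "C \<epsilon> = integral ?R (F dn (\<lambda>y. k y * dn y) (\<lambda>y. 0) (\<lambda>y. 0) \<epsilon>)" for \<epsilon>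
  have dC: "continuous_on ?D (\<lambda>y. k y * dn y)" "continuous_on ?D (\<lambda>y. 0 :: real)"
    by (intro continuous_intros cc dnc)+
  have C_lim: "(C \<longlongrightarrow> 0) (at_right 0)"
  proof -
    have "integral ?R (G dn (\<lambda>y. k y * dn y) (\<lambda>y. 0) (\<lambda>y. 0)) = 0"
      by (rule integral_unique, rule has_integral_is_0) (simp add: G_def dn0)
    then show ?thesis using lim4(2)[OF dnc dC(1) dC(2) dC(2)] by (simp add: C_def[abs_def])
  qed
  have dM: "continuous_on ?D (\<lambda>y. - (k y * c1 y))" "continuous_on ?D (\<lambda>y. - (k y * k y * c1 y))" "continuous_on ?D (\<lambda>y. k y * c1 y)"
    by (intro continuous_intros cc)+
  have slices: "integral ?R (F (\<lambda>y. - (k y * c1 y)) (\<lambda>y. - (k y * k y * c1 y)) c1 (\<lambda>y. k y * c1 y) \<epsilon>)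
        = integral ?R (\<lambda>z. h'' (snd z) * (c1 (\<epsilon>, z))\<^sup>2) - C \<epsilon>"
      "integral ?R (\<lambda>z. shear (fst z) (slice h s \<epsilon> (snd z))) = integral ?R (\<lambda>z. h'' (snd z) * (c1 (\<epsilon>, z))\<^sup>2) / 2 - C \<epsilon>"
    if e: "0 < \<epsilon>" "\<epsilon> < 1/2" for \<epsilon>
  proof -
    have e1: "\<epsilon> < 1" using e by simp
    have TU: "continuous_on ({t0..T} \<times> UNIV) (sl' w \<epsilon>)" if "jointly_continuous S w" for w
      using slice_continuous[OF that t(1) e(1) e1, of T UNIV s] by (simp add: sl'_def[abs_def])
    have h'TU: "continuous_on ({t0..T} \<times> UNIV) (\<lambda>z. h' (snd z))"
      by (intro continuous_on_compose2[OF h'_cont] continuous_intros) auto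
    define U1 where "U1 = sl' u1 \<epsilon>"
    define U2 where "U2 = sl' u2 \<epsilon>"
    define X1 where "X1 z = sl' (\<lambda>t. pd1 (u1 t)) \<epsilon> z + h' (snd z) * sl' (\<lambda>t. pd2 (u1 t)) \<epsilon> z" for z
    define X2 where "X2 z = sl' (\<lambda>t. pd1 (u2 t)) \<epsilon> z + h' (snd z) * sl' (\<lambda>t. pd2 (u2 t)) \<epsilon> z" for z
    have ct: "continuous_on ({t0..T} \<times> UNIV) U1" "continuous_on ({t0..T} \<times> UNIV) U2"
      "continuous_on ({t0..T} \<times> UNIV) X1" "continuous_on ({t0..T} \<times> UNIV) X2"
      unfolding U1_def U2_def X1_def X2_def by (intro continuous_intros TU h'TU jc)+
    have dU: "((\<lambda>x. U1 (t, x)) has_real_derivative X1 (t, x)) (at x)"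
        "((\<lambda>x. U2 (t, x)) has_real_derivative X2 (t, x)) (at x)" if "t \<in> {t0..T}" for t x
    proof -
      have "0 < t" using that t by simp
      note sd = slice_deriv[of u1 t, OF u1_C12(2)[OF this slice_in_S[OF e(1) e1]]]
        slice_deriv[of u2 t, OF u2_C12(2)[OF this slice_in_S[OF e(1) e1]]]
      show "((\<lambda>x. U1 (t, x)) has_real_derivative X1 (t, x)) (at x)"
        "((\<lambda>x. U2 (t, x)) has_real_derivative X2 (t, x)) (at x)"
        using sd by (simp_all add: U1_def U2_def X1_def X2_def sl'_def)
    qed
    have pU: "U1 (t, x + \<Gamma>) = U1 (t, x)" "U2 (t, x + \<Gamma>) = U2 (t, x)" if "t \<in> {t0..T}" for t x
    proof -
      have "0 < t" using that t by simp
      then show "U1 (t, x + \<Gamma>) = U1 (t, x)" "U2 (t, x + \<Gamma>) = U2 (t, x)"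
        using slice_periodic[OF periodic_S(1) e(1) e1] slice_periodic[OF periodic_S(2) e(1) e1]
        by (simp_all add: U1_def U2_def sl'_def)
    qed
    have I1: "((\<lambda>(t, x). h'' x * (\<lambda>z. (U1 z)\<^sup>2) (t, x) + h' x * (\<lambda>z. 2 * U1 z * X1 z) (t, x)) has_integral 0) ?R"
    proof (rule integration_by_parts_h')
      show "((\<lambda>x. (U1 (t, x))\<^sup>2) has_real_derivative 2 * U1 (t, x) * X1 (t, x)) (at x)" if "t \<in> {t0..T}" for t x
        using dU[OF that] by (auto intro!: derivative_eq_intros)
    qed (use ct pU in \<open>auto intro!: continuous_intros\<close>)
    \<comment> \<open>the smooth case: a constant factor \<open>1\<close> with derivative \<open>0\<close>\<close>
    have I2: "((\<lambda>(t, x). (\<lambda>x. 0) x * (\<lambda>z. U1 z * U2 z) (t, x) + (\<lambda>x. 1) x * (\<lambda>z. X1 z * U2 z + X2 z * U1 z) (t, x)) has_integral 0) ?R"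
    proof (rule Lipschitz_integration_by_parts[where K = 0 and N = "{}"])
      show "((\<lambda>x. U1 (t, x) * U2 (t, x)) has_real_derivative X1 (t, x) * U2 (t, x) + X2 (t, x) * U1 (t, x)) (at x)" if "t \<in> {t0..T}" for t x
        by (rule DERIV_mult[OF dU[OF that]])
    qed (use ct pU \<Gamma> in \<open>auto intro!: continuous_intros lipschitz_onI\<close>)
    have c1e: "c1 (\<epsilon>, z) = U1 z" "c2 (\<epsilon>, z) = U2 z" "k (\<epsilon>, z) = h' (snd z)" for z
      by (simp_all add: c1_def c2_def k_def U1_def U2_def sl'_def)
    have ctR: "continuous_on ?R f" if "continuous_on ({t0..T} \<times> UNIV) f" for f :: "real \<times> real \<Rightarrow> real"
      by (rule continuous_on_subset[OF that]) (auto simp: cbox_Pair_eq)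
    have iH: "(\<lambda>z. h'' (snd z) * (U1 z)\<^sup>2) integrable_on ?R"
      using h2i[OF c1sq, of \<epsilon>] e by (simp add: c1e)
    have iX: "(\<lambda>z. h' (snd z) * (2 * U1 z * X1 z)) integrable_on ?R" "(\<lambda>z. X1 z * U2 z) integrable_on ?R" "(\<lambda>z. X2 z * U1 z) integrable_on ?R"
      by (intro integrable_continuous ctR continuous_intros ct h'TU)+
    have e1: "integral ?R (\<lambda>z. h'' (snd z) * (U1 z)\<^sup>2) + integral ?R (\<lambda>z. h' (snd z) * (2 * U1 z * X1 z)) = 0"
      using integral_unique[OF I1] HK_integral_add[OF iH iX(1)] by (simp add: case_prod_unfold)
    have e2: "integral ?R (\<lambda>z. X1 z * U2 z) + integral ?R (\<lambda>z. X2 z * U1 z) = 0"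
      using integral_unique[OF I2] HK_integral_add[OF iX(2,3)] by (simp add: case_prod_unfold)
    have e3: "C \<epsilon> = integral ?R (\<lambda>z. X1 z * U2 z) - integral ?R (\<lambda>z. h' (snd z) * (2 * U1 z * X1 z)) / 2"
    proof -
      have "F dn (\<lambda>y. k y * dn y) (\<lambda>y. 0) (\<lambda>y. 0) \<epsilon> = (\<lambda>z. X1 z * U2 z - h' (snd z) * (2 * U1 z * X1 z) / 2)"
        by (simp add: fun_eq_iff F_def dn_def c1e X1_def algebra_simps)
      note Feq = this
      show ?thesis
        unfolding C_def Feq HK_integral_diff[OF iX(2) integrable_on_divide[OF iX(1), of 2]]
        by (simp only: HK_integral_divide)
    qed
    have e4: "integral ?R (F (\<lambda>y. - (k y * c1 y)) (\<lambda>y. - (k y * k y * c1 y)) c1 (\<lambda>y. k y * c1 y) \<epsilon>) =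
        integral ?R (\<lambda>z. X2 z * U1 z) - integral ?R (\<lambda>z. h' (snd z) * (2 * U1 z * X1 z)) / 2"
    proof -
      have "F (\<lambda>y. - (k y * c1 y)) (\<lambda>y. - (k y * k y * c1 y)) c1 (\<lambda>y. k y * c1 y) \<epsilon> = (\<lambda>z. X2 z * U1 z - h' (snd z) * (2 * U1 z * X1 z) / 2)"
        by (simp add: fun_eq_iff F_def c1e X1_def X2_def algebra_simps)
      note Feq = this
      show ?thesis
        unfolding Feq HK_integral_diff[OF iX(3) integrable_on_divide[OF iX(1), of 2]]
        by (simp only: HK_integral_divide)
    qed
    have e5: "integral ?R (\<lambda>z. shear (fst z) (slice h s \<epsilon> (snd z))) = integral ?R (\<lambda>z. X2 z * U1 z)"
      by (simp add: shear_def X2_def U1_def sl'_def slice_height mult.commute)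
    show "integral ?R (F (\<lambda>y. - (k y * c1 y)) (\<lambda>y. - (k y * k y * c1 y)) c1 (\<lambda>y. k y * c1 y) \<epsilon>)
        = integral ?R (\<lambda>z. h'' (snd z) * (c1 (\<epsilon>, z))\<^sup>2) - C \<epsilon>"
      "integral ?R (\<lambda>z. shear (fst z) (slice h s \<epsilon> (snd z))) = integral ?R (\<lambda>z. h'' (snd z) * (c1 (\<epsilon>, z))\<^sup>2) / 2 - C \<epsilon>"
      using e1 e2 e3 e4 e5 by (simp_all add: c1e field_simps)
  qed
  have K_lim: "((\<lambda>\<epsilon>. integral ?R (\<lambda>z. shear (fst z) (slice h s \<epsilon> (snd z)))) \<longlongrightarrow> A / 2) (at_right 0)"
  proof -
    have "((\<lambda>\<epsilon>. integral ?R (\<lambda>z. h'' (snd z) * (c1 (\<epsilon>, z))\<^sup>2) / 2 - C \<epsilon>) \<longlongrightarrow> A / 2 - 0) (at_right 0)"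
      by (intro tendsto_diff tendsto_divide A_lim C_lim tendsto_const) simp
    then have L: "((\<lambda>\<epsilon>. integral ?R (\<lambda>z. h'' (snd z) * (c1 (\<epsilon>, z))\<^sup>2) / 2 - C \<epsilon>) \<longlongrightarrow> A / 2) (at_right 0)" by simp
    show ?thesis
      by (rule Lim_transform_eventually[OF L], rule eventually_mono[OF small]) (simp add: slices(2))
  qed
  have M: "integral ?R (G (\<lambda>y. - (k y * c1 y)) (\<lambda>y. - (k y * k y * c1 y)) c1 (\<lambda>y. k y * c1 y)) = A"
  proof (rule tendsto_unique[OF _ lim4(2)[OF dM(1,2) cc(1) dM(3)]])
    have "((\<lambda>\<epsilon>. integral ?R (\<lambda>z. h'' (snd z) * (c1 (\<epsilon>, z))\<^sup>2) - C \<epsilon>) \<longlongrightarrow> A - 0) (at_right 0)"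
      by (intro tendsto_diff A_lim C_lim)
    then have L: "((\<lambda>\<epsilon>. integral ?R (\<lambda>z. h'' (snd z) * (c1 (\<epsilon>, z))\<^sup>2) - C \<epsilon>) \<longlongrightarrow> A) (at_right 0)" by simp
    show "((\<lambda>\<epsilon>. integral ?R (F (\<lambda>y. - (k y * c1 y)) (\<lambda>y. - (k y * k y * c1 y)) c1 (\<lambda>y. k y * c1 y) \<epsilon>)) \<longlongrightarrow> A) (at_right 0)"
      by (rule Lim_transform_eventually[OF L], rule eventually_mono[OF small]) (simp add: slices(1))
  qed simp
  \<comment> \<open>the density of the friction; the slip condition holds off a null set only\<close>
  define Bf where "Bf z = orientation s * (G (\<lambda>y. - (k y * c1 y)) c1 (\<lambda>y. - (k y * c2 y)) c2 z
      + G (\<lambda>y. - (k y * c1 y)) (\<lambda>y. - (k y * k y * c1 y)) c1 (\<lambda>y. k y * c1 y) z)" for z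
  have Bi: "Bf integrable_on ?R"
    unfolding Bf_def by (intro integrable_on_mult_right integrable_add lim4(1) dN dM cc)
  have Bint: "integral ?R Bf = orientation s * (N0 + A)"
    unfolding Bf_def using HK_integral_add[OF lim4(1)[OF dN(1) cc(1) dN(2) cc(2)] lim4(1)[OF dM(1,2) cc(1) dM(3)]]
    by (simp add: M N0_def)
  obtain Z1 where Z1: "negligible Z1" "\<And>x. x \<in> {0..\<Gamma>} \<Longrightarrow> x \<notin> Z1 \<Longrightarrow>
      0 < \<alpha> (bdry h s x) \<and> - curvature h s x \<le> 2 * \<alpha> (bdry h s x) * (1 + a)"
    using negligible_AE_lebesgue_on[OF slip] by blast
  obtain Z2 where Z2: "negligible Z2" "\<And>t x. (t, x) \<notin> Z2 \<Longrightarrow> t > 0 \<and> x \<in> {0..\<Gamma>} \<Longrightarrow>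
       tangent h s x \<bullet> (strain (g11 t x, g21 t x) (g12 t x, g22 t x) (normal h s x) + \<alpha> (bdry h s x) *\<^sub>R u t (bdry h s x)) = 0"
  proof -
    obtain N where N: "{z \<in> space lebesgue. \<not> (case z of (t, x) \<Rightarrow> t > 0 \<and> x \<in> {0..\<Gamma>} \<longrightarrow>
       tangent h s x \<bullet> (strain (g11 t x, g21 t x) (g12 t x, g22 t x) (normal h s x) + \<alpha> (bdry h s x) *\<^sub>R u t (bdry h s x)) = 0)} \<subseteq> N"
      "N \<in> null_sets lebesgue"
      using sl unfolding eventually_ae_filter by blast
    show ?thesis by (rule that[of N]) (use N in \<open>auto simp: negligible_iff_null_sets\<close>)
  qed
  define Z where "Z = UNIV \<times> (Z1 \<union> nondiff) \<union> Z2"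
  have Z: "negligible Z"
    unfolding Z_def by (intro negligible_Un negligible_UNIV_Times Z1 Z2 nondiff_negligible)
  have ptw: "0 \<le> Bf z \<and> orientation s * (h'' (snd z) * (c1 (0, z))\<^sup>2) \<le> (1 + a) * Bf z" if z: "z \<in> ?R" "z \<notin> Z" for z
  proof -
    obtain t' x where tx: "z = (t', x)" "0 < t'" "x \<in> {0..\<Gamma>}" using z t by (cases z) (auto simp: cbox_Pair_eq)
    have nz: "x \<notin> Z1" "x \<notin> nondiff" "(t', x) \<notin> Z2" using z tx by (auto simp: Z_def)
    define v1 where "v1 = u1 t' (bdry h s x)"
    define al where "al = \<alpha> (bdry h s x)"
    define l where "l = arclen h x"
    have l: "0 < l" by (auto simp: l_def arclen_def add_pos_nonneg)
    have Bf: "Bf z = 2 * al * v1\<^sup>2 * l ^ 3"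
      using slip_condition_scalar[OF tx(2) Z2(2)[OF nz(3)]] tx
      by (simp add: Bf_def G_def c1_def c2_def k_def bdry_def v1_def al_def l_def algebra_simps)
    have cv: "orientation s * h'' x \<le> 2 * al * (1 + a) * l ^ 3"
      using Z1(2)[OF tx(3) nz(1)] curvature_eq[OF nz(2), of s] l by (simp add: al_def l_def[symmetric] field_simps)
    have "orientation s * h'' x * v1\<^sup>2 \<le> 2 * al * (1 + a) * l ^ 3 * v1\<^sup>2"
      by (intro mult_right_mono cv) simp
    moreover have "c1 (0, z) = v1" by (simp add: c1_def tx v1_def bdry_def)
    moreover have "0 \<le> Bf z" unfolding Bf using Z1(2)[OF tx(3) nz(1)] l by (simp add: al_def)
    ultimately show ?thesis by (simp add: Bf[unfolded tx(1)] tx algebra_simps)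
  qed
  have "0 \<le> integral ?R Bf"
    by (rule integral_nonneg_off_negligible[OF Bi Z]) (use ptw in auto)
  moreover have "0 \<le> integral ?R (\<lambda>z. (1 + a) * Bf z - orientation s * (h'' (snd z) * (c1 (0, z))\<^sup>2))"
    by (rule integral_nonneg_off_negligible[OF _ Z])
      (use ptw h2i[OF c1sq, of 0] Bi in \<open>auto intro!: integrable_diff integrable_on_mult_right\<close>)
  moreover have "integral ?R (\<lambda>z. (1 + a) * Bf z - orientation s * (h'' (snd z) * (c1 (0, z))\<^sup>2)) =
      (1 + a) * integral ?R Bf - orientation s * A"
    unfolding A_def using h2i[OF c1sq, of 0] Bi
    by (subst HK_integral_diff) (auto intro!: integrable_on_mult_right)
  ultimately show ?thesis
    using that[OF N_lim K_lim] Bint by simp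
qed


section \<open>The energy balance\<close>

definition grad_u_sq :: "real \<Rightarrow> real \<times> real \<Rightarrow> real" where
  "grad_u_sq t x = (pd1 (u1 t) x)\<^sup>2 + (pd2 (u1 t) x)\<^sup>2 + (pd1 (u2 t) x)\<^sup>2 + (pd2 (u2 t) x)\<^sup>2"

text \<open>
  Truncated at distance \<open>\<epsilon>\<close> from both sides, since \<open>\<nabla>u\<close> need not be bounded near the boundary.
\<close>

definition dissipation :: "real \<Rightarrow> real \<Rightarrow> real \<Rightarrow> real" where
  "dissipation t0 T \<epsilon> = integral (cbox (t0, 0, \<epsilon>) (T, \<Gamma>, 1 - \<epsilon>)) (straight h grad_u_sq)"

definition kinetic_density :: "real \<Rightarrow> real \<times> real \<Rightarrow> real" where
  "kinetic_density t x = (u1 t x * u1 t x + u2 t x * u2 t x) * (1 / (2 * Pr))"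

definition kinetic_energy :: "real \<Rightarrow> real" where
  "kinetic_energy t = integral (cbox (0, 0) (\<Gamma>, 1)) (\<lambda>z. straight h kinetic_density (t, z))"

lemma grad_u_sq_cont: "jointly_continuous S grad_u_sq"
  unfolding grad_u_sq_def by (intro jc)+

lemma p_partials:
  assumes "0 < t" "x \<in> S" shows "has_partials (p t) (pd1 (p t) x) (pd2 (p t) x) x"
  by (rule differentiable_has_partials) (use sol assms in \<open>simp add: RB_solution_def\<close>)

lemma grad_p_cont: "jointly_continuous S (\<lambda>t. pd1 (p t))" "jointly_continuous S (\<lambda>t. pd2 (p t))"
proof -
  have "jointly_continuous S (\<lambda>t x. pd1 (pd1 (u1 t)) x + pd2 (pd2 (u1 t)) x
           - (1 / Pr) * (pdt u1 t x + u1 t x * pd1 (u1 t) x + u2 t x * pd2 (u1 t) x))"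
    by (intro jc)
  then show "jointly_continuous S (\<lambda>t. pd1 (p t))"
    by (rule jointly_continuous_cong) (simp add: equations(1))
  have "jointly_continuous S (\<lambda>t x. Ra * \<theta> t x + pd1 (pd1 (u2 t)) x + pd2 (pd2 (u2 t)) x
           - (1 / Pr) * (pdt u2 t x + u1 t x * pd1 (u2 t) x + u2 t x * pd2 (u2 t) x))"
    by (intro jc)
  then show "jointly_continuous S (\<lambda>t. pd2 (p t))"
    by (rule jointly_continuous_cong) (simp add: equations(2))
qed

lemma slice_Bottom_Top: "slice h Bottom \<epsilon> x = (x, h x + \<epsilon>)" "slice h Top \<epsilon> x = (x, h x + (1 - \<epsilon>))"
  by auto

text \<open>
  The momentum equation times \<open>u\<close>, in divergence form: with \<open>k = \<bar>u\<bar>\<^sup>2 / (2 Pr)\<close> one has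
  \<open>\<partial>\<^sub>t k + div ((k + p) u - (u \<bullet> \<partial>\<^sub>1u, u \<bullet> \<partial>\<^sub>2u)) = Ra \<theta> u\<^sub>2 - \<bar>\<nabla>u\<bar>\<^sup>2\<close>.
\<close>

lemma energy_identity:
  assumes t: "0 < t0" "t0 \<le> T" and \<epsilon>: "0 < \<epsilon>" "\<epsilon> < 1/2"
  shows "Ra * integral (cbox (t0, 0, \<epsilon>) (T, \<Gamma>, 1 - \<epsilon>)) (\<lambda>z. straight h \<theta> z * straight h u2 z) - dissipation t0 T \<epsilon> =
      integral (cbox (0, \<epsilon>) (\<Gamma>, 1 - \<epsilon>)) (\<lambda>z. straight h kinetic_density (T, z) - straight h kinetic_density (t0, z))
      - (integral (cbox (t0, 0) (T, \<Gamma>)) (\<lambda>z. traction (fst z) (slice h Top \<epsilon> (snd z)))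
         - integral (cbox (t0, 0) (T, \<Gamma>)) (\<lambda>z. traction (fst z) (slice h Bottom \<epsilon> (snd z))))"
proof -
  define c where "c = 1 / (2 * Pr)"
  define m where "m t x = (u1 t x * u1 t x + u2 t x * u2 t x) * c + p t x" for t x
  define m1 where "m1 t x = 2 * c * (u1 t x * pd1 (u1 t) x + u2 t x * pd1 (u2 t) x) + pd1 (p t) x" for t x
  define m2 where "m2 t x = 2 * c * (u1 t x * pd2 (u1 t) x + u2 t x * pd2 (u2 t) x) + pd2 (p t) x" for t x
  define V1 where "V1 t x = m t x * u1 t x - (u1 t x * pd1 (u1 t) x + u2 t x * pd1 (u2 t) x)" for t x
  define V2 where "V2 t x = m t x * u2 t x - (u1 t x * pd2 (u1 t) x + u2 t x * pd2 (u2 t) x)" for t x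
  have mp: "has_partials (m t) (m1 t x) (m2 t x) x" if "0 < t" "x \<in> S" for t x
  proof -
    note d = u1_C12(2)[OF that] u2_C12(2)[OF that]
    show ?thesis
      unfolding m_def
      by (rule has_partials_eq_rhs[OF has_partials_add[OF has_partials_mult[OF has_partials_add[OF
              has_partials_mult[OF d(1) d(1)] has_partials_mult[OF d(2) d(2)]] has_partials_const] p_partials[OF that]]])
        (simp_all add: m1_def m2_def algebra_simps)
  qed
  have mc: "jointly_continuous S m" "jointly_continuous S m1" "jointly_continuous S m2"
    unfolding m_def m1_def m2_def by (intro jc p_cont grad_p_cont)+
  let ?dq = "\<lambda>t x. 2 * (u1 t x * pdt u1 t x + u2 t x * pdt u2 t x) * c"
  let ?P1 = "\<lambda>t x. m t x * pd1 (u1 t) x + m1 t x * u1 t x - ((u1 t x * pd1 (pd1 (u1 t)) x + pd1 (u1 t) x * pd1 (u1 t) x)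
          + (u2 t x * pd1 (pd1 (u2 t)) x + pd1 (u2 t) x * pd1 (u2 t) x))"
  let ?Q1 = "\<lambda>t x. m t x * pd2 (u1 t) x + m2 t x * u1 t x - ((u1 t x * pd2 (pd1 (u1 t)) x + pd2 (u1 t) x * pd1 (u1 t) x)
          + (u2 t x * pd2 (pd1 (u2 t)) x + pd2 (u2 t) x * pd1 (u2 t) x))"
  let ?P2 = "\<lambda>t x. m t x * pd1 (u2 t) x + m1 t x * u2 t x - ((u1 t x * pd1 (pd2 (u1 t)) x + pd1 (u1 t) x * pd2 (u1 t) x)
          + (u2 t x * pd1 (pd2 (u2 t)) x + pd1 (u2 t) x * pd2 (u2 t) x))"
  let ?Q2 = "\<lambda>t x. m t x * pd2 (u2 t) x + m2 t x * u2 t x - ((u1 t x * pd2 (pd2 (u1 t)) x + pd2 (u1 t) x * pd2 (u1 t) x)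
          + (u2 t x * pd2 (pd2 (u2 t)) x + pd2 (u2 t) x * pd2 (u2 t) x))"
  have id: "integral (cbox (t0, 0, \<epsilon>) (T, \<Gamma>, 1 - \<epsilon>)) (straight h (\<lambda>t x. ?dq t x + ?P1 t x + ?Q2 t x)) =
      integral (cbox (0, \<epsilon>) (\<Gamma>, 1 - \<epsilon>)) (\<lambda>z. straight h kinetic_density (T, z) - straight h kinetic_density (t0, z)) +
      (integral (cbox (t0, 0) (T, \<Gamma>)) (\<lambda>(t, x). V2 t (x, h x + (1 - \<epsilon>)) - h' x * V1 t (x, h x + (1 - \<epsilon>))) -
       integral (cbox (t0, 0) (T, \<Gamma>)) (\<lambda>(t, x). V2 t (x, h x + \<epsilon>) - h' x * V1 t (x, h x + \<epsilon>)))"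
  proof (rule strip_divergence[where ?V1.0 = V1 and ?V2.0 = V2 and dq = ?dq and ?P1.0 = ?P1 and ?Q1.0 = ?Q1
        and ?P2.0 = ?P2 and ?Q2.0 = ?Q2, OF h_deriv h'_cont per \<Gamma>])
    show "x1_periodic_on S \<Gamma> (V1 t)" if "0 < t" for t
      using periodic_S[OF that] periodic_strip(4)[OF that] by (auto simp: x1_periodic_on_def V1_def m_def)
    show "((\<lambda>r. kinetic_density r x) has_real_derivative ?dq t x) (at t)" if "0 < t" "x \<in> S" for t x
      unfolding kinetic_density_def c_def[symmetric] using u1_C12(1)[OF that] u2_C12(1)[OF that]
      by (auto intro!: derivative_eq_intros)
    show "has_partials (V1 t) (?P1 t x) (?Q1 t x) x" if "0 < t" "x \<in> S" for t x
      unfolding V1_def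
      by (intro hp has_partials_add mp[OF that] u1_C12(2,3)[OF that] u2_C12(2,3)[OF that])
    show "has_partials (V2 t) (?P2 t x) (?Q2 t x) x" if "0 < t" "x \<in> S" for t x
      unfolding V2_def
      by (intro hp has_partials_add mp[OF that] u1_C12(2,4)[OF that] u2_C12(2,4)[OF that])
    show "jointly_continuous S V1" "jointly_continuous S V2" unfolding V1_def V2_def by (intro jc mc)+
    show "0 < t0" "t0 \<le> T" "0 < \<epsilon>" "\<epsilon> \<le> 1 - \<epsilon>" "1 - \<epsilon> < 1" using t \<epsilon> by auto
  qed (intro jc mc)+
  have D: "?dq t x + ?P1 t x + ?Q2 t x = Ra * (\<theta> t x * u2 t x) - grad_u_sq t x" if "0 < t" "x \<in> S" for t x
  proof -
    have a: "pd2 (u2 t) x = - pd1 (u1 t) x" using equations(3)[OF that] by simp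
    have e1: "pd1 (p t) x = pd1 (pd1 (u1 t)) x + pd2 (pd2 (u1 t)) x
           - 2 * c * (pdt u1 t x + u1 t x * pd1 (u1 t) x + u2 t x * pd2 (u1 t) x)"
      using equations(1)[OF that] by (simp add: c_def)
    have e2: "pd2 (p t) x = Ra * \<theta> t x + pd1 (pd1 (u2 t)) x + pd2 (pd2 (u2 t)) x
           - 2 * c * (pdt u2 t x + u1 t x * pd1 (u2 t) x + u2 t x * pd2 (u2 t) x)"
      using equations(2)[OF that] by (simp add: c_def)
    show ?thesis
      unfolding m1_def m2_def e1 e2 grad_u_sq_def a by (simp add: algebra_simps power2_eq_square)
  qed
  have inB: "0 < t' \<and> (x, h x + r) \<in> S" if "(t', x, r) \<in> cbox (t0, 0, \<epsilon>) (T, \<Gamma>, 1 - \<epsilon>)" for t' x r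
    using that t \<epsilon> by (auto simp: open_strip_def cbox_Pair_eq)
  have "integral (cbox (t0, 0, \<epsilon>) (T, \<Gamma>, 1 - \<epsilon>)) (straight h (\<lambda>t x. ?dq t x + ?P1 t x + ?Q2 t x)) =
      integral (cbox (t0, 0, \<epsilon>) (T, \<Gamma>, 1 - \<epsilon>)) (\<lambda>z. Ra * (straight h \<theta> z * straight h u2 z) - straight h grad_u_sq z)"
  proof (rule HK_integral_cong)
    fix z assume z: "z \<in> cbox (t0, 0, \<epsilon>) (T, \<Gamma>, 1 - \<epsilon>)"
    obtain t' x r where "z = (t', x, r)" by (cases z)
    with inB z D[of t' "(x, h x + r)"]
    show "straight h (\<lambda>t x. ?dq t x + ?P1 t x + ?Q2 t x) z = Ra * (straight h \<theta> z * straight h u2 z) - straight h grad_u_sq z"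
      by (simp only: straight_apply)
  qed
  also have "\<dots> = Ra * integral (cbox (t0, 0, \<epsilon>) (T, \<Gamma>, 1 - \<epsilon>)) (\<lambda>z. straight h \<theta> z * straight h u2 z) - dissipation t0 T \<epsilon>"
  proof -
    have "(\<lambda>z. Ra * (straight h \<theta> z * straight h u2 z)) integrable_on cbox (t0, 0, \<epsilon>) (T, \<Gamma>, 1 - \<epsilon>)"
      by (intro integrable_continuous continuous_intros straight_cont_closed cont_strip) (use t \<epsilon> in auto)
    moreover have "straight h grad_u_sq integrable_on cbox (t0, 0, \<epsilon>) (T, \<Gamma>, 1 - \<epsilon>)"
      by (intro integrable_continuous straight_cont_inside grad_u_sq_cont) (use t \<epsilon> in auto)
    ultimately show ?thesis
      by (simp add: HK_integral_diff dissipation_def)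
  qed
  finally have lhs: "integral (cbox (t0, 0, \<epsilon>) (T, \<Gamma>, 1 - \<epsilon>)) (straight h (\<lambda>t x. ?dq t x + ?P1 t x + ?Q2 t x)) =
    Ra * integral (cbox (t0, 0, \<epsilon>) (T, \<Gamma>, 1 - \<epsilon>)) (\<lambda>z. straight h \<theta> z * straight h u2 z) - dissipation t0 T \<epsilon>" .
  have tr: "V2 t (x, y) - h' x * V1 t (x, y) = - traction t (x, y)" for t x y
    unfolding V1_def V2_def m_def traction_def c_def[symmetric] by (simp add: algebra_simps)
  have "integral (cbox (t0, 0) (T, \<Gamma>)) (\<lambda>(t, x). V2 t (x, h x + (1 - \<epsilon>)) - h' x * V1 t (x, h x + (1 - \<epsilon>))) =
      - integral (cbox (t0, 0) (T, \<Gamma>)) (\<lambda>z. traction (fst z) (slice h Top \<epsilon> (snd z)))"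
    "integral (cbox (t0, 0) (T, \<Gamma>)) (\<lambda>(t, x). V2 t (x, h x + \<epsilon>) - h' x * V1 t (x, h x + \<epsilon>)) =
      - integral (cbox (t0, 0) (T, \<Gamma>)) (\<lambda>z. traction (fst z) (slice h Bottom \<epsilon> (snd z)))"
    unfolding tr slice_Bottom_Top by (simp_all add: case_prod_unfold)
  then show ?thesis using id unfolding lhs by simp
qed

text \<open>
  Pointwise \<open>\<bar>\<nabla>u\<bar>\<^sup>2 - 2 det \<nabla>u = (\<partial>\<^sub>1u\<^sub>1 - \<partial>\<^sub>2u\<^sub>2)\<^sup>2 + (\<partial>\<^sub>2u\<^sub>1 + \<partial>\<^sub>1u\<^sub>2)\<^sup>2\<close>, and the determinant is the divergence of
  \<open>(u\<^sub>1 \<partial>\<^sub>2u\<^sub>2, - u\<^sub>1 \<partial>\<^sub>1u\<^sub>2)\<close>.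
\<close>

lemma dissipation_lower_bound:
  assumes t: "0 < t0" "t0 \<le> T" and \<epsilon>: "0 < \<epsilon>" "\<epsilon> < 1/2"
  shows "2 * (integral (cbox (t0, 0) (T, \<Gamma>)) (\<lambda>z. shear (fst z) (slice h Bottom \<epsilon> (snd z)))
      - integral (cbox (t0, 0) (T, \<Gamma>)) (\<lambda>z. shear (fst z) (slice h Top \<epsilon> (snd z)))) \<le> dissipation t0 T \<epsilon>"
proof -
  let ?B = "cbox (t0, 0, \<epsilon>) (T, \<Gamma>, 1 - \<epsilon>)"
  let ?P1 = "\<lambda>t x. u1 t x * pd1 (pd2 (u2 t)) x + pd1 (u1 t) x * pd2 (u2 t) x"
  let ?Q1 = "\<lambda>t x. u1 t x * pd2 (pd2 (u2 t)) x + pd2 (u1 t) x * pd2 (u2 t) x"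
  let ?P2 = "\<lambda>t x. - (u1 t x * pd1 (pd1 (u2 t)) x + pd1 (u1 t) x * pd1 (u2 t) x)"
  let ?Q2 = "\<lambda>t x. - (u1 t x * pd2 (pd1 (u2 t)) x + pd2 (u1 t) x * pd1 (u2 t) x)"
  let ?V1 = "\<lambda>t x. u1 t x * pd2 (u2 t) x" and ?V2 = "\<lambda>t x. - (u1 t x * pd1 (u2 t) x)"
  have id: "integral ?B (straight h (\<lambda>t x. 0 + ?P1 t x + ?Q2 t x)) =
      integral (cbox (0, \<epsilon>) (\<Gamma>, 1 - \<epsilon>)) (\<lambda>z. straight h (\<lambda>t x. 0) (T, z) - straight h (\<lambda>t x. 0) (t0, z)) +
      (integral (cbox (t0, 0) (T, \<Gamma>)) (\<lambda>(t, x). ?V2 t (x, h x + (1 - \<epsilon>)) - h' x * ?V1 t (x, h x + (1 - \<epsilon>))) -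
       integral (cbox (t0, 0) (T, \<Gamma>)) (\<lambda>(t, x). ?V2 t (x, h x + \<epsilon>) - h' x * ?V1 t (x, h x + \<epsilon>)))"
  proof (rule strip_divergence[where ?V1.0 = ?V1 and ?V2.0 = ?V2 and q = "\<lambda>t x. 0" and dq = "\<lambda>t x. 0" and ?P1.0 = ?P1 and ?Q1.0 = ?Q1
        and ?P2.0 = ?P2 and ?Q2.0 = ?Q2, OF h_deriv h'_cont per \<Gamma>])
    show "x1_periodic_on S \<Gamma> (?V1 t)" if "0 < t" for t
      using periodic_S[OF that] by (auto simp: x1_periodic_on_def)
    show "has_partials (?V1 t) (?P1 t x) (?Q1 t x) x" if "0 < t" "x \<in> S" for t x
      by (intro hp u1_C12(2)[OF that] u2_C12(4)[OF that])
    show "has_partials (?V2 t) (?P2 t x) (?Q2 t x) x" if "0 < t" "x \<in> S" for t x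
      by (intro hp has_partials_minus u1_C12(2)[OF that] u2_C12(3)[OF that])
    show "0 < t0" "t0 \<le> T" "0 < \<epsilon>" "\<epsilon> \<le> 1 - \<epsilon>" "1 - \<epsilon> < 1" using t \<epsilon> by auto
    show "((\<lambda>r. 0) has_real_derivative 0) (at t)" for t by simp
  qed (intro jc)+
  have bd: "integral (cbox (t0, 0) (T, \<Gamma>)) (\<lambda>(t, x). ?V2 t (x, h x + r) - h' x * ?V1 t (x, h x + r)) =
      - integral (cbox (t0, 0) (T, \<Gamma>)) (\<lambda>z. shear (fst z) (snd z, h (snd z) + r))" for r
    by (simp add: shear_def case_prod_unfold integral_neg[symmetric] algebra_simps del: integral_neg)
  have "2 * integral ?B (straight h (\<lambda>t x. 0 + ?P1 t x + ?Q2 t x)) = integral ?B (\<lambda>z. 2 * straight h (\<lambda>t x. 0 + ?P1 t x + ?Q2 t x) z)"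
    by simp
  also have "\<dots> \<le> integral ?B (straight h grad_u_sq)"
  proof (rule integral_le)
    show "(\<lambda>z. 2 * straight h (\<lambda>t x. 0 + ?P1 t x + ?Q2 t x) z) integrable_on ?B"
      by (intro integrable_continuous continuous_on_mult continuous_on_const straight_cont_inside jc) (use t \<epsilon> in auto)
    show "straight h grad_u_sq integrable_on ?B"
      by (intro integrable_continuous straight_cont_inside grad_u_sq_cont) (use t \<epsilon> in auto)
    fix z assume z: "z \<in> ?B"
    obtain t' x r where z': "z = (t', x, r)" by (cases z)
    define y where "y = (x, h x + r)"
    have ty: "0 < t'" "y \<in> S" using z z' t \<epsilon> by (auto simp: open_strip_def cbox_Pair_eq y_def)
    have ct: "continuous_on S (w t')" if "jointly_continuous S w" for w :: "real \<Rightarrow> real \<times> real \<Rightarrow> real"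
    proof -
      have "continuous_on S (\<lambda>x. (\<lambda>z. w (fst z) (snd z)) (t', x))"
        by (rule continuous_on_compose2[OF jointly_continuousD[OF that] continuous_on_Pair[OF continuous_on_const continuous_on_id]])
          (use ty in auto)
      then show ?thesis by simp
    qed
    have "pd2 (pd1 (u2 t')) y = pd1 (pd2 (u2 t')) y"
      by (rule mixed_partials_commute[OF S_open ty(2) u2_C12(2)[OF ty(1)] u2_C12(3)[OF ty(1)] u2_C12(4)[OF ty(1)]
            ct[OF u2_C12(10)] ct[OF u2_C12(11)]])
    then have "2 * (0 + ?P1 t' y + ?Q2 t' y) = 2 * (pd1 (u1 t') y * pd2 (u2 t') y - pd2 (u1 t') y * pd1 (u2 t') y)"
      by (simp add: algebra_simps)
    also have "\<dots> = grad_u_sq t' y - ((pd1 (u1 t') y - pd2 (u2 t') y)\<^sup>2 + (pd2 (u1 t') y + pd1 (u2 t') y)\<^sup>2)"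
      by (simp add: grad_u_sq_def power2_eq_square algebra_simps)
    also have "\<dots> \<le> grad_u_sq t' y" by simp
    finally show "2 * straight h (\<lambda>t x. 0 + ?P1 t x + ?Q2 t x) z \<le> straight h grad_u_sq z"
      unfolding z' straight_apply y_def .
  qed
  finally show ?thesis
    unfolding id bd slice_Bottom_Top dissipation_def by (simp add: straight_def case_prod_unfold)
qed

lemma dissipation_mono:
  assumes t: "0 < t0" and \<epsilon>: "0 < \<epsilon>'" "\<epsilon>' \<le> \<epsilon>"
  shows "dissipation t0 T \<epsilon> \<le> dissipation t0 T \<epsilon>'"
  unfolding dissipation_def
proof (rule integral_subset_le)
  show "cbox (t0, 0, \<epsilon>) (T, \<Gamma>, 1 - \<epsilon>) \<subseteq> cbox (t0, 0, \<epsilon>') (T, \<Gamma>, 1 - \<epsilon>')" using \<epsilon> by (auto simp: cbox_Pair_eq)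
  show "straight h grad_u_sq integrable_on cbox (t0, 0, \<epsilon>) (T, \<Gamma>, 1 - \<epsilon>)"
    "straight h grad_u_sq integrable_on cbox (t0, 0, \<epsilon>') (T, \<Gamma>, 1 - \<epsilon>')"
    by (intro integrable_continuous straight_cont_inside grad_u_sq_cont; use t \<epsilon> in auto)+
qed (auto simp: straight_def grad_u_sq_def)

lemma kinetic_density_cont: "jointly_continuous (strip h) kinetic_density"
  unfolding kinetic_density_def by (intro jointly_continuous_intros cont_strip)

lemma kinetic_energy_integrable:
  assumes "0 < t"
  shows "continuous_on (cbox (0, 0) (\<Gamma>, 1)) (\<lambda>z. straight h kinetic_density (t, z))"
  by (rule continuous_on_compose2[OF straight_cont_closed[OF kinetic_density_cont, of t 0 1 0 t \<Gamma>]])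
    (use assms in \<open>auto intro!: continuous_intros simp: cbox_Pair_eq\<close>)

lemma kinetic_energy_nonneg: "0 < t \<Longrightarrow> 0 \<le> kinetic_energy t"
  unfolding kinetic_energy_def
  by (intro integral_nonneg integrable_continuous kinetic_energy_integrable)
    (use Pr in \<open>auto simp: straight_def kinetic_density_def\<close>)

text \<open>
  The common form of the two hypotheses on the slip coefficient; the first of them is the case \<open>a = 0\<close>.
\<close>

definition slip_dominates_curvature :: "real \<Rightarrow> bool" where
  "slip_dominates_curvature a \<longleftrightarrow> 0 \<le> a \<and> AE_bdry \<Gamma> (\<lambda>s x.
     0 < \<alpha> (bdry h s x) \<and> - curvature h s x \<le> 2 * \<alpha> (bdry h s x) * (1 + a))"

text \<open>
  The limit \<open>\<epsilon> \<rightarrow> 0\<close> of the energy balance and of the lower bound. The lower bound shows that the friction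
  on both sides is at most the available work \<open>R\<close>, and the hypothesis bounds the negative part of the
  curvature terms by \<open>a\<close> times the friction.
\<close>

theorem dissipation_upper_bound:
  assumes t: "0 < t0" "t0 < T" and a: "slip_dominates_curvature a" and \<epsilon>: "0 < \<epsilon>" "\<epsilon> < 1/2"
  shows "dissipation t0 T \<epsilon> \<le> (1 + a) * (Ra * buoyancy_work t0 T + kinetic_energy t0)"
proof -
  have a0: "0 \<le> a" and sl: "AE x in lebesgue_on {0..\<Gamma>}. 0 < \<alpha> (bdry h s x) \<and> - curvature h s x \<le> 2 * \<alpha> (bdry h s x) * (1 + a)" for s
    using a by (auto simp: slip_dominates_curvature_def AE_bdry_def)
  let ?tr = "\<lambda>s \<epsilon>. integral (cbox (t0, 0) (T, \<Gamma>)) (\<lambda>z. traction (fst z) (slice h s \<epsilon> (snd z)))"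
  let ?sh = "\<lambda>s \<epsilon>. integral (cbox (t0, 0) (T, \<Gamma>)) (\<lambda>z. shear (fst z) (slice h s \<epsilon> (snd z)))"
  obtain Nb Ab where b: "(?tr Bottom \<longlongrightarrow> Nb) (at_right 0)" "(?sh Bottom \<longlongrightarrow> Ab / 2) (at_right 0)"
    "0 \<le> Nb + Ab" "Ab \<le> (1 + a) * (Nb + Ab)"
    using boundary_work_limits[OF t a0 sl[of Bottom]] by auto
  obtain Nt At where tp: "(?tr Top \<longlongrightarrow> Nt) (at_right 0)" "(?sh Top \<longlongrightarrow> At / 2) (at_right 0)"
    "0 \<le> - (Nt + At)" "- At \<le> (1 + a) * (- (Nt + At))"
    using boundary_work_limits[OF t a0 sl[of Top]] by auto
  let ?W = "\<lambda>\<epsilon>. integral (cbox (t0, 0, \<epsilon>) (T, \<Gamma>, 1 - \<epsilon>)) (\<lambda>z. straight h \<theta> z * straight h u2 z)"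
  let ?K = "\<lambda>\<epsilon>. integral (cbox (0, \<epsilon>) (\<Gamma>, 1 - \<epsilon>)) (\<lambda>z. straight h kinetic_density (T, z) - straight h kinetic_density (t0, z))"
  have W: "(?W \<longlongrightarrow> buoyancy_work t0 T) (at_right 0)"
    unfolding buoyancy_work_def
    by (intro integral_exhaustion_tendsto continuous_intros straight_cont_closed cont_strip) (use t in auto)
  have K: "(?K \<longlongrightarrow> kinetic_energy T - kinetic_energy t0) (at_right 0)"
  proof -
    have "(?K \<longlongrightarrow> integral (cbox (0, 0) (\<Gamma>, 1)) (\<lambda>z. straight h kinetic_density (T, z) - straight h kinetic_density (t0, z))) (at_right 0)"
      by (intro integral_exhaustion_tendsto_2 continuous_intros kinetic_energy_integrable) (use t in auto)
    then show ?thesis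
      using HK_integral_diff[OF integrable_continuous[OF kinetic_energy_integrable[of T]]
          integrable_continuous[OF kinetic_energy_integrable[of t0]]] t
      by (simp add: kinetic_energy_def)
  qed
  define R where "R = Ra * buoyancy_work t0 T - (kinetic_energy T - kinetic_energy t0)"
  have small: "eventually (\<lambda>\<epsilon>::real. 0 < \<epsilon> \<and> \<epsilon> < 1/2) (at_right 0)"
    by (auto simp: eventually_at_right_field intro!: exI[of _ "1/2"])
  have "((\<lambda>\<epsilon>. Ra * ?W \<epsilon> - ?K \<epsilon> + (?tr Top \<epsilon> - ?tr Bottom \<epsilon>)) \<longlongrightarrow> R + (Nt - Nb)) (at_right 0)"
    unfolding R_def by (intro tendsto_intros W K b tp)
  then have D: "(dissipation t0 T \<longlongrightarrow> R + (Nt - Nb)) (at_right 0)"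
    by (rule Lim_transform_eventually, intro eventually_mono[OF small])
      (use energy_identity[of t0 T] t in \<open>simp add: algebra_simps\<close>)
  have "2 * (Ab / 2 - At / 2) \<le> R + (Nt - Nb)"
  proof (rule tendsto_le[OF _ D])
    show "((\<lambda>\<epsilon>. 2 * (?sh Bottom \<epsilon> - ?sh Top \<epsilon>)) \<longlongrightarrow> 2 * (Ab / 2 - At / 2)) (at_right 0)"
      by (intro tendsto_intros b tp)
    show "\<forall>\<^sub>F \<epsilon> in at_right 0. 2 * (?sh Bottom \<epsilon> - ?sh Top \<epsilon>) \<le> dissipation t0 T \<epsilon>"
      by (rule eventually_mono[OF small]) (use dissipation_lower_bound t in auto)
  qed simp
  then have slip_work: "(Nb + Ab) + - (Nt + At) \<le> R" by simp
  have "dissipation t0 T \<epsilon> \<le> R + (Nt - Nb)"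
  proof (rule tendsto_lowerbound[OF D])
    show "\<forall>\<^sub>F \<epsilon>' in at_right 0. dissipation t0 T \<epsilon> \<le> dissipation t0 T \<epsilon>'"
      using dissipation_mono[OF t(1)] \<epsilon> by (auto simp: eventually_at_right_field intro!: exI[of _ \<epsilon>])
  qed simp
  also have "\<dots> \<le> R + a * ((Nb + Ab) + - (Nt + At))"
    using b(4) tp(4) by (simp add: algebra_simps)
  also have "\<dots> \<le> R + a * R"
    using slip_work a0 by (intro add_left_mono mult_left_mono)
  also have "\<dots> = (1 + a) * R" by (simp add: algebra_simps)
  also have "\<dots> \<le> (1 + a) * (Ra * buoyancy_work t0 T + kinetic_energy t0)"
    using a0 kinetic_energy_nonneg[of T] t by (intro mult_left_mono) (auto simp: R_def)
  finally show ?thesis .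
qed

end

section \<open>The layer at the lower boundary\<close>

lemma integral_box_inner:
  fixes f :: "real \<times> real \<times> real \<Rightarrow> real"
  assumes f: "continuous_on (cbox (t0, x0, a) (T, x1, b)) f"
  shows "continuous_on (cbox (t0, x0) (T, x1)) (\<lambda>(t, x). integral {a..b} (\<lambda>s. f (t, x, s)))"
    and "integral (cbox (t0, x0, a) (T, x1, b)) f =
      integral (cbox (t0, x0) (T, x1)) (\<lambda>(t, x). integral {a..b} (\<lambda>s. f (t, x, s)))"
proof -
  have "continuous_on (cbox (t0, x0) (T, x1) \<times> cbox a b) (\<lambda>(z, s). f (fst z, snd z, s))"
    unfolding case_prod_unfold
    by (rule continuous_on_compose2[OF f]) (auto intro!: continuous_intros simp: cbox_Pair_eq)
  from integral_continuous_on_param[OF this]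
  show c: "continuous_on (cbox (t0, x0) (T, x1)) (\<lambda>(t, x). integral {a..b} (\<lambda>s. f (t, x, s)))"
    by (simp add: case_prod_unfold)
  have ct: "continuous_on (cbox (x0, a) (x1, b)) (\<lambda>y. f (t, y))" if "t \<in> {t0..T}" for t
    by (rule continuous_on_compose2[OF f]) (use that in \<open>auto intro!: continuous_intros simp: cbox_Pair_eq\<close>)
  have "integral (cbox (t0, x0, a) (T, x1, b)) f =
      integral {t0..T} (\<lambda>t. integral (cbox (x0, a) (x1, b)) (\<lambda>y. f (t, y)))"
    using integral_prod_continuous[OF f] by simp
  also have "\<dots> = integral {t0..T} (\<lambda>t. integral {x0..x1} (\<lambda>x. integral {a..b} (\<lambda>s. f (t, x, s))))"
    by (intro HK_integral_cong) (use integral_prod_continuous[OF ct] in simp)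
  also have "\<dots> = integral (cbox (t0, x0) (T, x1)) (\<lambda>(t, x). integral {a..b} (\<lambda>s. f (t, x, s)))"
    using integral_prod_continuous[OF c] by simp
  finally show "integral (cbox (t0, x0, a) (T, x1, b)) f =
      integral (cbox (t0, x0) (T, x1)) (\<lambda>(t, x). integral {a..b} (\<lambda>s. f (t, x, s)))" .
qed

context Rayleigh_Benard
begin

text \<open>
  The velocity \<open>u \<bullet> (-h', 1)\<close> across the graphs \<open>s = const\<close>.
\<close>

definition normal_velocity :: "real \<times> real \<times> real \<Rightarrow> real" where
  "normal_velocity z = straight h u2 z - h' (fst (snd z)) * straight h u1 z"

lemma normal_velocity_cont:
  "0 < t0 \<Longrightarrow> 0 \<le> a \<Longrightarrow> b \<le> 1 \<Longrightarrow> continuous_on (cbox (t0, x0, a) (T, x1, b)) normal_velocity"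
  unfolding normal_velocity_def by (intro continuous_intros straight_cont_closed cont_strip h'_cont_box)

text \<open>
  Cauchy-Schwarz for \<open>(c, b) \<bullet> (-h', 1)\<close> followed by Young's inequality. It serves for \<open>\<partial>\<^sub>2u\<close> as well as for
  \<open>\<nabla>\<theta>\<close>.
\<close>

lemma normal_Young:
  fixes c \<mu> :: real
  assumes "\<mu> > 0"
  shows "\<bar>b - h' x * c\<bar> \<le> (\<mu> * (1 + L\<^sup>2) + (c\<^sup>2 + b\<^sup>2) / \<mu>) / 2"
proof -
  have 1: "(b - h' x * c)\<^sup>2 \<le> (1 + (h' x)\<^sup>2) * (c\<^sup>2 + b\<^sup>2)"
  proof -
    have "(1 + (h' x)\<^sup>2) * (c\<^sup>2 + b\<^sup>2) - (b - h' x * c)\<^sup>2 = (h' x * b + c)\<^sup>2"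
      by (simp add: power2_eq_square algebra_simps)
    then show ?thesis by (metis diff_ge_0_iff_ge zero_le_power2)
  qed
  have "(h' x)\<^sup>2 \<le> L\<^sup>2" using h'_bound[of x] L_nonneg by (simp add: abs_le_square_iff[symmetric])
  then have 2: "(b - h' x * c)\<^sup>2 \<le> (1 + L\<^sup>2) * (c\<^sup>2 + b\<^sup>2)"
    using 1 by (smt (verit) mult_right_mono sum_power2_ge_zero)
  define A where "A = sqrt (\<mu> * (1 + L\<^sup>2))"
  define B where "B = sqrt ((c\<^sup>2 + b\<^sup>2) / \<mu>)"
  have A2: "A\<^sup>2 = \<mu> * (1 + L\<^sup>2)" and B2: "B\<^sup>2 = (c\<^sup>2 + b\<^sup>2) / \<mu>"
    unfolding A_def B_def using assms by (simp_all add: add_nonneg_nonneg)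
  have AB: "(A * B)\<^sup>2 = (1 + L\<^sup>2) * (c\<^sup>2 + b\<^sup>2)"
    unfolding power_mult_distrib A2 B2 using assms by simp
  have "0 \<le> A * B" unfolding A_def B_def using assms by (intro mult_nonneg_nonneg) auto
  then have "\<bar>b - h' x * c\<bar> \<le> A * B"
    using 2 unfolding AB[symmetric] by (simp add: abs_le_square_iff[symmetric])
  also have "\<dots> \<le> (A\<^sup>2 + B\<^sup>2) / 2"
    using sum_squares_bound[of A B] by simp
  finally show ?thesis unfolding A2 B2 .
qed

text \<open>
  Along a vertical line the normal velocity grows from zero with derivative \<open>\<partial>\<^sub>2u \<bullet> (-h', 1)\<close>. The
  integration starts at the level \<open>\<epsilon> > 0\<close> because this derivative is only known inside the strip.
\<close>

lemma normal_velocity_bound: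
  assumes t: "0 < t0" "t0 \<le> T" and s: "0 \<le> s" "s \<le> 1/2" and \<mu>: "\<mu> > 0"
    and D: "\<And>\<epsilon>. 0 < \<epsilon> \<Longrightarrow> \<epsilon> < 1/2 \<Longrightarrow> dissipation t0 T \<epsilon> \<le> D"
  shows "integral (cbox (t0, 0) (T, \<Gamma>)) (\<lambda>(t, x). \<bar>normal_velocity (t, x, s)\<bar>)
    \<le> (\<mu> * (1 + L\<^sup>2) * (s * \<Gamma> * (T - t0)) + D / \<mu>) / 2"
proof -
  let ?R = "cbox (t0, 0) (T, \<Gamma>)"
  define N where "N r = integral ?R (\<lambda>(t, x). \<bar>normal_velocity (t, x, r)\<bar>)" for r
  have nvc: "continuous_on (cbox (t0, 0, 0) (T, \<Gamma>, 1)) (\<lambda>z. \<bar>normal_velocity z\<bar>)"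
    by (intro continuous_intros normal_velocity_cont) (use t in auto)
  have Nc: "continuous_on {0..1} N"
    unfolding N_def using integral_slice_continuous[OF nvc] .
  have N0: "N 0 = 0"
    unfolding N_def
    by (rule integral_unique, rule has_integral_is_0)
      (use t no_penetration(1) in \<open>auto simp: normal_velocity_def cbox_Pair_eq\<close>)
  have Nlim: "(N \<longlongrightarrow> 0) (at_right 0)"
    using tendsto_at_right_0_compose[OF Nc, of 0 "\<lambda>\<epsilon>. \<epsilon>"] by (simp add: N0 tendsto_ident_at)
  have D0: "0 \<le> D"
  proof -
    have "0 \<le> dissipation t0 T (1/4)" unfolding dissipation_def
      by (intro integral_nonneg integrable_continuous straight_cont_inside grad_u_sq_cont)
        (use t in \<open>auto simp: straight_def grad_u_sq_def\<close>)
    then show ?thesis using D[of "1/4"] by simp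
  qed
  define R where "R = (\<mu> * (1 + L\<^sup>2) * (s * \<Gamma> * (T - t0)) + D / \<mu>) / 2"
  have R0: "0 \<le> R"
    unfolding R_def using t s \<mu> \<Gamma> D0 by (intro divide_nonneg_pos add_nonneg_nonneg mult_nonneg_nonneg) auto
  show ?thesis
  proof (cases "s = 0")
    case True
    then show ?thesis using N0 R0 by (simp add: N_def R_def)
  next
    case False
    have step: "N s \<le> N \<epsilon> + R" if \<epsilon>: "0 < \<epsilon>" "\<epsilon> < s" for \<epsilon>
    proof -
      let ?B = "cbox (t0, 0, \<epsilon>) (T, \<Gamma>, s)"
      define e where "e z = (\<mu> * (1 + L\<^sup>2) + straight h grad_u_sq z / \<mu>) / 2" for z
      have gc: "continuous_on ?B (straight h grad_u_sq)"
        by (rule straight_cont_inside[OF grad_u_sq_cont]) (use t s \<epsilon> in auto)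
      have ec: "continuous_on ?B e" unfolding e_def by (intro continuous_intros gc) (use \<mu> in auto)
      have dsl: "continuous_on ?R (\<lambda>(t, x). \<bar>normal_velocity (t, x, r)\<bar>)" if "r \<in> {0..1}" for r
        by (rule slice_integrable(1)[OF nvc that])
      have pt: "\<bar>normal_velocity (t', x, s)\<bar> \<le> \<bar>normal_velocity (t', x, \<epsilon>)\<bar> + integral {\<epsilon>..s} (\<lambda>r. e (t', x, r))"
        if z: "(t', x) \<in> ?R" for t' x
      proof -
        have t': "0 < t'" using z t by (auto simp: cbox_Pair_eq)
        define d where "d r = pd2 (u2 t') (x, h x + r) - h' x * pd2 (u1 t') (x, h x + r)" for r
        have der: "((\<lambda>r. normal_velocity (t', x, r)) has_real_derivative d r) (at r)" if r: "r \<in> {\<epsilon>..s}" for r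
        proof -
          have S: "(x, h x + r) \<in> S" using r \<epsilon> s by (auto simp: open_strip_def)
          have e1: "((\<lambda>r. h x + r) has_real_derivative 1) (at r)" by (auto intro!: derivative_eq_intros)
          have "((\<lambda>r. u1 t' (x, h x + r)) has_real_derivative pd2 (u1 t') (x, h x + r)) (at r)"
            "((\<lambda>r. u2 t' (x, h x + r)) has_real_derivative pd2 (u2 t') (x, h x + r)) (at r)"
            using DERIV_chain2[where f = "\<lambda>r. u1 t' (x, r)", OF has_partials_slices(2)[OF u1_C12(2)[OF t' S]] e1]
              DERIV_chain2[where f = "\<lambda>r. u2 t' (x, r)", OF has_partials_slices(2)[OF u2_C12(2)[OF t' S]] e1] by simp_all
          then show ?thesis unfolding normal_velocity_def d_def by (auto intro!: derivative_eq_intros)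
        qed
        have i: "(d has_integral normal_velocity (t', x, s) - normal_velocity (t', x, \<epsilon>)) {\<epsilon>..s}"
          by (rule fundamental_theorem_of_calculus)
            (use \<epsilon> der in \<open>auto simp: has_real_derivative_iff_has_vector_derivative intro: has_vector_derivative_at_within\<close>)
        have "norm (integral {\<epsilon>..s} d) \<le> integral {\<epsilon>..s} (\<lambda>r. e (t', x, r))"
        proof (rule HK_integral_norm_bound_integral)
          show "d integrable_on {\<epsilon>..s}" using i by blast
          show "(\<lambda>r. e (t', x, r)) integrable_on {\<epsilon>..s}"
            by (intro integrable_continuous_real continuous_on_compose2[OF ec])
              (use z in \<open>auto intro!: continuous_intros simp: cbox_Pair_eq\<close>)
          fix r assume "r \<in> {\<epsilon>..s}"
          have "\<bar>d r\<bar> \<le> (\<mu> * (1 + L\<^sup>2) + ((pd2 (u1 t') (x, h x + r))\<^sup>2 + (pd2 (u2 t') (x, h x + r))\<^sup>2) / \<mu>) / 2"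
            unfolding d_def by (rule normal_Young[OF \<mu>])
          also have "\<dots> \<le> e (t', x, r)"
            unfolding e_def straight_apply grad_u_sq_def using \<mu> by (intro divide_right_mono add_left_mono) auto
          finally show "norm (d r) \<le> e (t', x, r)" by simp
        qed
        then show ?thesis using integral_unique[OF i] by auto
      qed
      have "N s \<le> integral ?R (\<lambda>z. (case z of (t, x) \<Rightarrow> \<bar>normal_velocity (t, x, \<epsilon>)\<bar>) + (case z of (t, x) \<Rightarrow> integral {\<epsilon>..s} (\<lambda>r. e (t, x, r))))"
        unfolding N_def
      proof (rule integral_le)
        show "(\<lambda>(t, x). \<bar>normal_velocity (t, x, s)\<bar>) integrable_on ?R"
          by (intro integrable_continuous dsl) (use s in auto)
        show "(\<lambda>z. (case z of (t, x) \<Rightarrow> \<bar>normal_velocity (t, x, \<epsilon>)\<bar>) + (case z of (t, x) \<Rightarrow> integral {\<epsilon>..s} (\<lambda>r. e (t, x, r)))) integrable_on ?R"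
          by (intro integrable_add integrable_continuous dsl integral_box_inner(1)[OF ec]) (use s \<epsilon> in auto)
      qed (use pt in auto)
      also have "\<dots> = N \<epsilon> + integral ?B e"
        unfolding N_def integral_box_inner(2)[OF ec]
        by (rule HK_integral_add)
          (use s \<epsilon> in \<open>auto intro!: integrable_continuous dsl integral_box_inner(1)[OF ec]\<close>)
      also have "integral ?B e \<le> R"
      proof -
        have ci: "(\<lambda>z. \<mu> * (1 + L\<^sup>2)) integrable_on ?B" by (intro integrable_continuous continuous_on_const)
        have gi: "(\<lambda>z. straight h grad_u_sq z / \<mu>) integrable_on ?B"
          by (intro integrable_continuous continuous_intros gc) (use \<mu> in auto)
        have e_int: "integral ?B e = (integral ?B (\<lambda>z. \<mu> * (1 + L\<^sup>2)) + integral ?B (straight h grad_u_sq) / \<mu>) / 2"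
          unfolding e_def using HK_integral_add[OF ci gi] by simp
        have "integral ?B (\<lambda>z. \<mu> * (1 + L\<^sup>2)) = \<mu> * (1 + L\<^sup>2) * ((s - \<epsilon>) * \<Gamma> * (T - t0))"
          using t \<Gamma> \<epsilon> by (simp add: content_Pair)
        also have "\<dots> \<le> \<mu> * (1 + L\<^sup>2) * (s * \<Gamma> * (T - t0))"
          using t \<Gamma> \<epsilon> \<mu> by (intro mult_left_mono mult_right_mono) auto
        finally have vol: "integral ?B (\<lambda>z. \<mu> * (1 + L\<^sup>2)) \<le> \<mu> * (1 + L\<^sup>2) * (s * \<Gamma> * (T - t0))" .
        have "integral ?B (straight h grad_u_sq) \<le> dissipation t0 T \<epsilon>"
          unfolding dissipation_def
        proof (rule integral_subset_le)
          show "?B \<subseteq> cbox (t0, 0, \<epsilon>) (T, \<Gamma>, 1 - \<epsilon>)" using s \<epsilon> by (auto simp: cbox_Pair_eq)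
          show "straight h grad_u_sq integrable_on ?B" by (rule integrable_continuous[OF gc])
          show "straight h grad_u_sq integrable_on cbox (t0, 0, \<epsilon>) (T, \<Gamma>, 1 - \<epsilon>)"
            by (intro integrable_continuous straight_cont_inside grad_u_sq_cont) (use t s \<epsilon> in auto)
        qed (auto simp: straight_def grad_u_sq_def)
        then have diss: "integral ?B (straight h grad_u_sq) / \<mu> \<le> D / \<mu>"
          using D[of \<epsilon>] \<epsilon> s \<mu> by (intro divide_right_mono) auto
        show ?thesis unfolding R_def e_int by (rule divide_right_mono[OF add_mono[OF vol diss]]) simp
      qed
      finally show ?thesis by simp
    qed
    have "N s \<le> 0 + R"
    proof (rule tendsto_lowerbound)
      show "((\<lambda>\<epsilon>. N \<epsilon> + R) \<longlongrightarrow> 0 + R) (at_right 0)" by (intro tendsto_intros Nlim)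
      show "\<forall>\<^sub>F \<epsilon> in at_right 0. N s \<le> N \<epsilon> + R"
        using step False s by (auto simp: eventually_at_right_field intro!: exI[of _ s])
    qed simp
    then show ?thesis by (simp add: N_def R_def)
  qed
qed

text \<open>
  For each level \<open>s\<close> of the layer the conductive part is bounded by \<open>(1 + L\<^sup>2)/\<delta> + (\<delta>/4) \<bar>\<nabla>\<theta>\<bar>\<^sup>2\<close>, which is
  Young's inequality with weight \<open>2/\<delta>\<close>. Integration over \<open>0 \<le> s \<le> \<delta>\<close> and division by \<open>\<delta>\<close> turn the last
  term into a quarter of the dissipation of the temperature.
\<close>

lemma flux_le_layer_average:
  assumes t: "0 < t0" "t0 \<le> T" and \<delta>: "0 < \<delta>" "\<delta> \<le> 1/2" and c: "0 \<le> c"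
    and N: "\<And>s. 0 \<le> s \<Longrightarrow> s \<le> \<delta> \<Longrightarrow> integral (cbox (t0, 0) (T, \<Gamma>)) (\<lambda>(t, x). \<bar>normal_velocity (t, x, s)\<bar>) \<le> c"
  shows "boundary_flux t0 T 0 \<le> \<Gamma> + c + (1 + L\<^sup>2) * \<Gamma> * (T - t0) / \<delta> + (boundary_flux t0 T 0 + \<Gamma>) / 4"
proof -
  let ?R = "cbox (t0, 0) (T, \<Gamma>)"
  define X where "X = boundary_flux t0 T 0"
  define E where "E z = (straight h G1 z)\<^sup>2 + (straight h G2 z)\<^sup>2" for z
  have Ec: "continuous_on (cbox (t0, 0, 0) (T, \<Gamma>, 1)) E"
    unfolding E_def by (intro continuous_intros straight_cont_closed G_cont) (use t in auto)
  define k where "k s = integral ?R (\<lambda>(t, x). E (t, x, s))" for s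
  have kc: "continuous_on {0..1} k" unfolding k_def by (rule integral_slice_continuous[OF Ec])
  define Y where "Y = \<Gamma> + c + (1 + L\<^sup>2) * \<Gamma> * (T - t0) / \<delta>"
  have nvc: "continuous_on (cbox (t0, 0, 0) (T, \<Gamma>, 1)) (\<lambda>z. \<bar>normal_velocity z\<bar>)"
    by (intro continuous_intros normal_velocity_cont) (use t in auto)
  have each: "X \<le> Y + \<delta> / 4 * k s" if s: "0 \<le> s" "s \<le> \<delta>" for s
  proof -
    have s1: "s \<in> {0..1}" using s \<delta> by auto
    define J where "J = integral ?R (\<lambda>(t, x). \<theta> t (x, h x + s) * (u2 t (x, h x + s) - h' x * u1 t (x, h x + s)) + heat_flux (t, x, s))"
    have Jc: "continuous_on (cbox (t0, 0, 0) (T, \<Gamma>, 1)) (\<lambda>z. straight h \<theta> z * normal_velocity z + heat_flux z)"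
      by (intro continuous_intros straight_cont_closed cont_strip heat_flux_cont normal_velocity_cont) (use t in auto)
    have i1: "(\<lambda>(t, x). \<bar>normal_velocity (t, x, s)\<bar>) integrable_on ?R" by (rule slice_integrable(2)[OF nvc s1])
    have i2: "(\<lambda>(t, x). E (t, x, s)) integrable_on ?R" by (rule slice_integrable(2)[OF Ec s1])
    have i3: "(\<lambda>z. (1 + L\<^sup>2) / \<delta>) integrable_on ?R" by (intro integrable_continuous continuous_on_const)
    have "J \<le> integral ?R (\<lambda>z. (case z of (t, x) \<Rightarrow> \<bar>normal_velocity (t, x, s)\<bar>)
        + ((1 + L\<^sup>2) / \<delta> + \<delta> / 4 * (case z of (t, x) \<Rightarrow> E (t, x, s))))"
      unfolding J_def
    proof (rule integral_le)
      show "(\<lambda>(t, x). \<theta> t (x, h x + s) * (u2 t (x, h x + s) - h' x * u1 t (x, h x + s)) + heat_flux (t, x, s)) integrable_on ?R"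
        using slice_integrable(2)[OF Jc s1] by (simp add: normal_velocity_def)
      show "(\<lambda>z. (case z of (t, x) \<Rightarrow> \<bar>normal_velocity (t, x, s)\<bar>)
        + ((1 + L\<^sup>2) / \<delta> + \<delta> / 4 * (case z of (t, x) \<Rightarrow> E (t, x, s)))) integrable_on ?R"
        by (intro integrable_add i1 i3 integrable_on_mult_right[OF i2])
      fix z assume z: "z \<in> ?R"
      then obtain t' x where tx: "z = (t', x)" "0 < t'" "x \<in> {0..\<Gamma>}" using t by (cases z) (auto simp: cbox_Pair_eq)
      have m: "0 \<le> \<theta> t' (x, h x + s)" "\<theta> t' (x, h x + s) \<le> 1"
        using maximum_principle[OF tx(2,3) s1] by auto
      have "\<theta> t' (x, h x + s) * normal_velocity (t', x, s) \<le> \<theta> t' (x, h x + s) * \<bar>normal_velocity (t', x, s)\<bar>"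
        by (rule mult_left_mono) (use m in auto)
      also have "\<dots> \<le> 1 * \<bar>normal_velocity (t', x, s)\<bar>" by (rule mult_right_mono) (use m in auto)
      finally have 1: "\<theta> t' (x, h x + s) * (u2 t' (x, h x + s) - h' x * u1 t' (x, h x + s)) \<le> \<bar>normal_velocity (t', x, s)\<bar>"
        by (simp add: normal_velocity_def)
      have "heat_flux (t', x, s) \<le> \<bar>straight h G2 (t', x, s) - h' x * straight h G1 (t', x, s)\<bar>"
        by (simp add: heat_flux_def)
      also have "\<dots> \<le> (2 / \<delta> * (1 + L\<^sup>2) + E (t', x, s) / (2 / \<delta>)) / 2"
        unfolding E_def by (rule normal_Young) (use \<delta> in auto)
      also have "\<dots> = (1 + L\<^sup>2) / \<delta> + \<delta> / 4 * E (t', x, s)" using \<delta> by (simp add: field_simps)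
      finally show "(case z of (t, x) \<Rightarrow> \<theta> t (x, h x + s) * (u2 t (x, h x + s) - h' x * u1 t (x, h x + s)) + heat_flux (t, x, s))
          \<le> (case z of (t, x) \<Rightarrow> \<bar>normal_velocity (t, x, s)\<bar>) + ((1 + L\<^sup>2) / \<delta> + \<delta> / 4 * (case z of (t, x) \<Rightarrow> E (t, x, s)))"
        using 1 unfolding tx by simp
    qed
    also have "\<dots> = integral ?R (\<lambda>(t, x). \<bar>normal_velocity (t, x, s)\<bar>) + (integral ?R (\<lambda>z. (1 + L\<^sup>2) / \<delta>) + \<delta> / 4 * k s)"
      unfolding k_def
      using HK_integral_add[OF i1 integrable_add[OF i3 integrable_on_mult_right[OF i2, of "\<delta> / 4"]]]
        HK_integral_add[OF i3 integrable_on_mult_right[OF i2, of "\<delta> / 4"]]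
        integral_mult_right[of ?R "\<delta> / 4" "\<lambda>(t, x). E (t, x, s)"] by (simp only:)
    also have "integral ?R (\<lambda>z. (1 + L\<^sup>2) / \<delta>) = (1 + L\<^sup>2) * \<Gamma> * (T - t0) / \<delta>"
      using t \<Gamma> by (simp add: content_Pair)
    finally have "J \<le> c + ((1 + L\<^sup>2) * \<Gamma> * (T - t0) / \<delta> + \<delta> / 4 * k s)"
      using N[OF s] by linarith
    moreover have "\<bar>X - J\<bar> \<le> \<Gamma>" unfolding X_def J_def by (rule flux_identity[OF t]) (use s1 in auto)
    ultimately show ?thesis unfolding Y_def by linarith
  qed
  have ki: "k integrable_on {0..\<delta>}"
    by (intro integrable_continuous_real continuous_on_subset[OF kc]) (use \<delta> in auto)
  have "integral {0..\<delta>} (\<lambda>s. X) \<le> integral {0..\<delta>} (\<lambda>s. Y + \<delta> / 4 * k s)"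
    by (rule integral_le) (use each ki in \<open>auto intro!: integrable_add integrable_on_mult_right\<close>)
  also have "\<dots> = integral {0..\<delta>} (\<lambda>s. Y) + \<delta> / 4 * integral {0..\<delta>} k"
    by (subst HK_integral_add) (auto intro!: integrable_on_mult_right ki)
  also have "integral {0..\<delta>} k = integral (cbox (t0, 0, 0) (T, \<Gamma>, \<delta>)) E"
    unfolding k_def by (rule integral_box_slices[OF continuous_on_subset[OF Ec], symmetric])
      (use \<delta> in \<open>auto simp: cbox_Pair_eq\<close>)
  finally have "\<delta> * X \<le> \<delta> * Y + \<delta> / 4 * integral (cbox (t0, 0, 0) (T, \<Gamma>, \<delta>)) E"
    using \<delta> by simp
  then have "\<delta> * X \<le> \<delta> * (Y + integral (cbox (t0, 0, 0) (T, \<Gamma>, \<delta>)) E / 4)"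
    by (simp add: algebra_simps)
  then have "X \<le> Y + integral (cbox (t0, 0, 0) (T, \<Gamma>, \<delta>)) E / 4" using \<delta> by simp
  also have "integral (cbox (t0, 0, 0) (T, \<Gamma>, \<delta>)) E \<le> integral (cbox (t0, 0, 0) (T, \<Gamma>, 1)) E"
  proof (rule integral_subset_le)
    show sub: "cbox (t0, 0, 0) (T, \<Gamma>, \<delta>) \<subseteq> cbox (t0, 0, 0) (T, \<Gamma>, 1)" using \<delta> by (auto simp: cbox_Pair_eq)
    show "E integrable_on cbox (t0, 0, 0) (T, \<Gamma>, \<delta>)" "E integrable_on cbox (t0, 0, 0) (T, \<Gamma>, 1)"
      by (intro integrable_continuous continuous_on_subset[OF Ec sub] Ec)+
  qed (simp add: E_def)
  also have "\<dots> \<le> X + \<Gamma>" unfolding X_def E_def by (rule dissipation_bound[OF t])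
  finally show ?thesis unfolding X_def Y_def by simp
qed

text \<open>
  The flux \<open>X\<close> is bounded by itself: its coefficient on the right is a quarter from the conductive and a
  quarter from the convective part, the latter by the choice of \<open>\<mu>\<close>.
\<close>

theorem boundary_flux_bound:
  assumes a: "slip_dominates_curvature a" and t0: "0 < t0"
  obtains K where "\<And>T. t0 < T \<Longrightarrow>
    boundary_flux t0 T 0 \<le> K + (1 + L\<^sup>2) * (5 + 2 * (L * \<Gamma>)) * sqrt ((1 + a) * Ra) * \<Gamma> * (T - t0)"
proof -
  have a0: "0 \<le> a" using a by (simp add: slip_dominates_curvature_def)
  define M where "M = (1 + a) * Ra"
  have M: "1 \<le> M" unfolding M_def using a0 Ra mult_mono[of 1 "1 + a" 1 Ra] by simp
  define c1 where "c1 = 1 + 2 * (L * \<Gamma>)"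
  define c2 where "c2 = 2 * (1 + L * \<Gamma>) * \<Gamma>"
  have c1: "1 \<le> c1" using L_nonneg \<Gamma> by (simp add: c1_def)
  have c2: "0 \<le> c2" using L_nonneg \<Gamma> by (simp add: c2_def)
  define E0 where "E0 = kinetic_energy t0"
  have E0: "0 \<le> E0" using kinetic_energy_nonneg[OF t0] by (simp add: E0_def)
  define l where "l = 1 + L\<^sup>2"
  have l: "1 \<le> l" by (simp add: l_def)
  have "boundary_flux t0 T 0 \<le> (5 * \<Gamma> / 2 + (c2 + E0) / 2) + l * (5 + 2 * (L * \<Gamma>)) * sqrt M * \<Gamma> * (T - t0)" if T: "t0 < T" for T
  proof -
    define X where "X = boundary_flux t0 T 0"
    have X: "0 \<le> X" unfolding X_def by (rule boundary_flux_nonneg) (use t0 in auto)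
    define r where "r = sqrt M"
    have r: "1 \<le> r" "r * r = M" using M by (simp_all add: r_def)
    \<comment> \<open>balances \<open>\<mu> \<delta>\<close> with \<open>1/\<delta>\<close>; the factor \<open>2\<close> keeps the layer in the lower half of the strip\<close>
    define \<delta> where "\<delta> = 1 / (2 * r)"
    have \<delta>: "0 < \<delta>" "\<delta> \<le> 1/2" using r by (auto simp: \<delta>_def field_simps)
    define D where "D = M * (c1 * X + c2 + E0)"
    have D: "dissipation t0 T \<epsilon> \<le> D" if "0 < \<epsilon>" "\<epsilon> < 1/2" for \<epsilon>
    proof -
      have W: "buoyancy_work t0 T \<le> c1 * X + c2"
        using buoyancy_work_bound[of t0 T] t0 T by (simp add: X_def c1_def c2_def)
      have "dissipation t0 T \<epsilon> \<le> (1 + a) * (Ra * buoyancy_work t0 T + E0)"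
        unfolding E0_def by (rule dissipation_upper_bound[OF t0 T a that])
      also have "\<dots> \<le> (1 + a) * (Ra * (c1 * X + c2) + Ra * E0)"
        using a0 W Ra E0 mult_right_mono[OF Ra E0] by (intro mult_left_mono add_mono) auto
      also have "\<dots> = D" by (simp add: D_def M_def algebra_simps)
      finally show ?thesis .
    qed
    \<comment> \<open>makes \<open>D / (2 \<mu>)\<close> equal to \<open>X / 4\<close> up to a constant\<close>
    define \<mu> where "\<mu> = 2 * M * c1"
    have \<mu>: "0 < \<mu>" using M c1 by (simp add: \<mu>_def)
    define c where "c = (\<mu> * l * (\<delta> * \<Gamma> * (T - t0)) + D / \<mu>) / 2"
    have D0: "0 \<le> D" unfolding D_def using M c1 X c2 E0 by simp
    have c0: "0 \<le> c" unfolding c_def using \<mu> l \<delta> \<Gamma> T D0 by (intro divide_nonneg_pos add_nonneg_nonneg mult_nonneg_nonneg) auto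
    have main: "X \<le> \<Gamma> + c + l * \<Gamma> * (T - t0) / \<delta> + (X + \<Gamma>) / 4"
      unfolding X_def l_def
    proof (rule flux_le_layer_average[OF t0 _ \<delta> c0])
      fix s assume s: "0 \<le> s" "s \<le> \<delta>"
      have "integral (cbox (t0, 0) (T, \<Gamma>)) (\<lambda>(t, x). \<bar>normal_velocity (t, x, s)\<bar>)
          \<le> (\<mu> * (1 + L\<^sup>2) * (s * \<Gamma> * (T - t0)) + D / \<mu>) / 2"
        by (rule normal_velocity_bound[OF t0 _ s(1) _ \<mu> D]) (use s \<delta> T in auto)
      also have "\<dots> \<le> c"
        unfolding c_def l_def using s \<mu> \<Gamma> T by (intro divide_right_mono add_right_mono mult_left_mono mult_right_mono) auto
      finally show "integral (cbox (t0, 0) (T, \<Gamma>)) (\<lambda>(t, x). \<bar>normal_velocity (t, x, s)\<bar>) \<le> c" .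
    qed (use T in simp)
    have D\<mu>: "D / \<mu> \<le> X / 2 + (c2 + E0) / 2"
    proof -
      have "D / \<mu> = X / 2 + (c2 + E0) / (2 * c1)"
        using M c1 by (simp add: D_def \<mu>_def field_simps)
      moreover have "(c2 + E0) / (2 * c1) \<le> (c2 + E0) / 2"
        using c1 c2 E0 by (intro divide_left_mono) auto
      ultimately show ?thesis by simp
    qed
    have \<mu>\<delta>: "\<mu> * \<delta> = c1 * r" unfolding \<mu>_def \<delta>_def r(2)[symmetric] using r by (simp add: field_simps)
    have e1: "\<mu> * l * (\<delta> * \<Gamma> * (T - t0)) = c1 * r * l * \<Gamma> * (T - t0)"
      using arg_cong[OF \<mu>\<delta>, of "\<lambda>y. y * (l * \<Gamma> * (T - t0))"] by (simp only: mult.assoc mult.left_commute mult.commute)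
    have e2: "l * \<Gamma> * (T - t0) / \<delta> = 2 * r * l * \<Gamma> * (T - t0)"
      using r by (simp add: \<delta>_def)
    define Q where "Q = r * l * \<Gamma> * (T - t0)"
    have cQ: "c \<le> c1 * Q / 2 + X / 4 + (c2 + E0) / 4"
    proof -
      have "c1 * r * l * \<Gamma> * (T - t0) = c1 * Q" by (simp add: Q_def mult.assoc)
      then have "c \<le> (c1 * Q + (X / 2 + (c2 + E0) / 2)) / 2"
        unfolding c_def e1 using D\<mu> by (intro divide_right_mono add_mono) auto
      also have "\<dots> = c1 * Q / 2 + X / 4 + (c2 + E0) / 4" by (simp add: field_simps)
      finally show ?thesis .
    qed
    have "X \<le> \<Gamma> + (c1 * Q / 2 + X / 4 + (c2 + E0) / 4) + 2 * Q + (X + \<Gamma>) / 4"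
      using main cQ unfolding e2 Q_def by (simp add: mult.assoc)
    moreover have "x \<le> 5 * g / 2 + w / 2 + (y + 4 * q)"
      if "x \<le> g + (y / 2 + x / 4 + w / 4) + 2 * q + (x + g) / 4" for x g y w q :: real
      using that by (auto simp: field_simps)
    ultimately have "X \<le> 5 * \<Gamma> / 2 + (c2 + E0) / 2 + (c1 * Q + 4 * Q)" by blast
    then have "X \<le> 5 * \<Gamma> / 2 + (c2 + E0) / 2 + (c1 + 4) * Q" by (simp add: distrib_right)
    also have "(c1 + 4) * Q = l * (5 + 2 * (L * \<Gamma>)) * sqrt M * \<Gamma> * (T - t0)"
      by (simp add: Q_def c1_def r_def algebra_simps)
    finally show ?thesis unfolding X_def .
  qed
  then show ?thesis using that[of "5 * \<Gamma> / 2 + (c2 + E0) / 2"] by (simp add: M_def l_def)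
qed


section \<open>The Nusselt number\<close>

lemma bdry_value_grad:
  assumes "0 < t"
  shows "bdry_value h Bottom (grad (\<theta> t)) x = (G1 t (x, h x), G2 t (x, h x))"
  unfolding bdry_value_def
proof (rule tendsto_Lim)
  have lim: "((\<lambda>\<epsilon>. w t (x, h x + \<epsilon>)) \<longlongrightarrow> w t (x, h x)) (at_right 0)"
    if "jointly_continuous (strip h) w" for w :: "real \<Rightarrow> real \<times> real \<Rightarrow> real"
    using tendsto_at_right_0_compose[OF line_cont[OF that assms, of x], of 0 "\<lambda>\<epsilon>. \<epsilon>"] by (simp add: tendsto_ident_at)
  have "((\<lambda>\<epsilon>. (G1 t (x, h x + \<epsilon>), G2 t (x, h x + \<epsilon>))) \<longlongrightarrow> (G1 t (x, h x), G2 t (x, h x))) (at_right 0)"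
    by (intro tendsto_Pair lim G_cont)
  then show "((\<lambda>\<epsilon>. grad (\<theta> t) (slice h Bottom \<epsilon> x)) \<longlongrightarrow> (G1 t (x, h x), G2 t (x, h x))) (at_right 0)"
  proof (rule Lim_transform_eventually)
    have "(G1 t (x, h x + \<epsilon>), G2 t (x, h x + \<epsilon>)) = grad (\<theta> t) (slice h Bottom \<epsilon> x)" if "0 < \<epsilon>" "\<epsilon> < 1" for \<epsilon>
      using G_inside[OF assms slice_in_S[OF that, of Bottom x]] by (simp add: grad_def)
    then show "\<forall>\<^sub>F \<epsilon> in at_right 0. (G1 t (x, h x + \<epsilon>), G2 t (x, h x + \<epsilon>)) = grad (\<theta> t) (slice h Bottom \<epsilon> x)"
      by (auto simp: eventually_at_right_field intro!: exI[of _ 1])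
  qed
qed simp

lemma Nusselt_integrand:
  assumes "0 < t"
  shows "normal h Bottom x \<bullet> bdry_value h Bottom (grad (\<theta> t)) x * arclen h x = heat_flux (t, x, 0)"
proof -
  have "arclen h x > 0" unfolding arclen_def by (simp add: add_pos_nonneg)
  then show ?thesis unfolding bdry_value_grad[OF assms]
    by (simp add: heat_flux_def inner_prod_def field_simps)
qed

text \<open>
  The time integral is split at \<open>t = 1\<close>: the flux bound starts at a positive time, and the contribution of
  \<open>(0, 1]\<close> disappears in the average.
\<close>

theorem Nusselt_bound:
  assumes a: "slip_dominates_curvature a"
  shows "Nusselt \<Gamma> h \<theta> \<le> ereal ((1 + L\<^sup>2) * (5 + 2 * (L * \<Gamma>)) * sqrt ((1 + a) * Ra))"
proof -
  define B where "B = (1 + L\<^sup>2) * (5 + 2 * (L * \<Gamma>)) * sqrt ((1 + a) * Ra)"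
  obtain K where K: "\<And>T. 1 < T \<Longrightarrow> boundary_flux 1 T 0 \<le> K + B * \<Gamma> * (T - 1)"
    using boundary_flux_bound[OF a, of 1] unfolding B_def by auto
  have B: "0 \<le> B" unfolding B_def using L_nonneg \<Gamma> a Ra by (simp add: slip_dominates_curvature_def)
  define f where "f t = (1 / \<Gamma>) * (LINT x:{0..\<Gamma>}|lborel. normal h Bottom x \<bullet> bdry_value h Bottom (grad (\<theta> t)) x * arclen h x)" for t
  define \<phi> where "\<phi> t = integral {0..\<Gamma>} (\<lambda>x. heat_flux (t, x, 0))" for t
  have slc: "continuous_on (cbox (t0, 0) (T, \<Gamma>)) (\<lambda>z. heat_flux (fst z, snd z, 0))" if "0 < t0" for t0 T
    using slice_integrable(1)[OF heat_flux_cont, of t0 0] that by (simp add: case_prod_unfold)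
  have f: "f t = \<phi> t / \<Gamma>" if "0 < t" for t
  proof -
    have c: "continuous_on {0..\<Gamma>} (\<lambda>x. heat_flux (t, x, 0))"
      by (rule continuous_on_compose2[OF slc[OF that, of t], where f = "\<lambda>x. (t, x)", simplified])
        (auto intro!: continuous_intros simp: cbox_Pair_eq)
    have "set_integrable lborel {0..\<Gamma>} (\<lambda>x. heat_flux (t, x, 0))"
      unfolding set_integrable_def by (rule borel_integrable_compact[OF _ c]) simp
    then show ?thesis
      unfolding f_def Nusselt_integrand[OF that] \<phi>_def by (simp add: set_borel_integral_eq_integral)
  qed
  define c0 where "c0 = (LINT t:{0<..1}|lborel. f t)"
  have val: "(1 / T) * (LINT t:{0<..T}|lborel. f t) \<le> (\<bar>c0\<bar> + \<bar>K\<bar> / \<Gamma>) / T + B" if T: "1 < T" for T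
  proof (cases "set_integrable lborel {0<..T} f")
    \<comment> \<open>a flux that is not integrable as \<open>t \<rightarrow> 0\<close> has the default integral zero\<close>
    case False
    then have "(LINT t:{0<..T}|lborel. f t) = 0"
      unfolding set_lebesgue_integral_def set_integrable_def by (rule not_integrable_integral_eq)
    then show ?thesis using B T \<Gamma> by simp
  next
    case True
    have i: "set_integrable lborel {0<..1} f" "set_integrable lborel {1<..T} f"
      by (rule set_integrable_subset[OF True]; use T in auto)+
    have "{0<..T} = {0<..1} \<union> {1<..T}" using T by auto
    then have "(LINT t:{0<..T}|lborel. f t) = c0 + (LINT t:{1<..T}|lborel. f t)"
      unfolding c0_def using set_integral_Un[of "{0<..1}" "{1<..T}" lborel f] i by auto
    also have "(LINT t:{1<..T}|lborel. f t) = integral {1<..T} f"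
      using set_borel_integral_eq_integral(2)[OF i(2)] .
    also have "\<dots> = integral {1..T} f"
      by (rule integral_spike_set; rule negligible_subset[of "{1}"]) auto
    also have "\<dots> = integral {1..T} (\<lambda>t. \<phi> t / \<Gamma>)"
      by (rule HK_integral_cong) (use f in auto)
    also have "\<dots> = boundary_flux 1 T 0 / \<Gamma>"
      using integral_prod_continuous[OF slc[of 1 T]]
      by (simp add: boundary_flux_def \<phi>_def case_prod_unfold)
    also have "\<dots> \<le> (K + B * \<Gamma> * (T - 1)) / \<Gamma>" using K[OF T] \<Gamma> by (intro divide_right_mono) auto
    also have "\<dots> = K / \<Gamma> + B * (T - 1)" using \<Gamma> by (simp add: field_simps)
    also have "\<dots> \<le> \<bar>K\<bar> / \<Gamma> + B * T"
      using \<Gamma> B by (intro add_mono divide_right_mono mult_left_mono) auto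
    finally have "(LINT t:{0<..T}|lborel. f t) \<le> (\<bar>c0\<bar> + \<bar>K\<bar> / \<Gamma>) + B * T" by simp
    then have "(1 / T) * (LINT t:{0<..T}|lborel. f t) \<le> (1 / T) * ((\<bar>c0\<bar> + \<bar>K\<bar> / \<Gamma>) + B * T)"
      using T by (intro mult_left_mono) auto
    also have "\<dots> = (\<bar>c0\<bar> + \<bar>K\<bar> / \<Gamma>) / T + B" using T by (simp add: add_divide_distrib)
    finally show ?thesis .
  qed
  have "Nusselt \<Gamma> h \<theta> = Limsup at_top (\<lambda>T. ereal ((1 / T) * (LINT t:{0<..T}|lborel. f t)))"
    by (simp add: Nusselt_def long_time_avg_def f_def)
  also have "\<dots> \<le> Limsup at_top (\<lambda>T. ereal ((\<bar>c0\<bar> + \<bar>K\<bar> / \<Gamma>) / T + B))"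
    by (rule Limsup_mono, rule eventually_mono[OF eventually_gt_at_top[of 1]]) (use val in simp)
  also have "\<dots> = ereal B"
  proof (rule lim_imp_Limsup)
    have "((\<lambda>T. (\<bar>c0\<bar> + \<bar>K\<bar> / \<Gamma>) / T + B) \<longlongrightarrow> 0 + B) at_top"
      by (intro tendsto_add tendsto_const tendsto_divide_0[OF tendsto_const] filterlim_at_top_imp_at_infinity filterlim_ident)
    then show "((\<lambda>T. ereal ((\<bar>c0\<bar> + \<bar>K\<bar> / \<Gamma>) / T + B)) \<longlongrightarrow> ereal B) at_top" by simp
  qed simp
  finally show ?thesis by (simp add: B_def)
qed

end

lemma Linf_bdry_nonneg:
  assumes "0 < \<Gamma>" shows "0 \<le> Linf_bdry \<Gamma> f"
proof -
  have "0 \<le> esssup (lebesgue_on {0..\<Gamma>}) (\<lambda>x. ereal \<bar>f s x\<bar>)" for s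
  proof (rule ccontr)
    assume "\<not> ?thesis"
    then have lt: "esssup (lebesgue_on {0..\<Gamma>}) (\<lambda>x. ereal \<bar>f s x\<bar>) < 0" by simp
    have "AE x in lebesgue_on {0..\<Gamma>}. ereal \<bar>f s x\<bar> \<le> esssup (lebesgue_on {0..\<Gamma>}) (\<lambda>x. ereal \<bar>f s x\<bar>)"
      by (rule esssup_AE)
    then have "AE x in lebesgue_on {0..\<Gamma>}. False"
    proof (rule eventually_mono)
      fix x assume "ereal \<bar>f s x\<bar> \<le> esssup (lebesgue_on {0..\<Gamma>}) (\<lambda>x. ereal \<bar>f s x\<bar>)"
      then have "ereal \<bar>f s x\<bar> < 0" using lt by (rule le_less_trans)
      then show False by simp
    qed
    then have "ae_filter (lebesgue_on {0..\<Gamma>}) = bot" by (simp only: eventually_False)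
    then have "emeasure (lebesgue_on {0..\<Gamma>}) (space (lebesgue_on {0..\<Gamma>})) = 0"
      by (simp only: ae_filter_eq_bot_iff)
    then show False using assms by (simp add: emeasure_restrict_space)
  qed
  then show ?thesis by (auto simp: Linf_bdry_def max_def)
qed

lemma AE_bdry_le_Linf: "AE_bdry \<Gamma> (\<lambda>s x. ereal \<bar>f s x\<bar> \<le> Linf_bdry \<Gamma> f)"
  unfolding AE_bdry_def
proof
  fix s
  have "AE x in lebesgue_on {0..\<Gamma>}. ereal \<bar>f s x\<bar> \<le> esssup (lebesgue_on {0..\<Gamma>}) (\<lambda>x. ereal \<bar>f s x\<bar>)"
    by (rule esssup_AE)
  then show "AE x in lebesgue_on {0..\<Gamma>}. ereal \<bar>f s x\<bar> \<le> Linf_bdry \<Gamma> f"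
    by (rule eventually_mono) (cases s; auto simp: Linf_bdry_def le_max_iff_disj)
qed

lemma AE_bdry_mono2:
  assumes "AE_bdry \<Gamma> P" "AE_bdry \<Gamma> Q" "\<And>s x. P s x \<Longrightarrow> Q s x \<Longrightarrow> R s x"
  shows "AE_bdry \<Gamma> R"
  unfolding AE_bdry_def
proof
  fix s
  show "AE x in lebesgue_on {0..\<Gamma>}. R s x"
    by (rule eventually_elim2[of "P s" _ "Q s"]) (use assms in \<open>auto simp: AE_bdry_def\<close>)
qed

lemma sqrt_le_of_inverse_le:
  assumes "0 < y" "inverse y \<le> r" shows "sqrt y \<le> sqrt r * y"
proof -
  have "1 \<le> r * y" using assms by (simp add: field_simps)
  then have "y * 1 \<le> y * (r * y)" using assms by (intro mult_left_mono) auto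
  then have "sqrt y \<le> sqrt (r * y\<^sup>2)" by (simp add: power2_eq_square algebra_simps)
  then show ?thesis using assms by (simp add: real_sqrt_mult)
qed

theorem theorem12:
  fixes \<Gamma> L :: real
  assumes "\<Gamma> > 0"
  shows "\<exists>C>0. \<forall>(h :: real \<Rightarrow> real) (\<alpha> :: real \<times> real \<Rightarrow> real) (Pr :: real) (Ra :: real)
            (u0 :: real \<times> real \<Rightarrow> real \<times> real) (\<theta>0 :: real \<times> real \<Rightarrow> real)
            (u :: real \<Rightarrow> real \<times> real \<Rightarrow> real \<times> real) (p :: real \<Rightarrow> real \<times> real \<Rightarrow> real)
            (\<theta> :: real \<Rightarrow> real \<times> real \<Rightarrow> real).
      (\<forall>x1. h (x1 + \<Gamma>) = h x1) \<and> C11 h \<and> L-lipschitz_on UNIV h \<and>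
      Pr > 0 \<and> Ra \<ge> 1 \<and>
      (\<forall>s. x1_periodic_on (range (bdry h s)) \<Gamma> \<alpha>) \<and>
      (\<forall>s. (\<lambda>x1. \<alpha> (bdry h s x1)) \<in> borel_measurable (lebesgue_on {0..\<Gamma>})) \<and>
      AE_bdry \<Gamma> (\<lambda>s x1. \<alpha> (bdry h s x1) > 0) \<and>
      Linf_bdry \<Gamma> (\<lambda>s x1. \<alpha> (bdry h s x1)) < \<infinity> \<and>
      square_integrable_on_Omega \<Gamma> h u0 \<and>
      \<theta>0 \<in> borel_measurable (lebesgue_on (Omega \<Gamma> h)) \<and>
      (AE x in lebesgue_on (Omega \<Gamma> h). 0 \<le> \<theta>0 x \<and> \<theta>0 x \<le> 1) \<and>
      RB_solution \<Gamma> h \<alpha> Pr Ra u0 \<theta>0 u p \<theta>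
      \<longrightarrow>
      (AE_bdry \<Gamma> (\<lambda>s x1. \<bar>curvature h s x1\<bar> \<le> 2 * \<alpha> (bdry h s x1)) \<longrightarrow>
        Nusselt \<Gamma> h \<theta> \<le> ereal C * (ereal (Ra powr (1/2)) + Linf_bdry \<Gamma> (curvature h))) \<and>
      (AE_bdry \<Gamma> (\<lambda>s x1. \<bar>curvature h s x1\<bar> \<le> 2 * \<alpha> (bdry h s x1)
            + 1 / (4 * sqrt (1 + (deriv h x1)\<^sup>2)) * min 1 (sqrt (\<alpha> (bdry h s x1)))) \<longrightarrow>
        Nusselt \<Gamma> h \<theta> \<le> ereal C *
          ((1 + ereal_sqrt (Linf_bdry \<Gamma> (\<lambda>s x1. inverse (\<alpha> (bdry h s x1))))) * ereal (Ra powr (1/2))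
            + Linf_bdry \<Gamma> (curvature h)))"
proof -
  \<comment> \<open>the absolute value makes \<open>C\<close> positive for every \<open>L\<close>; Lipschitz constants are nonnegative\<close>
  define C where "C = (1 + L\<^sup>2) * (5 + 2 * (\<bar>L\<bar> * \<Gamma>))"
  have C: "0 < C" unfolding C_def using assms by (intro mult_pos_pos) (auto intro: add_pos_nonneg)
  show ?thesis
  proof (intro exI[of _ C] conjI C allI impI; elim conjE)
    fix h :: "real \<Rightarrow> real" and \<alpha> :: "real \<times> real \<Rightarrow> real" and Pr Ra :: real
      and u0 :: "real \<times> real \<Rightarrow> real \<times> real" and \<theta>0 :: "real \<times> real \<Rightarrow> real"
      and u :: "real \<Rightarrow> real \<times> real \<Rightarrow> real \<times> real" and p \<theta> :: "real \<Rightarrow> real \<times> real \<Rightarrow> real"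
    assume a: "\<forall>x1. h (x1 + \<Gamma>) = h x1" "C11 h" "L-lipschitz_on UNIV h" "Pr > 0" "Ra \<ge> 1"
      "AE_bdry \<Gamma> (\<lambda>s x1. \<alpha> (bdry h s x1) > 0)"
      "AE x in lebesgue_on (Omega \<Gamma> h). 0 \<le> \<theta>0 x \<and> \<theta>0 x \<le> 1"
      "RB_solution \<Gamma> h \<alpha> Pr Ra u0 \<theta>0 u p \<theta>"
    interpret Rayleigh_Benard \<Gamma> L h \<alpha> Pr Ra u0 \<theta>0 u p \<theta>
      by unfold_locales (use assms a in auto)
    have C_eq: "(1 + L\<^sup>2) * (5 + 2 * (L * \<Gamma>)) = C" using L_nonneg by (simp add: C_def)
    have root: "Ra powr (1/2) = sqrt Ra" using Ra by (simp add: powr_half_sqrt)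
    have \<kappa>: "0 \<le> Linf_bdry \<Gamma> (curvature h)" by (rule Linf_bdry_nonneg[OF assms])
    {
      assume c: "AE_bdry \<Gamma> (\<lambda>s x1. \<bar>curvature h s x1\<bar> \<le> 2 * \<alpha> (bdry h s x1))"
      have "slip_dominates_curvature 0"
        unfolding slip_dominates_curvature_def using AE_bdry_mono2[OF a(6) c] by auto
      from Nusselt_bound[OF this]
      have "Nusselt \<Gamma> h \<theta> \<le> ereal C * ereal (sqrt Ra)" by (simp add: C_eq)
      also have "\<dots> \<le> ereal C * (ereal (sqrt Ra) + Linf_bdry \<Gamma> (curvature h))"
        using C \<kappa> by (intro ereal_mult_left_mono add_increasing2) auto
      finally show "Nusselt \<Gamma> h \<theta> \<le> ereal C * (ereal (Ra powr (1/2)) + Linf_bdry \<Gamma> (curvature h))"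
        unfolding root .
    }
    {
      assume c: "AE_bdry \<Gamma> (\<lambda>s x1. \<bar>curvature h s x1\<bar> \<le> 2 * \<alpha> (bdry h s x1)
            + 1 / (4 * sqrt (1 + (deriv h x1)\<^sup>2)) * min 1 (sqrt (\<alpha> (bdry h s x1))))"
      define A where "A = Linf_bdry \<Gamma> (\<lambda>s x1. inverse (\<alpha> (bdry h s x1)))"
      have A: "0 \<le> A" unfolding A_def by (rule Linf_bdry_nonneg[OF assms])
      show "Nusselt \<Gamma> h \<theta> \<le> ereal C *
          ((1 + ereal_sqrt (Linf_bdry \<Gamma> (\<lambda>s x1. inverse (\<alpha> (bdry h s x1))))) * ereal (Ra powr (1/2))
            + Linf_bdry \<Gamma> (curvature h))"
        unfolding A_def[symmetric] root
      proof (cases "A = \<infinity>")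
        case True
        have inf: "(1 + ereal_sqrt A) * ereal (sqrt Ra) = \<infinity>" using True Ra by (simp add: ereal_sqrt_def)
        then show "Nusselt \<Gamma> h \<theta> \<le> ereal C * ((1 + ereal_sqrt A) * ereal (sqrt Ra) + Linf_bdry \<Gamma> (curvature h))"
          unfolding inf using C \<kappa> by simp
      next
        \<comment> \<open>\<open>b\<close> comes from \<open>\<surd>\<alpha> / 4 \<le> \<surd>r \<alpha> / 4 = 2\<alpha> b\<close>\<close>
        case False
        then obtain r where r: "A = ereal r" "0 \<le> r" using A by (cases A) auto
        define b where "b = sqrt r / 8"
        have b: "0 \<le> b" using r by (simp add: b_def)
        have inv: "AE_bdry \<Gamma> (\<lambda>s x1. inverse (\<alpha> (bdry h s x1)) \<le> r)"
          using AE_bdry_mono2[OF AE_bdry_le_Linf[of \<Gamma> "\<lambda>s x1. inverse (\<alpha> (bdry h s x1))"] a(6)]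
          unfolding A_def[symmetric] r(1) by simp
        have pos_inv: "AE_bdry \<Gamma> (\<lambda>s x1. 0 < \<alpha> (bdry h s x1) \<and> inverse (\<alpha> (bdry h s x1)) \<le> r)"
          by (rule AE_bdry_mono2[OF a(6) inv]) auto
        have "slip_dominates_curvature b"
          unfolding slip_dominates_curvature_def
        proof (intro conjI b AE_bdry_mono2[OF pos_inv c])
          fix s x
          let ?\<alpha> = "\<alpha> (bdry h s x)"
          assume \<alpha>: "0 < ?\<alpha> \<and> inverse ?\<alpha> \<le> r"
            and k: "\<bar>curvature h s x\<bar> \<le> 2 * ?\<alpha> + 1 / (4 * sqrt (1 + (deriv h x)\<^sup>2)) * min 1 (sqrt ?\<alpha>)"
          show "0 < ?\<alpha>" using \<alpha> by simp
          have "1 / (4 * sqrt (1 + (deriv h x)\<^sup>2)) * min 1 (sqrt ?\<alpha>) \<le> 1 / 4 * sqrt ?\<alpha>"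
          proof (rule mult_mono)
            show "1 / (4 * sqrt (1 + (deriv h x)\<^sup>2)) \<le> 1 / 4"
              by (rule divide_left_mono) (auto simp: add_pos_nonneg)
          qed (use \<alpha> in auto)
          also have "\<dots> \<le> 1 / 4 * (sqrt r * ?\<alpha>)" using sqrt_le_of_inverse_le \<alpha> by simp
          finally show "- curvature h s x \<le> 2 * ?\<alpha> * (1 + b)"
            using k by (simp add: b_def algebra_simps)
        qed
        from Nusselt_bound[OF this]
        have "Nusselt \<Gamma> h \<theta> \<le> ereal (C * sqrt ((1 + b) * Ra))" by (simp add: C_eq)
        also have "\<dots> \<le> ereal (C * ((1 + sqrt r) * sqrt Ra))"
        proof -
          have "sqrt (1 + b) \<le> 1 + sqrt r"
          proof (rule real_le_lsqrt)
            show "1 + b \<le> (1 + sqrt r)\<^sup>2" using r by (simp add: b_def power2_sum)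
          qed (use r b in auto)
          then have "sqrt (1 + b) * sqrt Ra \<le> (1 + sqrt r) * sqrt Ra"
            using Ra by (intro mult_right_mono) auto
          then show ?thesis using C by (simp add: real_sqrt_mult)
        qed
        also have "\<dots> = ereal C * ((1 + ereal_sqrt A) * ereal (sqrt Ra))"
          using r by (simp add: ereal_sqrt_def one_ereal_def)
        also have "\<dots> \<le> ereal C * ((1 + ereal_sqrt A) * ereal (sqrt Ra) + Linf_bdry \<Gamma> (curvature h))"
          using C \<kappa> r by (intro ereal_mult_left_mono add_increasing2) (auto simp: ereal_sqrt_def)
        finally show "Nusselt \<Gamma> h \<theta> \<le> ereal C * ((1 + ereal_sqrt A) * ereal (sqrt Ra) + Linf_bdry \<Gamma> (curvature h))" .
      qed
    }
  qed
qed

end
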